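(* The quotient $P_{\tilde\alpha}^u(\mathbb{Z})\backslash D_{\tilde\alpha}$ is the image of a section $r_f^{\mathrm{Sh}}$ in $P_\alpha^u(\mathbb{Z})\backslash D_\alpha$ (the universal Poincaré torsor over $\mathbb{H}_{d,\alpha}$) over the family of $B_\tau$ with $\tau$ ranging over $\mathbb{H}_{d,\alpha}$. In particular, the image of $r_f^{\mathrm{Sh}}$ is a special subvariety. This section $r_f^{\mathrm{Sh}}$ is equal to the Ribet section $r_f$, that is, over each $\tau\in\mathbb{H}_{d,\alpha}$ it is the unique section, with value $1$ at the origin, of the restriction of the Poincaré torsor $\mathcal{P}_\tau$ on $A_\tau\times B_\tau$ to the graph of $\alpha\colon B_\tau\to A_\tau$.
   Context: Matrices and Siegel space. $\mathrm{M}_{m,n}(R)$ denotes $m\times n$ matrices over $R$; $d\ge1$; $\mathbb{H}_d$ is the set of symmetric $\tau\in\mathrm{M}_d(\mathbb{C})$ with $\mathrm{Im}(\tau)$ positive definite. $\mathbb{Z}(1)=2\pi i\mathbb{Z}$, of Hodge type $(-1,-1)$. $\Psi(x,y)=2\pi i\,x^t\begin{pmatrix}0&-1_d\\1_d&0\end{pmatrix}y$ on $\mathbb{Z}^{2d}$. $\mathrm{GSp}(\Psi)(R)$ is the group of pairs $(g,\mu(g))\in\mathrm{GL}_{2d}(R)\times R^\times$ with $\Psi(gx,gy)=\mu(g)\Psi(x,y)$. The set $D$. $M=\mathbb{Z}(1)\oplus\mathbb{Z}^{2d}\oplus\mathbb{Z}$ with $\mathbb{Z}$-basis $2\pi i e_0,e_1,\dots,e_{2d+1}$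 and weight filtration $W_{-3}M=0$, $W_{-2}M=\mathbb{Z}\cdot 2\pi i e_0$, $W_{-1}M=\mathbb{Z}(1)\oplus\mathbb{Z}^{2d}$, $W_0M=M$. $D$ is the set of filtrations $F$ on $M_{\mathbb{C}}$ such that $(M,W,F)$ is a mixed $\mathbb{Z}$-Hodge structure of type $\{(-1,-1),(-1,0),(0,-1),(0,0)\}$ and $\Psi$ is a polarisation on $\mathrm{Gr}^W_{-1}M=\mathbb{Z}^{2d}$. Such $F$ is given by $F^0$, and $D$ is in bijection with $\mathbb{H}_d\times\mathrm{M}_{1,d}(\mathbb{C})\times\mathrm{M}_{d,1}(\mathbb{C})\times\mathbb{C}$ via $(\tau,u,v,w)\mapsto F^0=\begin{pmatrix}u&w\\ \tau&v\\1_d&0\\0&1\end{pmatrix}\mathbb{C}^{d+1}\subset M_{\mathbb{C}}=\bigoplus_j\mathbb{C}e_j$. Write $\tilde\tau$ for the point $(\tau,0,0,0)$. Groups. With respect to the basis $2\pi i e_0,e_1,\dots,e_{2d+1}$, $P(R)$ is the group of matrices $\begin{pmatrix}\mu(g)&x&z\\0&g&y\\0&0&1\end{pmatrix}$ with $(g,\mu(g))\in\mathrm{GSp}(\Psi)(R)$, $x\in\mathrm{M}_{1,2d}(R)$, $y\in\mathrm{M}_{2d,1}(R)$, $z\in R$; $P^u$ is the subgroup with $g=1$, $\mu(g)=1$ and $U\subset P^u$ the subgroup with moreover $x=0$, $y=0$. $P(\mathbb{R})^+U(\mathbb{C})$ acts on $D$ by acting on $F^0\subset M_{\mathbb{C}}$.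 Abelian varieties. $A_\tau=\mathrm{M}_{d,1}(\mathbb{C})/(1_d\ \,-\tau)\mathrm{M}_{2d,1}(\mathbb{Z})$ and $B_\tau=\mathrm{M}_{1,d}(\mathbb{C})/\mathrm{M}_{1,2d}(\mathbb{Z}(1))\begin{pmatrix}\tau\\1_d\end{pmatrix}$. $P^u(\mathbb{Z})\backslash D$ is the universal Poincaré torsor over $\mathbb{H}_d$: its fibre at $\tau$ is the Poincaré $\mathbb{C}^\times$-torsor $\mathcal{P}_\tau$ on $A_\tau\times B_\tau$ ($v$ gives the point of $A_\tau$, $u$ the point of $B_\tau$), which identifies $B_\tau$ with $A_\tau^\vee$ and $A_\tau$ with $B_\tau^\vee$. The data $f,\alpha$. Fix $\tau_0\in\mathbb{H}_d$ and a morphism $f\colon B_{\tau_0}\to A_{\tau_0}$, with dual $f^\vee\colon B_{\tau_0}\to A_{\tau_0}$, and $\alpha=f-f^\vee$. Let $f_{\mathbb{Z}}\in\mathrm{M}_{2d}(\mathbb{Z})$ be the matrix such that $f$ on lattices is $\mathrm{M}_{1,2d}(\mathbb{Z}(1))\to\mathrm{M}_{2d,1}(\mathbb{Z})$, $2\pi i\,n\mapsto f_{\mathbb{Z}}n^t$; likewise $\alpha$ is given by $2\pi i\,n\mapsto\alpha_{\mathbb{Z}}n^t$, and $\alpha_{\mathbb{Z}}=f_{\mathbb{Z}}+f_{\mathbb{Z}}^t$. View this last map as a map $\mathrm{Gr}^W_{-1}(M)^\vee(1)\to\mathrm{Gr}^W_{-1}(M)$ ( * ). $P_\alpha$ and $G_\alpha$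 are the identity components of the stabilisers of ( * ) in $P$ and in $\mathrm{GSp}(\Psi)$; $P_\alpha$ is the inverse image of $G_\alpha$ in $P$, and $P_\alpha^u=P^u$. Put $D_\alpha=P_\alpha(\mathbb{R})^+U(\mathbb{C})\cdot\tilde\tau_0\subset D$ and $\mathbb{H}_{d,\alpha}=G_\alpha(\mathbb{R})^+\cdot\tau_0\subset\mathbb{H}_d$. For every $\tau\in\mathbb{H}_{d,\alpha}$, $\alpha_{\mathbb{Z}}$ induces a morphism $\alpha\colon B_\tau\to A_\tau$. $P_\alpha^u(\mathbb{Z})\backslash D_\alpha$ is the universal Poincaré torsor over $\mathbb{H}_{d,\alpha}$. The group $P_{\tilde\alpha}$. It is the stabiliser of the map $M^\vee(1)=\mathbb{Z}\oplus\mathrm{M}_{1,2d}(\mathbb{Z}(1))\oplus\mathbb{Z}(1)\to M$, $(k_1,2\pi i n,2\pi i k_2)\mapsto(-2\pi i k_2,\alpha_{\mathbb{Z}}n^t,-k_1)^t$; for $R$ in which multiplication by $2$ is injective (e.g. $\mathbb{Z},\mathbb{Q},\mathbb{R}$), in the basis $2\pi i e_0,e_1,\dots,e_{2d+1}$, $P_{\tilde\alpha}(R)=\left\{\begin{pmatrix}\mu(g)&x&\mu(g)^{-1}xf_{\mathbb{Z}}x^t\\0&g&\mu(g)^{-1}g\alpha_{\mathbb{Z}}x^t\\0&0&1\end{pmatrix}: (g,\mu(g))\in G_\alpha(R),\ x\in\mathrm{M}_{1,2d}(R)\right\}$, and $P_{\tilde\alpha}^u$ is the subgroup with $g=1$,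 $\mu(g)=1$. Put $D_{\tilde\alpha}=P_{\tilde\alpha}(\mathbb{R})^+\cdot\tilde\tau_0\subset D_\alpha$. Special subvarieties. $(P_{\alpha,\mathbb{Q}},D_\alpha)$ and $(P_{\tilde\alpha,\mathbb{Q}},D_{\tilde\alpha})$ are connected mixed Shimura data in the sense of Pink. A special subvariety of the mixed Shimura variety attached to a connected mixed Shimura datum $(Q,X)$ (a quotient of $X$ by an arithmetic group) is the image of $X'$ for a connected mixed Shimura subdatum $(Q',X')\subset(Q,X)$. Here "special subvariety" is understood after a further quotient by a suitable congruence subgroup.
   Formalization: Connected mixed Shimura data are taken without Pink's conditions of no compact Q-factors in the adjoint group and minimality, since the datum for P_α can violate them (e.g. d=2, τ_0=i·1_2, α_Z=−2·1_4, where G_α is a definite unitary similitude group). *)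

theory Defs
  imports "HOL-Analysis.Analysis"
begin

section \<open>Linear algebra over the complex numbers\<close>

definition civ :: "int^'n \<Rightarrow> complex^'n" where
  "civ n = (\<chi> i. of_int (n $ i))"

definition cim :: "int^'n^'m \<Rightarrow> complex^'n^'m" where
  "cim A = (\<chi> i j. of_int (A $ i $ j))"

definition map_vec :: "(complex \<Rightarrow> complex) \<Rightarrow> complex^'n \<Rightarrow> complex^'n" where
  "map_vec s v = (\<chi> i. s (v $ i))"

definition map_mat :: "(complex \<Rightarrow> complex) \<Rightarrow> complex^'n^'m \<Rightarrow> complex^'n^'m" where
  "map_mat s A = (\<chi> i j. s (A $ i $ j))"

text \<open>The complex bilinear (not Hermitian) dot product.\<close>

definition bdot :: "complex^'n \<Rightarrow> complex^'n \<Rightarrow> complex" where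
  "bdot x y = (\<Sum>i\<in>UNIV. x $ i * y $ i)"

definition set_sum :: "'a::plus set \<Rightarrow> 'a set \<Rightarrow> 'a set" where
  "set_sum A B = {a + b |a b. a \<in> A \<and> b \<in> B}"

definition vec_of_mat :: "complex^'n^'n \<Rightarrow> complex^('n \<times> 'n)" where
  "vec_of_mat A = (\<chi> k. A $ fst k $ snd k)"

definition clinear_map :: "(complex^'n \<Rightarrow> complex^'m) \<Rightarrow> bool" where
  "clinear_map \<phi> \<longleftrightarrow> Vector_Spaces.linear (*s) (*s) \<phi>"

text \<open>Holomorphy in several variables: complex-linear Frechet derivative.\<close>

definition holo_on :: "(complex^'n) set \<Rightarrow> (complex^'n \<Rightarrow> complex) \<Rightarrow> bool" where
  "holo_on S h \<longleftrightarrow> (\<forall>x\<in>S. \<exists>h'. (h has_derivative h') (at x) \<and> (\<forall>t. h' (\<i> *s t) = \<i> * h' t))"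

definition holo2_on ::
    "((complex^'n^'n) \<times> (complex^'n)) set \<Rightarrow> ((complex^'n^'n) \<times> (complex^'n) \<Rightarrow> complex) \<Rightarrow> bool" where
  "holo2_on S h \<longleftrightarrow> (\<forall>x\<in>S. \<exists>h'. (h has_derivative h') (at x) \<and>
     (\<forall>s t. h' (map_mat (\<lambda>c. \<i> * c) s, \<i> *s t) = \<i> * h' (s, t)))"


section \<open>Mixed Hodge structures\<close>

definition field_aut :: "(complex \<Rightarrow> complex) \<Rightarrow> bool" where
  "field_aut s \<longleftrightarrow> bij s \<and> (\<forall>a b. s (a + b) = s a + s b \<and> s (a * b) = s a * s b)"

text \<open>
  A complex subspace (more generally a Zariski closed set) is defined over the rational numbers if
  and only if it is stable under all field automorphisms of the complex numbers, since the
  fixed field of the latter is the field of rational numbers. We use this as the definition of being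
  defined over the rationals throughout.
\<close>

definition subspace_over_Q :: "(complex^'n) set \<Rightarrow> bool" where
  "subspace_over_Q V \<longleftrightarrow> vec.subspace V \<and> (\<forall>s. field_aut s \<longrightarrow> map_vec s ` V = V)"

definition conj_set :: "(complex^'n) set \<Rightarrow> (complex^'n) set" where
  "conj_set V = map_vec cnj ` V"

text \<open>\<open>gr_F W F p n\<close> and \<open>gr_Fbar W F q n\<close> are the preimages in \<open>W n\<close> of the
  filtrations induced by \<open>F\<close> and its complex conjugate on the graded piece \<open>W n / W (n - 1)\<close>.\<close>

definition gr_F where
  "gr_F W F p n = set_sum (F p \<inter> W n) (W (n - 1))"

definition gr_Fbar where
  "gr_Fbar W F q n = set_sum (conj_set (F q) \<inter> W n) (W (n - 1))"

text \<open>\<open>(W, F)\<close> is a mixed Hodge structure on the complex space \<open>V\<close>, whose rational structure is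
  the one induced from that of the ambient coordinate space.\<close>

definition mixed_hodge ::
    "(complex^'n) set \<Rightarrow> (int \<Rightarrow> (complex^'n) set) \<Rightarrow> (int \<Rightarrow> (complex^'n) set) \<Rightarrow> bool" where
  "mixed_hodge V W F \<longleftrightarrow>
     subspace_over_Q V \<and>
     (\<forall>n. subspace_over_Q (W n)) \<and> (\<forall>n. W n \<subseteq> W (n + 1)) \<and> (\<exists>n. W n = {0}) \<and> (\<exists>n. W n = V) \<and>
     (\<forall>p. vec.subspace (F p)) \<and> (\<forall>p. F (p + 1) \<subseteq> F p) \<and> (\<exists>p. F p = {0}) \<and> (\<exists>p. F p = V) \<and>
     (\<forall>n p. set_sum (gr_F W F p n) (gr_Fbar W F (n + 1 - p) n) = W n \<and>
            gr_F W F p n \<inter> gr_Fbar W F (n + 1 - p) n = W (n - 1))"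

text \<open>All nonzero Hodge components of the graded pieces have their bidegree in \<open>T\<close>.\<close>

definition hodge_type ::
    "(int \<Rightarrow> (complex^'n) set) \<Rightarrow> (int \<Rightarrow> (complex^'n) set) \<Rightarrow> (int \<times> int) set \<Rightarrow> bool" where
  "hodge_type W F T \<longleftrightarrow>
     (\<forall>p q. gr_F W F p (p + q) \<inter> gr_Fbar W F q (p + q) \<noteq> W (p + q - 1) \<longrightarrow> (p, q) \<in> T)"

text \<open>Deligne's canonical bigrading of a mixed Hodge structure.\<close>

definition deligne_bigrading ::
    "(int \<Rightarrow> (complex^'n) set) \<Rightarrow> (int \<Rightarrow> (complex^'n) set) \<Rightarrow> int \<Rightarrow> int \<Rightarrow> (complex^'n) set" where
  "deligne_bigrading W F p q = F p \<inter> W (p + q) \<inter>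
     vec.span ((conj_set (F q) \<inter> W (p + q)) \<union>
               (\<Union>i::nat. conj_set (F (q - 1 - int i)) \<inter> W (p + q - 2 - int i)))"

text \<open>The homomorphism from the Deligne torus \<open>S\<close>, whose group of complex points is
  the product of two copies of the multiplicative group, to the general linear group attached to a
  mixed Hodge structure: \<open>(z1, z2)\<close> acts on the component of bidegree \<open>(p, q)\<close> as
  multiplication by \<open>z1\<close> to the power \<open>- p\<close> times \<open>z2\<close> to the power \<open>- q\<close>.
  Homomorphisms from \<open>S\<close> are curried and take the value 0 outside the torus.\<close>

definition hodge_hom ::
    "(int \<Rightarrow> (complex^'n) set) \<Rightarrow> (int \<Rightarrow> (complex^'n) set) \<Rightarrow> complex \<Rightarrow> complex \<Rightarrow> complex^'n^'n" where
  "hodge_hom W F z1 z2 = (if z1 = 0 \<or> z2 = 0 then 0 else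
     (THE A. \<forall>p q. \<forall>v\<in>deligne_bigrading W F p q. A *v v = (z1 powi (- p) * z2 powi (- q)) *s v))"


section \<open>Linear algebraic groups\<close>

text \<open>Linear algebraic groups are given by their groups of complex points inside the general
  linear group.\<close>

inductive_set polyfuns :: "((complex^'n^'n) \<Rightarrow> complex) set" where
  const: "(\<lambda>_. c) \<in> polyfuns"
| coord: "(\<lambda>A. A $ i $ j) \<in> polyfuns"
| add: "p \<in> polyfuns \<Longrightarrow> q \<in> polyfuns \<Longrightarrow> (\<lambda>A. p A + q A) \<in> polyfuns"
| mult: "p \<in> polyfuns \<Longrightarrow> q \<in> polyfuns \<Longrightarrow> (\<lambda>A. p A * q A) \<in> polyfuns"

definition zariski :: "(complex^'n^'n) topology" where
  "zariski = topology_generated_by {{A. p A \<noteq> 0} |p. p \<in> polyfuns}"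

definition mat_group :: "(complex^'n^'n) set \<Rightarrow> bool" where
  "mat_group G \<longleftrightarrow> G \<subseteq> {A. invertible A} \<and> mat 1 \<in> G \<and>
     (\<forall>A\<in>G. \<forall>B\<in>G. A ** B \<in> G) \<and> (\<forall>A\<in>G. matrix_inv A \<in> G)"

definition alg_group :: "(complex^'n^'n) set \<Rightarrow> bool" where
  "alg_group G \<longleftrightarrow> mat_group G \<and> (\<exists>Z. closedin zariski Z \<and> G = Z \<inter> {A. invertible A})"

definition alg_group_over_Q :: "(complex^'n^'n) set \<Rightarrow> bool" where
  "alg_group_over_Q G \<longleftrightarrow> alg_group G \<and> (\<forall>s. field_aut s \<longrightarrow> map_mat s ` G = G)"

definition id_component :: "(complex^'n^'n) set \<Rightarrow> (complex^'n^'n) set" where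
  "id_component G = connected_component_of_set (subtopology zariski G) (mat 1)"

text \<open>Points with coordinates in a subring \<open>R\<close> of the complex numbers.\<close>

definition pts :: "complex set \<Rightarrow> (complex^'n^'n) set \<Rightarrow> (complex^'n^'n) set" where
  "pts R G = {A \<in> G. (\<forall>i j. A $ i $ j \<in> R) \<and> (\<forall>i j. matrix_inv A $ i $ j \<in> R)}"

text \<open>\<open>G(\<real>)\<^sup>+\<close>: the identity component of the Lie group of real points.\<close>

definition real_plus :: "(complex^'n^'n) set \<Rightarrow> (complex^'n^'n) set" where
  "real_plus G = connected_component_set (pts \<real> G) (mat 1)"

definition mat_prods :: "(complex^'n^'n) set \<Rightarrow> (complex^'n^'n) set \<Rightarrow> (complex^'n^'n) set" where
  "mat_prods G H = {A ** B |A B. A \<in> G \<and> B \<in> H}"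

definition normal_in :: "(complex^'n^'n) set \<Rightarrow> (complex^'n^'n) set \<Rightarrow> bool" where
  "normal_in N G \<longleftrightarrow> N \<subseteq> G \<and> (\<forall>A\<in>G. \<forall>B\<in>N. A ** B ** matrix_inv A \<in> N)"

definition unipotent_mat :: "complex^'n^'n \<Rightarrow> bool" where
  "unipotent_mat A \<longleftrightarrow> (\<exists>k. ((\<lambda>B. (A - mat 1) ** B) ^^ k) (mat 1) = 0)"

definition normal_unipotent :: "(complex^'n^'n) set \<Rightarrow> (complex^'n^'n) set \<Rightarrow> bool" where
  "normal_unipotent N G \<longleftrightarrow> alg_group N \<and> connectedin zariski N \<and> normal_in N G \<and>
     (\<forall>A\<in>N. unipotent_mat A)"

definition unipotent_radical :: "(complex^'n^'n) set \<Rightarrow> (complex^'n^'n) set \<Rightarrow> bool" where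
  "unipotent_radical W G \<longleftrightarrow> normal_unipotent W G \<and> (\<forall>N. normal_unipotent N G \<longrightarrow> N \<subseteq> W)"

text \<open>The Lie algebra: the Zariski tangent space at the identity.\<close>

definition lie :: "(complex^'n^'n) set \<Rightarrow> (complex^'n^'n) set" where
  "lie G = {X. \<forall>p\<in>polyfuns. (\<forall>A\<in>G. p A = 0) \<longrightarrow>
     ((\<lambda>t. p (mat 1 + mat t ** X)) has_field_derivative 0) (at 0)}"

definition split_torus_over_Q :: "(complex^'n^'n) set \<Rightarrow> bool" where
  "split_torus_over_Q S \<longleftrightarrow> alg_group_over_Q S \<and> connectedin zariski S \<and>
     (\<exists>B :: complex^'n^'n. invertible B \<and> (\<forall>i j. B $ i $ j \<in> \<rat>) \<and>
          (\<forall>A\<in>S. \<forall>i j. i \<noteq> j \<longrightarrow> (B ** A ** matrix_inv B) $ i $ j = 0))"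


section \<open>Connected mixed Shimura data\<close>

text \<open>Homomorphisms of complex algebraic groups from the Deligne torus to \<open>G\<close>: homomorphisms
  whose coordinates are Laurent polynomials.\<close>

definition S_hom :: "(complex^'n^'n) set \<Rightarrow> (complex \<Rightarrow> complex \<Rightarrow> complex^'n^'n) \<Rightarrow> bool" where
  "S_hom G x \<longleftrightarrow>
     (\<forall>z1 z2. z1 = 0 \<or> z2 = 0 \<longrightarrow> x z1 z2 = 0) \<and>
     (\<forall>z1 z2. z1 \<noteq> 0 \<longrightarrow> z2 \<noteq> 0 \<longrightarrow> x z1 z2 \<in> G) \<and>
     (\<forall>z1 z2 w1 w2. z1 \<noteq> 0 \<longrightarrow> z2 \<noteq> 0 \<longrightarrow> w1 \<noteq> 0 \<longrightarrow> w2 \<noteq> 0 \<longrightarrow>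
        x (z1 * w1) (z2 * w2) = x z1 z2 ** x w1 w2) \<and>
     (\<exists>N m c. \<forall>z1 z2. z1 \<noteq> 0 \<longrightarrow> z2 \<noteq> 0 \<longrightarrow> (\<forall>i j.
        (z1 * z2) ^ N * x z1 z2 $ i $ j = (\<Sum>a\<le>m. \<Sum>b\<le>(m::nat). c a b i j * z1 ^ a * z2 ^ b)))"

definition conj_hom ::
    "complex^'n^'n \<Rightarrow> (complex \<Rightarrow> complex \<Rightarrow> complex^'n^'n) \<Rightarrow> complex \<Rightarrow> complex \<Rightarrow> complex^'n^'n" where
  "conj_hom A x = (\<lambda>z1 z2. A ** x z1 z2 ** matrix_inv A)"

definition hom_orbit ::
    "(complex^'n^'n) set \<Rightarrow> (complex \<Rightarrow> complex \<Rightarrow> complex^'n^'n) \<Rightarrow>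
     (complex \<Rightarrow> complex \<Rightarrow> complex^'n^'n) set" where
  "hom_orbit G x = (\<lambda>A. conj_hom A x) ` G"

text \<open>The components of the Lie algebra of \<open>G\<close> under the adjoint action composed with \<open>x\<close>,
  and the weight and Hodge filtrations which they define.\<close>

definition ad_component ::
    "(complex^'n^'n) set \<Rightarrow> (complex \<Rightarrow> complex \<Rightarrow> complex^'n^'n) \<Rightarrow> int \<Rightarrow> int \<Rightarrow> (complex^('n \<times> 'n)) set" where
  "ad_component G x p q = vec_of_mat ` {X \<in> lie G. \<forall>z1 z2. z1 \<noteq> 0 \<longrightarrow> z2 \<noteq> 0 \<longrightarrow>
     x z1 z2 ** X ** matrix_inv (x z1 z2) = mat (z1 powi (- p) * z2 powi (- q)) ** X}"

definition ad_W where
  "ad_W G x n = vec.span (\<Union>{ad_component G x p q |p q. p + q \<le> n})"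

definition ad_F where
  "ad_F G x p = vec.span (\<Union>{ad_component G x p' q |p' q. p' \<ge> p})"

text \<open>The preimage in \<open>G\<close> of the centre of \<open>G / W\<close>.\<close>

definition centre_mod :: "(complex^'n^'n) set \<Rightarrow> (complex^'n^'n) set \<Rightarrow> (complex^'n^'n) set" where
  "centre_mod G W = {Z \<in> G. \<forall>A\<in>G. Z ** A ** matrix_inv Z ** matrix_inv A \<in> W}"

text \<open>Conjugation by \<open>c\<close> is a Cartan involution of the real group \<open>(G / W)\<^sup>a\<^sup>d\<close>: it is an
  involution, and the real form of \<open>(G / W)\<^sup>a\<^sup>d\<close> obtained by twisting complex conjugation with it
  has a compact group of real points.
  Here \<open>G / centre_mod G W\<close> is the group of complex points of \<open>(G / W)\<^sup>a\<^sup>d\<close>; compactness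
  of a quotient is expressed by a compact set meeting all cosets.\<close>

definition cartan_mod :: "(complex^'n^'n) set \<Rightarrow> (complex^'n^'n) set \<Rightarrow> complex^'n^'n \<Rightarrow> bool" where
  "cartan_mod G W c \<longleftrightarrow> c ** c \<in> centre_mod G W \<and>
     (\<exists>K. compact K \<and> K \<subseteq> G \<and>
       {A \<in> G. matrix_inv A ** (c ** map_mat cnj A ** matrix_inv c) \<in> centre_mod G W}
         \<subseteq> mat_prods K (centre_mod G W))"

text \<open>The identity component of the centre of \<open>G / W\<close> is an almost direct product of a torus
  split over the rationals and of a group of compact type defined over the rationals.
  As \<open>W\<close> is unipotent, the split torus in \<open>G / W\<close> lifts to a split torus \<open>S\<close> in \<open>G\<close>,
  whereas \<open>T\<close> is the preimage in \<open>G\<close> of the compact part.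
  When \<open>W\<close> is the unipotent radical this is equivalent to the same condition on the maximal torus
  quotient of \<open>G\<close>, to which the connected centre of \<open>G / W\<close> is isogenous.\<close>

definition centre_split_compact :: "(complex^'n^'n) set \<Rightarrow> (complex^'n^'n) set \<Rightarrow> bool" where
  "centre_split_compact G W \<longleftrightarrow> (\<exists>S T.
     split_torus_over_Q S \<and> alg_group_over_Q T \<and> W \<subseteq> T \<and>
     mat_prods S T = id_component (centre_mod G W) \<and> finite (S \<inter> T) \<and>
     (\<exists>K. compact K \<and> K \<subseteq> pts \<real> T \<and> pts \<real> T \<subseteq> mat_prods K W))"

text \<open>Connected mixed Shimura data \<open>(G, X)\<close> in the sense of Pink. Instead of a connected component
  of an orbit of \<open>G(\<real>) U(\<complex>)\<close> we take an orbit of the identity component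
  \<open>G(\<real>)\<^sup>+ U(\<complex>)\<close> of this group, which is the same. The conditions hold for all \<open>x\<close> in \<open>X\<close>
  if they hold for one. There is no minimality condition on \<open>G\<close> (such as the absence of compact
  factors): it would not change the class of special subvarieties, and it fails for \<open>P_alpha\<close> in
  general, for instance if \<open>H_alpha\<close> is a point and \<open>G_alpha\<close> is not a torus. The complex conjugation of the Deligne torus sends \<open>(z1, z2)\<close> to
  \<open>(cnj z2, cnj z1)\<close>, and its real point \<open>\<i>\<close> is \<open>(\<i>, - \<i>)\<close>.\<close>

definition connected_msd ::
    "(complex^'n^'n) set \<Rightarrow> (complex \<Rightarrow> complex \<Rightarrow> complex^'n^'n) set \<Rightarrow> bool" where
  "connected_msd G X \<longleftrightarrow>
     alg_group_over_Q G \<and> connectedin zariski G \<and>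
     (\<exists>W U x.
       unipotent_radical W G \<and> alg_group_over_Q U \<and> U \<subseteq> W \<and> normal_in U G \<and>
       S_hom G x \<and> X = hom_orbit (mat_prods (real_plus G) U) x \<and>
       (\<forall>z1 z2. z1 \<noteq> 0 \<longrightarrow> z2 \<noteq> 0 \<longrightarrow>
          matrix_inv (map_mat cnj (x z1 z2)) ** x (cnj z2) (cnj z1) \<in> U) \<and>
       mixed_hodge (vec_of_mat ` lie G) (ad_W G x) (ad_F G x) \<and>
       hodge_type (ad_W G x) (ad_F G x) {(-1,1), (0,0), (1,-1), (-1,0), (0,-1), (-1,-1)} \<and>
       (\<forall>n. ad_W G x n = (if n < -2 then {0} else if n = -2 then vec_of_mat ` lie U
              else if n = -1 then vec_of_mat ` lie W else vec_of_mat ` lie G)) \<and>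
       cartan_mod G W (x \<i> (- \<i>)) \<and>
       centre_split_compact G W)"

text \<open>Congruence subgroups of \<open>G(\<int>)\<close>, inside \<open>G(\<real>)\<^sup>+\<close> so that they act on \<open>X\<close>.\<close>

definition congruence_subgroup :: "(complex^'n^'n) set \<Rightarrow> (complex^'n^'n) set \<Rightarrow> bool" where
  "congruence_subgroup \<Gamma> G \<longleftrightarrow> mat_group \<Gamma> \<and> \<Gamma> \<subseteq> pts \<int> G \<inter> real_plus G \<and>
     (\<exists>N::nat. N > 0 \<and> {A \<in> pts \<int> G \<inter> real_plus G.
        \<forall>i j. \<exists>k::int. (A - mat 1) $ i $ j = of_nat N * of_int k} \<subseteq> \<Gamma>)"

text \<open>\<open>Z\<close> is a special subvariety of the mixed Shimura variety \<open>\<Gamma> \ X\<close> attached to \<open>(G, X)\<close>.\<close>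

definition special_subvariety ::
    "(complex^'n^'n) set \<Rightarrow> (complex \<Rightarrow> complex \<Rightarrow> complex^'n^'n) set \<Rightarrow> (complex^'n^'n) set \<Rightarrow>
     (complex \<Rightarrow> complex \<Rightarrow> complex^'n^'n) set set \<Rightarrow> bool" where
  "special_subvariety G X \<Gamma> Z \<longleftrightarrow> connected_msd G X \<and>
     (\<exists>G' X'. connected_msd G' X' \<and> G' \<subseteq> G \<and> X' \<subseteq> X \<and> Z = hom_orbit \<Gamma> ` X')"


section \<open>The Siegel space, the group \<open>P\<close> and the domain \<open>D\<close>\<close>

definition siegel :: "(complex^'d^'d) set" where
  "siegel = {\<tau>. transpose \<tau> = \<tau> \<and>
     (\<forall>x::real^'d. x \<noteq> 0 \<longrightarrow> (\<Sum>i\<in>UNIV. \<Sum>j\<in>UNIV. x $ i * Im (\<tau> $ i $ j) * x $ j) > 0)}"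

definition J_mat :: "complex^('d::finite + 'd)^('d + 'd)" where
  "J_mat = (\<chi> i j. case i of
       Inl a \<Rightarrow> (case j of Inl b \<Rightarrow> 0 | Inr b \<Rightarrow> if a = b then -1 else 0)
     | Inr a \<Rightarrow> (case j of Inl b \<Rightarrow> if a = b then 1 else 0 | Inr b \<Rightarrow> 0))"

definition Psi :: "complex^('d::finite + 'd) \<Rightarrow> complex^('d + 'd) \<Rightarrow> complex" where
  "Psi x y = 2 * of_real pi * \<i> * bdot x (J_mat *v y)"

definition GSp :: "((complex^('d::finite + 'd)^('d + 'd)) \<times> complex) set" where
  "GSp = {(g, \<mu>). invertible g \<and> \<mu> \<noteq> 0 \<and> (\<forall>x y. Psi (g *v x) (g *v y) = \<mu> * Psi x y)}"

text \<open>Elements of \<open>M\<close> tensor \<open>\<complex>\<close> are given by their coordinates with respect to the basis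
  \<open>2 \<pi> \<i> e_0, e_1, \<dots>, e_{2d+1}\<close> of \<open>M\<close>, so that \<open>M\<close> is the standard lattice, complex conjugation is
  coordinatewise and the matrices in \<open>P\<close> act in the standard way.\<close>

type_synonym 'd ix = "unit + ('d + 'd) + unit"

abbreviation top_ix :: "'d ix" where "top_ix \<equiv> Inl ()"
abbreviation mid_ix :: "'d + 'd \<Rightarrow> 'd ix" where "mid_ix k \<equiv> Inr (Inl k)"
abbreviation bot_ix :: "'d ix" where "bot_ix \<equiv> Inr (Inr ())"

definition vec3 :: "complex \<Rightarrow> complex^('d::finite + 'd) \<Rightarrow> complex \<Rightarrow> complex^('d ix)" where
  "vec3 a b c = (\<chi> i. case i of Inl _ \<Rightarrow> a | Inr (Inl k) \<Rightarrow> b $ k | Inr (Inr _) \<Rightarrow> c)"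

definition vec2 :: "complex^('d::finite) \<Rightarrow> complex^'d \<Rightarrow> complex^('d + 'd)" where
  "vec2 a b = (\<chi> i. case i of Inl k \<Rightarrow> a $ k | Inr k \<Rightarrow> b $ k)"

text \<open>The block matrix with rows \<open>(m, x, z)\<close>, \<open>(0, g, y)\<close>, \<open>(0, 0, 1)\<close>.\<close>

definition blk :: "complex \<Rightarrow> complex^('d::finite + 'd) \<Rightarrow> complex \<Rightarrow> complex^('d + 'd)^('d + 'd) \<Rightarrow>
    complex^('d + 'd) \<Rightarrow> complex^('d ix)^('d ix)" where
  "blk m x z g y = (\<chi> i. case i of Inl _ \<Rightarrow> vec3 m x z
                            | Inr (Inl k) \<Rightarrow> vec3 0 (g $ k) (y $ k)
                            | Inr (Inr _) \<Rightarrow> vec3 0 0 1)"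

definition mu_of :: "complex^('d::finite ix)^('d ix) \<Rightarrow> complex" where
  "mu_of p = p $ top_ix $ top_ix"

definition g_of :: "complex^('d::finite ix)^('d ix) \<Rightarrow> complex^('d + 'd)^('d + 'd)" where
  "g_of p = (\<chi> i j. p $ mid_ix i $ mid_ix j)"

definition P_grp :: "(complex^('d::finite ix)^('d ix)) set" where
  "P_grp = {blk \<mu> x z g y |\<mu> x z g y. (g, \<mu>) \<in> GSp}"

text \<open>For a subgroup \<open>Q\<close> of \<open>P\<close>, its part \<open>Q\<^sup>u\<close>.\<close>

definition u_part :: "(complex^('d::finite ix)^('d ix)) set \<Rightarrow> (complex^('d ix)^('d ix)) set" where
  "u_part Q = {p \<in> Q. g_of p = mat 1 \<and> mu_of p = 1}"

definition U_grp :: "(complex^('d::finite ix)^('d ix)) set" where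
  "U_grp = {blk 1 0 z (mat 1) 0 |z. True}"

definition wt :: "int \<Rightarrow> (complex^('d::finite ix)) set" where
  "wt n = (if n \<le> -3 then {0} else if n = -2 then {v. \<exists>a. v = vec3 a 0 0}
           else if n = -1 then {v. \<exists>a b. v = vec3 a b 0} else UNIV)"

definition filt :: "(complex^'n) set \<Rightarrow> int \<Rightarrow> (complex^'n) set" where
  "filt F0 p = (if p < 0 then UNIV else if p = 0 then F0 else {0})"

text \<open>\<open>gr0 F0\<close> is the subspace \<open>F\<^sup>0\<close> of the complexified graded piece of weight \<open>-1\<close>.\<close>

definition gr0 :: "(complex^('d::finite ix)) set \<Rightarrow> (complex^('d + 'd)) set" where
  "gr0 F0 = {b. \<exists>a. vec3 a b 0 \<in> F0}"

text \<open>\<open>Psi\<close> is a polarisation of the Hodge structure of weight \<open>-1\<close> with \<open>F\<^sup>0 = E\<close>. The space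
  \<open>E\<close> is the component of bidegree \<open>(0,-1)\<close>, and the Weil operator is multiplication by \<open>\<i>\<close> on its
  conjugate (the sign for which \<open>D\<close> is fibred over the upper, and not the lower, Siegel space).\<close>

definition Psi_polarises :: "(complex^('d::finite + 'd)) set \<Rightarrow> bool" where
  "Psi_polarises E \<longleftrightarrow> (\<forall>x\<in>E. \<forall>y\<in>E. Psi x y = 0) \<and>
     (\<forall>x\<in>E. x \<noteq> 0 \<longrightarrow> (\<exists>r::real. r > 0 \<and>
        Psi x (\<i> *s map_vec cnj x) / (2 * of_real pi * \<i>) = of_real r))"

text \<open>A filtration in \<open>D\<close> is given by its term \<open>F\<^sup>0\<close>.\<close>

definition D_dom :: "(complex^('d::finite ix)) set set" where
  "D_dom = {F0. mixed_hodge UNIV wt (filt F0) \<and>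
     hodge_type wt (filt F0) {(-1,-1), (-1,0), (0,-1), (0,0)} \<and> Psi_polarises (gr0 F0)}"

text \<open>The point of \<open>D\<close> with coordinates \<open>(\<tau>, u, v, w)\<close>. The first row of the period matrix is
  divided by \<open>2 \<pi> \<i>\<close> because of our choice of the basis.\<close>

definition pt :: "complex^'d^'d \<Rightarrow> complex^'d \<Rightarrow> complex^'d \<Rightarrow> complex \<Rightarrow> (complex^('d::finite ix)) set" where
  "pt \<tau> u v w = {vec3 ((bdot u a + w * b) / (2 * of_real pi * \<i>)) (vec2 (\<tau> *v a + b *s v) a) b |a b. True}"

definition act :: "complex^'n^'n \<Rightarrow> (complex^'n) set \<Rightarrow> (complex^'n) set" where
  "act A F = (\<lambda>v. A *v v) ` F"

definition orb :: "(complex^'n^'n) set \<Rightarrow> (complex^'n) set \<Rightarrow> (complex^'n) set set" where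
  "orb G F = (\<lambda>A. act A F) ` G"

definition quot :: "(complex^'n^'n) set \<Rightarrow> (complex^'n) set set \<Rightarrow> (complex^'n) set set set" where
  "quot G X = orb G ` X"

text \<open>For \<open>G' \<subseteq> G\<close> and \<open>X' \<subseteq> X\<close>, the natural map from \<open>quot G' X'\<close> to \<open>quot G X\<close>.\<close>

definition quot_map :: "(complex^'n^'n) set \<Rightarrow> (complex^'n) set set \<Rightarrow> (complex^'n) set set" where
  "quot_map G C = (\<Union>F\<in>C. orb G F)"


section \<open>The abelian varieties and the Poincare torsor\<close>

definition projA :: "complex^'d^'d \<Rightarrow> complex^('d::finite + 'd) \<Rightarrow> complex^'d" where
  "projA \<tau> y = (\<chi> a. y $ Inl a) - \<tau> *v (\<chi> a. y $ Inr a)"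

definition projB :: "complex^'d^'d \<Rightarrow> complex^('d::finite + 'd) \<Rightarrow> complex^'d" where
  "projB \<tau> x = (2 * of_real pi * \<i>) *s ((\<chi> a. x $ Inl a) v* \<tau> + (\<chi> a. x $ Inr a))"

definition latA :: "complex^'d^'d \<Rightarrow> (complex^'d::finite) set" where
  "latA \<tau> = {projA \<tau> (civ n) |n. True}"

definition latB :: "complex^'d^'d \<Rightarrow> (complex^'d::finite) set" where
  "latB \<tau> = {projB \<tau> (civ n) |n. True}"

definition clsA :: "complex^'d^'d \<Rightarrow> complex^'d \<Rightarrow> (complex^'d::finite) set" where
  "clsA \<tau> v = (\<lambda>l. v + l) ` latA \<tau>"

definition clsB :: "complex^'d^'d \<Rightarrow> complex^'d \<Rightarrow> (complex^'d::finite) set" where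
  "clsB \<tau> u = (\<lambda>l. u + l) ` latB \<tau>"

definition A_var :: "complex^'d^'d \<Rightarrow> (complex^'d::finite) set set" where
  "A_var \<tau> = range (clsA \<tau>)"

definition B_var :: "complex^'d^'d \<Rightarrow> (complex^'d::finite) set set" where
  "B_var \<tau> = range (clsB \<tau>)"

definition coset_diff :: "'a::minus set \<Rightarrow> 'a set \<Rightarrow> 'a set" where
  "coset_diff a b = {x - y |x y. x \<in> a \<and> y \<in> b}"

text \<open>\<open>\<phi>\<close> is the complex-linear map of tangent spaces of the morphism (of abelian varieties)
  \<open>f\<close> from \<open>B_var \<tau>\<close> to \<open>A_var \<tau>\<close>.\<close>

definition lifts_to ::
    "complex^'d^'d \<Rightarrow> ((complex^'d) set \<Rightarrow> (complex^'d::finite) set) \<Rightarrow> (complex^'d \<Rightarrow> complex^'d) \<Rightarrow> bool" where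
  "lifts_to \<tau> f \<phi> \<longleftrightarrow> clinear_map \<phi> \<and> \<phi> ` latB \<tau> \<subseteq> latA \<tau> \<and> (\<forall>u. f (clsB \<tau> u) = clsA \<tau> (\<phi> u))"

definition morphism_BA ::
    "complex^'d^'d \<Rightarrow> ((complex^'d) set \<Rightarrow> (complex^'d::finite) set) \<Rightarrow> bool" where
  "morphism_BA \<tau> f \<longleftrightarrow> (\<exists>\<phi>. lifts_to \<tau> f \<phi>)"

text \<open>The morphism \<open>f\<close> is given on lattices by the integral matrix \<open>m\<close>.\<close>

definition lattice_matrix ::
    "complex^'d^'d \<Rightarrow> ((complex^'d) set \<Rightarrow> (complex^'d::finite) set) \<Rightarrow> int^('d + 'd)^('d + 'd) \<Rightarrow> bool" where
  "lattice_matrix \<tau> f m \<longleftrightarrow> (\<exists>\<phi>. lifts_to \<tau> f \<phi> \<and>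
     (\<forall>n. \<phi> (projB \<tau> (civ n)) = projA \<tau> (cim m *v civ n)))"

text \<open>The class in the quotient of \<open>D\<close> by \<open>P\<^sup>u(\<int>)\<close> of the point with coordinates
  \<open>(\<tau>, u, v, w)\<close>. Translation by \<open>c\<close> in the coordinate \<open>w\<close> is the
  action of the exponential of \<open>c\<close>.\<close>

definition cpt :: "complex^'d^'d \<Rightarrow> complex^'d \<Rightarrow> complex^'d \<Rightarrow> complex \<Rightarrow> (complex^('d::finite ix)) set set" where
  "cpt \<tau> u v w = orb (pts \<int> (u_part P_grp)) (pt \<tau> u v w)"

text \<open>The Poincare torsor at \<open>\<tau>\<close>, that is the fibre at \<open>\<tau>\<close> of the quotient of \<open>D\<close>, and its
  fibres over the points \<open>(a, b)\<close> of the product of \<open>A_var \<tau>\<close> and \<open>B_var \<tau>\<close>.\<close>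

definition poincare :: "complex^'d^'d \<Rightarrow> (complex^('d::finite ix)) set set set" where
  "poincare \<tau> = quot (pts \<int> (u_part P_grp)) {F \<in> D_dom. gr0 F = {vec2 (\<tau> *v a) a |a. True}}"

definition poincare_fibre ::
    "complex^'d^'d \<Rightarrow> (complex^'d) set \<Rightarrow> (complex^'d) set \<Rightarrow> (complex^('d::finite ix)) set set set" where
  "poincare_fibre \<tau> a b =
     {c \<in> poincare \<tau>. \<exists>u v w. c = cpt \<tau> u v w \<and> clsA \<tau> v = a \<and> clsB \<tau> u = b}"

text \<open>Holomorphic isomorphisms over \<open>B_var \<tau>\<close> between the pullbacks of the Poincare torsor by two
  maps \<open>b \<mapsto> (a1 b, b1 b)\<close> and \<open>b \<mapsto> (a2 b, b2 b)\<close> to the product of \<open>A_var \<tau>\<close> and \<open>B_var \<tau>\<close>,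
  which are given by holomorphic lifts \<open>(v1, u1)\<close> and \<open>(v2, u2)\<close> to the universal coverings.
  The function \<open>\<Phi>\<close> is given on the fibre at the class of \<open>t\<close> by multiplication with
  \<open>exp (h t)\<close> where \<open>h\<close> is locally a holomorphic function.\<close>

definition torsor_iso :: "complex^'d^'d \<Rightarrow> (complex^'d \<Rightarrow> complex^'d) \<Rightarrow> (complex^'d \<Rightarrow> complex^'d) \<Rightarrow>
    (complex^'d \<Rightarrow> complex^'d) \<Rightarrow> (complex^'d \<Rightarrow> complex^'d::finite) \<Rightarrow> bool" where
  "torsor_iso \<tau> v1 u1 v2 u2 \<longleftrightarrow>
     (\<exists>\<Phi> :: (complex^'d) set \<Rightarrow> (complex^('d ix)) set set \<Rightarrow> (complex^('d ix)) set set.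
       \<forall>t0. \<exists>N h. open N \<and> t0 \<in> N \<and> holo_on N h \<and>
         (\<forall>t\<in>N. \<forall>w. \<Phi> (clsB \<tau> t) (cpt \<tau> (u1 t) (v1 t) w) = cpt \<tau> (u2 t) (v2 t) (w + h t)))"

text \<open>\<open>g\<close> is the dual of \<open>f\<close>, where the Poincare torsor identifies \<open>B_var \<tau>\<close> with the dual of
  \<open>A_var \<tau>\<close> and \<open>A_var \<tau>\<close> with the dual of \<open>B_var \<tau>\<close>: for all \<open>b\<close> in \<open>B_var \<tau>\<close>,
  the pullback by \<open>f\<close> of the restriction of the Poincare torsor to \<open>A_var \<tau> \<times> {b}\<close> is isomorphic to
  its restriction to \<open>{g b} \<times> B_var \<tau>\<close>.\<close>

definition dual_morphism :: "complex^'d^'d \<Rightarrow> ((complex^'d) set \<Rightarrow> (complex^'d) set) \<Rightarrow>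
    ((complex^'d) set \<Rightarrow> (complex^'d::finite) set) \<Rightarrow> bool" where
  "dual_morphism \<tau> f g \<longleftrightarrow> morphism_BA \<tau> g \<and>
     (\<exists>\<phi>. lifts_to \<tau> f \<phi> \<and>
        (\<forall>u. \<forall>v\<in>g (clsB \<tau> u). torsor_iso \<tau> \<phi> (\<lambda>_. u) (\<lambda>_. v) (\<lambda>t. t)))"

text \<open>\<open>s\<close> is a holomorphic section of the restriction of the Poincare torsor to the graph of
  \<open>a\<close>, viewed as a torsor over \<open>B_var \<tau>\<close>.\<close>

definition graph_section :: "complex^'d^'d \<Rightarrow> ((complex^'d) set \<Rightarrow> (complex^'d) set) \<Rightarrow>
    ((complex^'d) set \<Rightarrow> (complex^('d::finite ix)) set set) \<Rightarrow> bool" where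
  "graph_section \<tau> a s \<longleftrightarrow>
     (\<forall>b\<in>B_var \<tau>. s b \<in> poincare_fibre \<tau> (a b) b) \<and>
     (\<forall>t0. \<exists>N V w. open N \<and> t0 \<in> N \<and> (\<forall>k. holo_on N (\<lambda>t. V t $ k)) \<and> holo_on N w \<and>
        (\<forall>t\<in>N. s (clsB \<tau> t) = cpt \<tau> t (V t) (w t)))"


section \<open>The objects attached to \<open>f\<close> and \<open>\<alpha>\<close>\<close>

text \<open>\<open>(g, \<mu>)\<close> acts on row vectors in the twisted dual of the graded piece of weight \<open>-1\<close>
  by \<open>n \<mapsto> \<mu> n g\<^sup>-\<^sup>1\<close>. It stabilises the map given by \<open>\<alpha>\<close> if this map commutes with
  the actions.\<close>

definition stabilises :: "complex^('d::finite + 'd)^('d + 'd) \<Rightarrow> complex^('d + 'd)^('d + 'd) \<Rightarrow> complex \<Rightarrow> bool" where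
  "stabilises \<alpha> g \<mu> \<longleftrightarrow> (\<forall>n. g *v (\<alpha> *v n) = \<alpha> *v (\<mu> *s (n v* matrix_inv g)))"

text \<open>The multiplier is determined by \<open>g\<close>, so \<open>G_alpha\<close> is given as a group of matrices \<open>g\<close>.\<close>

definition G_alpha :: "int^('d::finite + 'd)^('d + 'd) \<Rightarrow> (complex^('d + 'd)^('d + 'd)) set" where
  "G_alpha \<alpha> = id_component {g. \<exists>\<mu>. (g, \<mu>) \<in> GSp \<and> stabilises (cim \<alpha>) g \<mu>}"

definition P_alpha :: "int^('d::finite + 'd)^('d + 'd) \<Rightarrow> (complex^('d ix)^('d ix)) set" where
  "P_alpha \<alpha> = id_component {p \<in> P_grp. stabilises (cim \<alpha>) (g_of p) (mu_of p)}"

text \<open>With \<open>\<alpha> = f + f\<^sup>t\<close> this is the stabiliser in \<open>P_alpha\<close> of the map from the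
  twisted dual of \<open>M\<close> to \<open>M\<close> given by \<open>\<alpha>\<close>, written out; stabilising that map means
  \<open>2 \<mu> z = x \<alpha> x\<^sup>t = 2 x f x\<^sup>t\<close> and \<open>\<mu> y = g \<alpha> x\<^sup>t\<close>.\<close>

definition P_tilde :: "int^('d::finite + 'd)^('d + 'd) \<Rightarrow> int^('d + 'd)^('d + 'd) \<Rightarrow>
    (complex^('d ix)^('d ix)) set" where
  "P_tilde f \<alpha> = {blk \<mu> x (inverse \<mu> * bdot x (cim f *v x)) g (inverse \<mu> *s (g *v (cim \<alpha> *v x))) |\<mu> x g.
     (g, \<mu>) \<in> GSp \<and> g \<in> G_alpha \<alpha>}"

definition D_alpha :: "int^('d::finite + 'd)^('d + 'd) \<Rightarrow> complex^'d^'d \<Rightarrow> (complex^('d ix)) set set" where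
  "D_alpha \<alpha> \<tau>0 = orb (mat_prods (real_plus (P_alpha \<alpha>)) U_grp) (pt \<tau>0 0 0 0)"

definition D_tilde :: "int^('d::finite + 'd)^('d + 'd) \<Rightarrow> int^('d + 'd)^('d + 'd) \<Rightarrow> complex^'d^'d \<Rightarrow>
    (complex^('d ix)) set set" where
  "D_tilde f \<alpha> \<tau>0 = orb (real_plus (P_tilde f \<alpha>)) (pt \<tau>0 0 0 0)"

text \<open>The action of \<open>GSp(\<real>)\<^sup>+\<close> on the Siegel space is the action on the subspaces of
  \<open>\<complex>\<^sup>2\<^sup>d\<close> spanned by the columns of the period matrices.\<close>

definition H_alpha :: "int^('d::finite + 'd)^('d + 'd) \<Rightarrow> complex^'d^'d \<Rightarrow> (complex^'d^'d) set" where
  "H_alpha \<alpha> \<tau>0 = {\<tau> \<in> siegel. \<exists>g\<in>real_plus (G_alpha \<alpha>).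
     act g {vec2 (\<tau>0 *v a) a |a. True} = {vec2 (\<tau> *v a) a |a. True}}"

text \<open>The family of the abelian varieties \<open>B_var \<tau>\<close> over \<open>H_alpha \<alpha> \<tau>0\<close>.\<close>

definition B_family :: "int^('d::finite + 'd)^('d + 'd) \<Rightarrow> complex^'d^'d \<Rightarrow>
    ((complex^'d^'d) \<times> (complex^'d) set) set" where
  "B_family \<alpha> \<tau>0 = {(\<tau>, b). \<tau> \<in> H_alpha \<alpha> \<tau>0 \<and> b \<in> B_var \<tau>}"

text \<open>\<open>r\<close> is a holomorphic section of the projection from the quotient of \<open>D_alpha \<alpha> \<tau>0\<close> by
  \<open>P_alpha\<^sup>u(\<int>)\<close> to \<open>B_family \<alpha> \<tau>0\<close>, which sends the class of \<open>pt \<tau> u v w\<close> to \<open>(\<tau>, clsB \<tau> u)\<close>.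
  Holomorphic functions on \<open>H_alpha \<alpha> \<tau>0\<close> are locally
  restrictions of holomorphic functions on the space of all matrices.\<close>

definition family_section :: "int^('d::finite + 'd)^('d + 'd) \<Rightarrow> complex^'d^'d \<Rightarrow>
    ((complex^'d^'d) \<times> (complex^'d) set \<Rightarrow> (complex^('d ix)) set set) \<Rightarrow> bool" where
  "family_section \<alpha> \<tau>0 r \<longleftrightarrow>
     (\<forall>(\<tau>, b)\<in>B_family \<alpha> \<tau>0. r (\<tau>, b) \<in> quot (pts \<int> (u_part (P_alpha \<alpha>))) (D_alpha \<alpha> \<tau>0) \<and>
        (\<exists>u v w. pt \<tau> u v w \<in> r (\<tau>, b) \<and> clsB \<tau> u = b)) \<and>
     (\<forall>\<tau>1\<in>H_alpha \<alpha> \<tau>0. \<forall>t1. \<exists>N V w. open N \<and> (\<tau>1, t1) \<in> N \<and>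
        (\<forall>k. holo2_on N (\<lambda>y. V y $ k)) \<and> holo2_on N w \<and>
        (\<forall>(\<tau>, t)\<in>N. \<tau> \<in> H_alpha \<alpha> \<tau>0 \<longrightarrow>
           pt \<tau> t (V (\<tau>, t)) (w (\<tau>, t)) \<in> r (\<tau>, clsB \<tau> t)))"

text \<open>The homomorphism from the Deligne torus given by a point of \<open>D\<close>.\<close>

definition D_hom :: "(complex^('d::finite ix)) set \<Rightarrow> complex \<Rightarrow> complex \<Rightarrow> complex^('d ix)^('d ix)" where
  "D_hom F0 = hodge_hom wt (filt F0)"

end

theory Submission
  imports Defs "HOL-Complex_Analysis.Cauchy_Integral_Formula"
    "HOL-Computational_Algebra.Fundamental_Theorem_Algebra"
begin

text \<open>The factors of automorphy of the Poincare torsor show that the dual of \<open>f\<close> is given by minus the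
  transpose of the matrix of \<open>f\<close>, so that \<open>\<alpha>Z = fZ + fZ\<^sup>t\<close>. The orbit of \<open>P_tilde\<close> consists of one point for
  every \<open>\<tau>\<close> in \<open>H_alpha\<close> and every \<open>t\<close> in the universal covering of \<open>B_var \<tau>\<close>, with a \<open>v\<close>-coordinate linear in
  \<open>t\<close> and a \<open>w\<close>-coordinate quadratic in \<open>t\<close>; the group law of \<open>P_tilde\<^sup>u(\<int>)\<close> makes it descend to a section over the
  family of the \<open>B_var \<tau>\<close>. Two holomorphic sections over the graph of \<open>\<alpha>\<close> differ by a periodic
  holomorphic function without zeros, which is constant by Liouville's theorem.

  For the axioms of mixed Shimura data, conjugation by the Weil operator at \<open>\<tau>0\<close> turns the adjoint for a positive definite
  Hermitian form into an automorphism of \<open>G_alpha\<close>. A normal unipotent subgroup is stable under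
  commutators with adjoints, which forces it to be trivial, so the unipotent radical of \<open>P_alpha\<close> and of
  \<open>P_tilde\<close> is the part lying over 1; square roots of positive elements stay in Zariski closed groups,
  which gives the polar decomposition behind the Cartan involution.\<close>

section \<open>Block vectors and block matrices\<close>

text \<open>Nothing explicit is known about \<open>G_alpha\<close>: it is an identity component,
  without generators or a dimension. The arguments about it rest on three facts: it is Zariski
  closed and stable under field automorphisms, it contains the connected image of the Deligne torus
  at every compatible \<tau>, and it is stable under the Hermitian adjoint, which is expressed
  through complex conjugation, inversion and that torus. The matrix of f is not invariant under
  \<open>G_alpha\<close>; only \<alpha> is, up to the multiplier. The group law of
  \<open>P_tilde\<close> works because z involves only the quadratic form of f, which is half of
  that of \<alpha>. Both groups P contract to \<open>G_alpha\<close> when x and y get the weight 1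
  and z the weight 2, and this settles all their connectedness questions at once. The homomorphisms
  attached to points of D are defined through Deligne's bigrading, which commutes with real matrices
  but not with complex ones; so the translates by \<open>U_grp\<close> need an explicit computation,
  after which real equivariance does the rest.\<close>

lemma sum_UNIV_plus:
  fixes F :: "'a::finite + 'b::finite \<Rightarrow> 'c::comm_monoid_add"
  shows "(\<Sum>i\<in>UNIV. F i) = (\<Sum>i\<in>UNIV. F (Inl i)) + (\<Sum>i\<in>UNIV. F (Inr i))"
  using sum.Plus[of "UNIV :: 'a set" "UNIV :: 'b set" F] by (simp add: comp_def)

lemma bdot_add_left: "bdot (x + y) z = bdot x z + bdot y z"
  by (simp add: bdot_def ring_distribs sum.distrib)

lemma bdot_add_right: "bdot x (y + z) = bdot x y + bdot x z"
  by (simp add: bdot_def ring_distribs sum.distrib)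

lemma bdot_scale_left [simp]: "bdot (c *s x) y = c * bdot x y"
  by (simp add: bdot_def sum_distrib_left mult_ac)

lemma bdot_scale_right [simp]: "bdot x (c *s y) = c * bdot x y"
  by (simp add: bdot_def sum_distrib_left mult_ac)

lemma bdot_zero [simp]: "bdot 0 x = 0" "bdot x 0 = 0"
  by (simp_all add: bdot_def)

lemma bdot_minus [simp]: "bdot (- x) y = - bdot x y" "bdot x (- y) = - bdot x y"
  by (simp_all add: bdot_def sum_negf)

lemma bdot_diff_left: "bdot (x - y) z = bdot x z - bdot y z"
  by (simp add: bdot_def ring_distribs sum_subtractf)

lemma bdot_diff_right: "bdot x (y - z) = bdot x y - bdot x z"
  by (simp add: bdot_def ring_distribs sum_subtractf)

lemmas bdot_distribs = bdot_add_left bdot_add_right bdot_diff_left bdot_diff_right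

lemma bdot_commute: "bdot x y = bdot y x"
  by (simp add: bdot_def mult_ac)

lemma bdot_axis [simp]: "bdot (axis i 1) x = x $ i" "bdot x (axis i 1) = x $ i"
  by (simp_all add: bdot_def axis_def if_distrib if_distribR cong: if_cong)

lemma bdot_eqI: "(\<And>y. bdot x y = bdot x' y) \<Longrightarrow> x = x'"
  by (metis bdot_axis(2) vec_eq_iff)

lemma bdot_matrix: "bdot x (A *v y) = bdot (x v* A) y"
  unfolding bdot_def matrix_vector_mult_def vector_matrix_mult_def
  by (simp add: sum_distrib_left sum_distrib_right mult_ac, subst sum.swap, rule refl)

lemma mat_vec [simp]: "mat c *v x = c *s (x :: complex^'n)"
  by (simp add: vec_eq_iff matrix_vector_mult_def mat_def if_distrib if_distribR cong: if_cong)

lemma vec_mat [simp]: "x v* mat c = c *s (x :: complex^'n)"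
  by (metis mat_vec transpose_mat vector_transpose_matrix)

lemma matrix_eqI: "(\<And>x. A *v x = B *v x) \<Longrightarrow> A = (B :: complex^'n^'m)"
  by (simp add: matrix_eq)

lemma matrix_vec_scale [simp]: "A *v (c *s x) = c *s (A *v (x :: complex^'n))"
  by (simp add: vec.scale)

lemma vec_matrix_scale [simp]: "(c *s x) v* A = c *s ((x :: complex^'n) v* A)"
  by (metis matrix_vec_scale transpose_matrix_vector)

lemma matrix_vec_minus [simp]: "A *v (- x) = - (A *v (x :: complex^'n))"
  by (simp add: vec.neg)

lemma vec_matrix_minus [simp]: "(- x) v* A = - ((x :: complex^'n) v* A)"
  by (metis matrix_vec_minus transpose_matrix_vector)

lemma vec_matrix_add: "(x + y) v* A = x v* A + (y :: complex^'n) v* A"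
  by (metis matrix_vector_right_distrib transpose_matrix_vector)

lemma vec_matrix_diff: "(x - y) v* A = x v* A - (y :: complex^'n) v* A"
  by (metis matrix_vector_mult_diff_distrib transpose_matrix_vector)

lemma matrix_inv_eqI:
  fixes A B :: "complex^'n^'n"
  assumes "A ** B = mat 1" shows "matrix_inv A = B" "invertible A"
proof -
  have BA: "B ** A = mat 1" using assms matrix_left_right_inverse by blast
  then show "invertible A" using assms invertible_def by blast
  have "A ** matrix_inv A = mat 1 \<and> matrix_inv A ** A = mat 1"
    unfolding matrix_inv_def by (rule someI[of _ B]) (use assms BA in simp)
  then show "matrix_inv A = B"
    by (metis assms matrix_mul_assoc matrix_mul_lid matrix_mul_rid)
qed

lemma matrix_inv_left: "invertible A \<Longrightarrow> matrix_inv A ** A = mat (1::complex)"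
  and matrix_inv_right: "invertible A \<Longrightarrow> A ** matrix_inv A = mat (1::complex)"
  for A :: "complex^'n^'n"
  using matrix_inv_eqI(1) unfolding invertible_def by metis+

lemma matrix_inv_mult:
  fixes A B :: "complex^'n^'n"
  assumes "invertible A" "invertible B"
  shows "matrix_inv (A ** B) = matrix_inv B ** matrix_inv A"
  by (intro matrix_inv_eqI(1))
     (metis assms matrix_inv_right matrix_mul_assoc matrix_mul_rid)

lemma invertible_matrix_inv: "invertible A \<Longrightarrow> invertible (matrix_inv A)"
  for A :: "complex^'n^'n"
  using matrix_inv_eqI(2) matrix_inv_left by blast

lemma matrix_inv_inv: "invertible A \<Longrightarrow> matrix_inv (matrix_inv A) = A"
  for A :: "complex^'n^'n"
  using matrix_inv_eqI(1) matrix_inv_left by blast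

lemma vec3_nth [simp]:
  "vec3 a b c $ top_ix = a" "vec3 a b c $ mid_ix k = b $ k" "vec3 a b c $ bot_ix = c"
  by (simp_all add: vec3_def)

lemma vec3_eq [simp]: "vec3 a b c = vec3 a' b' c' \<longleftrightarrow> a = a' \<and> b = b' \<and> c = c'"
  by (metis vec3_nth vec_eq_iff)

lemma vec3_cases: obtains a b c where "v = vec3 a b c"
proof
  show "v = vec3 (v $ top_ix) (\<chi> k. v $ mid_ix k) (v $ bot_ix)"
    by (simp add: vec_eq_iff vec3_def split: sum.split)
qed

lemma vec3_add [simp]: "vec3 a b c + vec3 a' b' c' = vec3 (a + a') (b + b') (c + c')"
  and vec3_diff [simp]: "vec3 a b c - vec3 a' b' c' = vec3 (a - a') (b - b') (c - c')"
  and vec3_scale [simp]: "k *s vec3 a b c = vec3 (k * a) (k *s b) (k * c)"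
  and vec3_zero: "0 = vec3 0 0 0"
  by (simp_all add: vec_eq_iff vec3_def split: sum.split)

lemma vec3_eq_0 [simp]: "vec3 a b c = 0 \<longleftrightarrow> a = 0 \<and> b = 0 \<and> c = 0"
  by (simp add: vec3_zero)

lemma map_vec_vec3 [simp]: "map_vec s (vec3 a b c) = vec3 (s a) (map_vec s b) (s c)"
  by (simp add: vec_eq_iff map_vec_def vec3_def split: sum.split)

lemma bdot_vec3 [simp]: "bdot (vec3 a b c) (vec3 a' b' c') = a * a' + bdot b b' + c * c'"
  unfolding bdot_def by (simp add: sum_UNIV_plus[where 'a=unit] sum_UNIV_plus[where 'b=unit] add.assoc UNIV_unit)

lemma vec2_nth [simp]: "vec2 a b $ Inl k = a $ k" "vec2 a b $ Inr k = b $ k"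
  by (simp_all add: vec2_def)

lemma vec2_eq [simp]: "vec2 a b = vec2 a' b' \<longleftrightarrow> a = a' \<and> b = b'"
  by (metis vec2_nth vec_eq_iff)

lemma vec2_cases: obtains a b where "v = vec2 a b"
proof
  show "v = vec2 (\<chi> k. v $ Inl k) (\<chi> k. v $ Inr k)"
    by (simp add: vec_eq_iff vec2_def split: sum.split)
qed

lemma vec2_add [simp]: "vec2 a b + vec2 a' b' = vec2 (a + a') (b + b')"
  and vec2_diff [simp]: "vec2 a b - vec2 a' b' = vec2 (a - a') (b - b')"
  and vec2_scale [simp]: "k *s vec2 a b = vec2 (k *s a) (k *s b)"
  and vec2_zero: "0 = vec2 0 0"
  by (simp_all add: vec_eq_iff vec2_def split: sum.split)

lemma vec2_eq_0 [simp]: "vec2 a b = 0 \<longleftrightarrow> a = 0 \<and> b = 0"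
  by (simp add: vec2_zero)

lemma map_vec_vec2 [simp]: "map_vec s (vec2 a b) = vec2 (map_vec s a) (map_vec s b)"
  by (simp add: vec_eq_iff map_vec_def vec2_def split: sum.split)

lemma bdot_vec2 [simp]: "bdot (vec2 a b) (vec2 a' b') = bdot a a' + bdot b b'"
  unfolding bdot_def by (simp add: sum_UNIV_plus)

lemma vec2_halves [simp]: "(\<chi> a. vec2 p q $ Inl a) = p" "(\<chi> a. vec2 p q $ Inr a) = q"
  by (simp_all add: vec_eq_iff)

lemma J_vec2 [simp]: "J_mat *v vec2 a b = vec2 (- b) a"
  by (simp add: vec_eq_iff J_mat_def matrix_vector_mult_def vec2_def sum_UNIV_plus if_distrib
      if_distribR split: sum.split cong: if_cong)

lemma blk_vec3 [simp]:
  "blk m x z g y *v vec3 a b c = vec3 (m * a + bdot x b + z * c) (g *v b + c *s y) c"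
proof -
  have row: "(A *v v) $ i = bdot (A $ i) v" for A :: "complex^'e^'f" and v i
    by (simp add: matrix_vector_mult_def bdot_def)
  show ?thesis
    by (simp add: vec_eq_iff row blk_def vec3_def[of "m * a + bdot x b + z * c"] mult_ac
        split: sum.split)
qed

lemma blk_eq [simp]:
  "blk m x z g y = blk m' x' z' g' y' \<longleftrightarrow> m = m' \<and> x = x' \<and> z = z' \<and> g = g' \<and> y = y'"
proof
  assume eq: "blk m x z g y = blk m' x' z' g' y'"
  have "blk m x z g y $ top_ix = blk m' x' z' g' y' $ top_ix"
    "blk m x z g y $ mid_ix k = blk m' x' z' g' y' $ mid_ix k" for k
    unfolding eq by simp_all
  then show "m = m' \<and> x = x' \<and> z = z' \<and> g = g' \<and> y = y'"
    by (simp add: blk_def vec_eq_iff[of g] vec_eq_iff[of y])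
qed simp

lemma blk_mult [simp]:
  fixes g :: "complex^('a::finite + 'a)^('a + 'a)"
  shows
  "blk m x z g y ** blk m' x' z' g' y' =
   blk (m * m') (m *s x' + x v* g') (m * z' + bdot x y' + z) (g ** g') (g *v y' + y)"
proof (rule matrix_eqI)
  fix v :: "complex^('a ix)"
  obtain a b c where "v = vec3 a b c" by (rule vec3_cases)
  then show "(blk m x z g y ** blk m' x' z' g' y') *v v =
      blk (m * m') (m *s x' + x v* g') (m * z' + bdot x y' + z) (g ** g') (g *v y' + y) *v v"
    by (simp add: matrix_vector_mul_assoc[symmetric] bdot_distribs bdot_matrix[of x]
        ring_distribs matrix_vector_right_distrib)
qed

lemma blk_1: "mat 1 = blk 1 0 0 (mat 1) 0"
proof (rule matrix_eqI)
  fix v :: "complex^('a ix)"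
  obtain a b c where "v = vec3 a b c" by (rule vec3_cases)
  then show "mat 1 *v v = blk 1 0 0 (mat 1) 0 *v v" by simp
qed

lemma blk_inv:
  assumes "m \<noteq> 0" "invertible g"
  shows "invertible (blk m x z g y)"
    "matrix_inv (blk m x z g y) = blk (inverse m) (- (inverse m *s (x v* matrix_inv g)))
       (inverse m * (bdot x (matrix_inv g *v y) - z)) (matrix_inv g) (- (matrix_inv g *v y))"
proof -
  have "blk m x z g y ** blk (inverse m) (- (inverse m *s (x v* matrix_inv g)))
       (inverse m * (bdot x (matrix_inv g *v y) - z)) (matrix_inv g) (- (matrix_inv g *v y)) = mat 1"
    using assms by (simp add: blk_1 matrix_inv_right matrix_vector_mul_assoc ring_distribs
        mult.assoc[symmetric])
  then show "invertible (blk m x z g y)" "matrix_inv (blk m x z g y) = blk (inverse m) (- (inverse m *s (x v* matrix_inv g)))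
       (inverse m * (bdot x (matrix_inv g *v y) - z)) (matrix_inv g) (- (matrix_inv g *v y))"
    by (rule matrix_inv_eqI)+
qed

lemma mu_of_blk [simp]: "mu_of (blk m x z g y) = m"
  and g_of_blk [simp]: "g_of (blk m x z g y) = g"
  by (simp_all add: mu_of_def g_of_def blk_def vec_eq_iff)

lemma map_mat_blk [simp]:
  assumes "s 0 = 0" "s 1 = 1"
  shows "map_mat s (blk m x z g y) = blk (s m) (map_vec s x) (s z) (map_mat s g) (map_vec s y)"
  using assms by (auto simp: vec_eq_iff map_mat_def map_vec_def blk_def vec3_def split: sum.split)

lemma blk_entries:
  "(\<forall>i j. blk m x z g y $ i $ j \<in> R) \<longleftrightarrow> 0 \<in> R \<and> 1 \<in> R \<and> m \<in> R \<and> z \<in> R \<and>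
     (\<forall>k. x $ k \<in> R) \<and> (\<forall>k. y $ k \<in> R) \<and> (\<forall>k l. g $ k $ l \<in> R)" (is "?L \<longleftrightarrow> ?R")
proof
  assume ?L
  then have "blk m x z g y $ i $ j \<in> R" for i j by blast
  from this[of top_ix top_ix] this[of top_ix "mid_ix _"] this[of top_ix bot_ix]
    this[of "mid_ix _" "mid_ix _"] this[of "mid_ix _" bot_ix] this[of bot_ix top_ix] this[of bot_ix bot_ix]
  show ?R by (auto simp: blk_def)
qed (auto simp: blk_def vec3_def split: sum.split)

section \<open>The Zariski topology\<close>

lemma polyfuns_minus: "p \<in> polyfuns \<Longrightarrow> (\<lambda>A. - p A) \<in> polyfuns"
  using polyfuns.mult[OF polyfuns.const[of "-1"]] by simp

lemma polyfuns_diff: "p \<in> polyfuns \<Longrightarrow> q \<in> polyfuns \<Longrightarrow> (\<lambda>A. p A - q A) \<in> polyfuns"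
  using polyfuns.add[OF _ polyfuns_minus] by simp

lemma polyfuns_sum: "(\<And>i. i \<in> I \<Longrightarrow> p i \<in> polyfuns) \<Longrightarrow> (\<lambda>A. \<Sum>i\<in>I. p i A) \<in> polyfuns"
  by (induction I rule: infinite_finite_induct) (auto intro: polyfuns.intros)

definition poly_map :: "(complex^'n^'n \<Rightarrow> complex^'k^'m) \<Rightarrow> bool" where
  "poly_map f \<longleftrightarrow> (\<forall>i j. (\<lambda>A. f A $ i $ j) \<in> polyfuns)"

definition poly_vec :: "(complex^'n^'n \<Rightarrow> complex^'m) \<Rightarrow> bool" where
  "poly_vec f \<longleftrightarrow> (\<forall>i. (\<lambda>A. f A $ i) \<in> polyfuns)"

lemma poly_map_comp:
  assumes "poly_map f" "p \<in> polyfuns" shows "(\<lambda>A. p (f A)) \<in> polyfuns"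
  using assms(2)
  by (induction p rule: polyfuns.induct) (use assms(1) in \<open>auto simp: poly_map_def intro: polyfuns.intros\<close>)

lemma poly_map_id: "poly_map (\<lambda>A. A)"
  and poly_map_const: "poly_map (\<lambda>A. B)"
  and poly_vec_const: "poly_vec (\<lambda>A. x)"
  by (auto simp: poly_map_def poly_vec_def intro: polyfuns.intros)

lemma poly_map_mult: "poly_map f \<Longrightarrow> poly_map g \<Longrightarrow> poly_map (\<lambda>A. f A ** g A)"
  unfolding poly_map_def matrix_matrix_mult_def by (auto intro!: polyfuns_sum polyfuns.mult)

lemma poly_map_transpose: "poly_map f \<Longrightarrow> poly_map (\<lambda>A. transpose (f A))"
  by (simp add: poly_map_def transpose_def)

lemma poly_map_mat: "p \<in> polyfuns \<Longrightarrow> poly_map (\<lambda>A. mat (p A))"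
  unfolding poly_map_def mat_def
proof (intro allI)
  fix i j
  assume "p \<in> polyfuns"
  then show "(\<lambda>A. (\<chi> i j. if i = j then p A else 0) $ i $ j) \<in> polyfuns"
    by (cases "i = j") (auto intro: polyfuns.intros)
qed

lemma poly_vec_mv: "poly_map f \<Longrightarrow> poly_vec x \<Longrightarrow> poly_vec (\<lambda>A. f A *v x A)"
  unfolding poly_map_def poly_vec_def matrix_vector_mult_def
  by (auto intro!: polyfuns_sum polyfuns.mult)

lemma poly_vec_scale: "p \<in> polyfuns \<Longrightarrow> poly_vec x \<Longrightarrow> poly_vec (\<lambda>A. p A *s x A)"
  by (auto simp: poly_vec_def intro: polyfuns.intros)

lemma polyfuns_bdot: "poly_vec x \<Longrightarrow> poly_vec y \<Longrightarrow> (\<lambda>A. bdot (x A) (y A)) \<in> polyfuns"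
  unfolding poly_vec_def bdot_def by (auto intro!: polyfuns_sum polyfuns.mult)

lemma poly_map_blk:
  assumes "m \<in> polyfuns" "poly_vec x" "z \<in> polyfuns" "poly_map g" "poly_vec y"
  shows "poly_map (\<lambda>A. blk (m A) (x A) (z A) (g A) (y A))"
  unfolding poly_map_def
proof (intro allI)
  fix i j
  show "(\<lambda>A. blk (m A) (x A) (z A) (g A) (y A) $ i $ j) \<in> polyfuns"
  proof -
    have "\<exists>k. i = top_ix \<or> i = mid_ix k \<or> i = bot_ix" for i :: "'b ix"
    proof (cases i)
      case (Inr k) then show ?thesis by (cases k) auto
    qed simp
    from this[of i] this[of j] show ?thesis
      using assms unfolding poly_map_def poly_vec_def by (auto simp: blk_def intro: polyfuns.intros)
  qed
qed

lemmas poly_intros = polyfuns.intros polyfuns_diff poly_map_comp poly_map_id poly_map_const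
  poly_vec_const poly_map_mult poly_map_transpose poly_map_mat poly_vec_mv poly_vec_scale
  polyfuns_bdot poly_map_blk

lemma UNIV_zariski_basic: "UNIV \<in> {{A. p A \<noteq> 0} |p. p \<in> polyfuns}"
  using polyfuns.const[of 1] by (intro CollectI exI[of _ "\<lambda>_. 1"]) auto

lemma topspace_zariski [simp]: "topspace zariski = UNIV"
  using UNIV_zariski_basic unfolding zariski_def topology_generated_by_topspace by blast

lemma openin_zariski_basic: "p \<in> polyfuns \<Longrightarrow> openin zariski {A. p A \<noteq> 0}"
  unfolding zariski_def by (rule topology_generated_by_Basis) auto

lemma closedin_zariski_basic: "p \<in> polyfuns \<Longrightarrow> closedin zariski {A. p A = 0}"
  using openin_zariski_basic[of p] by (simp add: closedin_def Compl_eq_Diff_UNIV[symmetric] Collect_neg_eq[symmetric])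

lemma closedin_zariski_all: "(\<And>i. closedin zariski {A. Q i A}) \<Longrightarrow> closedin zariski {A. \<forall>i. Q i A}"
  using closedin_Inter[of "range (\<lambda>i. {A. Q i A})" zariski] by (auto simp: INTER_eq)

text \<open>With \<open>closedin_zariski_all\<close> this treats quantifiers bounded by an arbitrary
  set, such as commuting with every element of a group: the intersection may be infinite and the
  index set need not be algebraic.\<close>

lemma closedin_zariski_imp:
  "(P \<Longrightarrow> closedin zariski {A. Q A}) \<Longrightarrow> closedin zariski {A. P \<longrightarrow> Q A}"
  using closedin_topspace[of zariski] by (cases P) auto

lemma closedin_zariski_conj:
  "closedin zariski {A. P A} \<Longrightarrow> closedin zariski {A. Q A} \<Longrightarrow> closedin zariski {A. P A \<and> Q A}"
  by (simp add: closedin_Int Collect_conj_eq)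

lemma closedin_zariski_eq: "p \<in> polyfuns \<Longrightarrow> q \<in> polyfuns \<Longrightarrow> closedin zariski {A. p A = q A}"
  using closedin_zariski_basic[OF polyfuns_diff, of p q] by simp

lemma closedin_zariski_eq_map: "poly_map f \<Longrightarrow> poly_map g \<Longrightarrow> closedin zariski {A. f A = g A}"
  unfolding vec_eq_iff poly_map_def by (intro closedin_zariski_all closedin_zariski_eq) auto

lemma closedin_zariski_eq_vec: "poly_vec f \<Longrightarrow> poly_vec g \<Longrightarrow> closedin zariski {A. f A = g A}"
  unfolding vec_eq_iff poly_vec_def by (intro closedin_zariski_all closedin_zariski_eq) auto

lemma continuous_map_zariskiI:
  fixes f :: "'b \<Rightarrow> complex^'c^'c"
  assumes "\<And>p. p \<in> polyfuns \<Longrightarrow> openin X {x \<in> topspace X. p (f x) \<noteq> 0}"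
  shows "continuous_map X zariski f"
  unfolding zariski_def continuous_on_generated_topo_iff
proof (intro conjI allI impI)
  fix U :: "(complex^'c^'c) set" assume "U \<in> {{A. p A \<noteq> 0} |p. p \<in> polyfuns}"
  then obtain p where p: "p \<in> polyfuns" "U = {A. p A \<noteq> 0}" by blast
  have "f -` U \<inter> topspace X = {x \<in> topspace X. p (f x) \<noteq> 0}" using p by auto
  then show "openin X (f -` U \<inter> topspace X)" using assms p by simp
next
  show "f ` topspace X \<subseteq> \<Union> {{A. p A \<noteq> 0} |p. p \<in> polyfuns}"
    using UNIV_zariski_basic by blast
qed

lemma continuous_map_poly_map: "poly_map f \<Longrightarrow> continuous_map zariski zariski f"
  using openin_zariski_basic[OF poly_map_comp] by (intro continuous_map_zariskiI) auto

lemma continuous_polyfuns: "p \<in> polyfuns \<Longrightarrow> continuous_on UNIV p"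
  by (induction p rule: polyfuns.induct) (auto intro!: continuous_intros)

lemma continuous_map_euclidean_zariski: "continuous_map euclidean zariski (\<lambda>A. A)"
proof (rule continuous_map_zariskiI)
  fix p :: "complex^'n^'n \<Rightarrow> complex" assume "p \<in> polyfuns"
  then have "open (p -` (- {0}))"
    by (intro open_vimage continuous_polyfuns) auto
  then show "openin euclidean {x \<in> topspace euclidean. p x \<noteq> 0}" by (simp add: vimage_def)
qed

text \<open>Polynomials are continuous, so the Zariski topology is coarser than the Euclidean one.
  Apart from identity components, the Zariski connected sets below are swept out by continuous
  images of connected subsets of complex spaces, without recourse to irreducibility.\<close>

lemma connectedin_zariski: "connected S \<Longrightarrow> connectedin zariski S"
  using connectedin_continuous_map_image[OF continuous_map_euclidean_zariski, of S]
  by (simp only: image_ident connectedin_iff_connected)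

lemma closed_zariski: "closedin zariski Z \<Longrightarrow> closed Z"
  using closedin_continuous_map_preimage[OF continuous_map_euclidean_zariski, of Z] by simp

lemma id_component_maximal:
  "connectedin zariski S \<Longrightarrow> S \<subseteq> G \<Longrightarrow> mat 1 \<in> S \<Longrightarrow> S \<subseteq> id_component G"
  unfolding id_component_def by (rule connected_component_of_maximal) (auto simp: connectedin_subtopology)

lemma connectedin_id_component: "connectedin zariski (id_component G)"
  and id_component_subset: "id_component G \<subseteq> G"
  using connectedin_connected_component_of[of "subtopology zariski G" "mat 1"]
  unfolding id_component_def connectedin_subtopology by auto

lemma one_in_id_component: "mat 1 \<in> G \<Longrightarrow> mat 1 \<in> id_component G"
  using id_component_maximal[of "{mat 1}"] by (auto simp: connectedin_sing)

lemma mat_group_closed: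
  assumes "mat_group G"
  shows "mat 1 \<in> G" "A \<in> G \<Longrightarrow> B \<in> G \<Longrightarrow> A ** B \<in> G" "A \<in> G \<Longrightarrow> matrix_inv A \<in> G"
    "A \<in> G \<Longrightarrow> invertible A"
  using assms by (auto simp: mat_group_def)

lemma mat_groupI:
  assumes "mat 1 \<in> G" "\<And>A. A \<in> G \<Longrightarrow> invertible A"
    "\<And>A B. A \<in> G \<Longrightarrow> B \<in> G \<Longrightarrow> matrix_inv A ** B \<in> G"
  shows "mat_group G"
proof -
  have inv: "matrix_inv A \<in> G" if "A \<in> G" for A
    using assms(3)[OF that assms(1)] by simp
  moreover have "A ** B \<in> G" if "A \<in> G" "B \<in> G" for A B
    using assms(3)[OF inv[OF that(1)] that(2)] assms(2)[OF that(1)] by (simp add: matrix_inv_inv)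
  ultimately show ?thesis using assms(1,2) by (auto simp: mat_group_def)
qed

text \<open>The translate of the component by \<open>matrix_inv A\<close> is connected, and it
  contains 1 because A lies in the component. With the criterion \<open>mat_groupI\<close> only such
  a translation by a constant matrix is needed, and it is polynomial, unlike inversion.\<close>

lemma mat_group_id_component:
  assumes G: "mat_group G" shows "mat_group (id_component G)"
proof (rule mat_groupI)
  show "mat 1 \<in> id_component G" using one_in_id_component mat_group_closed(1)[OF G] .
  show inv: "invertible A" if "A \<in> id_component G" for A
    using that id_component_subset mat_group_closed(4)[OF G] by blast
  fix A B assume A: "A \<in> id_component G" and B: "B \<in> id_component G"
  let ?T = "(\<lambda>B. matrix_inv A ** B) ` id_component G"
  have "A \<in> G" using A id_component_subset by blast
  have "connectedin zariski ?T"
    by (rule connectedin_continuous_map_image[OF continuous_map_poly_map connectedin_id_component])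
       (intro poly_intros)
  moreover have "?T \<subseteq> G"
    using mat_group_closed(2)[OF G mat_group_closed(3)[OF G \<open>A \<in> G\<close>]] id_component_subset by blast
  moreover have "mat 1 \<in> ?T" using A inv[OF A] by (metis imageI matrix_inv_left)
  ultimately show "matrix_inv A ** B \<in> id_component G"
    using id_component_maximal B by blast
qed

lemma alg_groupI:
  "mat_group G \<Longrightarrow> closedin zariski Z \<Longrightarrow> G = Z \<inter> {A. invertible A} \<Longrightarrow> alg_group G"
  unfolding alg_group_def by blast

lemma alg_group_id_component:
  assumes "alg_group G" shows "alg_group (id_component G)"
proof -
  from assms obtain Z where Z: "closedin zariski Z" "G = Z \<inter> {A. invertible A}"
    and G: "mat_group G" by (auto simp: alg_group_def)
  have "closedin (subtopology zariski G) (id_component G)"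
    unfolding id_component_def by (rule closedin_connected_component_of)
  then obtain Z' where "closedin zariski Z'" "id_component G = Z' \<inter> G"
    unfolding closedin_subtopology by blast
  then show ?thesis
    using Z by (intro alg_groupI[OF mat_group_id_component[OF G], of "Z' \<inter> Z"]) auto
qed

section \<open>Field automorphisms\<close>

lemma field_aut_props:
  assumes "field_aut s"
  shows "s 0 = 0" "s 1 = 1" "s (a + b) = s a + s b" "s (a * b) = s a * s b" "s (- a) = - s a"
    "s (a - b) = s a - s b" "s (inverse a) = inverse (s a)" "s a = 0 \<longleftrightarrow> a = 0" "s (of_int n) = of_int n"
    "s (sum f I) = (\<Sum>i\<in>I. s (f i))"
proof -
  have add: "s (a + b) = s a + s b" and mult: "s (a * b) = s a * s b" for a b
    using assms by (auto simp: field_aut_def)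
  show 0: "s 0 = 0" using add[of 0 0] by simp
  have inj: "inj s" using assms by (simp add: field_aut_def bij_is_inj)
  show z: "s a = 0 \<longleftrightarrow> a = 0" for a using inj 0 by (metis injD)
  show 1: "s 1 = 1" using mult[of 1 1] z[of 1] by simp
  show m: "s (- a) = - s a" for a using add[of a "- a"] 0 by (simp add: add_eq_0_iff)
  show "s (a - b) = s a - s b" using add[of a "- b"] m by simp
  show "s (inverse a) = inverse (s a)"
    using mult[of a "inverse a"] z[of a] 0 1 by (cases "a = 0") (auto simp: inverse_unique)
  have n: "s (of_nat k) = of_nat k" for k by (induction k) (simp_all add: 0 1 add)
  show "s (of_int n) = of_int n" by (cases n) (simp_all add: n m 1 add del: of_nat_Suc)
  show "s (sum f I) = (\<Sum>i\<in>I. s (f i))" by (induction I rule: infinite_finite_induct) (simp_all add: 0 add)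
  show "s (a + b) = s a + s b" "s (a * b) = s a * s b" by (fact add, fact mult)
qed

lemma field_aut_inv: assumes "field_aut s" shows "field_aut (inv s)"
proof -
  have b: "bij s" using assms by (simp add: field_aut_def)
  note s = field_aut_props[OF assms]
  have "inv s (a + b) = inv s a + inv s b" "inv s (a * b) = inv s a * inv s b" for a b
    using b s(3,4) by (metis bij_inv_eq_iff)+
  then show ?thesis using b by (simp add: field_aut_def bij_imp_bij_inv)
qed

lemma field_aut_cnj: "field_aut cnj"
  unfolding field_aut_def by (auto intro!: bijI injI surjI[of _ cnj])

lemma field_aut_inv_simps [simp]:
  assumes "field_aut s" shows "s (inv s a) = a" "inv s (s a) = a"
  using assms by (auto simp: field_aut_def bij_is_surj surj_f_inv_f bij_is_inj)

lemma map_mat_mult: "field_aut s \<Longrightarrow> map_mat s (A ** B) = map_mat s A ** map_mat s B"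
  by (simp add: vec_eq_iff map_mat_def matrix_matrix_mult_def field_aut_props)

lemma map_vec_mv: "field_aut s \<Longrightarrow> map_vec s (A *v x) = map_mat s A *v map_vec s x"
  by (simp add: vec_eq_iff map_mat_def map_vec_def matrix_vector_mult_def field_aut_props)

lemma map_vec_vm: "field_aut s \<Longrightarrow> map_vec s (x v* A) = map_vec s x v* map_mat s A"
  by (simp add: vec_eq_iff map_mat_def map_vec_def vector_matrix_mult_def field_aut_props)

lemma map_mat_mat [simp]: "field_aut s \<Longrightarrow> map_mat s (mat c) = mat (s c)"
  by (simp add: vec_eq_iff map_mat_def mat_def field_aut_props)

lemma map_mat_transpose: "map_mat s (transpose A) = transpose (map_mat s A)"
  by (simp add: vec_eq_iff map_mat_def transpose_def)

lemma map_mat_cim [simp]: "field_aut s \<Longrightarrow> map_mat s (cim A) = cim A"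
  by (simp add: vec_eq_iff map_mat_def cim_def field_aut_props)

lemma map_mat_J [simp]: "field_aut s \<Longrightarrow> map_mat s J_mat = J_mat"
  by (simp add: vec_eq_iff map_mat_def J_mat_def field_aut_props split: sum.split)

lemma map_vec_linear:
  assumes "field_aut s"
  shows "map_vec s (x + y) = map_vec s x + map_vec s y" "map_vec s (x - y) = map_vec s x - map_vec s y"
    "map_vec s (c *s x) = s c *s map_vec s x" "map_vec s 0 = 0" "map_vec s (- x) = - map_vec s x"
    "s (bdot x y) = bdot (map_vec s x) (map_vec s y)"
  using assms by (simp_all add: vec_eq_iff map_vec_def bdot_def field_aut_props)

lemma map_mat_inv_simps [simp]:
  assumes "field_aut s"
  shows "map_mat s (map_mat (inv s) A) = A" "map_mat (inv s) (map_mat s A) = A"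
  using assms by (simp_all add: vec_eq_iff map_mat_def)

lemma map_vec_inv_simps [simp]:
  assumes "field_aut s"
  shows "map_vec (inv s) (map_vec s A) = A"
  using assms by (simp_all add: vec_eq_iff map_vec_def)

lemma map_mat_matrix_inv:
  fixes A :: "complex^'n^'n"
  assumes "field_aut s" "invertible A"
  shows "invertible (map_mat s A)" "matrix_inv (map_mat s A) = map_mat s (matrix_inv A)"
proof -
  have "map_mat s A ** map_mat s (matrix_inv A) = mat 1"
    by (simp only: map_mat_mult[OF assms(1), symmetric] matrix_inv_right[OF assms(2)]
        map_mat_mat[OF assms(1)] field_aut_props(2)[OF assms(1)])
  then show "invertible (map_mat s A)" "matrix_inv (map_mat s A) = map_mat s (matrix_inv A)"
    by (rule matrix_inv_eqI)+
qed

text \<open>A field automorphism of the complex numbers is in general not continuous, but applying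
  its inverse to the coefficients of p gives q. Hence it acts on matrices by Zariski homeomorphisms,
  and identity components inherit rationality.\<close>

lemma polyfuns_field_aut:
  assumes s: "field_aut s" and "p \<in> polyfuns"
  shows "\<exists>q\<in>polyfuns. \<forall>A. p (map_mat s A) = s (q A)"
  using assms(2)
proof (induction p rule: polyfuns.induct)
  case (const c)
  show ?case by (rule bexI[OF _ polyfuns.const[of "inv s c"]]) (simp add: s)
next
  case (coord i j)
  show ?case by (rule bexI[OF _ polyfuns.coord[of i j]]) (simp add: map_mat_def)
next
  case (add p q)
  then show ?case by (metis field_aut_props(3)[OF s] polyfuns.add)
next
  case (mult p q)
  then show ?case by (metis field_aut_props(4)[OF s] polyfuns.mult)
qed

lemma continuous_map_field_aut:
  assumes s: "field_aut s" shows "continuous_map zariski zariski (map_mat s)"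
proof (rule continuous_map_zariskiI)
  fix p :: "complex^'a^'a \<Rightarrow> complex" assume "p \<in> polyfuns"
  with polyfuns_field_aut[OF s] obtain q where q: "q \<in> polyfuns" "\<And>A. p (map_mat s A) = s (q A)"
    by blast
  then have "{x \<in> topspace zariski. p (map_mat s x) \<noteq> 0} = {A. q A \<noteq> 0}"
    by (simp add: field_aut_props[OF s])
  then show "openin zariski {x \<in> topspace zariski. p (map_mat s x) \<noteq> 0}"
    using openin_zariski_basic[OF q(1)] by simp
qed

lemma alg_group_over_QI:
  assumes "alg_group G" "\<And>s A. field_aut s \<Longrightarrow> A \<in> G \<Longrightarrow> map_mat s A \<in> G"
  shows "alg_group_over_Q G"
  unfolding alg_group_over_Q_def
proof (intro conjI allI impI)
  fix s assume s: "field_aut s"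
  have "A \<in> map_mat s ` G" if "A \<in> G" for A
    using assms(2)[OF field_aut_inv[OF s] that] s by (metis image_eqI map_mat_inv_simps(1))
  then show "map_mat s ` G = G" using assms(2)[OF s] by blast
qed (fact assms(1))

lemma alg_group_over_QD:
  assumes "alg_group_over_Q G"
  shows "alg_group G" "mat_group G" "field_aut s \<Longrightarrow> A \<in> G \<Longrightarrow> map_mat s A \<in> G"
  using assms by (auto simp: alg_group_over_Q_def alg_group_def)

lemma alg_group_over_Q_id_component:
  assumes G: "alg_group_over_Q G" shows "alg_group_over_Q (id_component G)"
proof (rule alg_group_over_QI)
  show "alg_group (id_component G)" by (rule alg_group_id_component[OF alg_group_over_QD(1)[OF G]])
  fix s :: "complex \<Rightarrow> complex" and A assume s: "field_aut s" and A: "A \<in> id_component G"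
  have "connectedin zariski (map_mat s ` id_component G)"
    by (rule connectedin_continuous_map_image[OF continuous_map_field_aut[OF s] connectedin_id_component])
  moreover have "map_mat s ` id_component G \<subseteq> G"
    using alg_group_over_QD(3)[OF G s] id_component_subset by blast
  moreover have "mat 1 \<in> map_mat s ` id_component G"
    using one_in_id_component[OF mat_group_closed(1)[OF alg_group_over_QD(2)[OF G]]] s
    by (metis field_aut_props(2) image_eqI map_mat_mat)
  ultimately show "map_mat s A \<in> id_component G" using id_component_maximal A by blast
qed

section \<open>Lie algebras\<close>

lemma matrix_distribs:
  fixes A B C :: "complex^'n^'n"
  shows "A ** (B + C) = A ** B + A ** C" "(A + B) ** C = A ** C + B ** C"
    "A ** (B - C) = A ** B - A ** C" "(A - B) ** C = A ** C - B ** C"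
    "A ** (- B) = - (A ** B)" "(- A) ** B = - (A ** B)"
  by (simp_all add: vec_eq_iff matrix_matrix_mult_def ring_distribs sum.distrib sum_subtractf sum_negf)

text \<open>The definition of \<open>lie\<close> uses derivatives along complex lines only. The
  Frechet derivative linearises all lines at once, which makes the Lie algebra closed under sums;
  its homogeneity under \<open>mat c\<close> recovers the complex derivative along each
  line.\<close>

lemma polyfuns_derivative:
  "p \<in> polyfuns \<Longrightarrow> \<exists>p'. (p has_derivative p') (at A) \<and> (\<forall>c X. p' (mat c ** X) = c * p' X)"
proof (induction p rule: polyfuns.induct)
  case (const c)
  show ?case by (intro exI[of _ "\<lambda>_. 0"]) simp
next
  case (coord i j)
  have "((\<lambda>A. A $ i $ j) has_derivative (\<lambda>X. X $ i $ j)) (at A)"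
    by (intro bounded_linear.has_derivative[OF bounded_linear_vec_nth] has_derivative_ident)
  moreover have "(mat c ** X) $ i $ j = c * X $ i $ j" for c :: complex and X :: "complex^'a^'a"
    by (simp add: matrix_matrix_mult_def mat_def if_distrib if_distribR cong: if_cong)
  ultimately show ?case by blast
next
  case (add p q)
  then obtain p' q' where "(p has_derivative p') (at A)" "\<forall>c X. p' (mat c ** X) = c * p' X"
    "(q has_derivative q') (at A)" "\<forall>c X. q' (mat c ** X) = c * q' X" by blast
  then show ?case
    by (intro exI[of _ "\<lambda>X. p' X + q' X"]) (auto intro: has_derivative_add simp: algebra_simps)
next
  case (mult p q)
  then obtain p' q' where "(p has_derivative p') (at A)" "\<forall>c X. p' (mat c ** X) = c * p' X"
    "(q has_derivative q') (at A)" "\<forall>c X. q' (mat c ** X) = c * q' X" by blast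
  then show ?case
    using has_derivative_mult[of p p' A UNIV q q']
    by (intro exI[of _ "\<lambda>X. p A * q' X + p' X * q A"]) (auto simp: algebra_simps)
qed

lemma mat_add: "mat (a + b) = mat a + (mat b :: complex^'n^'n)"
  by (simp add: vec_eq_iff mat_def)

lemma mat_times: "mat (a * b) = mat a ** (mat b :: complex^'n^'n)"
  by (rule matrix_eqI) (simp add: matrix_vector_mul_assoc[symmetric])

lemma mat_commute: "mat c ** A = A ** (mat c :: complex^'n^'n)"
  by (rule matrix_eqI) (simp add: matrix_vector_mul_assoc[symmetric])

lemma bounded_linear_mat_times: "bounded_linear (\<lambda>t. mat t ** (X :: complex^'n^'n))"
  unfolding linear_conv_bounded_linear[symmetric]
proof (rule linearI)
  show "mat (r *\<^sub>R b) ** X = r *\<^sub>R (mat b ** X)" for r b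
    by (simp add: vec_eq_iff mat_def matrix_matrix_mult_def if_distrib if_distribR cong: if_cong)
qed (simp add: mat_add matrix_distribs)

lemma has_derivative_along_line:
  fixes p :: "complex^'n^'n \<Rightarrow> complex"
  assumes "(p has_derivative p') (at (mat 1))" "\<And>c X. p' (mat c ** X) = c * p' X"
  shows "((\<lambda>t. p (mat 1 + mat t ** X)) has_field_derivative p' X) (at 0)"
proof -
  have "((\<lambda>t. mat 1 + mat t ** X) has_derivative (\<lambda>t. mat t ** X)) (at 0)"
    using bounded_linear.has_derivative[OF bounded_linear_mat_times has_derivative_ident]
    by (auto intro!: derivative_eq_intros)
  moreover have "mat 0 = (0 :: complex^'n^'n)" by (simp add: vec_eq_iff mat_def)
  ultimately have "((\<lambda>t. p (mat 1 + mat t ** X)) has_derivative (\<lambda>t. p' (mat t ** X))) (at 0)"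
    using has_derivative_compose[of "\<lambda>t. mat 1 + mat t ** X" _ 0 UNIV p p'] assms(1) by simp
  then show ?thesis using assms(2) by (simp add: has_field_derivative_def mult.commute[of _ "p' X"])
qed

lemma lieI:
  assumes "\<And>p p'. \<lbrakk>p \<in> polyfuns; \<And>A. A \<in> G \<Longrightarrow> p A = 0; (p has_derivative p') (at (mat 1))\<rbrakk> \<Longrightarrow> p' X = 0"
  shows "X \<in> lie G"
  unfolding lie_def
proof (intro CollectI ballI impI)
  fix p :: "complex^'a^'a \<Rightarrow> complex" assume p: "p \<in> polyfuns" "\<forall>A\<in>G. p A = 0"
  obtain p' where p': "(p has_derivative p') (at (mat 1))" "\<forall>c X. p' (mat c ** X) = c * p' X"
    using polyfuns_derivative[OF p(1)] by blast
  then show "((\<lambda>t. p (mat 1 + mat t ** X)) has_field_derivative 0) (at 0)"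
    using has_derivative_along_line[of p p' X] assms[of p p'] p by auto
qed

lemma lieD:
  assumes "X \<in> lie G" "p \<in> polyfuns" "\<And>A. A \<in> G \<Longrightarrow> p A = 0" "(p has_derivative p') (at (mat 1))"
  shows "p' X = 0"
proof -
  obtain q' where q': "(p has_derivative q') (at (mat 1))" "\<forall>c X. q' (mat c ** X) = c * q' X"
    using polyfuns_derivative[OF assms(2)] by blast
  then have "p' = q'" using assms(4) has_derivative_unique by blast
  then show ?thesis
    using assms q' has_derivative_along_line[of p p' X] DERIV_unique unfolding lie_def by blast
qed

lemma lie_coord:
  assumes "X \<in> lie G" "\<And>A. A \<in> G \<Longrightarrow> A $ i $ j = c" shows "X $ i $ j = 0"
proof -
  have "((\<lambda>A. A $ i $ j - c) has_derivative (\<lambda>X. X $ i $ j - 0)) (at (mat 1))"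
    by (intro bounded_linear.has_derivative[OF bounded_linear_vec_nth] derivative_intros)
  moreover have "(\<lambda>A. A $ i $ j - c) \<in> polyfuns" by (intro poly_intros)
  ultimately show ?thesis using lieD[OF assms(1)] assms(2) by fastforce
qed

text \<open>The curve need not be a line: in \<open>P_tilde\<close> the coordinate z is quadratic in
  x, so tangent vectors there come from parabolas.\<close>

lemma lie_curve:
  assumes "\<And>t. \<gamma> t \<in> G" "(\<gamma> has_derivative (\<lambda>t. mat t ** X)) (at 0)" "\<gamma> 0 = mat 1"
  shows "X \<in> lie G"
proof (rule lieI)
  fix p p' assume p: "p \<in> polyfuns" "\<And>A. A \<in> G \<Longrightarrow> p A = 0" "(p has_derivative p') (at (mat 1))"
  have "((\<lambda>t. p (\<gamma> t)) has_derivative (\<lambda>t. p' (mat t ** X))) (at 0)"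
    using has_derivative_compose[of \<gamma> _ 0 UNIV p p'] assms p(3) by simp
  moreover have "(\<lambda>t. p (\<gamma> t)) = (\<lambda>_. 0)" using assms(1) p(2) by auto
  ultimately have "(\<lambda>t. p' (mat t ** X)) = (\<lambda>_. 0)"
    using has_derivative_unique has_derivative_const by metis
  then have "p' (mat 1 ** X) = 0" by metis
  then show "p' X = 0" by simp
qed

lemma vec_of_mat_linear:
  "vec_of_mat (A + B) = vec_of_mat A + vec_of_mat B" "vec_of_mat 0 = 0"
  "vec_of_mat (mat c ** A) = c *s vec_of_mat A"
  by (simp_all add: vec_eq_iff vec_of_mat_def matrix_matrix_mult_def mat_def if_distrib if_distribR
      cong: if_cong)

lemma vec_of_mat_inject [simp]: "vec_of_mat A = vec_of_mat B \<longleftrightarrow> A = B"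
  by (auto simp: vec_eq_iff vec_of_mat_def)

lemma lie_closed:
  shows "0 \<in> lie G" "X \<in> lie G \<Longrightarrow> Y \<in> lie G \<Longrightarrow> X + Y \<in> lie G" "X \<in> lie G \<Longrightarrow> mat c ** X \<in> lie G"
proof -
  show "0 \<in> lie G"
    by (rule lieI) (auto dest: has_derivative_linear linear_0)
  show "X + Y \<in> lie G" if XY: "X \<in> lie G" "Y \<in> lie G"
  proof (rule lieI)
    fix p p' assume p: "p \<in> polyfuns" "\<And>A. A \<in> G \<Longrightarrow> p A = 0" "(p has_derivative p') (at (mat 1))"
    then show "p' (X + Y) = 0"
      using lieD[OF XY(1), of p p'] lieD[OF XY(2), of p p']
      by (simp add: linear_add[OF has_derivative_linear[OF p(3)]])
  qed
  show "mat c ** X \<in> lie G" if X: "X \<in> lie G"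
  proof (rule lieI)
    fix p p' assume p: "p \<in> polyfuns" "\<And>A. A \<in> G \<Longrightarrow> p A = 0" "(p has_derivative p') (at (mat 1))"
    obtain q' where q': "(p has_derivative q') (at (mat 1))" "\<forall>c X. q' (mat c ** X) = c * q' X"
      using polyfuns_derivative[OF p(1)] by blast
    then have "p' = q'" using p(3) has_derivative_unique by blast
    then show "p' (mat c ** X) = 0" using q'(2) lieD[OF X p] by simp
  qed
qed

lemma subspace_lie: "vec.subspace (vec_of_mat ` lie G)"
  unfolding vec.subspace_def
  by (force simp: vec_of_mat_linear[symmetric] intro: lie_closed)

lemma lie_conj:
  assumes G: "mat_group G" and A: "A \<in> G" and X: "X \<in> lie G"
  shows "A ** X ** matrix_inv A \<in> lie G"
  unfolding lie_def
proof (intro CollectI ballI impI)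
  fix p :: "complex^'a^'a \<Rightarrow> complex" assume p: "p \<in> polyfuns" "\<forall>A\<in>G. p A = 0"
  have "(\<lambda>B. p (A ** B ** matrix_inv A)) \<in> polyfuns"
    by (rule poly_map_comp[OF _ p(1)]) (intro poly_intros)
  moreover have "\<forall>B\<in>G. p (A ** B ** matrix_inv A) = 0"
    using p(2) mat_group_closed(2,3)[OF G] A by simp
  ultimately have "((\<lambda>t. p (A ** (mat 1 + mat t ** X) ** matrix_inv A)) has_field_derivative 0) (at 0)"
    using X unfolding lie_def mem_Collect_eq
    by (elim ballE[of _ _ "\<lambda>B. p (A ** B ** matrix_inv A)"]) simp_all
  moreover have "A ** (mat 1 + mat t ** X) ** matrix_inv A = mat 1 + mat t ** (A ** X ** matrix_inv A)" for t
  proof -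
    have "A ** (mat t ** X) ** matrix_inv A = mat t ** (A ** X ** matrix_inv A)"
      by (metis mat_commute matrix_mul_assoc)
    then show ?thesis
      using mat_group_closed(4)[OF G A] by (simp add: matrix_distribs matrix_inv_right)
  qed
  ultimately show "((\<lambda>t. p (mat 1 + mat t ** (A ** X ** matrix_inv A))) has_field_derivative 0) (at 0)"
    by simp
qed

lemma poly_map_poly_aut:
  assumes "field_aut s" shows "poly (map_poly s r) (s x) = s (poly r x)"
  by (induction r) (simp_all add: map_poly_pCons field_aut_props[OF assms])

lemma polyfuns_line_poly:
  "p \<in> polyfuns \<Longrightarrow> \<exists>q. \<forall>t. p (mat 1 + mat t ** X) = poly q t"
proof (induction p rule: polyfuns.induct)
  case (const c)
  show ?case by (rule exI[of _ "[:c:]"]) simp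
next
  case (coord i j)
  show ?case
    by (rule exI[of _ "[:mat 1 $ i $ j, X $ i $ j:]"])
       (simp add: matrix_matrix_mult_def mat_def if_distrib if_distribR cong: if_cong)
qed (metis poly_add, metis poly_mult)

text \<open>An automorphism s cannot be moved through a limit. Along the line through X, however, a
  polynomial function is a polynomial r in t, and the vanishing of its derivative at 0 says that the
  linear coefficient of r is 0, a condition which s preserves.\<close>

lemma lie_field_aut:
  assumes s: "field_aut s" and G: "\<And>A. A \<in> G \<Longrightarrow> map_mat s A \<in> G" and X: "X \<in> lie G"
  shows "map_mat s X \<in> lie G"
  unfolding lie_def
proof (intro CollectI ballI impI)
  fix p :: "complex^'a^'a \<Rightarrow> complex" assume p: "p \<in> polyfuns" "\<forall>A\<in>G. p A = 0"
  obtain q where q: "q \<in> polyfuns" "\<And>A. p (map_mat s A) = s (q A)"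
    using polyfuns_field_aut[OF s p(1)] by blast
  have q0: "\<forall>A\<in>G. q A = 0" using q(2) p(2) G field_aut_props(8)[OF s] by metis
  obtain r where r: "\<And>t. q (mat 1 + mat t ** X) = poly r t"
    using polyfuns_line_poly[OF q(1)] by blast
  have "((\<lambda>t. poly r t) has_field_derivative 0) (at 0)"
    using X q(1) q0 unfolding lie_def r[symmetric] by blast
  then have "poly (pderiv r) 0 = 0" using poly_DERIV DERIV_unique by blast
  then have "coeff r 1 = 0" by (simp add: poly_0_coeff_0 coeff_pderiv)
  then have "poly (pderiv (map_poly s r)) 0 = 0"
    by (simp add: poly_0_coeff_0 coeff_pderiv coeff_map_poly field_aut_props[OF s])
  then have "((\<lambda>t. poly (map_poly s r) t) has_field_derivative 0) (at 0)"
    using poly_DERIV by metis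
  moreover have "poly (map_poly s r) t = p (mat 1 + mat t ** map_mat s X)" for t
  proof -
    \<comment> \<open>The parameter moves as well: the point at t on the line of
      \<open>map_mat s X\<close> is the image under s of the point at \<open>inv s t\<close> on the
      line of X.\<close>
    have "mat 1 + mat t ** map_mat s X = map_mat s (mat 1 + mat (inv s t) ** X)"
      by (simp add: vec_eq_iff map_mat_def mat_def matrix_matrix_mult_def s field_aut_props[OF s]
          if_distrib if_distribR cong: if_cong)
    then show ?thesis using q(2) r poly_map_poly_aut[OF s, of r "inv s t"] s by simp
  qed
  ultimately show "((\<lambda>t. p (mat 1 + mat t ** map_mat s X)) has_field_derivative 0) (at 0)" by simp
qed

lemma subspace_over_Q_lie:
  assumes "alg_group_over_Q G" shows "subspace_over_Q (vec_of_mat ` lie G)"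
  unfolding subspace_over_Q_def
proof (intro conjI allI impI subspace_lie)
  fix s assume s: "field_aut s"
  have vm: "map_vec s (vec_of_mat X) = vec_of_mat (map_mat s X)" for s and X :: "complex^'a^'a"
    by (simp add: vec_eq_iff map_vec_def vec_of_mat_def map_mat_def)
  have lie: "map_mat s X \<in> lie G" if "X \<in> lie G" "field_aut s" for X s
    using lie_field_aut alg_group_over_QD(3)[OF assms] that by blast
  show "map_vec s ` vec_of_mat ` lie G = vec_of_mat ` lie G"
  proof (intro subset_antisym subsetI)
    fix v assume "v \<in> vec_of_mat ` lie G"
    then obtain X where X: "X \<in> lie G" "v = vec_of_mat X" by blast
    then have "v = map_vec s (vec_of_mat (map_mat (inv s) X))" by (simp add: vm s)
    then show "v \<in> map_vec s ` vec_of_mat ` lie G"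
      using lie[OF X(1) field_aut_inv[OF s]] by blast
  qed (use lie s in \<open>force simp: vm\<close>)
qed

section \<open>Bigraded mixed Hodge structures\<close>

text \<open>A bigrading which is symmetric under complex conjugation. The subspaces \<open>sub Q\<close> cut out by a
  set of bidegrees turn sums and intersections into disjunctions and conjunctions.\<close>

locale bigrading =
  fixes V :: "(complex^'k) set" and I :: "int \<Rightarrow> int \<Rightarrow> (complex^'k) set" and T :: "(int \<times> int) set"
    and \<pi> :: "int \<Rightarrow> int \<Rightarrow> complex^'k \<Rightarrow> complex^'k"
  assumes finT: "finite T"
    and V: "vec.subspace V"
    and \<pi>_add: "\<pi> p q (v + v') = \<pi> p q v + \<pi> p q v'"
    and \<pi>_scale: "\<pi> p q (c *s v) = c *s \<pi> p q v"
    and \<pi>_V: "v \<in> V \<Longrightarrow> \<pi> p q v \<in> V"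
    and \<pi>_\<pi>: "\<pi> p q (\<pi> p' q' v) = (if p = p' \<and> q = q' then \<pi> p q v else 0)"
    and \<pi>_T: "(p, q) \<notin> T \<Longrightarrow> \<pi> p q v = 0"
    and \<pi>_sum: "v \<in> V \<Longrightarrow> v = (\<Sum>(p, q)\<in>T. \<pi> p q v)"
    and I: "I p q = {v \<in> V. \<pi> p q v = v}"
    and conjV: "v \<in> V \<Longrightarrow> map_vec cnj v \<in> V"
    and conj\<pi>: "map_vec cnj (\<pi> p q v) = \<pi> q p (map_vec cnj v)"
begin

definition sub :: "(int \<Rightarrow> int \<Rightarrow> bool) \<Rightarrow> (complex^'k) set" where
  "sub Q = {v \<in> V. \<forall>p q. \<not> Q p q \<longrightarrow> \<pi> p q v = 0}"

lemma \<pi>_0 [simp]: "\<pi> p q 0 = 0"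
  using \<pi>_scale[of p q 0 0] by simp

lemma \<pi>_sum_gen: "\<pi> p q (sum f J) = (\<Sum>j\<in>J. \<pi> p q (f j))"
  by (induction J rule: infinite_finite_induct) (auto simp: \<pi>_add)

lemma subspace_sub: "vec.subspace (sub Q)"
  using V unfolding vec.subspace_def sub_def by (auto simp: \<pi>_add \<pi>_scale)

lemma sub_span: "vec.span (\<Union>{I p q |p q. Q p q}) = sub Q"
proof (rule subset_antisym)
  have "\<Union>{I p q |p q. Q p q} \<subseteq> sub Q"
    by (auto simp: sub_def I) (metis \<pi>_\<pi>)
  then show "vec.span (\<Union>{I p q |p q. Q p q}) \<subseteq> sub Q"
    by (rule vec.span_minimal[OF _ subspace_sub])
  show "sub Q \<subseteq> vec.span (\<Union>{I p q |p q. Q p q})"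
  proof
    fix v assume v: "v \<in> sub Q"
    have "\<pi> p q v \<in> vec.span (\<Union>{I p q |p q. Q p q})" for p q
    proof (cases "Q p q")
      case True
      have "\<pi> p q v \<in> I p q" using v \<pi>_V by (auto simp: I \<pi>_\<pi> sub_def)
      then show ?thesis using True by (intro vec.span_base) blast
    qed (use v vec.span_zero in \<open>auto simp: sub_def\<close>)
    then have "(\<Sum>(p, q)\<in>T. \<pi> p q v) \<in> vec.span (\<Union>{I p q |p q. Q p q})"
      by (intro vec.span_sum) auto
    then show "v \<in> vec.span (\<Union>{I p q |p q. Q p q})" using \<pi>_sum[of v] v by (simp add: sub_def)
  qed
qed

lemma sub_Int: "sub Q \<inter> sub R = sub (\<lambda>p q. Q p q \<and> R p q)"
  by (auto simp: sub_def)

lemma sub_sum: "set_sum (sub Q) (sub R) = sub (\<lambda>p q. Q p q \<or> R p q)"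
proof (intro subset_antisym subsetI)
  fix v assume "v \<in> set_sum (sub Q) (sub R)"
  then show "v \<in> sub (\<lambda>p q. Q p q \<or> R p q)"
    using V by (auto simp: set_sum_def sub_def \<pi>_add vec.subspace_def)
next
  fix v assume v: "v \<in> sub (\<lambda>p q. Q p q \<or> R p q)"
  \<comment> \<open>Components satisfying both conditions go into the first summand; the second one
    keeps those violating Q, which satisfy R or vanish.\<close>
  let ?a = "\<Sum>(p, q)\<in>T. if Q p q then \<pi> p q v else 0"
  let ?b = "\<Sum>(p, q)\<in>T. if Q p q then 0 else \<pi> p q v"
  have "v = ?a + ?b"
    using \<pi>_sum[of v] v by (simp add: sub_def sum.distrib[symmetric] if_distrib split_def cong: if_cong)
  moreover have "?a \<in> sub Q"
    unfolding sub_def using v V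
    by (auto simp: \<pi>_sum_gen \<pi>_\<pi> sub_def vec.subspace_0 \<pi>_V intro!: sum.neutral vec.subspace_sum split: prod.splits)
  moreover have "?b \<in> sub R"
    unfolding sub_def using v V
    by (auto simp: \<pi>_sum_gen \<pi>_\<pi> sub_def vec.subspace_0 \<pi>_V intro!: sum.neutral vec.subspace_sum split: prod.splits)
  ultimately show "v \<in> set_sum (sub Q) (sub R)" unfolding set_sum_def by blast
qed

lemma conj_sub: "conj_set (sub Q) = sub (\<lambda>p q. Q q p)"
proof -
  have *: "map_vec cnj v \<in> sub (\<lambda>p q. Q q p)" if "v \<in> sub Q" for v Q
    using that conjV by (auto simp: sub_def conj\<pi>[symmetric]) (simp add: map_vec_def vec_eq_iff)
  have inv: "v = map_vec cnj (map_vec cnj v)" for v :: "complex^'k" by (simp add: map_vec_def vec_eq_iff)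
  show ?thesis unfolding conj_set_def
  proof (intro subset_antisym subsetI)
    fix v assume "v \<in> sub (\<lambda>p q. Q q p)"
    from *[OF this] show "v \<in> map_vec cnj ` sub Q" using inv[of v] by simp
  qed (use * in auto)
qed

definition W where "W n = vec.span (\<Union>{I p q |p q. p + q \<le> n})"
definition F where "F p = vec.span (\<Union>{I p' q |p' q. p' \<ge> p})"

lemma W_sub: "W n = sub (\<lambda>p q. p + q \<le> n)" and F_sub: "F p = sub (\<lambda>p' q. p' \<ge> p)"
  unfolding W_def F_def by (rule sub_span)+

lemma sub_cong: "(\<And>p q. (p, q) \<in> T \<Longrightarrow> Q p q = R p q) \<Longrightarrow> sub Q = sub R"
  unfolding sub_def using \<pi>_T by (metis (mono_tags, lifting))

lemma sub_True: "(\<And>p q. (p, q) \<in> T \<Longrightarrow> Q p q) \<Longrightarrow> sub Q = V"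
  unfolding sub_def using \<pi>_T by blast

lemma sub_False: "(\<And>p q. (p, q) \<in> T \<Longrightarrow> \<not> Q p q) \<Longrightarrow> sub Q = {0}"
proof -
  assume *: "\<And>p q. (p, q) \<in> T \<Longrightarrow> \<not> Q p q"
  then have "v = 0" if "v \<in> sub Q" for v
  proof -
    have "(\<Sum>(p, q)\<in>T. \<pi> p q v) = 0" using that * by (intro sum.neutral) (auto simp: sub_def)
    then show ?thesis using that \<pi>_sum[of v] by (simp add: sub_def)
  qed
  then show ?thesis using vec.subspace_0[OF subspace_sub] by auto
qed

lemma gr_sub:
  "gr_F W F p n = sub (\<lambda>p' q'. p' \<ge> p \<and> p' + q' \<le> n \<or> p' + q' \<le> n - 1)"
  "gr_Fbar W F q n = sub (\<lambda>p' q'. q' \<ge> q \<and> p' + q' \<le> n \<or> p' + q' \<le> n - 1)"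
  unfolding gr_F_def gr_Fbar_def W_sub F_sub conj_sub sub_Int sub_sum by simp_all

text \<open>Since conjugation exchanges the two degrees of the bigrading, W, F and the conjugate of
  F are all of the form \<open>sub\<close>. In total degree n the conditions
  \<open>p' \<ge> p\<close> and \<open>q' \<ge> n + 1 - p\<close> are complementary, so both Hodge
  identities become linear arithmetic on bidegrees.\<close>

lemma mixed_hodge:
  assumes "\<And>n. subspace_over_Q (W n)" "\<And>p q. (p, q) \<in> T \<Longrightarrow> \<bar>p\<bar> \<le> N \<and> \<bar>p + q\<bar> \<le> N"
  shows "mixed_hodge V W F"
proof -
  have WV: "W N = V" unfolding W_sub by (rule sub_True) (use assms(2) in fastforce)
  have "W (- N - 1) = {0}" unfolding W_sub by (rule sub_False) (use assms(2) in fastforce)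
  moreover have "F (- N) = V" unfolding F_sub by (rule sub_True) (use assms(2) in fastforce)
  moreover have "F (N + 1) = {0}" unfolding F_sub by (rule sub_False) (use assms(2) in fastforce)
  moreover have "W n \<subseteq> W (n + 1)" "F (p + 1) \<subseteq> F p" for n p
    unfolding W_sub F_sub by (auto simp: sub_def)
  moreover have "set_sum (gr_F W F p n) (gr_Fbar W F (n + 1 - p) n) = W n"
    "gr_F W F p n \<inter> gr_Fbar W F (n + 1 - p) n = W (n - 1)" for n p
    unfolding gr_sub W_sub sub_sum sub_Int by (rule sub_cong, linarith)+
  moreover have "vec.subspace (F p)" for p unfolding F_sub by (rule subspace_sub)
  ultimately show ?thesis unfolding mixed_hodge_def using assms(1) WV by metis
qed

lemma hodge_type: "hodge_type W F T"
  unfolding hodge_type_def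
proof (intro allI impI)
  fix p q assume neq: "gr_F W F p (p + q) \<inter> gr_Fbar W F q (p + q) \<noteq> W (p + q - 1)"
  show "(p, q) \<in> T"
  proof (rule ccontr)
    assume nT: "(p, q) \<notin> T"
    have "gr_F W F p (p + q) \<inter> gr_Fbar W F q (p + q) = W (p + q - 1)"
      unfolding gr_sub W_sub sub_Int
    proof (rule sub_cong)
      fix p' q' assume "(p', q') \<in> T"
      then have "p' \<noteq> p \<or> q' \<noteq> q" using nT by auto
      then show "((p \<le> p' \<and> p' + q' \<le> p + q \<or> p' + q' \<le> p + q - 1) \<and>
         (q \<le> q' \<and> p' + q' \<le> p + q \<or> p' + q' \<le> p + q - 1)) = (p' + q' \<le> p + q - 1)" by linarith
    qed
    then show False using neq by contradiction
  qed
qed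

end

text \<open>Products of polynomials turn the generating sets into a base. A point outside a closed
  set is thus separated from it by one polynomial, to which analytic arguments can be
  applied.\<close>

lemma openin_zariski_imp_basic:
  assumes "openin zariski U" "A \<in> U"
  shows "\<exists>p\<in>polyfuns. p A \<noteq> 0 \<and> {B. p B \<noteq> 0} \<subseteq> U"
proof -
  have "generate_topology_on {{A. p A \<noteq> 0} |p. p \<in> polyfuns} U"
    using assms(1) unfolding zariski_def by (rule openin_topology_generated_by)
  then show ?thesis using assms(2)
  proof (induction U rule: generate_topology_on.induct)
    case (Int a b)
    then obtain p q where "p \<in> polyfuns" "p A \<noteq> 0" "{B. p B \<noteq> 0} \<subseteq> a"
      "q \<in> polyfuns" "q A \<noteq> 0" "{B. q B \<noteq> 0} \<subseteq> b" by blast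
    then show ?case by (intro bexI[of _ "\<lambda>A. p A * q A"]) (auto intro: polyfuns.mult)
  next
    case (UN K)
    then show ?case by blast
  qed auto
qed

section \<open>Exponential sums\<close>

text \<open>The entries of the real powers of a positive diagonalisable matrix have this shape, with
  the eigenvalues as bases. Bases may repeat in the list, which makes sums and products easy and is
  harmless for \<open>expsums_eq_0\<close>.\<close>

definition expsum :: "(complex \<times> real) list \<Rightarrow> real \<Rightarrow> complex" where
  "expsum xs s = (\<Sum>(c, x)\<leftarrow>xs. c * of_real (x powr s))"

definition expsums :: "(real \<Rightarrow> complex) set" where
  "expsums = {F. \<exists>xs. (\<forall>(c, x)\<in>set xs. x > 0) \<and> F = expsum xs}"

lemma expsums_const: "(\<lambda>s. c) \<in> expsums"
  unfolding expsums_def by (intro CollectI exI[of _ "[(c, 1)]"]) (auto simp: expsum_def)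

lemma expsums_powr: "x > 0 \<Longrightarrow> (\<lambda>s. of_real (x powr s)) \<in> expsums"
  unfolding expsums_def by (intro CollectI exI[of _ "[(1, x)]"]) (auto simp: expsum_def)

lemma expsums_add: assumes "F \<in> expsums" "G \<in> expsums" shows "(\<lambda>s. F s + G s) \<in> expsums"
proof -
  obtain xs ys where "\<forall>(c, x)\<in>set xs. x > 0" "F = expsum xs" "\<forall>(c, x)\<in>set ys. x > 0" "G = expsum ys"
    using assms by (auto simp: expsums_def)
  then show ?thesis unfolding expsums_def
    by (intro CollectI exI[of _ "xs @ ys"]) (auto simp: expsum_def)
qed

lemma expsums_mult: assumes "F \<in> expsums" "G \<in> expsums" shows "(\<lambda>s. F s * G s) \<in> expsums"
proof -
  obtain xs ys where *: "\<forall>(c, x)\<in>set xs. x > 0" "F = expsum xs" "\<forall>(c, x)\<in>set ys. x > 0" "G = expsum ys"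
    using assms by (auto simp: expsums_def)
  have single: "(\<lambda>s. c * of_real (x powr s) * expsum ys s) \<in> expsums" if "x > 0" for c x
  proof -
    have "(\<lambda>s. c * of_real (x powr s) * expsum ys s) = expsum (map (\<lambda>(d, y). (c * d, x * y)) ys)"
      using *(3) that
      by (intro ext, induction ys) (auto simp: expsum_def powr_mult algebra_simps)
    moreover have "\<forall>(c, x)\<in>set (map (\<lambda>(d, y). (c * d, x * y)) ys). x > 0" using *(3) that by auto
    ultimately show ?thesis unfolding expsums_def by blast
  qed
  have "(\<lambda>s. expsum xs s * expsum ys s) \<in> expsums" using *(1)
  proof (induction xs)
    case Nil show ?case using expsums_const[of 0] by (simp add: expsum_def)
  next
    case (Cons a xs)
    obtain c x where a: "a = (c, x)" by force
    have "(\<lambda>s. c * of_real (x powr s) * expsum ys s + expsum xs s * expsum ys s) \<in> expsums"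
      using Cons single[of x c] by (intro expsums_add) (auto simp: a)
    then show ?case by (simp add: a expsum_def ring_distribs)
  qed
  then show ?thesis using * by simp
qed

lemma expsums_sum: "(\<And>i. i \<in> I \<Longrightarrow> F i \<in> expsums) \<Longrightarrow> (\<lambda>s. \<Sum>i\<in>I. F i s) \<in> expsums"
  by (induction I rule: infinite_finite_induct) (auto intro: expsums_const expsums_add)

lemma interpolation:
  fixes f :: "complex \<Rightarrow> complex"
  assumes "finite X" shows "\<exists>q. \<forall>x\<in>X. poly q x = f x"
  using assms
proof (induction X)
  case (insert a X)
  then obtain q where q: "\<forall>x\<in>X. poly q x = f x" by blast
  let ?r = "\<Prod>x\<in>X. [:- x, 1:]"
  have "poly ?r a \<noteq> 0" using insert by (auto simp: poly_prod)
  moreover have "poly ?r x = 0" if "x \<in> X" for x using insert that by (auto simp: poly_prod)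
  ultimately show ?case
    using q by (intro exI[of _ "q + smult ((f a - poly q a) / poly ?r a) ?r"]) auto
qed simp

text \<open>Vanishing at all natural exponents means that the functional sending a polynomial q to
  the sum of the c q(x) is zero. For a given real exponent s, a polynomial interpolating
  \<open>x powr s\<close> at the finitely many bases turns \<open>F s\<close> into a value of this
  functional.\<close>

lemma expsums_eq_0:
  assumes "F \<in> expsums" "\<And>k::nat. F (real k) = 0" shows "F s = 0"
proof -
  obtain xs where xs: "\<forall>(c, x)\<in>set xs. x > 0" "F = expsum xs" using assms(1) by (auto simp: expsums_def)
  have pow: "(\<Sum>(c, x)\<leftarrow>xs. c * of_real x ^ k) = 0" for k :: nat
  proof -
    have "(\<Sum>(c, x)\<leftarrow>xs. c * of_real x ^ k) = expsum xs (real k)"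
      unfolding expsum_def using xs(1)
      by (intro arg_cong[of _ _ sum_list] map_cong) (auto simp: powr_realpow)
    then show ?thesis using assms(2) xs(2) by simp
  qed
  \<comment> \<open>The additional power k is shifted by one when the induction peels off the
    constant coefficient of q.\<close>
  have all: "(\<Sum>(c, x)\<leftarrow>xs. c * (of_real x ^ k * poly q (of_real x))) = 0" for q k
  proof (induction q arbitrary: k)
    case 0 show ?case by (induction xs) auto
  next
    case (pCons a q)
    have "(\<Sum>(c, x)\<leftarrow>xs. c * (of_real x ^ k * poly (pCons a q) (of_real x)))
      = a * (\<Sum>(c, x)\<leftarrow>xs. c * of_real x ^ k) + (\<Sum>(c, x)\<leftarrow>xs. c * (of_real x ^ Suc k * poly q (of_real x)))"
      by (induction xs) (auto simp: algebra_simps)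
    then show ?case using pow[of k] pCons.IH[of "Suc k"] by (simp only: mult_zero_right add_0)
  qed
  obtain q where q: "\<forall>x\<in>(\<lambda>(c, x). complex_of_real x) ` set xs. poly q x = of_real (Re x powr s)"
    using interpolation[of "(\<lambda>(c, x). complex_of_real x) ` set xs" "\<lambda>x. of_real (Re x powr s)"] by auto
  have "expsum xs s = (\<Sum>(c, x)\<leftarrow>xs. c * (of_real x ^ 0 * poly q (of_real x)))"
    unfolding expsum_def using q
    by (intro arg_cong[of _ _ sum_list] map_cong) force+
  then show ?thesis using all[of 0 q] xs(2) by simp
qed

text \<open>A polynomial in the entries of the curve is again an exponential sum; if it vanishes on
  Z, it vanishes at all natural exponents and hence identically. So the natural powers of a positive
  matrix force all its real powers, in particular square roots and inverses, into Z.\<close>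

lemma zariski_closed_expsums:
  assumes Z: "closedin zariski Z" and ex: "\<And>i j. (\<lambda>s. \<gamma> s $ i $ j) \<in> expsums"
    and k: "\<And>k::nat. \<gamma> (real k) \<in> Z"
  shows "\<gamma> s \<in> Z"
proof (rule ccontr)
  assume "\<gamma> s \<notin> Z"
  moreover have "openin zariski (- Z)" using Z by (simp add: closedin_def Compl_eq_Diff_UNIV)
  ultimately obtain p where p: "p \<in> polyfuns" "p (\<gamma> s) \<noteq> 0" "{B. p B \<noteq> 0} \<subseteq> - Z"
    using openin_zariski_imp_basic[of "- Z" "\<gamma> s"] by auto
  have "(\<lambda>s. p (\<gamma> s)) \<in> expsums" using p(1)
    by (induction p rule: polyfuns.induct) (auto intro: expsums_const ex expsums_add expsums_mult)
  moreover have "p (\<gamma> (real k)) = 0" for k using p(3) k by blast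
  ultimately show False using expsums_eq_0[of "\<lambda>s. p (\<gamma> s)" s] p(2) by blast
qed

section \<open>Positive definite Hermitian forms\<close>

locale pos_form =
  fixes H :: "complex^'n \<Rightarrow> complex^'n \<Rightarrow> complex"
  assumes H_add_left: "H (x + x') y = H x y + H x' y"
    and H_scale_left: "H (c *s x) y = c * H x y"
    and H_cnj: "H y x = cnj (H x y)"
    and H_pos: "x \<noteq> 0 \<Longrightarrow> \<exists>r>0. H x x = of_real r"
begin

lemma H_add_right: "H x (y + y') = H x y + H x y'"
  by (metis H_add_left H_cnj complex_cnj_add)

lemma H_scale_right: "H x (c *s y) = cnj c * H x y"
  by (metis H_scale_left H_cnj complex_cnj_mult)

lemma H_zero [simp]: "H 0 y = 0" "H y 0 = 0"
  using H_scale_left[of 0 0 y] H_scale_right[of y 0 0] by simp_all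

lemma H_diff_left: "H (x - x') y = H x y - H x' y"
  using H_add_left[of "x - x'" x' y] by simp

lemma H_diff_right: "H x (y - y') = H x y - H x y'"
  using H_add_right[of x "y - y'" y'] by simp

lemma H_eq_0 [simp]: "H x x = 0 \<longleftrightarrow> x = 0"
  using H_pos by force

definition adj :: "complex^'n^'n \<Rightarrow> complex^'n^'n \<Rightarrow> bool" where
  "adj A A' \<longleftrightarrow> (\<forall>x y. H (A *v x) y = H x (A' *v y))"

lemma adj_sym: "adj A A' \<Longrightarrow> adj A' A"
  unfolding adj_def by (metis H_cnj)

lemma adj_mult: "adj A A' \<Longrightarrow> adj B B' \<Longrightarrow> adj (A ** B) (B' ** A')"
  unfolding adj_def by (simp add: matrix_vector_mul_assoc[symmetric])

lemma adj_diff_1: "adj A A' \<Longrightarrow> adj (A - mat 1) (A' - mat 1)"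
  unfolding adj_def by (simp add: matrix_vector_mult_diff_rdistrib H_diff_left H_diff_right)

lemma adj_inv: "adj A A' \<Longrightarrow> invertible A \<Longrightarrow> invertible A' \<Longrightarrow> adj (matrix_inv A) (matrix_inv A')"
  unfolding adj_def
  by (metis matrix_inv_left matrix_inv_right matrix_vector_mul_assoc matrix_vector_mul_lid)

lemma normal_nilpotent:
  assumes adj: "adj N N'" and comm: "N ** N' = N' ** N" and nil: "((\<lambda>B. N ** B) ^^ k) (mat 1) = 0"
  shows "N = 0"
proof -
  \<comment> \<open>The kernels of N and of its square agree: for y = N x in the kernel of N,
    normality gives H (N' y) (N' y) = H (N' N y) y = 0, and then H y y = H x (N' y) = 0.\<close>
  have step: "N *v x = 0" if "N *v (N *v x) = 0" for x
  proof -
    let ?y = "N *v x"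
    have "H (N' *v ?y) (N' *v ?y) = H (N *v (N' *v ?y)) ?y"
      using adj by (simp add: adj_def)
    also have "\<dots> = H (N' *v (N *v ?y)) ?y"
      using comm by (metis matrix_vector_mul_assoc)
    finally have "N' *v ?y = 0" using that by simp
    then have "H ?y ?y = 0" using adj by (simp add: adj_def)
    then show ?thesis by simp
  qed
  have pow: "((\<lambda>B. N ** B) ^^ j) (mat 1) *v x = ((\<lambda>y. N *v y) ^^ j) x" for j x
    by (induction j) (simp_all add: matrix_vector_mul_assoc[symmetric])
  have "N *v x = 0" if "((\<lambda>y. N *v y) ^^ j) x = 0" for j x
    using that
  proof (induction j arbitrary: x)
    case (Suc j)
    then have "((\<lambda>y. N *v y) ^^ j) (N *v x) = 0" by (simp add: funpow_swap1)
    then show ?case using Suc.IH step by blast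
  qed simp
  then have "N *v x = 0" for x using pow[of k x] nil by (metis matrix_vector_mult_0)
  then show ?thesis by (intro matrix_eqI) simp
qed

text \<open>Put \<open>P = A A'\<close> and \<open>Q = A' A\<close>. The commutator is \<open>P Q\<^sup>-\<^sup>1\<close>, which is self-adjoint for the form
  \<open>H x (Q\<^sup>-\<^sup>1 y)\<close>. If it is unipotent it is trivial, so that \<open>A\<close> is normal.\<close>

lemma unipotent_commutator:
  assumes adj: "adj A A'" and A: "invertible A" "invertible A'" and uni: "unipotent_mat A"
    and uniC: "unipotent_mat (A ** A' ** matrix_inv A ** matrix_inv A')"
  shows "A = mat 1"
proof -
  define R where "R = matrix_inv A ** matrix_inv A'"
  define C where "C = A ** A' ** matrix_inv A ** matrix_inv A'"
  have CR: "C = A ** A' ** R" by (simp add: C_def R_def matrix_mul_assoc)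
  have adjI: "adj (matrix_inv A) (matrix_inv A')" using adj_inv[OF adj A] .
  have adjR: "adj R R" unfolding R_def by (rule adj_mult[OF adjI adj_sym[OF adjI]])
  have adjP: "adj (A ** A') (A ** A')" by (rule adj_mult[OF adj adj_sym[OF adj]])
  have HR: "H x (R *v y) = H (matrix_inv A' *v x) (matrix_inv A' *v y)" for x y
    using adj_sym[OF adjI] unfolding R_def adj_def by (simp add: matrix_vector_mul_assoc[symmetric])
  interpret K: pos_form "\<lambda>x y. H x (R *v y)"
  proof
    fix x x' y :: "complex^'n" and c
    show "H (x + x') (R *v y) = H x (R *v y) + H x' (R *v y)" by (rule H_add_left)
    show "H (c *s x) (R *v y) = c * H x (R *v y)" by (rule H_scale_left)
    show "H y (R *v x) = cnj (H x (R *v y))" unfolding HR by (rule H_cnj)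
    assume "x \<noteq> 0"
    then have "matrix_inv A' *v x \<noteq> 0"
      by (metis A(2) matrix_inv_right matrix_vector_mul_assoc matrix_vector_mul_lid matrix_vector_mult_0_right)
    then show "\<exists>r>0. H x (R *v x) = of_real r" unfolding HR by (rule H_pos)
  qed
  have "K.adj C C" unfolding K.adj_def CR
    using adjR adjP unfolding adj_def by (simp add: matrix_vector_mul_assoc[symmetric])
  then have "C - mat 1 = 0"
    using K.normal_nilpotent[OF K.adj_diff_1, of C C] uniC unfolding unipotent_mat_def C_def by blast
  then have "C = mat 1" by simp
  moreover have "C ** (A' ** A) = A ** A'"
    unfolding C_def using A
    by (metis matrix_inv_left matrix_mul_assoc matrix_mul_rid)
  ultimately have comm: "A ** A' = A' ** A" by simp
  have "(A - mat 1) ** (A' - mat 1) = (A' - mat 1) ** (A - mat 1)"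
    using comm by (simp add: matrix_distribs)
  then have "A - mat 1 = 0"
    using normal_nilpotent[OF adj_diff_1[OF adj]] uni unfolding unipotent_mat_def by blast
  then show ?thesis by simp
qed

text \<open>The family w is indexed by the eigenvalues themselves, so each eigenvalue occurs once
  and the part belonging to a given number a is simply \<open>w a\<close>.\<close>

definition eigsum :: "complex^'n^'n \<Rightarrow> (complex^'n) set" where
  "eigsum S = {v. \<exists>L w. finite L \<and> (\<forall>l. S *v w l = l *s w l) \<and> v = (\<Sum>l\<in>L. w l)}"

text \<open>Dividing the parts with eigenvalue l different from a by l - a solves the equation up to
  a vector u of eigenvalue a that lies in the image of S - a. For self-adjoint S this image is
  orthogonal to the eigenvectors for a (which is real if u is nonzero), so u = 0 and what remains of
  v is an eigenvector.\<close>

lemma eigsum_step: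
  assumes S: "adj S S" and v: "S *v v - a *s v \<in> eigsum S"
  shows "v \<in> eigsum S"
proof -
  obtain L w where L: "finite L" "\<And>l. S *v w l = l *s w l" "S *v v - a *s v = (\<Sum>l\<in>L. w l)"
    using v by (auto simp: eigsum_def)
  define v' where "v' = v - (\<Sum>l\<in>L - {a}. inverse (l - a) *s w l)"
  define u where "u = (if a \<in> L then w a else 0)"
  have split: "(\<Sum>l\<in>L. w l) = u + (\<Sum>l\<in>L - {a}. w l)"
    using L(1) by (simp add: u_def sum.remove)
  have "S *v (\<Sum>l\<in>L - {a}. inverse (l - a) *s w l) = (\<Sum>l\<in>L - {a}. inverse (l - a) *s (l *s w l))"
    by (simp add: vec.sum L(2))
  then have "S *v v' - a *s v' = (S *v v - a *s v) - (\<Sum>l\<in>L - {a}. (l - a) *s (inverse (l - a) *s w l))"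
    unfolding v'_def matrix_vector_mult_diff_distrib
    by (simp add: vec_eq_iff sum_subtractf sum_distrib_left algebra_simps)
  also have "(\<Sum>l\<in>L - {a}. (l - a) *s (inverse (l - a) *s w l)) = (\<Sum>l\<in>L - {a}. w l)"
    by (intro sum.cong) auto
  finally have u: "S *v v' - a *s v' = u" using L(3) split by simp
  have Su: "S *v u = a *s u" using L(2) by (simp add: u_def)
  have "u = 0"
  proof (rule ccontr)
    assume u0: "u \<noteq> 0"
    have "a * H u u = cnj a * H u u"
      using S Su unfolding adj_def by (metis H_scale_left H_scale_right)
    then have "cnj a = a" using u0 by simp
    moreover have "H u u = H v' (S *v u) - a * H v' u"
      using S u[symmetric] H_diff_left[of "S *v v'" "a *s v'" u] by (simp add: adj_def H_scale_left)
    ultimately have "H u u = 0" using Su by (simp add: H_scale_right)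
    then show False using u0 by simp
  qed
  then have Sv': "S *v v' = a *s v'" using u by simp
  define w2 where "w2 l = (if l = a then v' else inverse (l - a) *s w l)" for l
  have "S *v w2 l = l *s w2 l" for l using L(2) Sv' by (simp add: w2_def vec_eq_iff)
  moreover have "v = (\<Sum>l\<in>insert a (L - {a}). w2 l)"
  proof -
    have "(\<Sum>l\<in>L - {a}. w2 l) = (\<Sum>l\<in>L - {a}. inverse (l - a) *s w l)"
      by (intro sum.cong) (auto simp: w2_def)
    moreover have "(\<Sum>l\<in>insert a (L - {a}). w2 l) = w2 a + (\<Sum>l\<in>L - {a}. w2 l)"
      using L(1) by (subst sum.insert) auto
    ultimately show ?thesis by (simp add: v'_def w2_def[of a])
  qed
  moreover have "finite (insert a (L - {a}))" using L(1) by simp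
  ultimately show ?thesis unfolding eigsum_def by (intro CollectI exI[of _ "insert a (L - {a})"] exI[of _ w2]) blast
qed

text \<open>The iterates of S on v are linearly dependent, so some nonzero polynomial in S kills v.
  Its linear factors, which exist over the complex numbers, are removed one at a time by
  \<open>eigsum_step\<close>.\<close>

lemma selfadj_eigsum:
  assumes S: "adj S S" shows "v \<in> eigsum S"
proof -
  \<comment> \<open>\<open>ev q v\<close> is q(S) applied to v, by Horner's scheme.\<close>
  define ev where "ev q v = fold_coeffs (\<lambda>a u. a *s v + S *v u) q 0" for q :: "complex poly" and v
  have ev_pCons: "ev (pCons a q) v = a *s v + S *v ev q v" for a q v
    by (cases "a = 0 \<and> q = 0") (auto simp: ev_def)
  have ev_0: "ev 0 v = 0" for v by (simp add: ev_def)
  have ev_add: "ev (p + q) v = ev p v + ev q v" for p q v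
  proof (induction p q rule: poly_induct2)
    case (pCons a p b q)
    then show ?case
      by (simp add: ev_pCons matrix_vector_right_distrib vec.scale_left_distrib)
  qed (simp add: ev_0)
  have ev_lin: "ev q (x - a *s y) = ev q x - a *s ev q y" for q x y a
  proof (induction q)
    case (pCons b q)
    then show ?case
      by (simp only: ev_pCons matrix_vector_mult_diff_distrib matrix_vec_scale)
         (simp add: vec_eq_iff algebra_simps)
  qed (simp add: ev_0)
  have ev_S: "ev q (S *v x) = S *v ev q x" for q x
    by (induction q) (simp_all add: ev_pCons ev_0 matrix_vector_right_distrib)
  have ev_factor: "ev ([:- a, 1:] * q) x = ev q (S *v x - a *s x)" for a q x
  proof -
    have sm: "ev (smult c q) x = c *s ev q x" for c
      by (induction q) (simp_all add: ev_pCons ev_0 vec.scale_right_distrib)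
    have "[:- a, 1:] * q = pCons 0 q + smult (- a) q" by (simp add: mult_pCons_left)
    then show ?thesis by (simp only: ev_add ev_pCons sm ev_lin ev_S) (simp add: vec_eq_iff)
  qed
  have main: "v \<in> eigsum S" if "q \<noteq> 0" "ev q v = 0" for q v
    using that
  proof (induction "degree q" arbitrary: q v)
    case 0
    then obtain c where "q = [:c:]" "c \<noteq> 0" by (metis degree_eq_zeroE pCons_0_0)
    then have "v = 0" using 0 by (simp add: ev_pCons ev_0)
    then show ?case unfolding eigsum_def by (intro CollectI exI[of _ "{}"] exI[of _ "\<lambda>_. 0"]) simp
  next
    case (Suc n)
    then have "\<not> constant (poly q)" by (simp add: constant_degree)
    then obtain a where "poly q a = 0" using fundamental_theorem_of_algebra by blast
    then obtain r where r: "q = [:- a, 1:] * r" by (metis dvd_def poly_eq_0_iff_dvd)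
    have "r \<noteq> 0" using Suc.prems r by auto
    moreover have "degree q = 1 + degree r" unfolding r using \<open>r \<noteq> 0\<close> by (subst degree_mult_eq) auto
    then have "n = degree r" using Suc.hyps(2) by simp
    moreover have "ev r (S *v v - a *s v) = 0" using Suc.prems(2) r ev_factor by simp
    ultimately show ?case using Suc.hyps(1) eigsum_step[OF S] by blast
  qed
  define f where "f k = ((\<lambda>x. S *v x) ^^ k) v" for k :: nat
  have ev_monom: "ev (monom c k) v = c *s f k" for c k
    by (induction k) (simp_all add: monom_0 monom_Suc ev_pCons ev_0 f_def)
  have ev_sum: "ev (sum p I) v = (\<Sum>i\<in>I. ev (p i) v)" if "finite I" for p and I :: "nat set"
    using that by (induction I) (auto simp: ev_0 ev_add)
  \<comment> \<open>These are \<open>CARD('n) + 1\<close> exponents, one more than the dimension. If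
    two iterates coincide, dependence of the set of iterates says nothing, but then the difference
    of the two monomials kills v.\<close>
  let ?N = "{..CARD('n)}"
  show ?thesis
  proof (cases "inj_on f ?N")
    case True
    have "vec.dependent (f ` ?N)"
    proof (rule ccontr)
      assume "vec.independent (f ` ?N)"
      then have "card (f ` ?N) \<le> vec.dim (UNIV :: (complex^'n) set)"
        using vec.independent_card_le_dim[of "f ` ?N" UNIV] by simp
      then show False using True by (simp add: card_image vec.dim_UNIV vec.dimension_def card_cart_basis)
    qed
    then obtain g where g: "\<exists>x\<in>f ` ?N. g x \<noteq> 0" "(\<Sum>x\<in>f ` ?N. g x *s x) = 0"
      using vec.dependent_finite[of "f ` ?N"] by blast
    define q where "q = (\<Sum>k\<in>?N. monom (g (f k)) k)"
    have "ev q v = (\<Sum>k\<in>?N. g (f k) *s f k)" unfolding q_def by (simp add: ev_sum ev_monom)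
    also have "\<dots> = 0" using g(2) True by (simp add: sum.reindex)
    finally have "ev q v = 0" .
    moreover have "q \<noteq> 0"
    proof -
      obtain k where "k \<in> ?N" "g (f k) \<noteq> 0" using g(1) by blast
      then have "coeff q k \<noteq> 0" by (simp add: q_def coeff_sum)
      then show ?thesis by auto
    qed
    ultimately show ?thesis using main by blast
  next
    case False
    then obtain j k where jk: "j \<noteq> k" "f j = f k" by (auto simp: inj_on_def)
    have "ev (monom 1 j + monom (- 1) k) v = 0" using jk by (simp add: ev_add ev_monom vec_eq_iff)
    moreover have "coeff (monom 1 j + monom (- 1) k :: complex poly) j = 1" using jk by simp
    then have "monom 1 j + monom (- 1) k \<noteq> (0 :: complex poly)" by (metis coeff_0 zero_neq_one)
    ultimately show ?thesis using main by blast
  qed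
qed

text \<open>In a basis B of eigenvectors S is diagonal with positive eigenvalues, and \<gamma> s has
  their s-th powers. The basis is not orthogonal in general; self-adjointness of \<gamma> s uses
  only that eigenvectors for different eigenvalues are orthogonal.\<close>

lemma real_powers:
  assumes S: "adj S S" and pos: "\<And>x. x \<noteq> 0 \<Longrightarrow> \<exists>r>0. H (S *v x) x = of_real r"
  obtains \<gamma> where "\<gamma> 1 = S" "\<gamma> 0 = mat 1" "\<And>s t. \<gamma> (s + t) = \<gamma> s ** \<gamma> t" "\<And>s. adj (\<gamma> s) (\<gamma> s)"
    "\<And>i j. (\<lambda>s. \<gamma> s $ i $ j) \<in> expsums"
proof -
  have "vec.span {v. \<exists>l. S *v v = l *s v} = UNIV"
  proof (intro subset_antisym subset_UNIV subsetI)
    fix v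
    obtain L w where "finite L" "\<And>l. S *v w l = l *s w l" "v = (\<Sum>l\<in>L. w l)"
      using selfadj_eigsum[OF S, of v] by (auto simp: eigsum_def)
    then show "v \<in> vec.span {v. \<exists>l. S *v v = l *s v}"
      by (simp, intro vec.span_sum vec.span_base) auto
  qed
  moreover obtain B where B: "B \<subseteq> {v. \<exists>l. S *v v = l *s v}" "vec.independent B"
    "{v. \<exists>l. S *v v = l *s v} \<subseteq> vec.span B"
    using vec.maximal_independent_subset by blast
  moreover have "vec.span {v. \<exists>l. S *v v = l *s v} \<subseteq> vec.span B"
    by (rule vec.span_minimal[OF B(3) vec.subspace_span])
  ultimately have B3: "vec.span B = UNIV" by blast
  note B = B(1,2) B3
  have finB: "finite B" using B(2) vec.finiteI_independent by blast
  have "\<exists>l>0. S *v b = of_real l *s b" if b: "b \<in> B" for b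
  proof -
    obtain l where l: "S *v b = l *s b" using subsetD[OF B(1) b] by auto
    have b0: "b \<noteq> 0" using B(2) that vec.dependent_zero by blast
    obtain r t where "r > 0" "H (S *v b) b = of_real r" "t > 0" "H b b = of_real t"
      using pos[OF b0] H_pos[OF b0] by blast
    then have "l = of_real (r / t)" "r / t > 0" using l by (auto simp: H_scale_left field_simps)
    then show ?thesis using l by blast
  qed
  then obtain l where l: "\<And>b. b \<in> B \<Longrightarrow> l b > 0" "\<And>b. b \<in> B \<Longrightarrow> S *v b = of_real (l b) *s b"
    by metis
  \<comment> \<open>The coordinate along b of the j-th standard basis vector; with it the entries of
    \<gamma> s are visibly exponential sums.\<close>
  define c where "c j b = vec.representation B (axis j 1) b" for j b
  define \<gamma> :: "real \<Rightarrow> complex^'n^'n" where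
    "\<gamma> s = (\<chi> i j. \<Sum>b\<in>B. c j b * of_real (l b powr s) * b $ i)" for s
  have rep: "(\<Sum>j\<in>UNIV. v $ j * c j b) = vec.representation B v b" for v b
  proof -
    have "vec.representation B v b = vec.representation B (\<Sum>j\<in>UNIV. v $ j *s axis j 1) b"
      by (simp add: basis_expansion)
    also have "\<dots> = (\<Sum>j\<in>UNIV. v $ j * c j b)"
      by (subst vec.representation_sum[OF B(2)])
         (simp_all add: B(3) vec.representation_scale[OF B(2)] c_def)
    finally show ?thesis by simp
  qed
  have \<gamma>v: "\<gamma> s *v v = (\<Sum>b\<in>B. (vec.representation B v b * of_real (l b powr s)) *s b)" for s v
    unfolding rep[symmetric]
    by (simp add: vec_eq_iff \<gamma>_def matrix_vector_mult_def sum_distrib_left sum_distrib_right mult_ac, subst sum.swap, simp)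
  have \<gamma>b: "\<gamma> s *v b = of_real (l b powr s) *s b" if "b \<in> B" for s b
  proof -
    have "\<gamma> s *v b = (\<Sum>b'\<in>B. if b' = b then of_real (l b powr s) *s b else 0)"
      unfolding \<gamma>v using vec.representation_basis[OF B(2) that] by (intro sum.cong) auto
    then show ?thesis using that finB by simp
  qed
  have eqI: "A = A'" if "\<And>b. b \<in> B \<Longrightarrow> A *v b = A' *v b" for A A' :: "complex^'n^'n"
  proof (rule matrix_eqI)
    fix x
    show "A *v x = A' *v x"
      by (rule vec.linear_eq_on[of "(*v) A" "(*v) A'" x B]) (use that B(3) in auto)
  qed
  show thesis
  proof
    show "\<gamma> 1 = S" by (rule eqI) (simp add: \<gamma>b l less_imp_le)
    show "\<gamma> 0 = mat 1" by (rule eqI) (use l(1) in \<open>force simp: \<gamma>b vec_eq_iff\<close>)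
    show "\<gamma> (s + t) = \<gamma> s ** \<gamma> t" for s t
      by (rule eqI) (simp add: matrix_vector_mul_assoc[symmetric] \<gamma>b powr_add vec_eq_iff)
    show "(\<lambda>s. \<gamma> s $ i $ j) \<in> expsums" for i j
      unfolding \<gamma>_def
      by (simp, intro expsums_sum expsums_mult expsums_const expsums_powr l(1))
    show "adj (\<gamma> s) (\<gamma> s)" for s
    proof -
      have HB: "H (\<gamma> s *v b) b' = H b (\<gamma> s *v b')" if "b \<in> B" "b' \<in> B" for b b'
      proof (cases "l b = l b'")
        case False
        have "of_real (l b) * H b b' = of_real (l b') * H b b'"
          using S l(2) that unfolding adj_def by (metis H_scale_left H_scale_right complex_cnj_complex_of_real)
        then have "H b b' = 0" using False by simp
        then show ?thesis using that by (simp add: \<gamma>b H_scale_left H_scale_right)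
      qed (use that in \<open>simp add: \<gamma>b H_scale_left H_scale_right\<close>)
      have sub: "vec.subspace {x. H (\<gamma> s *v x) y = H x (\<gamma> s *v y)}" for y
        by (simp add: vec.subspace_def matrix_vector_right_distrib H_add_left H_scale_left)
      have sub2: "vec.subspace {y. \<forall>x. H (\<gamma> s *v x) y = H x (\<gamma> s *v y)}"
        by (simp add: vec.subspace_def matrix_vector_right_distrib H_add_right H_scale_right)
      have "H (\<gamma> s *v x) b' = H x (\<gamma> s *v b')" if "b' \<in> B" for x b'
        using vec.span_minimal[OF _ sub[of b'], of B] HB that B(3) by blast
      then show ?thesis
        using vec.span_minimal[OF _ sub2, of B] B(3) unfolding adj_def by blast
    qed
  qed
qed

lemma H_expand: "H x y = (\<Sum>i\<in>UNIV. \<Sum>j\<in>UNIV. x $ i * cnj (y $ j) * H (axis i 1) (axis j 1))"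
proof -
  have suml: "H (sum f J) z = (\<Sum>j\<in>J. H (f j) z)" for f z and J :: "'n set"
    by (induction J rule: infinite_finite_induct) (auto simp: H_add_left)
  have sumr: "H z (sum f J) = (\<Sum>j\<in>J. H z (f j))" for f z and J :: "'n set"
    by (induction J rule: infinite_finite_induct) (auto simp: H_add_right)
  have "H x y = H (\<Sum>i\<in>UNIV. x $ i *s axis i 1) (\<Sum>j\<in>UNIV. y $ j *s axis j 1)"
    by (simp add: basis_expansion)
  then show ?thesis
    by (simp add: suml sumr H_scale_left H_scale_right, subst sum.swap)
       (simp add: sum_distrib_left mult_ac)
qed

text \<open>On the unit sphere H x x attains a positive minimum m, so H dominates m times the
  squared norm. If a matrix preserves H, the squared norm of its j-th column is therefore at most H
  e e / m, where e is the j-th standard vector.\<close>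

lemma compact_unitary: "compact {A. \<forall>x y. H (A *v x) (A *v y) = H x y}" (is "compact ?K")
proof -
  have contH: "continuous_on UNIV (\<lambda>A :: complex^'n^'n. H (A *v x) (A *v y))" for x y
  proof -
    have eq: "(\<lambda>A :: complex^'n^'n. H (A *v x) (A *v y)) = (\<lambda>A. \<Sum>i\<in>UNIV. \<Sum>j\<in>UNIV.
        (A *v x) $ i * cnj ((A *v y) $ j) * H (axis i 1) (axis j 1))"
      by (rule ext, rule H_expand)
    show ?thesis unfolding eq unfolding matrix_vector_mult_def by (simp, intro continuous_intros)
  qed
  have "?K = (\<Inter>x. \<Inter>y. {A. H (A *v x) (A *v y) = H x y})" by auto
  moreover have "closed \<dots>"
    by (intro closed_INT ballI closed_Collect_eq contH continuous_on_const)
  ultimately have "closed ?K" by simp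
  moreover have "bounded ?K"
  proof -
    have cont: "continuous_on (sphere 0 1) (\<lambda>x :: complex^'n. Re (H x x))"
    proof -
      have eq: "(\<lambda>x. Re (H x x)) = (\<lambda>x. Re (\<Sum>i\<in>UNIV. \<Sum>j\<in>UNIV.
          x $ i * cnj (x $ j) * H (axis i 1) (axis j 1)))"
        by (rule ext, subst H_expand, rule refl)
      show ?thesis unfolding eq by (intro continuous_intros)
    qed
    have "axis i 1 \<in> (sphere 0 1 :: (complex^'n) set)" for i 
      by (simp add: norm_vec_def L2_set_def axis_def if_distrib if_distribR cong: if_cong)
    then obtain x0 :: "complex^'n" where x0: "x0 \<in> sphere 0 1" "\<And>x. x \<in> sphere 0 1 \<Longrightarrow> Re (H x0 x0) \<le> Re (H x x)"
      using continuous_attains_inf[OF compact_sphere _ cont] by blast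
    define m where "m = Re (H x0 x0)"
    have "x0 \<noteq> 0" using x0(1) by auto
    then have m: "m > 0" using H_pos[of x0] by (auto simp: m_def)
    have low: "m * (norm x)\<^sup>2 \<le> Re (H x x)" for x
    proof (cases "x = 0")
      case False
      let ?c = "complex_of_real (inverse (norm x))"
      have "?c *s x = inverse (norm x) *\<^sub>R x" by (simp add: vec_eq_iff) (simp add: scaleR_conv_of_real)
      then have "?c *s x \<in> sphere 0 1" using False by simp
      from x0(2)[OF this] have "m \<le> Re (cnj ?c * (?c * H x x))"
        by (simp only: m_def H_scale_left H_scale_right)
      also have "cnj ?c * (?c * H x x) = of_real (inverse ((norm x)\<^sup>2)) * H x x"
        by (simp add: power2_eq_square)
      finally have "m \<le> Re (H x x) / (norm x)\<^sup>2" by (simp add: field_simps Re_divide_of_real)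
      then show ?thesis using False by (simp add: field_simps)
    qed simp
    let ?b = "\<lambda>j. sqrt (Re (H (axis j 1) (axis j 1)) / m)"
    have "norm A \<le> (\<Sum>i\<in>(UNIV :: 'n set). \<Sum>j\<in>UNIV. ?b j)" if "A \<in> ?K" for A
    proof -
      have ent: "norm (A $ i $ j) \<le> ?b j" for i j
      proof -
        let ?v = "A *v axis j 1"
        have "m * (norm ?v)\<^sup>2 \<le> Re (H (axis j 1) (axis j 1))"
          using low[of ?v] that by auto
        then have "(norm ?v)\<^sup>2 \<le> Re (H (axis j 1) (axis j 1)) / m"
          using m by (simp add: field_simps)
        then have "norm ?v \<le> ?b j" by (rule real_le_rsqrt)
        moreover have "A $ i $ j = ?v $ i" 
          by (simp add: matrix_vector_mult_def axis_def if_distrib cong: if_cong)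
        ultimately show ?thesis using Finite_Cartesian_Product.norm_nth_le[of ?v i] by simp
      qed
      have row: "norm (A $ i) \<le> (\<Sum>j\<in>UNIV. ?b j)" for i :: "'n"
        by (rule order_trans[OF _ sum_mono[OF ent[of i]]])
           (simp add: norm_vec_def L2_set_le_sum)
      have "norm A \<le> (\<Sum>i\<in>UNIV. norm (A $ i))" by (simp add: norm_vec_def[of A] L2_set_le_sum)
      also have "\<dots> \<le> (\<Sum>i\<in>(UNIV :: 'n set). \<Sum>j\<in>UNIV. ?b j)" by (rule sum_mono) (rule row)
      finally show ?thesis .
    qed
    then show ?thesis unfolding bounded_iff by blast
  qed
  ultimately show ?thesis by (simp add: compact_eq_bounded_closed)
qed

end

section \<open>Quasi-periodic holomorphic functions\<close>

lemma periodic_int_combination: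
  fixes f :: "complex^'n \<Rightarrow> 'a" and p :: "'m::finite \<Rightarrow> complex^'n"
  assumes "\<And>k t. f (t + p k) = f t"
  shows "f (t + (\<Sum>k\<in>UNIV. of_int (n k) *\<^sub>R p k)) = f t"
proof -
  have minus: "f (t - p k) = f t" for t k using assms[of "t - p k" k] by simp
  have single: "f (t + of_int m *\<^sub>R p k) = f t" for t m k
  proof (induction m rule: int_induct[of _ 0])
    case (step1 i)
    then show ?case using assms[of "t + of_int i *\<^sub>R p k" k] by (simp add: algebra_simps)
  next
    case (step2 i)
    then show ?case using minus[of "t + of_int i *\<^sub>R p k" k] by (simp add: algebra_simps)
  qed simp
  have "f (t + (\<Sum>k\<in>S. of_int (n k) *\<^sub>R p k)) = f t" for S
    by (induction S arbitrary: t rule: infinite_finite_induct)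
       (simp_all add: single add.assoc[symmetric])
  then show ?thesis by simp
qed

lemma holo_on_has_field_derivative:
  assumes "(h has_derivative h') (at (s0 *s t))" "\<And>t. h' (\<i> *s t) = \<i> * h' t"
  shows "((\<lambda>s. h (s *s t)) has_field_derivative h' t) (at s0)"
proof -
  have lin: "linear h'" using assms(1) by (rule has_derivative_linear)
  have "bounded_linear (\<lambda>s :: complex. s *s t)"
    unfolding linear_conv_bounded_linear[symmetric]
    by (rule linearI) (simp_all add: vec_eq_iff algebra_simps)
  then have "((\<lambda>s :: complex. s *s t) has_derivative (\<lambda>s. s *s t)) (at s0)"
    by (rule bounded_linear.has_derivative) (rule has_derivative_ident)
  then have "((\<lambda>s. h (s *s t)) has_derivative (\<lambda>s. h' (s *s t))) (at s0)"
    by (rule has_derivative_compose) (fact assms(1))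
  moreover have "h' (s *s t) = h' t * s" for s
  proof -
    have "s *s t = Re s *\<^sub>R t + Im s *\<^sub>R (\<i> *s t)"
      by (simp add: vec_eq_iff) (simp add: complex_eq_iff)
    then have "h' (s *s t) = Re s *\<^sub>R h' t + Im s *\<^sub>R (\<i> * h' t)"
      by (simp add: linear_add[OF lin] linear_scale[OF lin] assms(2))
    then show ?thesis by (simp add: complex_eq_iff)
  qed
  ultimately show ?thesis by (simp add: has_field_derivative_def)
qed

lemma real_linear_eq_Re_bdot:
  fixes \<rho> :: "complex^'n \<Rightarrow> real"
  assumes "linear \<rho>" shows "\<exists>l. \<forall>t. \<rho> t = Re (bdot l t)"
proof (intro exI allI)
  fix t :: "complex^'n"
  have "t = (\<Sum>j\<in>UNIV. Re (t $ j) *\<^sub>R axis j 1 + Im (t $ j) *\<^sub>R axis j \<i>)"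
    by (simp add: vec_eq_iff axis_def if_distrib if_distribR cong: if_cong)
       (simp add: complex_eq_iff)
  then have "\<rho> t = \<rho> (\<Sum>j\<in>UNIV. Re (t $ j) *\<^sub>R axis j 1 + Im (t $ j) *\<^sub>R axis j \<i>)"
    by (rule arg_cong)
  also have "\<dots> = (\<Sum>j\<in>UNIV. Re (t $ j) * \<rho> (axis j 1) + Im (t $ j) * \<rho> (axis j \<i>))"
    by (simp add: linear_sum[OF assms] linear_add[OF assms] linear_scale[OF assms])
  also have "\<dots> = Re (bdot (\<chi> j. Complex (\<rho> (axis j 1)) (- \<rho> (axis j \<i>))) t)"
    by (simp add: bdot_def algebra_simps)
  finally show "\<rho> t = Re (bdot (\<chi> j. Complex (\<rho> (axis j 1)) (- \<rho> (axis j \<i>))) t)" .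
qed

text \<open>After division by the exponential of a suitable linear form, the absolute value of \<open>E\<close> is
  periodic, hence bounded, so Liouville's theorem applies on every complex line through 0.\<close>

lemma quasi_periodic_exp:
  fixes E :: "complex^'n \<Rightarrow> complex" and p :: "'m::finite \<Rightarrow> complex^'n"
    and r :: "complex^'n \<Rightarrow> real^'m"
  assumes holo: "\<And>t0. \<exists>N h. open N \<and> t0 \<in> N \<and> holo_on N h \<and> (\<forall>t\<in>N. E t = exp (h t))"
    and r: "linear r" "\<And>k. r (p k) = axis k 1" "\<And>t. t = (\<Sum>k\<in>UNIV. r t $ k *\<^sub>R p k)"
    and qp: "\<And>t k. E (t + p k) = m k * E t"
  shows "\<exists>l. \<forall>t. E t = E 0 * exp (bdot l t)"
proof -
  have E0: "E t \<noteq> 0" for t using holo[of t] by (metis exp_not_eq_zero)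
  have m0: "m k \<noteq> 0" for k using qp[of 0 k] E0 by (metis mult_zero_left)
  \<comment> \<open>This real linear form takes the value ln |m k| at the period p k. It is the real
    part of a complex linear form l, whose exponential has exactly the growth of E along the
    periods.\<close>
  have "linear (\<lambda>t. \<Sum>k\<in>UNIV. r t $ k * ln (cmod (m k)))"
    by (rule linearI) (simp_all add: linear_add[OF r(1)] linear_scale[OF r(1)] algebra_simps
        sum.distrib sum_distrib_left)
  from real_linear_eq_Re_bdot[OF this] obtain l where
    l: "\<And>t. (\<Sum>k\<in>UNIV. r t $ k * ln (cmod (m k))) = Re (bdot l t)" by blast
  have lp: "Re (bdot l (p k)) = ln (cmod (m k))" for k
    unfolding l[symmetric] r(2) by (simp add: axis_def if_distrib if_distribR cong: if_cong)
  define G where "G t = E t * exp (- bdot l t)" for t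
  have "cmod (G (t + p k)) = cmod (G t)" for t k
  proof -
    have "cmod (G (t + p k)) = cmod (m k) * cmod (E t) * exp (- Re (bdot l t) - ln (cmod (m k)))"
      by (simp add: G_def qp norm_mult bdot_add_right lp)
    also have "\<dots> = cmod (G t)" using m0[of k] by (simp add: G_def norm_mult exp_diff)
    finally show ?thesis .
  qed
  note per = periodic_int_combination[of "\<lambda>t. cmod (G t)" p, OF this]
  have contE: "isCont E t" for t
  proof -
    obtain N h where N: "open N" "t \<in> N" "holo_on N h" "\<forall>t\<in>N. E t = exp (h t)" using holo by blast
    then have "isCont h t" unfolding holo_on_def using has_derivative_continuous by blast
    then have "isCont (\<lambda>t. exp (h t)) t" by (intro continuous_intros)
    moreover have "\<forall>\<^sub>F s in nhds t. E s = exp (h s)" using N eventually_nhds by blast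
    ultimately show ?thesis using isCont_cong[of E "\<lambda>t. exp (h t)" t] by simp
  qed
  have contG: "continuous_on UNIV G"
    unfolding G_def bdot_def
    by (intro continuous_intros continuous_at_imp_continuous_on ballI contE)
  let ?q = "\<lambda>x :: real^'m. \<Sum>k\<in>UNIV. x $ k *\<^sub>R p k"
  have "compact ((\<lambda>x. G (?q x)) ` cbox 0 1)"
    by (intro compact_continuous_image compact_cbox continuous_on_compose2[OF contG] continuous_intros) auto
  then have "bounded ((\<lambda>x. G (?q x)) ` cbox 0 1)" by (rule compact_imp_bounded)
  then obtain b where "\<forall>y\<in>(\<lambda>x. G (?q x)) ` cbox 0 1. norm y \<le> b"
    unfolding bounded_iff by blast
  then have b: "cmod (G (?q x)) \<le> b" if "x \<in> cbox 0 1" for x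
    using that by simp
  have bd: "cmod (G t) \<le> b" for t
  proof -
    let ?x = "\<chi> k. frac (r t $ k)"
    have "t = ?q ?x + (\<Sum>k\<in>UNIV. of_int \<lfloor>r t $ k\<rfloor> *\<^sub>R p k)"
      by (subst r(3)[of t]) (simp add: sum.distrib[symmetric] scaleR_add_left[symmetric] frac_def)
    then have "cmod (G t) = cmod (G (?q ?x))" using per by metis
    moreover have "?x \<in> cbox 0 1"
      by (auto simp: mem_box_cart frac_ge_0 less_imp_le[OF frac_lt_1])
    ultimately show ?thesis using b by metis
  qed
  have "G t = G 0" for t
  proof -
    have "(\<lambda>s. E (s *s t)) field_differentiable (at s0)" for s0
    proof -
      obtain N h where N: "open N" "s0 *s t \<in> N" "holo_on N h" "\<forall>t\<in>N. E t = exp (h t)" using holo by blast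
      obtain h' where h': "(h has_derivative h') (at (s0 *s t))" "\<forall>t. h' (\<i> *s t) = \<i> * h' t"
        using N(2,3) unfolding holo_on_def by blast
      have "((\<lambda>s. exp (h (s *s t))) has_field_derivative exp (h (s0 *s t)) * h' t) (at s0)"
        using holo_on_has_field_derivative[OF h'(1)] h'(2)
        by (auto intro!: derivative_eq_intros)
      moreover have "continuous_on UNIV (\<lambda>s :: complex. s *s t)"
        unfolding vector_scalar_mult_def by (intro continuous_intros)
      then have "open ((\<lambda>s. s *s t) -` N)" using N(1) by (metis open_vimage)
      ultimately have "((\<lambda>s. E (s *s t)) has_field_derivative exp (h (s0 *s t)) * h' t) (at s0)"
        by (rule has_field_derivative_transform_within_open) (use N in auto)
      then show ?thesis by (auto simp: field_differentiable_def)
    qed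
    then have "(\<lambda>s. E (s *s t)) holomorphic_on UNIV"
      by (simp add: holomorphic_on_def)
    then have "(\<lambda>s. G (s *s t)) holomorphic_on UNIV"
      unfolding G_def by (simp, intro holomorphic_intros)
    moreover have "bounded (range (\<lambda>s. G (s *s t)))" using bd unfolding bounded_iff by blast
    ultimately obtain c where "\<And>s. G (s *s t) = c" 
      using Liouville_theorem[of "\<lambda>s. G (s *s t)"] by (auto simp: constant_on_def)
    from this[of 1] this[of 0] show ?thesis by simp
  qed
  moreover have "E t = G t * exp (bdot l t)" for t by (simp add: G_def exp_minus field_simps)
  moreover have "G 0 = E 0" by (simp add: G_def)
  ultimately have "E t = E 0 * exp (bdot l t)" for t by metis
  then show ?thesis by blast
qed

section \<open>Orbits\<close>

lemma act_act: "act A (act B F) = act (A ** B) F"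
  by (auto simp: act_def image_image matrix_vector_mul_assoc)

lemma act_1 [simp]: "act (mat 1) F = F"
  by (simp add: act_def)

lemma orb_eq_iff:
  assumes "mat_group G"
  shows "orb G F = orb G F' \<longleftrightarrow> (\<exists>A\<in>G. F' = act A F)"
proof
  assume "orb G F = orb G F'"
  moreover have "F' \<in> orb G F'"
    unfolding orb_def using mat_group_closed(1)[OF assms] by (metis act_1 image_eqI)
  ultimately show "\<exists>A\<in>G. F' = act A F" unfolding orb_def by blast
next
  assume "\<exists>A\<in>G. F' = act A F"
  then obtain A where A: "A \<in> G" "F' = act A F" by blast
  have F: "F = act (matrix_inv A) F'"
    using A mat_group_closed(4)[OF assms] by (simp add: act_act matrix_inv_left)
  have "orb G (act B F) \<subseteq> orb G F" if "B \<in> G" for B F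
    unfolding orb_def using mat_group_closed(2)[OF assms _ that] by (auto simp: act_act)
  then show "orb G F = orb G F'"
    using A F mat_group_closed(3)[OF assms] by (metis subset_antisym)
qed

lemma orb_self: "mat_group G \<Longrightarrow> F \<in> orb G F"
  unfolding orb_def using mat_group_closed(1) by (metis act_1 image_eqI)

section \<open>Period matrices and lattices\<close>

abbreviation vfst :: "'a^('d + 'd) \<Rightarrow> 'a^('d::finite)" where "vfst y \<equiv> (\<chi> a. y $ Inl a)"
abbreviation vsnd :: "'a^('d + 'd) \<Rightarrow> 'a^('d::finite)" where "vsnd y \<equiv> (\<chi> a. y $ Inr a)"

abbreviation tpi :: complex where "tpi \<equiv> 2 * of_real pi * \<i>"

lemma tpi_inverse: "tpi * inverse tpi = 1" "inverse tpi * tpi = 1"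
  by (rule right_inverse, simp, rule left_inverse, simp)

definition cor :: "real^'n \<Rightarrow> complex^'n" where
  "cor x = (\<chi> i. of_real (x $ i))"

lemma cor_civ: "civ n = cor (\<chi> i. of_int (n $ i))"
  by (simp add: civ_def cor_def)

lemma vfst_vsnd: "vec2 (vfst y) (vsnd y) = y"
  by (simp add: vec_eq_iff vec2_def split: sum.split)

lemma projA_vec2 [simp]: "projA \<tau> (vec2 p q) = p - \<tau> *v q"
  and projB_vec2 [simp]: "projB \<tau> (vec2 p q) = tpi *s (p v* \<tau> + q)"
  by (simp_all add: projA_def projB_def)

lemma projA_linear:
  "projA \<tau> (x + y) = projA \<tau> x + projA \<tau> y" "projA \<tau> (c *s x) = c *s projA \<tau> x"
  "projA \<tau> (x - y) = projA \<tau> x - projA \<tau> y" "projA \<tau> 0 = 0" "projA \<tau> (- x) = - projA \<tau> x"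
proof -
  show a: "projA \<tau> (x + y) = projA \<tau> x + projA \<tau> y" for x y
    by (rule vec2_cases[of x], rule vec2_cases[of y]) (simp add: matrix_vector_right_distrib)
  show s: "projA \<tau> (c *s x) = c *s projA \<tau> x" for c x
    by (rule vec2_cases[of x]) (simp add: vec.scale_right_diff_distrib)
  show "projA \<tau> (x - y) = projA \<tau> x - projA \<tau> y" using a[of "x - y" y] by simp
  show "projA \<tau> 0 = 0" using s[of 0 0] by simp
  show "projA \<tau> (- x) = - projA \<tau> x" using a[of x "- x"] a[of 0 0] by (simp add: add_eq_0_iff)
qed

lemma projB_linear:
  "projB \<tau> (x + y) = projB \<tau> x + projB \<tau> y" "projB \<tau> (c *s x) = c *s projB \<tau> x"
  "projB \<tau> (x - y) = projB \<tau> x - projB \<tau> y" "projB \<tau> 0 = 0"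
proof -
  show a: "projB \<tau> (x + y) = projB \<tau> x + projB \<tau> y" for x y
    by (rule vec2_cases[of x], rule vec2_cases[of y]) (simp add: vec_matrix_add vec.scale_right_distrib)
  show s: "projB \<tau> (c *s x) = c *s projB \<tau> x" for c x
    by (rule vec2_cases[of x]) (simp add: vec.scale_right_distrib mult_ac)
  show "projB \<tau> (x - y) = projB \<tau> x - projB \<tau> y" using a[of "x - y" y] by simp
  show "projB \<tau> 0 = 0" using s[of 0 0] by simp
qed

lemma siegel_sym: "\<tau> \<in> siegel \<Longrightarrow> x v* \<tau> = \<tau> *v x"
  by (simp add: siegel_def) (metis transpose_matrix_vector)

text \<open>For a = x + i y the terms with the real part of \<tau> cancel because \<tau> is
  symmetric, and the values of the quadratic form of the imaginary part at x and at y
  remain.\<close>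

lemma siegel_Im_pos:
  assumes "\<tau> \<in> siegel" "a \<noteq> 0"
  shows "Im (bdot (map_vec cnj a) (\<tau> *v a)) > 0"
proof -
  have sym: "\<tau> $ i $ j = \<tau> $ j $ i" for i j
    using assms(1) by (simp add: siegel_def transpose_def vec_eq_iff)
  have pos: "(\<Sum>i\<in>UNIV. \<Sum>j\<in>UNIV. x $ i * Im (\<tau> $ i $ j) * x $ j) > 0" if "x \<noteq> 0" for x
    using assms(1) that by (simp add: siegel_def)
  have nonneg: "(\<Sum>i\<in>UNIV. \<Sum>j\<in>UNIV. x $ i * Im (\<tau> $ i $ j) * x $ j) \<ge> 0" for x
    using pos[of x] by (cases "x = 0") auto
  define x y where "x = (\<chi> i. Re (a $ i))" and "y = (\<chi> i. Im (a $ i))"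
  have "(\<Sum>i\<in>UNIV. \<Sum>j\<in>UNIV. y $ i * Re (\<tau> $ i $ j) * x $ j)
      = (\<Sum>i\<in>UNIV. \<Sum>j\<in>UNIV. x $ i * Re (\<tau> $ i $ j) * y $ j)"
    by (subst sum.swap) (simp add: sym mult_ac)
  moreover have "Im (bdot (map_vec cnj a) (\<tau> *v a)) = (\<Sum>i\<in>UNIV. \<Sum>j\<in>UNIV.
      x $ i * Im (\<tau> $ i $ j) * x $ j + y $ i * Im (\<tau> $ i $ j) * y $ j
      + (x $ i * Re (\<tau> $ i $ j) * y $ j - y $ i * Re (\<tau> $ i $ j) * x $ j))"
    by (simp add: bdot_def map_vec_def matrix_vector_mult_def x_def y_def sum_distrib_left
        algebra_simps)
  ultimately have "Im (bdot (map_vec cnj a) (\<tau> *v a)) =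
      (\<Sum>i\<in>UNIV. \<Sum>j\<in>UNIV. x $ i * Im (\<tau> $ i $ j) * x $ j) +
      (\<Sum>i\<in>UNIV. \<Sum>j\<in>UNIV. y $ i * Im (\<tau> $ i $ j) * y $ j)"
    by (simp add: sum.distrib sum_subtractf)
  moreover have "x \<noteq> 0 \<or> y \<noteq> 0"
    using assms(2) by (auto simp: vec_eq_iff x_def y_def complex_eq_iff)
  ultimately show ?thesis
    using pos[of x] pos[of y] nonneg[of x] nonneg[of y] by (cases "x = 0") linarith+
qed

lemma siegelI:
  assumes "transpose \<tau> = \<tau>" "\<And>a. a \<noteq> 0 \<Longrightarrow> Im (bdot (map_vec cnj a) (\<tau> *v a)) > 0"
  shows "\<tau> \<in> siegel"
  unfolding siegel_def
proof (intro CollectI conjI allI impI assms(1))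
  fix x :: "real^'a" assume "x \<noteq> 0"
  then have "cor x \<noteq> 0" by (auto simp: cor_def vec_eq_iff)
  from assms(2)[OF this] show "(\<Sum>i\<in>UNIV. \<Sum>j\<in>UNIV. x $ i * Im (\<tau> $ i $ j) * x $ j) > 0"
    by (simp add: bdot_def map_vec_def matrix_vector_mult_def cor_def sum_distrib_left algebra_simps)
qed

text \<open>The imaginary part Y of \<tau> is invertible, so v = p - \<tau> q with real p and q is
  solved by taking imaginary parts first: q = - Y^-1 Im v, and then p = Re v + X q with X the real
  part of \<tau>.\<close>

lemma projA_real_coords:
  fixes \<tau> :: "complex^'d^'d::finite"
  assumes \<tau>: "\<tau> \<in> siegel"
  obtains r where "linear r" "\<And>v. projA \<tau> (cor (r v)) = v" "\<And>x. r (projA \<tau> (cor x)) = x"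
proof -
  define Y X :: "real^'d^'d" where "Y = (\<chi> i j. Im (\<tau> $ i $ j))" and "X = (\<chi> i j. Re (\<tau> $ i $ j))"
  have posY: "x = 0" if "Y *v x = 0" for x
  proof (rule ccontr)
    assume "x \<noteq> 0"
    then have "(\<Sum>i\<in>UNIV. \<Sum>j\<in>UNIV. x $ i * Im (\<tau> $ i $ j) * x $ j) > 0" using \<tau> by (simp add: siegel_def)
    moreover have "(\<Sum>i\<in>UNIV. \<Sum>j\<in>UNIV. x $ i * Im (\<tau> $ i $ j) * x $ j) = (\<Sum>i\<in>UNIV. x $ i * (Y *v x) $ i)"
      by (simp add: Y_def matrix_vector_mult_def sum_distrib_left mult_ac)
    ultimately show False using that by simp
  qed
  obtain Z where Z: "Z ** Y = mat 1" using matrix_left_invertible_ker[of Y] posY by blast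
  then have Z': "Y ** Z = mat 1" using matrix_left_right_inverse by blast
  define q p where "q v = - (Z *v (\<chi> i. Im (v $ i)))" and "p v = (\<chi> i. Re (v $ i)) + X *v q v" for v :: "complex^'d"
  define r :: "complex^'d \<Rightarrow> real^('d + 'd)" where
    "r v = (\<chi> k. case k of Inl i \<Rightarrow> p v $ i | Inr i \<Rightarrow> q v $ i)" for v
  have Imlin: "(\<chi> i. Im ((v + v') $ i)) = (\<chi> i. Im (v $ i)) + (\<chi> i. Im (v' $ i))"
    "(\<chi> i. Im ((c *\<^sub>R v) $ i)) = c *\<^sub>R (\<chi> i. Im (v $ i))" for v v' :: "complex^'d" and c
    by (simp_all add: vec_eq_iff)
  have q: "q (v + v') = q v + q v'" "q (c *\<^sub>R v) = c *\<^sub>R q v" for v v' c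
    unfolding q_def Imlin by (simp_all add: matrix_vector_right_distrib matrix_vector_mult_scaleR)
  have p: "p (v + v') = p v + p v'" "p (c *\<^sub>R v) = c *\<^sub>R p v" for v v' c
    unfolding p_def q by (simp_all add: vec_eq_iff algebra_simps matrix_vector_mult_scaleR)
  have lin: "linear r"
    by (rule linearI) (simp_all add: r_def p q vec_eq_iff split: sum.split)
  have cA: "projA \<tau> (cor x) $ i = Complex (x $ Inl i - (X *v vsnd x) $ i) (- (Y *v vsnd x) $ i)" for x i
    by (simp add: projA_def cor_def X_def Y_def matrix_vector_mult_def complex_eq_iff)
  have r1: "projA \<tau> (cor (r v)) = v" for v
  proof -
    have vq: "vsnd (r v) = q v" by (simp add: r_def vec_eq_iff)
    have "Y *v q v = - (\<chi> i. Im (v $ i))"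
      unfolding q_def by (metis Z' matrix_vector_mul_assoc matrix_vector_mul_lid mult_minus_right
        matrix_vector_mult_diff_distrib diff_0 matrix_vector_mult_0_right)
    then show ?thesis unfolding vec_eq_iff cA vq by (simp add: r_def p_def complex_eq_iff)
  qed
  moreover have "r (projA \<tau> (cor x)) = x" for x
  proof -
    have "projA \<tau> (cor (r (projA \<tau> (cor x)))) = projA \<tau> (cor x)" by (rule r1)
    then have eq: "x $ Inl i - (X *v vsnd x) $ i = r (projA \<tau> (cor x)) $ Inl i - (X *v vsnd (r (projA \<tau> (cor x)))) $ i"
       "(Y *v vsnd x) $ i = (Y *v vsnd (r (projA \<tau> (cor x)))) $ i" for i
      unfolding vec_eq_iff cA by (auto simp: complex_eq_iff)
    have "vsnd x = vsnd (r (projA \<tau> (cor x)))"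
      using eq(2) posY[of "vsnd x - vsnd (r (projA \<tau> (cor x)))"]
      by (simp add: matrix_vector_mult_diff_distrib vec_eq_iff[of "Y *v _"])
    moreover from this eq(1) have "x $ Inl i = r (projA \<tau> (cor x)) $ Inl i" for i by simp
    ultimately show ?thesis by (metis (no_types, lifting) vec_eq_iff vec_lambda_beta sum.exhaust)
  qed
  ultimately show thesis using that lin by blast
qed

lemma projB_real_coords:
  fixes \<tau> :: "complex^'d^'d::finite"
  assumes \<tau>: "\<tau> \<in> siegel"
  obtains r where "linear r" "\<And>v. projB \<tau> (cor (r v)) = v" "\<And>x. r (projB \<tau> (cor x)) = x"
proof -
  obtain s where s: "linear s" "\<And>v. projA \<tau> (cor (s v)) = v" "\<And>x. s (projA \<tau> (cor x)) = x"
    using projA_real_coords[OF \<tau>] by blast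
  \<comment> \<open>Since \<tau> is symmetric, \<open>projB \<tau> x\<close> is \<open>tpi\<close>
    times \<open>projA \<tau>\<close> of this rotation of x; J squares to -1, whence the sign in
    r.\<close>
  define J :: "real^('d + 'd) \<Rightarrow> real^('d + 'd)" where
    "J x = (\<chi> k. case k of Inl i \<Rightarrow> x $ Inr i | Inr i \<Rightarrow> - x $ Inl i)" for x
  define r where "r v = - J (s (inverse tpi *s v))" for v
  have JJ: "J (J x) = - x" for x by (simp add: J_def vec_eq_iff split: sum.split)
  have Jm: "J (- x) = - J x" for x by (simp add: J_def vec_eq_iff split: sum.split)
  have sc: "c *s projA \<tau> x = projA \<tau> (c *s x)" for c x by (simp add: projA_linear)
  have BA: "projB \<tau> (cor x) = tpi *s projA \<tau> (cor (J x))" for x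
  proof -
    have "vfst (cor (J x)) = vsnd (cor x)" "vsnd (cor (J x)) = - vfst (cor x)"
      by (simp_all add: cor_def J_def vec_eq_iff)
    then show ?thesis by (simp add: projA_def projB_def siegel_sym[OF \<tau>] add.commute)
  qed
  have "linear r"
  proof (rule linearI)
    have J: "J (x + y) = J x + J y" "J (c *\<^sub>R x) = c *\<^sub>R J x" for x y c
      by (simp_all add: J_def vec_eq_iff split: sum.split)
    show "r (v + v') = r v + r v'" for v v'
      unfolding r_def by (simp only: vec.scale_right_distrib linear_add[OF s(1)] J minus_add_distrib)
    have "inverse tpi *s (c *\<^sub>R v) = c *\<^sub>R (inverse tpi *s v)" for c and v :: "complex^'d"
      by (simp add: vec_eq_iff)
    then show "r (c *\<^sub>R v) = c *\<^sub>R r v" for c v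
      unfolding r_def by (simp only: linear_scale[OF s(1)] J scaleR_minus_right)
  qed
  moreover have "projB \<tau> (cor (r v)) = v" for v
    by (simp only: BA r_def JJ Jm minus_minus s(2) vec.scale_scale tpi_inverse vec.scale_one)
  moreover have "r (projB \<tau> (cor x)) = x" for x
    by (simp only: BA r_def JJ Jm minus_minus s(3) vec.scale_scale tpi_inverse vec.scale_one)
  ultimately show thesis using that by blast
qed

lemma projA_real_inject: "\<tau> \<in> siegel \<Longrightarrow> projA \<tau> (cor x) = projA \<tau> (cor y) \<Longrightarrow> x = y"
  by (metis projA_real_coords)

lemma projB_real_inject: "\<tau> \<in> siegel \<Longrightarrow> projB \<tau> (cor x) = projB \<tau> (cor y) \<Longrightarrow> x = y"
  by (metis projB_real_coords)

lemma projA_civ_inject: "\<tau> \<in> siegel \<Longrightarrow> projA \<tau> (civ m) = projA \<tau> (civ n) \<Longrightarrow> m = n"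
  using projA_real_inject unfolding cor_civ by (fastforce simp: vec_eq_iff)

lemma projB_civ_inject: "\<tau> \<in> siegel \<Longrightarrow> projB \<tau> (civ m) = projB \<tau> (civ n) \<Longrightarrow> m = n"
  using projB_real_inject unfolding cor_civ by (fastforce simp: vec_eq_iff)

lemma civ_linear: "civ (m + n) = civ m + civ n" "civ 0 = 0" "civ (- m) = - civ m" "civ (m - n) = civ m - civ n"
  by (simp_all add: civ_def vec_eq_iff)

text \<open>The image would be a real vector space inside a discrete set: after a suitable scaling
  of u a nonzero real coordinate of the image becomes 1/2, which is not an integer. This lifts
  identities modulo the lattice to identities of linear maps.\<close>

lemma linear_into_lattice_eq_0:
  assumes \<tau>: "\<tau> \<in> siegel" and \<psi>: "clinear_map \<psi>" and lat: "\<And>u. \<psi> u \<in> latA \<tau>"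
  shows "\<psi> u = 0"
proof -
  obtain r where r: "linear r" "\<And>v. projA \<tau> (cor (r v)) = v" "\<And>x. r (projA \<tau> (cor x)) = x"
    using projA_real_coords[OF \<tau>] by blast
  have int: "\<exists>n. r (\<psi> u) = (\<chi> i. real_of_int (n $ i))" for u
    using lat[of u] r(3) unfolding latA_def cor_civ by force
  have sc: "r (\<psi> (of_real t *s u)) = t *\<^sub>R r (\<psi> u)" for t
  proof -
    have "\<psi> (of_real t *s u) = t *\<^sub>R \<psi> u"
      using \<psi> unfolding clinear_map_def
      by (simp add: Vector_Spaces.linear_iff) (simp add: vec_eq_iff scaleR_conv_of_real[symmetric])
    then show ?thesis by (simp add: linear_scale[OF r(1)])
  qed
  have "r (\<psi> u) $ k = 0" for k
  proof (rule ccontr)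
    assume k: "r (\<psi> u) $ k \<noteq> 0"
    obtain n where "r (\<psi> (of_real (1 / (2 * r (\<psi> u) $ k)) *s u)) = (\<chi> i. real_of_int (n $ i))" using int by blast
    then have "r (\<psi> u) $ k / (2 * r (\<psi> u) $ k) = real_of_int (n $ k)"
      unfolding sc by (simp add: vec_eq_iff)
    then have "1 / 2 = real_of_int (n $ k)" using k by simp
    then have "real_of_int 1 = real_of_int (2 * n $ k)" by simp
    then show False unfolding of_int_eq_iff by presburger
  qed
  then have "r (\<psi> u) = 0" by (simp add: vec_eq_iff)
  then have "\<psi> u = projA \<tau> (cor 0)" using r(2)[of "\<psi> u"] by simp
  also have "\<dots> = 0" using projA_linear(4) by (simp add: cor_def zero_vec_def)
  finally show ?thesis .
qed

section \<open>The points of the domain\<close>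

lemma pt_eq_iff: "pt \<tau> u v w = pt \<tau>' u' v' w' \<longleftrightarrow> \<tau> = \<tau>' \<and> u = u' \<and> v = v' \<and> w = w'"
proof
  assume eq: "pt \<tau> u v w = pt \<tau>' u' v' w'"
  have *: "bdot u a + w * b = bdot u' a + w' * b \<and> \<tau> *v a + b *s v = \<tau>' *v a + b *s v'" for a b
  proof -
    have "vec3 ((bdot u a + w * b) / tpi) (vec2 (\<tau> *v a + b *s v) a) b \<in> pt \<tau>' u' v' w'"
      unfolding eq[symmetric] unfolding pt_def by blast
    then show ?thesis unfolding pt_def by (auto simp: divide_cancel_right)
  qed
  from *[of _ 0] have "\<tau> = \<tau>'" "u = u'" by (auto intro: matrix_eqI bdot_eqI)
  moreover from *[of 0 1] have "v = v'" "w = w'" by auto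
  ultimately show "\<tau> = \<tau>' \<and> u = u' \<and> v = v' \<and> w = w'" by blast
qed auto

text \<open>The unipotent matrix adds b times the lower half of y to the parameter a, so the period
  matrix has to be brought back to its normal form. The substitution \<open>a + b *s vsnd y\<close>
  does this and is the source of the term \<open>- bdot (u + projB \<tau> x) (vsnd y)\<close>, hence
  of one of the two factors of automorphy.\<close>

lemma act_unipotent:
  assumes "\<tau> \<in> siegel"
  shows "act (blk 1 x z (mat 1) y) (pt \<tau> u v w) = pt \<tau> (u + projB \<tau> x) (v + projA \<tau> y)
    (w + tpi * (bdot (vfst x) v + z) - bdot (u + projB \<tau> x) (vsnd y))"
proof -
  have key: "blk 1 x z (mat 1) y *v vec3 ((bdot u a + w * b) / tpi) (vec2 (\<tau> *v a + b *s v) a) b =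
    vec3 ((bdot (u + projB \<tau> x) (a + b *s vsnd y) + (w + tpi * (bdot (vfst x) v + z) - bdot (u + projB \<tau> x) (vsnd y)) * b) / tpi)
      (vec2 (\<tau> *v (a + b *s vsnd y) + b *s (v + projA \<tau> y)) (a + b *s vsnd y)) b" for a b
  proof -
    obtain x1 x2 where x: "x = vec2 x1 x2" by (rule vec2_cases)
    obtain y1 y2 where y: "y = vec2 y1 y2" by (rule vec2_cases)
    have "bdot x1 (\<tau> *v a) = bdot (x1 v* \<tau>) a" by (rule bdot_matrix)
    then show ?thesis
      unfolding x y
      by (simp add: bdot_distribs matrix_vector_right_distrib vec.scale_right_distrib vec.scale_right_diff_distrib add_ac)
         (simp add: field_simps)
  qed
  show ?thesis
  proof (intro subset_antisym subsetI)
    fix s assume "s \<in> pt \<tau> (u + projB \<tau> x) (v + projA \<tau> y)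
      (w + tpi * (bdot (vfst x) v + z) - bdot (u + projB \<tau> x) (vsnd y))"
    then obtain a b where s: "s = vec3 ((bdot (u + projB \<tau> x) a + (w + tpi * (bdot (vfst x) v + z)
        - bdot (u + projB \<tau> x) (vsnd y)) * b) / tpi) (vec2 (\<tau> *v a + b *s (v + projA \<tau> y)) a) b"
      unfolding pt_def by blast
    have "s = blk 1 x z (mat 1) y *v vec3 ((bdot u (a - b *s vsnd y) + w * b) / tpi)
      (vec2 (\<tau> *v (a - b *s vsnd y) + b *s v) (a - b *s vsnd y)) b"
      unfolding key s by simp
    then show "s \<in> act (blk 1 x z (mat 1) y) (pt \<tau> u v w)" unfolding act_def pt_def by blast
  next
    fix s assume "s \<in> act (blk 1 x z (mat 1) y) (pt \<tau> u v w)"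
    then show "s \<in> pt \<tau> (u + projB \<tau> x) (v + projA \<tau> y)
      (w + tpi * (bdot (vfst x) v + z) - bdot (u + projB \<tau> x) (vsnd y))"
      unfolding act_def pt_def using key by blast
  qed
qed

section \<open>Symplectic similitudes\<close>

lemma J_J: "J_mat ** J_mat = (mat (-1) :: complex^('d::finite + 'd)^('d + 'd))"
proof (rule matrix_eqI)
  fix x :: "complex^('d + 'd)"
  obtain a b where "x = vec2 a b" by (rule vec2_cases)
  then show "J_mat ** J_mat *v x = mat (- 1) *v x"
    by (simp add: matrix_vector_mul_assoc[symmetric])
qed

text \<open>An entry at which \<open>J_mat\<close> is 1, so that the multiplier of a similitude is a
  polynomial in its entries; \<open>undefined\<close> stands for an arbitrary index.\<close>

definition multiplier :: "complex^('d::finite + 'd)^('d + 'd) \<Rightarrow> complex" where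
  "multiplier g = (transpose g ** J_mat ** g) $ Inr undefined $ Inl undefined"

lemma mat_times_nth [simp]: "(mat c ** A) $ i $ j = c * A $ i $ j" for A :: "complex^'n^'n"
  by (simp add: matrix_matrix_mult_def mat_def if_distrib if_distribR cong: if_cong)

lemma bdot_matrix_left: "bdot (A *v x) y = bdot x (y v* A)"
  by (metis bdot_commute bdot_matrix)

lemma mat_pull: "A ** (mat c ** B) ** C = mat c ** (A ** B ** C)" for A :: "complex^'n^'n"
  by (metis mat_commute matrix_mul_assoc)

lemma mat_div: "mat c ** A = B \<Longrightarrow> c \<noteq> 0 \<Longrightarrow> A = mat (inverse c) ** B" for A :: "complex^'n^'n"
  by (simp add: vec_eq_iff) (metis inverse_unique left_inverse mult.assoc mult.left_neutral)

lemma invertible_transpose: "invertible A \<Longrightarrow> invertible (transpose A)" for A :: "complex^'n^'n"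
  by (rule matrix_inv_eqI(2)[of _ "transpose (matrix_inv A)"])
     (simp add: matrix_transpose_mul[symmetric] matrix_inv_left)

lemma matrix_cancel2:
  "A' ** A = mat 1 \<Longrightarrow> C ** C' = mat 1 \<Longrightarrow> A' ** (A ** B ** C) ** C' = B" for A B C :: "complex^'n^'n"
  by (metis matrix_mul_assoc matrix_mul_lid matrix_mul_rid)

lemma invertible_mat_1 [simp]: "invertible (mat 1 :: complex^'n^'n)"
  by (rule matrix_inv_eqI(2)[of _ "mat 1"]) simp

lemma bilinear_matrix_eq:
  fixes A B :: "complex^'n^'n"
  shows "(\<forall>x y. bdot x (A *v y) = bdot x (B *v y)) \<longleftrightarrow> A = B"
  by (metis bdot_commute bdot_eqI matrix_eqI)

lemma GSp_iff: "(g, \<mu>) \<in> GSp \<longleftrightarrow> invertible g \<and> \<mu> \<noteq> 0 \<and> transpose g ** J_mat ** g = mat \<mu> ** J_mat"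
proof -
  have 1: "Psi (g *v x) (g *v y) = tpi * bdot x ((transpose g ** J_mat ** g) *v y)" for x y
    unfolding Psi_def by (simp add: matrix_vector_mul_assoc[symmetric] bdot_matrix_left)
  have 2: "\<mu> * Psi x y = tpi * bdot x ((mat \<mu> ** J_mat) *v y)" for x y
    unfolding Psi_def by (simp add: matrix_vector_mul_assoc[symmetric])
  have "(\<forall>x y. Psi (g *v x) (g *v y) = \<mu> * Psi x y) \<longleftrightarrow>
      (\<forall>x y. bdot x ((transpose g ** J_mat ** g) *v y) = bdot x ((mat \<mu> ** J_mat) *v y))"
    unfolding 1 2 by simp
  then have "(\<forall>x y. Psi (g *v x) (g *v y) = \<mu> * Psi x y) \<longleftrightarrow>
      transpose g ** J_mat ** g = mat \<mu> ** J_mat"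
    unfolding bilinear_matrix_eq .
  then show ?thesis by (simp add: GSp_def)
qed

lemma multiplier_eq: "transpose g ** J_mat ** g = mat \<mu> ** J_mat \<Longrightarrow> multiplier g = \<mu>"
  by (simp add: multiplier_def J_mat_def)

lemma polyfuns_multiplier: "multiplier \<in> polyfuns"
  using poly_map_mult[OF poly_map_mult[OF poly_map_transpose[OF poly_map_id] poly_map_const] poly_map_id]
  unfolding multiplier_def poly_map_def by blast

lemmas poly_map_intros = poly_map_id poly_map_const poly_vec_const poly_map_mult poly_map_transpose
  poly_map_mat poly_vec_mv poly_vec_scale polyfuns_bdot poly_map_blk polyfuns_multiplier

lemma GSp_alt: "(\<exists>\<mu>. (g, \<mu>) \<in> GSp \<and> Q \<mu>) \<longleftrightarrow> (g, multiplier g) \<in> GSp \<and> Q (multiplier g)"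
  using GSp_iff multiplier_eq by metis

lemma GSp_multiplier_eq: "(g, \<mu>) \<in> GSp \<Longrightarrow> multiplier g = \<mu>"
  using GSp_iff multiplier_eq by metis

text \<open>Replacing n by n g removes the inverse of g and turns the stabiliser condition into
  polynomial equations.\<close>

lemma stabilises_iff:
  assumes "invertible g"
  shows "stabilises A g \<mu> \<longleftrightarrow> g ** A ** transpose g = mat \<mu> ** A"
proof
  assume st: "stabilises A g \<mu>"
  show "g ** A ** transpose g = mat \<mu> ** A"
  proof (rule matrix_eqI)
    fix m
    have "g *v (A *v (m v* g)) = A *v (\<mu> *s ((m v* g) v* matrix_inv g))"
      using st unfolding stabilises_def by blast
    then show "g ** A ** transpose g *v m = mat \<mu> ** A *v m"
      by (simp add: vector_matrix_mul_assoc matrix_inv_right[OF assms] matrix_vector_mul_assoc[symmetric])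
  qed
next
  assume eq: "g ** A ** transpose g = mat \<mu> ** A"
  show "stabilises A g \<mu>" unfolding stabilises_def
  proof
    fix n
    have "g *v (A *v ((n v* matrix_inv g) v* g)) = \<mu> *s (A *v (n v* matrix_inv g))"
      using arg_cong[OF eq, of "\<lambda>M. M *v (n v* matrix_inv g)"]
      by (simp add: matrix_vector_mul_assoc[symmetric])
    then show "g *v (A *v n) = A *v (\<mu> *s (n v* matrix_inv g))"
      by (simp add: vector_matrix_mul_assoc matrix_inv_left[OF assms])
  qed
qed

definition G_full :: "int^('d::finite + 'd)^('d + 'd) \<Rightarrow> (complex^('d + 'd)^('d + 'd)) set" where
  "G_full \<alpha> = {g. \<exists>\<mu>. (g, \<mu>) \<in> GSp \<and> stabilises (cim \<alpha>) g \<mu>}"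

lemma G_alpha_eq: "G_alpha \<alpha> = id_component (G_full \<alpha>)"
  by (simp add: G_alpha_def G_full_def)

lemma G_full_iff: "g \<in> G_full \<alpha> \<longleftrightarrow> invertible g \<and> multiplier g \<noteq> 0 \<and>
    transpose g ** J_mat ** g = mat (multiplier g) ** J_mat \<and> g ** cim \<alpha> ** transpose g = mat (multiplier g) ** cim \<alpha>"
  unfolding G_full_def mem_Collect_eq GSp_alt by (auto simp: GSp_iff stabilises_iff)

lemma G_fullI:
  assumes "invertible g" "\<mu> \<noteq> 0" "transpose g ** J_mat ** g = mat \<mu> ** J_mat"
    "g ** cim \<alpha> ** transpose g = mat \<mu> ** cim \<alpha>"
  shows "g \<in> G_full \<alpha>" "multiplier g = \<mu>"
  using assms multiplier_eq[OF assms(3)] by (auto simp: G_full_iff)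

lemma multiplier_1 [simp]: "multiplier (mat 1) = 1"
  by (rule multiplier_eq) simp

lemma multiplier_mult:
  assumes "g \<in> G_full \<alpha>" "h \<in> G_full \<alpha>"
  shows "g ** h \<in> G_full \<alpha>" "multiplier (g ** h) = multiplier g * multiplier h"
proof -
  have "transpose (g ** h) ** J_mat ** (g ** h) = transpose h ** (transpose g ** J_mat ** g) ** h"
    by (simp add: matrix_transpose_mul matrix_mul_assoc)
  also have "\<dots> = mat (multiplier g) ** (transpose h ** J_mat ** h)"
    using assms(1) by (simp add: G_full_iff mat_pull)
  also have "\<dots> = mat (multiplier g * multiplier h) ** J_mat"
    using assms(2) by (simp add: G_full_iff mat_times matrix_mul_assoc)
  finally have 1: "transpose (g ** h) ** J_mat ** (g ** h) = mat (multiplier g * multiplier h) ** J_mat" .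
  have "(g ** h) ** cim \<alpha> ** transpose (g ** h) = g ** (h ** cim \<alpha> ** transpose h) ** transpose g"
    by (simp add: matrix_transpose_mul matrix_mul_assoc)
  also have "\<dots> = mat (multiplier h) ** (g ** cim \<alpha> ** transpose g)"
    using assms(2) by (simp add: G_full_iff mat_pull)
  also have "\<dots> = mat (multiplier g * multiplier h) ** cim \<alpha>"
    using assms(1) by (simp add: G_full_iff mat_times[symmetric] matrix_mul_assoc mult.commute)
  finally have 2: "(g ** h) ** cim \<alpha> ** transpose (g ** h) = mat (multiplier g * multiplier h) ** cim \<alpha>" .
  show "g ** h \<in> G_full \<alpha>" "multiplier (g ** h) = multiplier g * multiplier h"
    using G_fullI[OF _ _ 1 2] assms by (auto simp: G_full_iff invertible_mult)
qed

lemma multiplier_inverse: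
  assumes "g \<in> G_full \<alpha>"
  shows "matrix_inv g \<in> G_full \<alpha>" "multiplier (matrix_inv g) = inverse (multiplier g)"
proof -
  let ?h = "matrix_inv g"
  have gh: "g ** ?h = mat 1" "?h ** g = mat 1" and m: "multiplier g \<noteq> 0"
    using assms by (auto simp: G_full_iff matrix_inv_left matrix_inv_right)
  have ght: "transpose ?h ** transpose g = mat 1" "transpose g ** transpose ?h = mat 1"
    using gh by (metis matrix_transpose_mul transpose_mat)+
  have "transpose ?h ** (transpose g ** J_mat ** g) ** ?h = J_mat"
    by (rule matrix_cancel2[OF ght(1) gh(1)])
  then have "mat (multiplier g) ** (transpose ?h ** J_mat ** ?h) = J_mat"
    using assms unfolding G_full_iff by (simp add: mat_pull)
  then have 1: "transpose ?h ** J_mat ** ?h = mat (inverse (multiplier g)) ** J_mat"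
    using m by (rule mat_div)
  have "?h ** (g ** cim \<alpha> ** transpose g) ** transpose ?h = cim \<alpha>"
    by (rule matrix_cancel2[OF gh(2) ght(2)])
  then have "mat (multiplier g) ** (?h ** cim \<alpha> ** transpose ?h) = cim \<alpha>"
    using assms unfolding G_full_iff by (simp add: mat_pull)
  then have 2: "?h ** cim \<alpha> ** transpose ?h = mat (inverse (multiplier g)) ** cim \<alpha>"
    using m by (rule mat_div)
  show "?h \<in> G_full \<alpha>" "multiplier ?h = inverse (multiplier g)"
    using G_fullI[OF _ _ 1 2] assms m by (auto simp: G_full_iff invertible_matrix_inv)
qed

lemma multiplier_map_mat: assumes "field_aut s" shows "multiplier (map_mat s g) = s (multiplier g)"
proof -
  have "transpose (map_mat s g) ** J_mat ** map_mat s g = map_mat s (transpose g ** J_mat ** g)"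
    using assms by (simp add: map_mat_mult map_mat_transpose)
  then show ?thesis by (simp add: multiplier_def map_mat_def)
qed

lemma G_full_over_Q: "alg_group_over_Q (G_full \<alpha>)"
proof (rule alg_group_over_QI)
  have mg: "mat_group (G_full \<alpha>)"
  proof (rule mat_groupI)
    show "mat 1 \<in> G_full \<alpha>" by (rule G_fullI[of _ 1]) auto
    show "invertible g" if "g \<in> G_full \<alpha>" for g using that by (simp add: G_full_iff)
  qed (intro multiplier_mult(1) multiplier_inverse(1))
  let ?Z = "{g. transpose g ** J_mat ** g = mat (multiplier g) ** J_mat \<and> g ** cim \<alpha> ** transpose g = mat (multiplier g) ** cim \<alpha>}"
  show "alg_group (G_full \<alpha>)"
  proof (rule alg_groupI[OF mg])
    show "closedin zariski ?Z"
      by (intro closedin_zariski_conj closedin_zariski_eq_map poly_map_intros)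
    \<comment> \<open>Being nonzero is not a closed condition; it is derived from the similitude
      equation and the invertibility of \<open>J_mat\<close>.\<close>
    have "multiplier g \<noteq> 0" if g: "invertible g" "transpose g ** J_mat ** g = mat (multiplier g) ** J_mat" for g :: "complex^('a + 'a)^('a + 'a)"
    proof
      assume "multiplier g = 0"
      then have 0: "transpose g ** J_mat ** g = 0" using g by (simp add: vec_eq_iff)
      have "invertible (transpose g ** J_mat ** g)"
      proof -
        have "invertible (J_mat :: complex^('a + 'a)^('a + 'a))"
        proof (rule matrix_inv_eqI(2))
          have "J_mat ** (mat (-1) ** J_mat) ** mat 1 = (mat (-1) ** (J_mat ** J_mat ** mat 1) :: complex^('a + 'a)^('a + 'a))"
            by (rule mat_pull)
          then show "J_mat ** (mat (-1) ** J_mat) = (mat 1 :: complex^('a + 'a)^('a + 'a))"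
            by (simp add: J_J mat_times[symmetric])
        qed
        then show ?thesis using g(1) by (simp add: invertible_mult invertible_transpose)
      qed
      then have "mat 1 = (0 :: complex^('a + 'a)^('a + 'a))"
        unfolding 0 by (metis matrix_inv_right matrix_vector_mult_0 matrix_eqI matrix_vector_mul_assoc)
      then have "(mat 1 :: complex^('a + 'a)^('a + 'a)) $ i $ i = 0" for i by simp
      then show False by (simp add: mat_def)
    qed
    then show "G_full \<alpha> = ?Z \<inter> {g. invertible g}" by (auto simp: G_full_iff)
  qed
  fix s :: "complex \<Rightarrow> complex" and g assume s: "field_aut s" and g: "g \<in> G_full \<alpha>"
  have eqs: "transpose g ** J_mat ** g = mat (multiplier g) ** J_mat" "g ** cim \<alpha> ** transpose g = mat (multiplier g) ** cim \<alpha>"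
    using g by (simp_all add: G_full_iff)
  have "transpose (map_mat s g) ** J_mat ** map_mat s g = map_mat s (transpose g ** J_mat ** g)"
    "map_mat s g ** cim \<alpha> ** transpose (map_mat s g) = map_mat s (g ** cim \<alpha> ** transpose g)"
    using s by (simp_all add: map_mat_mult map_mat_transpose)
  then show "map_mat s g \<in> G_full \<alpha>"
    unfolding eqs using g s by (intro G_fullI[of _ "s (multiplier g)"])
      (simp_all add: G_full_iff map_mat_matrix_inv field_aut_props map_mat_mult)
qed

lemma G_alpha_over_Q: "alg_group_over_Q (G_alpha \<alpha>)"
  unfolding G_alpha_eq by (rule alg_group_over_Q_id_component[OF G_full_over_Q])

lemmas G_alpha_group = alg_group_over_QD(2)[OF G_alpha_over_Q]

lemma G_alpha_full: "g \<in> G_alpha \<alpha> \<Longrightarrow> g \<in> G_full \<alpha>"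
  using id_component_subset unfolding G_alpha_eq by blast

lemma G_alphaD:
  assumes "g \<in> G_alpha \<alpha>"
  shows "invertible g" "multiplier g \<noteq> 0" "(g, multiplier g) \<in> GSp" "g ** cim \<alpha> ** transpose g = mat (multiplier g) ** cim \<alpha>"
  using G_alpha_full[OF assms] by (auto simp: G_full_iff GSp_iff)

lemma G_alpha_mult: "g \<in> G_alpha \<alpha> \<Longrightarrow> h \<in> G_alpha \<alpha> \<Longrightarrow> multiplier (g ** h) = multiplier g * multiplier h"
  using multiplier_mult(2) G_alpha_full by blast

section \<open>The groups \<open>P\<close>\<close>

definition levi :: "complex^('d::finite + 'd)^('d + 'd) \<Rightarrow> complex^('d ix)^('d ix)" where
  "levi g = blk (multiplier g) 0 0 g 0"

lemma poly_map_levi: "poly_map levi"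
  unfolding levi_def by (intro poly_map_blk polyfuns_multiplier poly_intros)

lemma ix_cases: "\<exists>k. i = top_ix \<or> i = mid_ix k \<or> i = bot_ix" for i :: "'a ix"
proof (cases i)
  case (Inr k) then show ?thesis by (cases k) auto
qed simp

lemma continuous_on_vecI:
  fixes f :: "'a::topological_space \<Rightarrow> 'b::topological_space^'n"
  assumes "\<And>i. continuous_on S (\<lambda>t. f t $ i)" shows "continuous_on S f"
  using continuous_on_vec_lambda[of S "\<lambda>i t. f t $ i"] assms by simp

text \<open>The weight 2 of z is the one compatible with \<open>P_tilde\<close>, where y is linear
  and z quadratic in x.\<close>

lemma continuous_on_segment:
  "continuous_on S (\<lambda>t :: complex. blk m (t *s x) (t ^ 2 * z) g (t *s y))"
proof (intro continuous_on_vecI)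
  fix i j
  show "continuous_on S (\<lambda>t. blk m (t *s x) (t ^ 2 * z) g (t *s y) $ i $ j)"
    using ix_cases[of i] ix_cases[of j] by (auto simp: blk_def) (intro continuous_intros)+
qed

lemma connectedin_segment_zariski:
  "connectedin zariski ((\<lambda>t. blk m (t *s x) (t ^ 2 * z) g (t *s y)) ` UNIV)"
  by (rule connectedin_zariski, rule connected_continuous_image[OF continuous_on_segment], rule connected_UNIV)

lemma continuous_on_poly_map: "poly_map f \<Longrightarrow> continuous_on S f"
  using continuous_polyfuns continuous_on_subset unfolding poly_map_def
  by (intro continuous_on_vecI) blast

lemma poly_map_g_of: "poly_map g_of"
  unfolding g_of_def poly_map_def by (auto intro: polyfuns.intros)

text \<open>Subgroups of \<open>P\<close> over \<open>G_alpha\<close> which contain its Levi lift and are stable under the scaling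
  which contracts their unipotent part. This covers both \<open>P_alpha\<close> and \<open>P_tilde\<close>.\<close>

locale p_group =
  fixes \<alpha> :: "int^('d::finite + 'd)^('d + 'd)" and G :: "(complex^('d ix)^('d ix)) set"
  assumes G_Q: "alg_group_over_Q G"
    and G_cases: "A \<in> G \<Longrightarrow> \<exists>x z g y. A = blk (multiplier g) x z g y \<and> g \<in> G_alpha \<alpha>"
    and levi_G: "g \<in> G_alpha \<alpha> \<Longrightarrow> levi g \<in> G"
    and scale_G: "blk m x z g y \<in> G \<Longrightarrow> blk m (t *s x) (t ^ 2 * z) g (t *s y) \<in> G"
begin

lemmas G_group = alg_group_over_QD(2)[OF G_Q]

lemma g_of_G: "A \<in> G \<Longrightarrow> g_of A \<in> G_alpha \<alpha>"
  and mu_of_G: "A \<in> G \<Longrightarrow> mu_of A = multiplier (g_of A)"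
  using G_cases by force+

lemma G_ne: "mat 1 \<in> G" by (rule mat_group_closed(1)[OF G_group])

lemma connected_G: "connectedin zariski G"
proof -
  let ?L = "levi ` G_alpha \<alpha>"
  have L: "connectedin zariski ?L"
    unfolding G_alpha_eq
    by (rule connectedin_continuous_map_image[OF continuous_map_poly_map[OF poly_map_levi] connectedin_id_component])
  have 1: "mat 1 \<in> ?L"
    using mat_group_closed(1)[OF G_alpha_group[of \<alpha>]] by (force simp: levi_def blk_1)
  \<comment> \<open>S A joins A to its Levi part by the contraction and adds the connected Levi
    subgroup; all these sets contain 1, and together they exhaust G.\<close>
  define S where "S A = ?L \<union> (case A of A \<Rightarrow> (\<lambda>t. blk (mu_of A) (t *s (\<chi> k. A $ top_ix $ mid_ix k))
     (t ^ 2 * A $ top_ix $ bot_ix) (g_of A) (t *s (\<chi> k. A $ mid_ix k $ bot_ix))) ` UNIV)" for A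
  have SA: "connectedin zariski (S A) \<and> mat 1 \<in> S A \<and> A \<in> S A \<and> S A \<subseteq> G" if A: "A \<in> G" for A
  proof -
    obtain x z g y where Ab: "A = blk (multiplier g) x z g y" "g \<in> G_alpha \<alpha>" using G_cases[OF A] by blast
    let ?C = "(\<lambda>t. blk (multiplier g) (t *s x) (t ^ 2 * z) g (t *s y)) ` UNIV"
    have S: "S A = ?L \<union> ?C" unfolding S_def Ab(1) by (simp, simp add: blk_def)
    have "levi g \<in> ?L \<inter> ?C" using Ab(2) by (force simp: levi_def intro: image_eqI[of _ _ 0])
    then have "connectedin zariski (?L \<union> ?C)"
      by (intro connectedin_Un L connectedin_segment_zariski) blast
    moreover have "A \<in> ?C" by (auto simp: Ab intro: image_eqI[of _ _ 1])
    moreover have "?C \<subseteq> G" using scale_G A Ab by blast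
    ultimately show ?thesis using 1 levi_G unfolding S by blast
  qed
  have "connectedin zariski (\<Union>(S ` G))"
    by (rule connectedin_Union) (use SA G_ne in auto)
  moreover have "\<Union>(S ` G) = G" using SA by blast
  ultimately show ?thesis by simp
qed

end

lemma cnj_mat_real: "(\<forall>i j. A $ i $ j \<in> \<real>) \<longleftrightarrow> map_mat cnj A = A"
  by (simp add: Reals_cnj_iff map_mat_def vec_eq_iff)

lemma cnj_vec_real: "(\<forall>i. x $ i \<in> \<real>) \<longleftrightarrow> map_vec cnj x = x"
  by (simp add: Reals_cnj_iff map_vec_def vec_eq_iff)

lemma pts_real:
  assumes "mat_group G" shows "pts \<real> G = {A \<in> G. map_mat cnj A = A}"
  unfolding pts_def cnj_mat_real
  using map_mat_matrix_inv(2)[OF field_aut_cnj mat_group_closed(4)[OF assms]] by metis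

context p_group
begin

text \<open>Contracting with real parameters joins a real matrix to its Levi part within the real
  points, so the unipotent part never disconnects them and only the component of
  \<open>g_of A\<close> matters.\<close>

lemma real_plus_G:
  "real_plus G = {A \<in> G. map_mat cnj A = A \<and> g_of A \<in> real_plus (G_alpha \<alpha>)}"
proof -
  let ?R = "pts \<real> (G_alpha \<alpha>)" and ?RG = "pts \<real> G"
  have R: "?R = {g \<in> G_alpha \<alpha>. map_mat cnj g = g}" by (rule pts_real[OF G_alpha_group])
  have RG: "?RG = {A \<in> G. map_mat cnj A = A}" by (rule pts_real[OF G_group])
  show ?thesis
  proof (intro subset_antisym subsetI)
    fix A assume A: "A \<in> real_plus G"
    let ?C = "g_of ` real_plus G"
    have "connected (real_plus G)" unfolding real_plus_def by (rule connected_connected_component)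
    then have "connected ?C"
      by (rule connected_continuous_image[OF continuous_on_poly_map[OF poly_map_g_of]])
    moreover have sub: "real_plus G \<subseteq> ?RG" unfolding real_plus_def by (rule connected_component_subset)
    then have "?C \<subseteq> ?R" unfolding R RG using g_of_G by (auto simp: g_of_def map_mat_def vec_eq_iff)
    moreover have "mat 1 \<in> real_plus G"
      using G_ne unfolding real_plus_def RG by (simp add: field_aut_cnj)
    then have "mat 1 \<in> ?C" by (force simp: blk_1 intro: image_eqI[of _ _ "mat 1"])
    ultimately have "?C \<subseteq> real_plus (G_alpha \<alpha>)"
      unfolding real_plus_def by (intro connected_component_maximal)
    then show "A \<in> {A \<in> G. map_mat cnj A = A \<and> g_of A \<in> real_plus (G_alpha \<alpha>)}"
      using A sub unfolding RG by blast
  next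
    fix A assume A: "A \<in> {A \<in> G. map_mat cnj A = A \<and> g_of A \<in> real_plus (G_alpha \<alpha>)}"
    then obtain x z g y where Ab: "A = blk (multiplier g) x z g y" "g \<in> G_alpha \<alpha>" using G_cases by blast
    have real: "map_vec cnj x = x" "map_vec cnj y = y" "cnj z = z" "map_mat cnj g = g"
      using A unfolding Ab by auto
    let ?L = "levi ` real_plus (G_alpha \<alpha>)"
    let ?\<gamma> = "\<lambda>t :: complex. blk (multiplier g) (t *s x) (t ^ 2 * z) g (t *s y)"
    have "connected (real_plus (G_alpha \<alpha>))" unfolding real_plus_def by (rule connected_connected_component)
    then have cL: "connected ?L"
      by (rule connected_continuous_image[OF continuous_on_poly_map[OF poly_map_levi]])
    have cC: "connected ((?\<gamma> \<circ> of_real) ` UNIV)"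
      by (intro connected_continuous_image continuous_on_compose continuous_intros) (auto intro: continuous_on_segment)
    have g: "g \<in> real_plus (G_alpha \<alpha>)" using A Ab by simp
    have "levi g \<in> ?L \<inter> (?\<gamma> \<circ> of_real) ` UNIV"
      using g by (auto simp: levi_def intro!: image_eqI[of _ _ 0])
    then have "connected (?L \<union> (?\<gamma> \<circ> of_real) ` UNIV)"
      by (intro connected_Un cL cC) blast
    moreover have "real_plus (G_alpha \<alpha>) \<subseteq> ?R" unfolding real_plus_def by (rule connected_component_subset)
    then have "?L \<subseteq> ?RG"
      unfolding R RG using levi_G by (auto simp: levi_def multiplier_map_mat[OF field_aut_cnj, symmetric] map_vec_linear field_aut_cnj)
    moreover have "(?\<gamma> \<circ> of_real) ` UNIV \<subseteq> ?RG"
      unfolding RG using A scale_G real unfolding Ab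
      by (auto simp: multiplier_map_mat[OF field_aut_cnj, symmetric] map_vec_linear field_aut_cnj)
    moreover have "mat 1 \<in> real_plus (G_alpha \<alpha>)"
      using mat_group_closed(1)[OF G_alpha_group] unfolding real_plus_def R by (simp add: field_aut_cnj)
    then have "mat 1 \<in> ?L" by (force simp: levi_def blk_1)
    ultimately have "?L \<union> (?\<gamma> \<circ> of_real) ` UNIV \<subseteq> real_plus G"
      unfolding real_plus_def by (intro connected_component_maximal) auto
    moreover have "A \<in> (?\<gamma> \<circ> of_real) ` UNIV" by (auto simp: Ab intro!: image_eqI[of _ _ 1])
    ultimately show "A \<in> real_plus G" by blast
  qed
qed

end

section \<open>The stabiliser of \<alpha> in P and its identity component\<close>

lemma blk_invertibleD:
  assumes "invertible (blk m x z g y)" shows "m \<noteq> 0" "invertible g"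
proof -
  obtain B where B: "B ** blk m x z g y = mat 1" using assms matrix_inv_left by blast
  have inj: "v = 0" if "blk m x z g y *v v = 0" for v
    using arg_cong[OF that, of "\<lambda>w. B *v w"] by (simp add: matrix_vector_mul_assoc B)
  show m: "m \<noteq> 0" using inj[of "vec3 1 0 0"] by auto
  have "b = 0" if "g *v b = 0" for b
    using inj[of "vec3 (- (bdot x b / m)) b 0"] m that by simp
  then show "invertible g"
    using matrix_left_invertible_ker[of g] matrix_inv_eqI(2) matrix_left_right_inverse by metis
qed

definition x_of :: "complex^('d::finite ix)^('d ix) \<Rightarrow> complex^('d + 'd)" where
  "x_of p = (\<chi> k. p $ top_ix $ mid_ix k)"
definition y_of :: "complex^('d::finite ix)^('d ix) \<Rightarrow> complex^('d + 'd)" where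
  "y_of p = (\<chi> k. p $ mid_ix k $ bot_ix)"
definition z_of :: "complex^('d::finite ix)^('d ix) \<Rightarrow> complex" where
  "z_of p = p $ top_ix $ bot_ix"

lemma of_blk [simp]: "x_of (blk m x z g y) = x" "y_of (blk m x z g y) = y" "z_of (blk m x z g y) = z"
  by (simp_all add: x_of_def y_of_def z_of_def blk_def vec_eq_iff)

lemma poly_map_of: "mu_of \<in> polyfuns" "z_of \<in> polyfuns" "poly_vec x_of" "poly_vec y_of"
  unfolding mu_of_def z_of_def x_of_def y_of_def poly_vec_def by (auto intro: polyfuns.intros)

lemmas poly_map_of_intros = poly_map_intros poly_map_of poly_map_g_of

lemma closedin_blk_shape:
  "closedin zariski {p. p = blk (mu_of p) (x_of p) (z_of p) (g_of p) (y_of p)}"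
  by (intro closedin_zariski_eq_map poly_map_id poly_map_blk poly_map_of poly_map_g_of)

lemma cim_mv_civ: "cim A *v civ n = civ (A *v n)"
  by (simp add: vec_eq_iff cim_def civ_def matrix_vector_mult_def)

definition P_full :: "int^('d::finite + 'd)^('d + 'd) \<Rightarrow> (complex^('d ix)^('d ix)) set" where
  "P_full \<alpha> = {p \<in> P_grp. stabilises (cim \<alpha>) (g_of p) (mu_of p)}"

lemma P_alpha_eq_component: "P_alpha \<alpha> = id_component (P_full \<alpha>)"
  by (simp add: P_alpha_def P_full_def)

lemma P_full_eq: "P_full \<alpha> = {blk (multiplier g) x z g y |x z g y. g \<in> G_full \<alpha>}"
  unfolding P_full_def P_grp_def G_full_def using GSp_multiplier_eq by fastforce

lemma blk_family_group:
  assumes "mat_group H" and "\<And>g h. g \<in> H \<Longrightarrow> h \<in> H \<Longrightarrow> multiplier (g ** h) = multiplier g * multiplier h"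
    and ne: "\<And>g. g \<in> H \<Longrightarrow> multiplier g \<noteq> 0"
  shows "mat_group {blk (multiplier g) x z g y |x z g y. g \<in> H}"
proof (rule mat_groupI)
  note H = mat_group_closed[OF assms(1)]
  show "mat 1 \<in> {blk (multiplier g) x z g y |x z g y. g \<in> H}"
    using H(1) by (force simp: blk_1)
  show "invertible A" if "A \<in> {blk (multiplier g) x z g y |x z g y. g \<in> H}" for A
    using that H(4) ne by (auto intro: blk_inv)
  fix A B assume "A \<in> {blk (multiplier g) x z g y |x z g y. g \<in> H}" "B \<in> {blk (multiplier g) x z g y |x z g y. g \<in> H}"
  then obtain x z g y x' z' g' y' where A: "A = blk (multiplier g) x z g y" "g \<in> H"
    and B: "B = blk (multiplier g') x' z' g' y'" "g' \<in> H" by blast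
  have "multiplier (matrix_inv g ** g') = inverse (multiplier g) * multiplier g'"
  proof -
    have "multiplier (g ** matrix_inv g) = multiplier g * multiplier (matrix_inv g)" using assms(2) A(2) H(3) by blast
    then have "multiplier g * multiplier (matrix_inv g) = 1" using H(4)[OF A(2)] by (simp add: matrix_inv_right)
    then have "multiplier (matrix_inv g) = inverse (multiplier g)" by (metis inverse_unique)
    then show ?thesis using assms(2)[OF H(3)[OF A(2)] B(2)] by simp
  qed
  moreover have "matrix_inv g ** g' \<in> H" using H(2,3) A(2) B(2) by blast
  ultimately show "matrix_inv A ** B \<in> {blk (multiplier g) x z g y |x z g y. g \<in> H}"
    unfolding A(1) B(1) blk_inv(2)[OF ne[OF A(2)] H(4)[OF A(2)]] blk_mult by (metis (mono_tags, lifting) mem_Collect_eq)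
qed

lemma P_full_over_Q: "alg_group_over_Q (P_full \<alpha>)"
proof (rule alg_group_over_QI)
  let ?Z = "{p. p = blk (mu_of p) (x_of p) (z_of p) (g_of p) (y_of p) \<and>
     transpose (g_of p) ** J_mat ** g_of p = mat (mu_of p) ** J_mat \<and>
     g_of p ** cim \<alpha> ** transpose (g_of p) = mat (mu_of p) ** cim \<alpha>}"
  show "alg_group (P_full \<alpha>)"
  proof (rule alg_groupI)
    show "mat_group (P_full \<alpha>)" unfolding P_full_eq
      by (rule blk_family_group[OF alg_group_over_QD(2)[OF G_full_over_Q]])
         (use multiplier_mult G_full_iff in blast)+
    show "closedin zariski ?Z"
      by (intro closedin_zariski_conj closedin_blk_shape closedin_zariski_eq_map poly_map_of_intros)
    show "P_full \<alpha> = ?Z \<inter> {p. invertible p}"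
    proof (intro subset_antisym subsetI)
      fix p assume "p \<in> ?Z \<inter> {p. invertible p}"
      then have p: "p = blk (mu_of p) (x_of p) (z_of p) (g_of p) (y_of p)" "invertible p"
        "transpose (g_of p) ** J_mat ** g_of p = mat (mu_of p) ** J_mat"
        "g_of p ** cim \<alpha> ** transpose (g_of p) = mat (mu_of p) ** cim \<alpha>" by auto
      have "mu_of p \<noteq> 0" "invertible (g_of p)"
        using blk_invertibleD p(2) unfolding p(1)[symmetric] by (metis p(1))+
      then have "g_of p \<in> G_full \<alpha>" "multiplier (g_of p) = mu_of p" using G_fullI p(3,4) by blast+
      then show "p \<in> P_full \<alpha>" unfolding P_full_eq using p(1) by (metis (mono_tags, lifting) mem_Collect_eq)
    next
      fix p assume "p \<in> P_full \<alpha>"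
      then obtain x z g y where p: "p = blk (multiplier g) x z g y" "g \<in> G_full \<alpha>" unfolding P_full_eq by blast
      then show "p \<in> ?Z \<inter> {p. invertible p}" by (auto simp: G_full_iff intro: blk_inv)
    qed
  qed
  fix s :: "complex \<Rightarrow> complex" and p assume s: "field_aut s" and "p \<in> P_full \<alpha>"
  then obtain x z g y where p: "p = blk (multiplier g) x z g y" "g \<in> G_full \<alpha>" unfolding P_full_eq by blast
  have "map_mat s p = blk (multiplier (map_mat s g)) (map_vec s x) (s z) (map_mat s g) (map_vec s y)"
    unfolding p by (simp add: multiplier_map_mat[OF s] field_aut_props[OF s])
  moreover have "map_mat s g \<in> G_full \<alpha>" using alg_group_over_QD(3)[OF G_full_over_Q s p(2)] .
  ultimately show "map_mat s p \<in> P_full \<alpha>" unfolding P_full_eq by blast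
qed

text \<open>The fibres over \<open>G_full\<close> are affine spaces, contracted by the scaling, so
  the identity component is the full inverse image of that of \<open>G_full\<close>.\<close>

lemma P_alpha_eq: "P_alpha \<alpha> = {blk (multiplier g) x z g y |x z g y. g \<in> G_alpha \<alpha>}"
proof (intro subset_antisym subsetI)
  fix p assume p: "p \<in> P_alpha \<alpha>"
  have full: "P_alpha \<alpha> \<subseteq> P_full \<alpha>" unfolding P_alpha_eq_component by (rule id_component_subset)
  have "connectedin zariski (g_of ` P_alpha \<alpha>)"
    unfolding P_alpha_eq_component
    by (rule connectedin_continuous_map_image[OF continuous_map_poly_map[OF poly_map_g_of] connectedin_id_component])
  moreover have "g_of ` P_alpha \<alpha> \<subseteq> G_full \<alpha>" using full unfolding P_full_eq by auto
  moreover have "mat 1 \<in> P_alpha \<alpha>"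
    using one_in_id_component mat_group_closed(1)[OF alg_group_over_QD(2)[OF P_full_over_Q]]
    unfolding P_alpha_eq_component by blast
  then have "mat 1 \<in> g_of ` P_alpha \<alpha>" by (force simp: blk_1 intro: image_eqI[of _ _ "mat 1"])
  ultimately have "g_of ` P_alpha \<alpha> \<subseteq> G_alpha \<alpha>" unfolding G_alpha_eq by (rule id_component_maximal)
  then have "g_of p \<in> G_alpha \<alpha>" using p by blast
  moreover obtain x z g y where "p = blk (multiplier g) x z g y" using full p unfolding P_full_eq by blast
  ultimately show "p \<in> {blk (multiplier g) x z g y |x z g y. g \<in> G_alpha \<alpha>}" by auto
next
  fix p assume "p \<in> {blk (multiplier g) x z g y |x z g y. g \<in> G_alpha \<alpha>}"
  then obtain x z g y where p: "p = blk (multiplier g) x z g y" "g \<in> G_alpha \<alpha>" by blast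
  let ?L = "levi ` G_alpha \<alpha>"
  let ?C = "(\<lambda>t. blk (multiplier g) (t *s x) (t ^ 2 * z) g (t *s y)) ` UNIV"
  have L: "connectedin zariski ?L"
    unfolding G_alpha_eq
    by (rule connectedin_continuous_map_image[OF continuous_map_poly_map[OF poly_map_levi] connectedin_id_component])
  have 1: "mat 1 \<in> ?L"
    using mat_group_closed(1)[OF G_alpha_group[of \<alpha>]] by (force simp: levi_def blk_1)
  have "levi g \<in> ?L \<inter> ?C" using p(2) by (force simp: levi_def intro: image_eqI[of _ _ 0])
  then have "connectedin zariski (?L \<union> ?C)"
    by (intro connectedin_Un L connectedin_segment_zariski) blast
  moreover have "?L \<union> ?C \<subseteq> P_full \<alpha>"
    unfolding P_full_eq levi_def using G_alpha_full p(2) by blast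
  ultimately have "?L \<union> ?C \<subseteq> P_alpha \<alpha>" unfolding P_alpha_eq_component using 1 by (intro id_component_maximal) auto
  moreover have "p \<in> ?C" by (auto simp: p intro: image_eqI[of _ _ 1])
  ultimately show "p \<in> P_alpha \<alpha>" by blast
qed

lemma p_group_P_alpha: "p_group \<alpha> (P_alpha \<alpha>)"
proof
  show "alg_group_over_Q (P_alpha \<alpha>)"
    unfolding P_alpha_eq_component by (rule alg_group_over_Q_id_component[OF P_full_over_Q])
qed (auto simp: P_alpha_eq levi_def)

lemma u_part_P_alpha: "u_part (P_alpha \<alpha>) = {blk 1 x z (mat 1) y |x z y. True}"
  using mat_group_closed(1)[OF G_alpha_group[of \<alpha>]] unfolding u_part_def P_alpha_eq by fastforce

lemma u_part_P_grp: "u_part P_grp = {blk 1 x z (mat 1) y |x z y. True}"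
proof -
  have "(mat 1, 1) \<in> GSp" by (simp add: GSp_iff)
  then show ?thesis unfolding u_part_def P_grp_def by fastforce
qed

section \<open>The group \<open>P_tilde\<close>\<close>

definition tilde_blk :: "int^('d::finite + 'd)^('d + 'd) \<Rightarrow> int^('d + 'd)^('d + 'd) \<Rightarrow> complex^('d + 'd) \<Rightarrow>
    complex^('d + 'd)^('d + 'd) \<Rightarrow> complex^('d ix)^('d ix)" where
  "tilde_blk f \<alpha> x g = blk (multiplier g) x (inverse (multiplier g) * bdot x (cim f *v x)) g
     (inverse (multiplier g) *s (g *v (cim \<alpha> *v x)))"

lemma P_tilde_eq: "P_tilde f \<alpha> = {tilde_blk f \<alpha> x g |x g. g \<in> G_alpha \<alpha>}"
  unfolding P_tilde_def tilde_blk_def using GSp_multiplier_eq G_alphaD(3) by (smt (verit) Collect_cong)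

locale symm_pair =
  fixes f \<alpha> :: "int^('d::finite + 'd)^('d + 'd)"
  assumes \<alpha>_f: "\<alpha> = f + transpose f"
begin

lemma cim_\<alpha>: "cim \<alpha> *v x = cim f *v x + x v* cim f"
proof -
  have "cim \<alpha> = cim f + transpose (cim f)"
    by (simp add: \<alpha>_f cim_def transpose_def vec_eq_iff)
  then have "cim \<alpha> *v x = cim f *v x + transpose (cim f) *v x"
    by (simp only: matrix_vector_mult_add_rdistrib)
  then show ?thesis by simp
qed

lemma \<alpha>_sym: "x v* cim \<alpha> = cim \<alpha> *v x"
proof -
  have "transpose (cim \<alpha>) = cim \<alpha>" by (simp add: \<alpha>_f cim_def transpose_def vec_eq_iff)
  then show ?thesis by (metis transpose_matrix_vector)
qed

lemma bdot_\<alpha>: "bdot x (cim \<alpha> *v x) = 2 * bdot x (cim f *v x)"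
  by (simp add: cim_\<alpha> bdot_distribs bdot_matrix[of x "cim f"]) (simp add: bdot_commute)

lemma tilde_blk_mult:
  assumes g: "g \<in> G_alpha \<alpha>" and h: "h \<in> G_alpha \<alpha>"
  shows "tilde_blk f \<alpha> x g ** tilde_blk f \<alpha> x' h = tilde_blk f \<alpha> (multiplier g *s x' + x v* h) (g ** h)"
proof -
  have ne: "multiplier g \<noteq> 0" "multiplier h \<noteq> 0" using G_alphaD(2) g h by blast+
  have h\<alpha>: "h *v (cim \<alpha> *v (x v* h)) = multiplier h *s (cim \<alpha> *v x)"
    using arg_cong[OF G_alphaD(4)[OF h], of "\<lambda>M. M *v x"] by (simp add: matrix_vector_mul_assoc[symmetric])
  \<comment> \<open>Invariance under h is known for \<alpha> only; it is transferred to the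
    quadratic form of f by dividing by 2.\<close>
  have q: "bdot (x v* h) (cim f *v (x v* h)) = multiplier h * bdot x (cim f *v x)"
  proof -
    have "2 * bdot (x v* h) (cim f *v (x v* h)) = bdot x (h *v (cim \<alpha> *v (x v* h)))"
      by (simp add: bdot_\<alpha>[symmetric] bdot_matrix[of x h])
    then show ?thesis by (simp add: h\<alpha> bdot_\<alpha>)
  qed
  \<comment> \<open>The mixed terms of the quadratic form of f at a sum; they have to match the term
    \<open>bdot x y'\<close> of the block product.\<close>
  have c: "bdot x' (cim f *v (x v* h)) + bdot (x v* h) (cim f *v x') = bdot x (h *v (cim \<alpha> *v x'))"
    by (simp add: cim_\<alpha> bdot_matrix[of x h] bdot_distribs bdot_matrix[of x' "cim f"] bdot_commute[of _ "x v* h"])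
  have "multiplier g * (inverse (multiplier h) * bdot x' (cim f *v x')) + inverse (multiplier h) * bdot x (h *v (cim \<alpha> *v x')) +
      inverse (multiplier g) * bdot x (cim f *v x) =
    inverse (multiplier g * multiplier h) * bdot (multiplier g *s x' + x v* h) (cim f *v (multiplier g *s x' + x v* h))"
    using ne by (simp add: matrix_vector_right_distrib bdot_distribs q c[symmetric] field_simps)
  moreover have "g *v (inverse (multiplier h) *s (h *v (cim \<alpha> *v x'))) + inverse (multiplier g) *s (g *v (cim \<alpha> *v x)) =
    inverse (multiplier g * multiplier h) *s (g ** h *v (cim \<alpha> *v (multiplier g *s x' + x v* h)))"
  proof -
    have "inverse (multiplier g * multiplier h) * multiplier g = inverse (multiplier h)" "inverse (multiplier g * multiplier h) * multiplier h = inverse (multiplier g)"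
      using ne by (simp_all add: field_simps)
    then show ?thesis
      by (simp add: matrix_vector_right_distrib matrix_vector_mul_assoc[symmetric] h\<alpha>
          vec.scale_right_distrib del: inverse_mult_distrib)
  qed
  ultimately show ?thesis
    unfolding tilde_blk_def blk_mult G_alpha_mult[OF g h] by simp
qed

lemma tilde_blk_1: "tilde_blk f \<alpha> 0 (mat 1) = mat 1"
  by (simp add: tilde_blk_def blk_1)

lemma p_group_P_tilde: "p_group \<alpha> (P_tilde f \<alpha>)"
proof
  have mg: "mat_group (P_tilde f \<alpha>)"
  proof (rule mat_groupI)
    note grp = mat_group_closed[OF G_alpha_group[of \<alpha>]]
    show "mat 1 \<in> P_tilde f \<alpha>" unfolding P_tilde_eq
      by (intro CollectI exI[of _ 0] exI[of _ "mat 1"]) (simp add: grp(1) tilde_blk_1)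
    show inv: "invertible A" if "A \<in> P_tilde f \<alpha>" for A
      using that blk_inv(1)[OF G_alphaD(2,1)] unfolding P_tilde_eq tilde_blk_def by blast
    fix A B assume "A \<in> P_tilde f \<alpha>" "B \<in> P_tilde f \<alpha>"
    then obtain x g x' h where A: "A = tilde_blk f \<alpha> x g" "g \<in> G_alpha \<alpha>" and B: "B = tilde_blk f \<alpha> x' h" "h \<in> G_alpha \<alpha>"
      unfolding P_tilde_eq by blast
    have "A ** tilde_blk f \<alpha> (- (inverse (multiplier g) *s (x v* matrix_inv g))) (matrix_inv g) = mat 1"
      unfolding A(1) tilde_blk_mult[OF A(2) grp(3)[OF A(2)]] using G_alphaD(1,2)[OF A(2)]
      by (simp add: matrix_inv_right tilde_blk_1)
    then have "matrix_inv A = tilde_blk f \<alpha> (- (inverse (multiplier g) *s (x v* matrix_inv g))) (matrix_inv g)"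
      by (rule matrix_inv_eqI)
    then show "matrix_inv A ** B \<in> P_tilde f \<alpha>"
      unfolding B(1) using tilde_blk_mult[OF grp(3)[OF A(2)] B(2)] grp(2)[OF grp(3)[OF A(2)] B(2)]
      unfolding P_tilde_eq by force
  qed
  obtain Z0 where Z0: "closedin zariski Z0" "G_alpha \<alpha> = Z0 \<inter> {g. invertible g}"
    using alg_group_over_QD(1)[OF G_alpha_over_Q[of \<alpha>]] unfolding alg_group_def by blast
  \<comment> \<open>The relations for z and y are multiplied by the multiplier, which makes them
    polynomial; on invertible matrices they are equivalent to the original ones.\<close>
  let ?Z = "{p. p = blk (mu_of p) (x_of p) (z_of p) (g_of p) (y_of p) \<and> g_of p \<in> Z0 \<and>
     transpose (g_of p) ** J_mat ** g_of p = mat (mu_of p) ** J_mat \<and>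
     mu_of p * z_of p = bdot (x_of p) (cim f *v x_of p) \<and> mu_of p *s y_of p = g_of p *v (cim \<alpha> *v x_of p)}"
  have ag: "alg_group (P_tilde f \<alpha>)"
  proof (rule alg_groupI[OF mg])
    have "closedin zariski {p. g_of p \<in> Z0}"
      using closedin_continuous_map_preimage[OF continuous_map_poly_map[OF poly_map_g_of] Z0(1)] by simp
    then show "closedin zariski ?Z"
      by (intro closedin_zariski_conj closedin_blk_shape closedin_zariski_eq_map closedin_zariski_eq
        closedin_zariski_eq_vec poly_map_of_intros polyfuns.mult)
    show "P_tilde f \<alpha> = ?Z \<inter> {p. invertible p}"
    proof (intro subset_antisym subsetI)
      fix p assume "p \<in> ?Z \<inter> {p. invertible p}"
      then have p: "p = blk (mu_of p) (x_of p) (z_of p) (g_of p) (y_of p)" "invertible p" "g_of p \<in> Z0"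
        "transpose (g_of p) ** J_mat ** g_of p = mat (mu_of p) ** J_mat"
        "mu_of p * z_of p = bdot (x_of p) (cim f *v x_of p)" "mu_of p *s y_of p = g_of p *v (cim \<alpha> *v x_of p)"
        by auto
      have ne: "mu_of p \<noteq> 0" "invertible (g_of p)"
        using blk_invertibleD p(2) by (metis p(1))+
      then have "g_of p \<in> G_alpha \<alpha>" "multiplier (g_of p) = mu_of p" using Z0 p multiplier_eq by auto
      moreover have "z_of p = inverse (mu_of p) * bdot (x_of p) (cim f *v x_of p)"
        using p(5) ne by (simp add: field_simps)
      moreover have "y_of p = inverse (mu_of p) *s (g_of p *v (cim \<alpha> *v x_of p))"
        using ne by (simp add: p(6)[symmetric])
      ultimately show "p \<in> P_tilde f \<alpha>" unfolding P_tilde_eq tilde_blk_def using p(1) by (metis (mono_tags, lifting) mem_Collect_eq)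
    next
      fix p assume "p \<in> P_tilde f \<alpha>"
      then obtain x g where p: "p = tilde_blk f \<alpha> x g" "g \<in> G_alpha \<alpha>" unfolding P_tilde_eq by blast
      have "transpose g ** J_mat ** g = mat (multiplier g) ** J_mat" using G_alphaD(3)[OF p(2)] GSp_iff by blast
      then show "p \<in> ?Z \<inter> {p. invertible p}"
        using p G_alphaD(1,2)[OF p(2)] Z0(2) by (auto simp: tilde_blk_def intro: blk_inv)
    qed
  qed
  show "alg_group_over_Q (P_tilde f \<alpha>)"
  proof (rule alg_group_over_QI[OF ag])
    fix s :: "complex \<Rightarrow> complex" and p assume s: "field_aut s" and "p \<in> P_tilde f \<alpha>"
    then obtain x g where p: "p = tilde_blk f \<alpha> x g" "g \<in> G_alpha \<alpha>" unfolding P_tilde_eq by blast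
    have "map_mat s p = tilde_blk f \<alpha> (map_vec s x) (map_mat s g)"
      unfolding p tilde_blk_def using s
      by (simp add: multiplier_map_mat field_aut_props map_vec_linear map_vec_mv)
    then show "map_mat s p \<in> P_tilde f \<alpha>"
      unfolding P_tilde_eq using alg_group_over_QD(3)[OF G_alpha_over_Q s p(2)] by blast
  qed
  show "\<exists>x z g y. A = blk (multiplier g) x z g y \<and> g \<in> G_alpha \<alpha>" if "A \<in> P_tilde f \<alpha>" for A
    using that unfolding P_tilde_eq tilde_blk_def by blast
  show "levi g \<in> P_tilde f \<alpha>" if "g \<in> G_alpha \<alpha>" for g
    using that unfolding P_tilde_eq levi_def tilde_blk_def by force
  show "blk m (t *s x) (t ^ 2 * z) g (t *s y) \<in> P_tilde f \<alpha>" if "blk m x z g y \<in> P_tilde f \<alpha>" for m x z g y t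
  proof -
    have "blk m (t *s x) (t ^ 2 * z) g (t *s y) = tilde_blk f \<alpha> (t *s x) g" "g \<in> G_alpha \<alpha>"
      using that unfolding P_tilde_eq tilde_blk_def by (auto simp: power2_eq_square mult_ac)
    then show ?thesis unfolding P_tilde_eq by blast
  qed
qed

lemma u_part_P_tilde:
  "u_part (P_tilde f \<alpha>) = {blk 1 x (bdot x (cim f *v x)) (mat 1) (cim \<alpha> *v x) |x. True}"
  using mat_group_closed(1)[OF G_alpha_group[of \<alpha>]] unfolding u_part_def P_tilde_eq tilde_blk_def by fastforce

lemma P_tilde_subset: "P_tilde f \<alpha> \<subseteq> P_alpha \<alpha>"
  unfolding P_tilde_eq P_alpha_eq tilde_blk_def by blast

end

section \<open>Integral points of the unipotent part\<close>

lemma int_vec_civ: "(\<forall>k. x $ k \<in> \<int>) \<longleftrightarrow> (\<exists>n. x = civ n)"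
proof
  assume "\<forall>k. x $ k \<in> \<int>"
  then have "\<forall>k. \<exists>m. x $ k = of_int m" by (auto elim: Ints_cases)
  then obtain n where "\<forall>k. x $ k = of_int (n k)" by metis
  then show "\<exists>n. x = civ n" by (intro exI[of _ "\<chi> k. n k"]) (simp add: civ_def vec_eq_iff)
qed (auto simp: civ_def)

lemma bdot_civ: "\<exists>k::int. bdot (civ m) (civ n) = of_int k"
  by (intro exI[of _ "\<Sum>i\<in>UNIV. m $ i * n $ i"]) (simp add: bdot_def civ_def)

lemma unipotent_blk_int:
  "(\<forall>i j. blk 1 x z (mat 1) y $ i $ j \<in> \<int>) \<and> (\<forall>i j. matrix_inv (blk 1 x z (mat 1) y) $ i $ j \<in> \<int>) \<longleftrightarrow>
   (\<exists>m k n. x = civ m \<and> z = of_int k \<and> y = civ n)"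
proof
  assume "(\<forall>i j. blk 1 x z (mat 1) y $ i $ j \<in> \<int>) \<and> (\<forall>i j. matrix_inv (blk 1 x z (mat 1) y) $ i $ j \<in> \<int>)"
  then have "\<forall>k. x $ k \<in> \<int>" "\<forall>k. y $ k \<in> \<int>" "z \<in> \<int>" unfolding blk_entries by auto
  then show "\<exists>m k n. x = civ m \<and> z = of_int k \<and> y = civ n"
    unfolding int_vec_civ by (auto elim: Ints_cases)
next
  assume "\<exists>m k n. x = civ m \<and> z = of_int k \<and> y = civ n"
  then obtain m k n where x: "x = civ m" "z = of_int k" "y = civ n" by blast
  obtain l where "bdot (civ m) (civ n) = of_int l" using bdot_civ by blast
  then have "bdot x y - z \<in> \<int>" using x by simp
  moreover have "matrix_inv (mat 1) = (mat 1 :: complex^('a + 'a)^('a + 'a))" by (rule matrix_inv_eqI) simp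
  moreover have "mat (1 :: complex) $ i $ j \<in> \<int>" for i j :: "'a + 'a" by (simp add: mat_def)
  ultimately show "(\<forall>i j. blk 1 x z (mat 1) y $ i $ j \<in> \<int>) \<and> (\<forall>i j. matrix_inv (blk 1 x z (mat 1) y) $ i $ j \<in> \<int>)"
    using x by (simp add: blk_inv(2) blk_entries) (simp add: civ_def)
qed

definition Pu_int :: "(complex^('d::finite ix)^('d ix)) set" where
  "Pu_int = {blk 1 (civ m) (of_int k) (mat 1) (civ n) |m k n. True}"

lemma pts_u_part_eq:
  assumes "\<And>A. A \<in> S \<Longrightarrow> \<exists>x z y. A = blk 1 x z (mat 1) y"
  shows "pts \<int> S = S \<inter> Pu_int"
proof (intro subset_antisym subsetI)
  fix A assume A: "A \<in> pts \<int> S"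
  then obtain x z y where "A = blk 1 x z (mat 1) y" using assms unfolding pts_def by blast
  then show "A \<in> S \<inter> Pu_int" using A unipotent_blk_int[of x z y] unfolding pts_def Pu_int_def by blast
next
  fix A assume A: "A \<in> S \<inter> Pu_int"
  then obtain m k n where "A = blk 1 (civ m) (of_int k) (mat 1) (civ n)" unfolding Pu_int_def by blast
  then show "A \<in> pts \<int> S" using A unipotent_blk_int[of "civ m" "of_int k" "civ n"] unfolding pts_def by blast
qed

lemma pts_u_part: "pts \<int> (u_part P_grp) = Pu_int" "pts \<int> (u_part (P_alpha \<alpha>)) = Pu_int"
  by (subst pts_u_part_eq; force simp: u_part_P_grp u_part_P_alpha Pu_int_def)+

text \<open>Integrality of x implies that of z and y because f and \<alpha> are integral.\<close>

lemma (in symm_pair) pts_u_part_tilde: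
  "pts \<int> (u_part (P_tilde f \<alpha>)) = {blk 1 (civ n) (bdot (civ n) (cim f *v civ n)) (mat 1) (cim \<alpha> *v civ n) |n. True}"
proof -
  have "pts \<int> (u_part (P_tilde f \<alpha>)) = u_part (P_tilde f \<alpha>) \<inter> Pu_int"
    by (rule pts_u_part_eq) (auto simp: u_part_P_tilde)
  moreover have "\<exists>k::int. bdot (civ n) (cim f *v civ n) = of_int k" for n
    unfolding cim_mv_civ by (rule bdot_civ)
  ultimately show ?thesis unfolding u_part_P_tilde Pu_int_def by (auto simp: cim_mv_civ) metis
qed

lemma Pu_int_group: "mat_group Pu_int"
proof (rule mat_groupI)
  show "mat 1 \<in> Pu_int" unfolding Pu_int_def blk_1 using civ_linear(2) of_int_0 by (metis (mono_tags, lifting) mem_Collect_eq)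
  show "invertible A" if "A \<in> Pu_int" for A using that unfolding Pu_int_def by (auto intro: blk_inv)
  fix A B :: "complex^('a ix)^('a ix)" assume "A \<in> Pu_int" "B \<in> Pu_int"
  then obtain m k n m' k' n' where A: "A = blk 1 (civ m) (of_int k) (mat 1) (civ n)"
    and B: "B = blk 1 (civ m') (of_int k') (mat 1) (civ n')" unfolding Pu_int_def by blast
  obtain l where l: "bdot (civ m) (civ n) = of_int l" using bdot_civ by blast
  obtain l' where l': "bdot (civ m) (civ n') = of_int l'" using bdot_civ by blast
  have i1: "matrix_inv (mat 1) = (mat 1 :: complex^('a + 'a)^('a + 'a))" by (rule matrix_inv_eqI) simp
  have "matrix_inv A ** B = blk 1 (civ (m' - m)) (of_int (k' - l' + (l - k))) (mat 1) (civ (n' - n))"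
    unfolding A B by (simp add: blk_inv(2) i1 l l' civ_linear)
  then show "matrix_inv A ** B \<in> Pu_int" unfolding Pu_int_def by blast
qed

section \<open>The Poincare torsor\<close>

lemma cpt_Pu: "cpt \<tau> u v w = orb Pu_int (pt \<tau> u v w)"
  by (simp add: cpt_def pts_u_part)

lemma cpt_eq_iff:
  assumes "\<tau> \<in> siegel"
  shows "cpt \<tau> u v w = cpt \<tau>' u' v' w' \<longleftrightarrow> \<tau>' = \<tau> \<and> (\<exists>m k n. u' = u + projB \<tau> (civ m) \<and>
    v' = v + projA \<tau> (civ n) \<and> w' = w + tpi * (bdot (vfst (civ m)) v + of_int k) - bdot u' (vsnd (civ n)))"
proof -
  have "cpt \<tau> u v w = cpt \<tau>' u' v' w' \<longleftrightarrow>
    (\<exists>m k n. pt \<tau>' u' v' w' = act (blk 1 (civ m) (of_int k) (mat 1) (civ n)) (pt \<tau> u v w))"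
    unfolding cpt_Pu orb_eq_iff[OF Pu_int_group] unfolding Pu_int_def by blast
  then show ?thesis unfolding act_unipotent[OF assms] pt_eq_iff by auto
qed

lemma vec_lambda_0 [simp]: "(\<chi> a. 0) = 0"
  by (simp add: zero_vec_def)

text \<open>This and the following lemma give the factors of automorphy of the Poincare torsor, for
  lattice translations in v and in u separately.\<close>

lemma cpt_shift_v:
  "\<tau> \<in> siegel \<Longrightarrow> cpt \<tau> u (v + projA \<tau> (civ n)) w = cpt \<tau> u v (w + bdot u (vsnd (civ n)))"
  by (rule sym, subst cpt_eq_iff, assumption)
     (rule conjI[OF refl], rule exI[of _ 0], rule exI[of _ 0], rule exI[of _ n], simp add: civ_linear projB_linear)

lemma cpt_shift_u:
  "\<tau> \<in> siegel \<Longrightarrow> cpt \<tau> (u + projB \<tau> (civ m)) v w = cpt \<tau> u v (w - tpi * bdot (vfst (civ m)) v)"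
  by (rule sym, subst cpt_eq_iff, assumption)
     (rule conjI[OF refl], rule exI[of _ m], rule exI[of _ 0], rule exI[of _ 0], simp add: civ_linear projA_linear)

text \<open>The lattices of \<open>A_var\<close> and \<open>B_var\<close> act freely, so only the
  integer k remains, which changes w by a multiple of \<open>tpi\<close>: the fibres are torsors
  under the multiplicative group.\<close>

lemma cpt_w_iff:
  assumes \<tau>: "\<tau> \<in> siegel" shows "cpt \<tau> u v w = cpt \<tau> u v w' \<longleftrightarrow> exp w = exp w'"
proof
  assume "cpt \<tau> u v w = cpt \<tau> u v w'"
  then obtain m k n where *: "projB \<tau> (civ m) = 0" "projA \<tau> (civ n) = 0"
    "w' = w + tpi * (bdot (vfst (civ m)) v + of_int k) - bdot u (vsnd (civ n))"
    unfolding cpt_eq_iff[OF \<tau>] by auto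
  then have "m = 0" "n = 0"
    using projB_civ_inject[OF \<tau>, of m 0] projA_civ_inject[OF \<tau>, of n 0]
    by (simp_all add: civ_linear projA_linear projB_linear)
  then have "w' = w + of_int (2 * k) * of_real pi * \<i>" using *(3) by (simp add: civ_linear)
  then show "exp w = exp w'" unfolding exp_eq by (intro exI[of _ "- k"]) simp
next
  assume "exp w = exp w'"
  then have "exp w' = exp w" by simp
  then obtain k :: int where "w' = w + of_int (2 * k) * of_real pi * \<i>" unfolding exp_eq of_real_mult of_real_of_int_eq by blast
  then show "cpt \<tau> u v w = cpt \<tau> u v w'"
    unfolding cpt_eq_iff[OF \<tau>]
    by (intro conjI refl exI[of _ 0] exI[of _ k]) (simp_all add: civ_linear projA_linear projB_linear)
qed

lemma latA_group: "0 \<in> latA \<tau>" "a \<in> latA \<tau> \<Longrightarrow> b \<in> latA \<tau> \<Longrightarrow> a - b \<in> latA \<tau>"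
  "a \<in> latA \<tau> \<Longrightarrow> b \<in> latA \<tau> \<Longrightarrow> a + b \<in> latA \<tau>"
proof -
  show "0 \<in> latA \<tau>" unfolding latA_def using civ_linear(2) projA_linear(4) by (metis (mono_tags, lifting) mem_Collect_eq)
  show "a - b \<in> latA \<tau>" "a + b \<in> latA \<tau>" if "a \<in> latA \<tau>" "b \<in> latA \<tau>"
    using that unfolding latA_def by (auto simp: projA_linear[symmetric] civ_linear[symmetric])
qed

lemma latB_group: "0 \<in> latB \<tau>" "a \<in> latB \<tau> \<Longrightarrow> b \<in> latB \<tau> \<Longrightarrow> a - b \<in> latB \<tau>"
  "a \<in> latB \<tau> \<Longrightarrow> b \<in> latB \<tau> \<Longrightarrow> a + b \<in> latB \<tau>"
proof -
  show "0 \<in> latB \<tau>" unfolding latB_def using civ_linear(2) projB_linear(4) by (metis (mono_tags, lifting) mem_Collect_eq)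
  show "a - b \<in> latB \<tau>" "a + b \<in> latB \<tau>" if "a \<in> latB \<tau>" "b \<in> latB \<tau>"
    using that unfolding latB_def by (auto simp: projB_linear[symmetric] civ_linear[symmetric])
qed

lemma coset_eq_iff:
  fixes L :: "'a::ab_group_add set"
  assumes "0 \<in> L" "\<And>a b. a \<in> L \<Longrightarrow> b \<in> L \<Longrightarrow> a - b \<in> L"
  shows "(\<lambda>l. v + l) ` L = (\<lambda>l. v' + l) ` L \<longleftrightarrow> v' - v \<in> L"
proof
  assume "(\<lambda>l. v + l) ` L = (\<lambda>l. v' + l) ` L"
  moreover have "v' \<in> (\<lambda>l. v' + l) ` L" using assms(1) by (force intro: image_eqI[of _ _ 0])
  ultimately obtain l where "v' = v + l" "l \<in> L" by blast
  then show "v' - v \<in> L" by simp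
next
  assume d: "v' - v \<in> L"
  have neg: "- a \<in> L" if "a \<in> L" for a using assms(2)[OF assms(1) that] by simp
  have add: "a + b \<in> L" if "a \<in> L" "b \<in> L" for a b using assms(2)[OF that(1) neg[OF that(2)]] by simp
  show "(\<lambda>l. v + l) ` L = (\<lambda>l. v' + l) ` L"
  proof (intro subset_antisym subsetI)
    fix x assume "x \<in> (\<lambda>l. v + l) ` L"
    then obtain l where "x = v' + (l - (v' - v))" "l \<in> L" by auto
    then show "x \<in> (\<lambda>l. v' + l) ` L" using assms(2)[OF _ d] by blast
  next
    fix x assume "x \<in> (\<lambda>l. v' + l) ` L"
    then obtain l where "x = v + (l + (v' - v))" "l \<in> L" by auto
    then show "x \<in> (\<lambda>l. v + l) ` L" using add[OF _ d] by blast
  qed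
qed

lemma clsA_eq: "clsA \<tau> v = clsA \<tau> v' \<longleftrightarrow> v' - v \<in> latA \<tau>"
  unfolding clsA_def by (rule coset_eq_iff) (auto intro: latA_group)

lemma clsB_eq: "clsB \<tau> v = clsB \<tau> v' \<longleftrightarrow> v' - v \<in> latB \<tau>"
  unfolding clsB_def by (rule coset_eq_iff) (auto intro: latB_group)

lemma clsB_shift: "clsB \<tau> (u + projB \<tau> (civ m)) = clsB \<tau> u"
  unfolding clsB_eq using latB_group(2)[OF latB_group(1), of "projB \<tau> (civ m)" \<tau>]
  by (auto simp: latB_def)

lemma coset_diff_clsA: "coset_diff (clsA \<tau> a) (clsA \<tau> b) = clsA \<tau> (a - b)"
proof (intro subset_antisym subsetI)
  fix c assume "c \<in> coset_diff (clsA \<tau> a) (clsA \<tau> b)"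
  then obtain l l' where "c = (a + l) - (b + l')" "l \<in> latA \<tau>" "l' \<in> latA \<tau>"
    unfolding coset_diff_def clsA_def by blast
  then show "c \<in> clsA \<tau> (a - b)" unfolding clsA_def
    by (intro image_eqI[of _ _ "l - l'"]) (auto intro: latA_group)
next
  fix c assume "c \<in> clsA \<tau> (a - b)"
  then obtain l where l: "c = a - b + l" "l \<in> latA \<tau>" unfolding clsA_def by blast
  then have "c = (a + l) - (b + 0)" by simp
  then show "c \<in> coset_diff (clsA \<tau> a) (clsA \<tau> b)"
    unfolding coset_diff_def clsA_def using l(2) latA_group(1) by blast
qed

lemma clinearD:
  assumes "clinear_map \<phi>"
  shows "\<phi> (x + y) = \<phi> x + \<phi> y" "\<phi> (c *s x) = c *s \<phi> x" "\<phi> 0 = 0" "\<phi> (x - y) = \<phi> x - \<phi> y"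
proof -
  interpret Vector_Spaces.linear "(*s)" "(*s)" \<phi> using assms by (simp add: clinear_map_def)
  show "\<phi> (x + y) = \<phi> x + \<phi> y" "\<phi> (c *s x) = c *s \<phi> x" "\<phi> 0 = 0" "\<phi> (x - y) = \<phi> x - \<phi> y"
    by (simp_all add: add scale zero diff)
qed

lemma clinearI:
  "(\<And>x y. \<phi> (x + y) = \<phi> x + \<phi> y) \<Longrightarrow> (\<And>c x. \<phi> (c *s x) = c *s \<phi> x) \<Longrightarrow> clinear_map \<phi>"
  unfolding clinear_map_def by (simp add: Vector_Spaces.linear_iff vec.vector_space_axioms)

lemma lifts_to_unique:
  assumes "\<tau> \<in> siegel" "lifts_to \<tau> f \<phi>" "lifts_to \<tau> f \<psi>" shows "\<phi> u = \<psi> u"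
proof -
  have "clinear_map (\<lambda>u. \<phi> u - \<psi> u)"
    using assms clinearD unfolding lifts_to_def
    by (intro clinearI) (auto simp: clinearD vec.scale_right_diff_distrib)
  moreover have "\<phi> u - \<psi> u \<in> latA \<tau>" for u
    using assms clsA_eq unfolding lifts_to_def by metis
  ultimately have "\<phi> u - \<psi> u = 0" using linear_into_lattice_eq_0[OF assms(1)] by blast
  then show ?thesis by simp
qed

lemma axis_expansion: "x = (\<Sum>k\<in>UNIV. x $ k *s civ (axis k 1))"
  by (simp add: vec_eq_iff civ_def axis_def if_distrib if_distribR cong: if_cong)

text \<open>All maps involved are complex linear, so the identity extends from the lattice to
  complex vectors; the kernel of \<open>projB\<close> on complex vectors then yields
  \<open>compatible\<close>.\<close>

lemma lattice_matrix_all: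
  assumes "clinear_map \<phi>" "\<And>n. \<phi> (projB \<tau> (civ n)) = projA \<tau> (cim m *v civ n)"
  shows "\<phi> (projB \<tau> x) = projA \<tau> (cim m *v x)"
proof -
  have sB: "projB \<tau> (sum f I) = (\<Sum>i\<in>I. projB \<tau> (f i))" and sA: "projA \<tau> (sum f I) = (\<Sum>i\<in>I. projA \<tau> (f i))"
    and s\<phi>: "\<phi> (sum g I) = (\<Sum>i\<in>I. \<phi> (g i))"
    for f and g :: "_ \<Rightarrow> complex^'a" and I :: "('a + 'a) set"
    by (induction I rule: infinite_finite_induct) (simp_all add: projA_linear projB_linear clinearD[OF assms(1)])
  show ?thesis
    by (subst (1 2) axis_expansion[of x])
       (simp add: sB sA s\<phi> vec.sum projA_linear projB_linear clinearD[OF assms(1)] assms(2))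
qed

text \<open>The vectors \<open>ann \<tau> a\<close> form the annihilator of the term \<open>F\<^sup>0\<close> of the graded piece of weight \<open>-1\<close>,
  and \<open>A\<close> induces a morphism from \<open>B_var \<tau>\<close> to \<open>A_var \<tau>\<close> if and only if it maps them into \<open>F\<^sup>0\<close>.\<close>

definition ann :: "complex^'d^'d \<Rightarrow> complex^'d \<Rightarrow> complex^('d::finite + 'd)" where
  "ann \<tau> a = vec2 a (- (\<tau> *v a))"

lemma projB_ann: "\<tau> \<in> siegel \<Longrightarrow> projB \<tau> (ann \<tau> a) = 0"
  by (simp add: ann_def siegel_sym)

lemma bdot_projA: "\<tau> \<in> siegel \<Longrightarrow> bdot b (projA \<tau> y) = bdot (ann \<tau> b) y"
  by (rule vec2_cases[of y]) (simp add: ann_def bdot_diff_right bdot_matrix siegel_sym)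

definition compatible :: "complex^'d^'d \<Rightarrow> complex^('d::finite + 'd)^('d + 'd) \<Rightarrow> bool" where
  "compatible \<tau> A \<longleftrightarrow> (\<forall>a. projA \<tau> (A *v ann \<tau> a) = 0)"

text \<open>Pairing \<open>projA\<close> with b amounts to pairing with \<open>ann \<tau> b\<close>,
  so compatibility is the vanishing of a bilinear form on annihilators, a condition symmetric under
  transposition.\<close>

lemma compatible_transpose:
  assumes \<tau>: "\<tau> \<in> siegel" and A: "compatible \<tau> A"
  shows "projA \<tau> (ann \<tau> a v* A) = 0"
proof (rule bdot_eqI)
  fix b
  have "bdot b (projA \<tau> (ann \<tau> a v* A)) = bdot a (projA \<tau> (A *v ann \<tau> b))"
    by (simp add: bdot_projA[OF \<tau>] bdot_matrix bdot_commute)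
  then show "bdot (projA \<tau> (ann \<tau> a v* A)) b = bdot 0 b"
    using A by (simp add: compatible_def bdot_commute)
qed

lemma compatible_of_lattice:
  assumes "\<tau> \<in> siegel" "clinear_map \<phi>" "\<And>n. \<phi> (projB \<tau> (civ n)) = projA \<tau> (cim m *v civ n)"
  shows "compatible \<tau> (cim m)"
  using lattice_matrix_all[OF assms(2,3)] projB_ann[OF assms(1)] clinearD(3)[OF assms(2)]
  unfolding compatible_def by metis

lemma lat_coords:
  assumes \<tau>: "\<tau> \<in> siegel"
  obtains r :: "complex^'d::finite \<Rightarrow> real^('d + 'd)" where "linear r"
    "\<And>k. r (projB \<tau> (civ (axis k 1))) = axis k 1"
    "\<And>t. t = (\<Sum>k\<in>UNIV. r t $ k *\<^sub>R projB \<tau> (civ (axis k 1)))"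
proof -
  obtain r where r: "linear r" "\<And>v. projB \<tau> (cor (r v)) = v" "\<And>x. r (projB \<tau> (cor x)) = x"
    using projB_real_coords[OF \<tau>] by blast
  have "r (projB \<tau> (civ (axis k 1))) = axis k 1" for k
  proof -
    have "civ (axis k 1) = cor (axis k 1)" by (simp add: civ_def cor_def axis_def vec_eq_iff)
    then show ?thesis by (simp add: r(3))
  qed
  moreover have "t = (\<Sum>k\<in>UNIV. r t $ k *\<^sub>R projB \<tau> (civ (axis k 1)))" for t
  proof -
    have sB: "projB \<tau> (sum f I) = (\<Sum>i\<in>I. projB \<tau> (f i))" for f and I :: "('d + 'd) set"
      by (induction I rule: infinite_finite_induct) (simp_all add: projB_linear)
    have "t = projB \<tau> (cor (r t))" by (simp add: r(2))
    also have "\<dots> = (\<Sum>k\<in>UNIV. cor (r t) $ k *s projB \<tau> (civ (axis k 1)))"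
      by (subst axis_expansion[of "cor (r t)"]) (simp add: sB projB_linear)
    also have "\<dots> = (\<Sum>k\<in>UNIV. r t $ k *\<^sub>R projB \<tau> (civ (axis k 1)))"
      by (intro sum.cong refl) (simp add: vec_eq_iff cor_def, simp add: scaleR_conv_of_real)
    finally show ?thesis .
  qed
  ultimately show thesis using that r(1) by blast
qed

section \<open>The dual morphism\<close>

text \<open>An isomorphism of the two torsors is a nowhere vanishing function E whose multipliers
  are the quotients of the factors of automorphy. By \<open>quasi_periodic_exp\<close> it is a
  constant times the exponential of a linear form l, and comparison on the lattice shows that a
  vector made of v, l and the transpose of m at u is integral. The contribution of l lies in
  \<open>F^0\<close> and disappears under \<open>projA\<close>.\<close>

lemma torsor_iso_dual:
  fixes \<tau> :: "complex^'d^'d::finite"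
  assumes \<tau>: "\<tau> \<in> siegel" and \<phi>: "clinear_map \<phi>" "\<And>n. \<phi> (projB \<tau> (civ n)) = projA \<tau> (cim m *v civ n)"
    and iso: "torsor_iso \<tau> \<phi> (\<lambda>_. u) (\<lambda>_. v) (\<lambda>t. t)"
  shows "v + projA \<tau> (inverse tpi *s (vec2 0 u v* cim m)) \<in> latA \<tau>"
proof -
  obtain \<Phi> :: "(complex^'d) set \<Rightarrow> (complex^('d ix)) set set \<Rightarrow> (complex^('d ix)) set set" where
    \<Phi>: "\<And>t0. \<exists>N h. open N \<and> t0 \<in> N \<and> holo_on N h \<and>
         (\<forall>t\<in>N. \<forall>w. \<Phi> (clsB \<tau> t) (cpt \<tau> u (\<phi> t) w) = cpt \<tau> t v (w + h t))"
    using iso unfolding torsor_iso_def by blast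
  \<comment> \<open>At each t the value of h is determined only up to multiples of
    \<open>tpi\<close>; the exponentials glue to a global function E.\<close>
  define good where "good t c \<longleftrightarrow> (\<forall>w. \<Phi> (clsB \<tau> t) (cpt \<tau> u (\<phi> t) w) = cpt \<tau> t v (w + c))" for t c
  have good_ex: "\<exists>c. good t c" for t using \<Phi>[of t] unfolding good_def by blast
  have good_unique: "exp c = exp c'" if "good t c" "good t c'" for t c c'
  proof -
    have "cpt \<tau> t v c = cpt \<tau> t v c'" using that unfolding good_def by (metis add_0)
    then show ?thesis unfolding cpt_w_iff[OF \<tau>] .
  qed
  define E where "E t = exp (SOME c. good t c)" for t
  have E: "E t = exp c" if "good t c" for t c
    unfolding E_def by (rule good_unique[OF someI[of "good t"] that]) (fact that)
  have holoE: "\<exists>N h. open N \<and> t0 \<in> N \<and> holo_on N h \<and> (\<forall>t\<in>N. E t = exp (h t))" for t0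
    using \<Phi>[of t0] E unfolding good_def by blast
  define \<chi>' where "\<chi>' n = exp (tpi * bdot (vfst (civ n)) v + bdot u (vsnd (cim m *v civ n)))" for n :: "int^('d + 'd)"
  have qp: "E (t + projB \<tau> (civ n)) = \<chi>' n * E t" for t n
  proof -
    let ?l = "projB \<tau> (civ n)" and ?w = "bdot u (vsnd (cim m *v civ n))"
    obtain c0 where c0: "good t c0" using good_ex by blast
    obtain c1 where c1: "good (t + ?l) c1" using good_ex by blast
    \<comment> \<open>The fibre at the class of t is reached both through t and through t + ?l. On
      the target torsor this costs the factor of automorphy in u, on the source the one in
      v.\<close>
    have "cpt \<tau> (t + ?l) v (c0 + tpi * bdot (vfst (civ n)) v) = cpt \<tau> t v c0"
      by (simp add: cpt_shift_u[OF \<tau>])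
    also have "\<dots> = \<Phi> (clsB \<tau> t) (cpt \<tau> u (\<phi> t) 0)" using c0 unfolding good_def by simp
    also have "cpt \<tau> u (\<phi> t) 0 = cpt \<tau> u (\<phi> (t + ?l)) (- ?w)"
      unfolding clinearD(1)[OF \<phi>(1)] \<phi>(2) cim_mv_civ cpt_shift_v[OF \<tau>] by simp
    also have "clsB \<tau> t = clsB \<tau> (t + ?l)" by (simp add: clsB_shift)
    also have "\<Phi> (clsB \<tau> (t + ?l)) (cpt \<tau> u (\<phi> (t + ?l)) (- ?w)) = cpt \<tau> (t + ?l) v (- ?w + c1)"
      using c1 unfolding good_def by blast
    finally have "exp (c0 + tpi * bdot (vfst (civ n)) v) = exp (- ?w + c1)" unfolding cpt_w_iff[OF \<tau>] .
    then show ?thesis unfolding E[OF c0] E[OF c1] \<chi>'_def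
      by (simp add: exp_add exp_diff field_simps)
  qed
  obtain r :: "complex^'d \<Rightarrow> real^('d + 'd)" where r: "linear r"
    "\<And>k. r (projB \<tau> (civ (axis k 1))) = axis k 1"
    "\<And>t. t = (\<Sum>k\<in>UNIV. r t $ k *\<^sub>R projB \<tau> (civ (axis k 1)))"
    using lat_coords[OF \<tau>] by blast
  obtain l where l: "\<And>t. E t = E 0 * exp (bdot l t)"
    using quasi_periodic_exp[OF holoE r, of "\<lambda>k. \<chi>' (axis k 1)"] qp by blast
  have E0: "E 0 \<noteq> 0" by (simp add: E_def)
  have "exp (tpi * bdot (vfst (civ n)) v + bdot u (vsnd (cim m *v civ n))) = exp (bdot l (projB \<tau> (civ n)))" for n
    using qp[of 0 n] l[of "projB \<tau> (civ n)"] E0 by (simp add: \<chi>'_def)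
  then have "\<exists>K::int. tpi * bdot (vfst (civ n)) v + bdot u (vsnd (cim m *v civ n)) =
      bdot l (projB \<tau> (civ n)) + of_int (2 * K) * of_real pi * \<i>" for n
    unfolding exp_eq of_real_mult of_real_of_int_eq by blast
  then obtain K where K: "\<And>n. tpi * bdot (vfst (civ n)) v + bdot u (vsnd (cim m *v civ n)) =
      bdot l (projB \<tau> (civ n)) + of_int (2 * K n) * of_real pi * \<i>" by metis
  let ?c = "vec2 0 u v* cim m"
  have lin: "tpi * bdot (vfst x) v + bdot u (vsnd (cim m *v x)) - bdot l (projB \<tau> x) =
      bdot (tpi *s vec2 v 0 + ?c - tpi *s vec2 (\<tau> *v l) l) x" for x
  proof -
    have "bdot u (vsnd y) = bdot (vec2 0 u) y" for y by (rule vec2_cases[of y]) simp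
    moreover have "bdot (vfst x) v = bdot (vec2 v 0) x" by (rule vec2_cases[of x]) (simp add: bdot_commute)
    moreover have "bdot l (projB \<tau> x) = tpi * bdot (vec2 (\<tau> *v l) l) x"
      by (rule vec2_cases[of x]) (simp add: bdot_distribs siegel_sym[OF \<tau>] bdot_matrix[of l] ring_distribs)
    ultimately show ?thesis by (simp add: bdot_matrix bdot_distribs del: vec2_scale)
  qed
  have "tpi *s vec2 v 0 + ?c - tpi *s vec2 (\<tau> *v l) l = tpi *s civ (\<chi> k. K (axis k 1))"
  proof -
    have "(tpi *s vec2 v 0 + ?c - tpi *s vec2 (\<tau> *v l) l) $ k = tpi * of_int (K (axis k 1))" for k
    proof -
      have "civ (axis k 1) = axis k 1" by (simp add: civ_def axis_def vec_eq_iff)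
      then show ?thesis
        using K[of "axis k 1"] lin[of "civ (axis k 1)"] by (simp add: mult_ac del: vec2_scale)
    qed
    then show ?thesis by (simp add: vec_eq_iff civ_def)
  qed
  then have "inverse tpi *s (tpi *s vec2 v 0 + ?c - tpi *s vec2 (\<tau> *v l) l) = inverse tpi *s (tpi *s civ (\<chi> k. K (axis k 1)))"
    by simp
  then have "vec2 v 0 + inverse tpi *s ?c - vec2 (\<tau> *v l) l = civ (\<chi> k. K (axis k 1))"
    by (simp only: vec.scale_right_distrib vec.scale_right_diff_distrib vec.scale_scale tpi_inverse vec.scale_one)
  then have "projA \<tau> (vec2 v 0 + inverse tpi *s ?c - vec2 (\<tau> *v l) l) \<in> latA \<tau>"
    unfolding latA_def by auto
  then show ?thesis by (simp add: projA_linear)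
qed

theorem alpha_eq:
  fixes \<tau> :: "complex^'d^'d::finite"
  assumes \<tau>: "\<tau> \<in> siegel" and f: "lattice_matrix \<tau> f m" and g: "dual_morphism \<tau> f g"
    and a: "lattice_matrix \<tau> (\<lambda>b. coset_diff (f b) (g b)) \<alpha>"
  shows "\<alpha> = m + transpose m" "compatible \<tau> (cim \<alpha>)"
proof -
  obtain \<phi> where \<phi>: "lifts_to \<tau> f \<phi>" "\<And>n. \<phi> (projB \<tau> (civ n)) = projA \<tau> (cim m *v civ n)"
    using f unfolding lattice_matrix_def by blast
  obtain \<psi> where \<psi>: "lifts_to \<tau> g \<psi>" using g unfolding dual_morphism_def morphism_BA_def by blast
  obtain \<phi>' where \<phi>': "lifts_to \<tau> f \<phi>'" "\<And>u v. v \<in> g (clsB \<tau> u) \<Longrightarrow> torsor_iso \<tau> \<phi>' (\<lambda>_. u) (\<lambda>_. v) (\<lambda>t. t)"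
    using g unfolding dual_morphism_def by blast
  \<comment> \<open>\<open>dual_morphism\<close> comes with its own lift of f, which agrees with
    that of \<open>lattice_matrix\<close> because lifts are unique.\<close>
  have "\<phi>' = \<phi>" using lifts_to_unique[OF \<tau> \<phi>'(1) \<phi>(1)] by blast
  have lin\<phi>: "clinear_map \<phi>" and lin\<psi>: "clinear_map \<psi>" using \<phi>(1) \<psi> by (auto simp: lifts_to_def)
  have self: "v \<in> clsA \<tau> v" for v unfolding clsA_def using latA_group(1) by (force intro: image_eqI[of _ _ 0])
  let ?c = "\<lambda>u. projA \<tau> (inverse tpi *s (vec2 0 u v* cim m))"
  have "\<psi> u + ?c u \<in> latA \<tau>" for u
  proof (rule torsor_iso_dual[OF \<tau> lin\<phi> \<phi>(2)])
    show "torsor_iso \<tau> \<phi> (\<lambda>_. u) (\<lambda>_. \<psi> u) (\<lambda>t. t)"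
      using \<phi>'(2)[of "\<psi> u" u] \<psi> self \<open>\<phi>' = \<phi>\<close> unfolding lifts_to_def by auto
  qed
  moreover have "clinear_map (\<lambda>u. \<psi> u + ?c u)"
  proof (rule clinearI)
    have v2: "vec2 0 (x + y) = vec2 0 x + vec2 0 y" "vec2 0 (k *s x) = k *s vec2 0 x" for x y :: "complex^'d" and k
      by simp_all
    show "\<psi> (x + y) + ?c (x + y) = \<psi> x + ?c x + (\<psi> y + ?c y)" for x y
      unfolding v2 by (simp only: clinearD[OF lin\<psi>] vec_matrix_add vec.scale_right_distrib projA_linear add_ac)
    show "\<psi> (k *s x) + ?c (k *s x) = k *s (\<psi> x + ?c x)" for x k
      unfolding v2 by (simp only: clinearD[OF lin\<psi>] vec_matrix_scale projA_linear vec.scale_right_distrib)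
         (simp add: mult_ac)
  qed
  ultimately have "\<psi> u + ?c u = 0" for u using linear_into_lattice_eq_0[OF \<tau>] by blast
  then have \<psi>_eq: "\<psi> u = - ?c u" for u by (simp add: eq_neg_iff_add_eq_0)
  have compm: "compatible \<tau> (cim m)" using compatible_of_lattice[OF \<tau> lin\<phi> \<phi>(2)] .
  \<comment> \<open>The vector (0, \<tau> p + q) differs from x by \<open>ann \<tau> p\<close>,
    whose contribution vanishes by compatibility; this turns the formula for \<psi> into minus the
    transpose of m on the lattice.\<close>
  have \<psi>B: "\<psi> (projB \<tau> x) = - projA \<tau> (x v* cim m)" for x
  proof -
    obtain p q where x: "x = vec2 p q" by (rule vec2_cases)
    have "inverse tpi *s (vec2 0 (projB \<tau> x) v* cim m) = vec2 0 (\<tau> *v p + q) v* cim m"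
    proof -
      have "vec2 0 (projB \<tau> x) = tpi *s vec2 0 (\<tau> *v p + q)" unfolding x by (simp add: siegel_sym[OF \<tau>])
      then show ?thesis by (simp only: vec_matrix_scale vec.scale_scale tpi_inverse vec.scale_one)
    qed
    also have "vec2 0 (\<tau> *v p + q) = x - ann \<tau> p" unfolding x ann_def by simp
    finally show ?thesis
      unfolding \<psi>_eq by (simp only: vec_matrix_diff projA_linear compatible_transpose[OF \<tau> compm] diff_0_right)
  qed
  obtain \<chi>' where \<chi>': "lifts_to \<tau> (\<lambda>b. coset_diff (f b) (g b)) \<chi>'"
    "\<And>n. \<chi>' (projB \<tau> (civ n)) = projA \<tau> (cim \<alpha> *v civ n)"
    using a unfolding lattice_matrix_def by blast
  have lin\<chi>: "clinear_map \<chi>'" using \<chi>' by (simp add: lifts_to_def)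
  have "lifts_to \<tau> (\<lambda>b. coset_diff (f b) (g b)) (\<lambda>u. \<phi> u - \<psi> u)"
    unfolding lifts_to_def
  proof (intro conjI allI)
    show "clinear_map (\<lambda>u. \<phi> u - \<psi> u)"
      by (intro clinearI) (simp_all add: clinearD[OF lin\<phi>] clinearD[OF lin\<psi>] vec.scale_right_diff_distrib)
    show "(\<lambda>u. \<phi> u - \<psi> u) ` latB \<tau> \<subseteq> latA \<tau>"
      using \<phi>(1) \<psi> unfolding lifts_to_def by (auto intro!: latA_group)
    show "coset_diff (f (clsB \<tau> u)) (g (clsB \<tau> u)) = clsA \<tau> (\<phi> u - \<psi> u)" for u
      using \<phi>(1) \<psi> unfolding lifts_to_def by (simp add: coset_diff_clsA)
  qed
  then have "\<chi>' u = \<phi> u - \<psi> u" for u using lifts_to_unique[OF \<tau> \<chi>'(1)] by blast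
  then have eq: "projA \<tau> (cim \<alpha> *v civ n) = projA \<tau> (cim m *v civ n + civ n v* cim m)" for n
    using \<chi>'(2)[of n] \<phi>(2)[of n] \<psi>B[of "civ n"] by (simp add: projA_linear)
  have "\<alpha> *v n = (m + transpose m) *v n" for n
  proof -
    have "civ n v* cim m = civ (transpose m *v n)"
      by (simp add: vec_eq_iff civ_def cim_def vector_matrix_mult_def)
    then have "projA \<tau> (civ (\<alpha> *v n)) = projA \<tau> (civ (m *v n + transpose m *v n))"
      using eq[of n] by (simp only: cim_mv_civ civ_linear)
    then have "\<alpha> *v n = m *v n + transpose m *v n" using projA_civ_inject[OF \<tau>] by blast
    then show ?thesis by (simp only: matrix_vector_mult_add_rdistrib)
  qed
  then show "\<alpha> = m + transpose m" by (simp add: matrix_eq)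
  show "compatible \<tau> (cim \<alpha>)" using compatible_of_lattice[OF \<tau> lin\<chi> \<chi>'(2)] .
qed

section \<open>The Hodge structure attached to a point of the Siegel space\<close>

lemma map_vec_cnj_cnj [simp]: "map_vec cnj (map_vec cnj x) = x"
  by (simp add: map_vec_def vec_eq_iff)

lemma map_mat_cnj_cnj [simp]: "map_mat cnj (map_mat cnj x) = x"
  by (simp add: map_mat_def vec_eq_iff)

lemmas cnj_simps = map_vec_linear[OF field_aut_cnj] map_vec_mv[OF field_aut_cnj]
  map_mat_mult[OF field_aut_cnj] map_mat_J[OF field_aut_cnj] map_mat_cim[OF field_aut_cnj]

definition ev :: "complex^'d^'d \<Rightarrow> complex^'d \<Rightarrow> complex^('d::finite + 'd)" where
  "ev \<tau> a = vec2 (\<tau> *v a) a"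

definition evbar :: "complex^'d^'d \<Rightarrow> complex^'d \<Rightarrow> complex^('d::finite + 'd)" where
  "evbar \<tau> a = vec2 (map_mat cnj \<tau> *v a) a"

lemma ev_linear: "ev \<tau> (a + b) = ev \<tau> a + ev \<tau> b" "ev \<tau> (c *s a) = c *s ev \<tau> a"
  by (simp_all add: ev_def matrix_vector_right_distrib)

lemma cnj_ev: "map_vec cnj (ev \<tau> a) = evbar \<tau> (map_vec cnj a)"
  and cnj_evbar: "map_vec cnj (evbar \<tau> a) = ev \<tau> (map_vec cnj a)"
  by (simp_all add: ev_def evbar_def cnj_simps)

lemma projA_eq_0_iff: "projA \<tau> x = 0 \<longleftrightarrow> (\<exists>a. x = ev \<tau> a)"
  by (rule vec2_cases[of x]) (auto simp: ev_def)

text \<open>\<open>proj_m10 \<tau>\<close> is the projection to the component of bidegree \<open>(-1,0)\<close>, which is the range of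
  \<open>evbar \<tau>\<close>, and \<open>deligne_gr \<tau>\<close> is the action of the Deligne torus on the graded piece of weight \<open>-1\<close>.\<close>

definition proj_m10 :: "complex^'d^'d \<Rightarrow> complex^('d::finite + 'd)^('d + 'd)" where
  "proj_m10 \<tau> = matrix (\<lambda>x. evbar \<tau> (matrix_inv (map_mat cnj \<tau> - \<tau>) *v projA \<tau> x))"

definition deligne_gr :: "complex^'d^'d \<Rightarrow> complex \<Rightarrow> complex \<Rightarrow> complex^('d::finite + 'd)^('d + 'd)" where
  "deligne_gr \<tau> z1 z2 = mat z1 ** proj_m10 \<tau> + mat z2 ** (mat 1 - proj_m10 \<tau>)"

definition sp :: "complex^('d::finite + 'd) \<Rightarrow> complex^('d + 'd) \<Rightarrow> complex" where
  "sp x y = bdot x (J_mat *v y)"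

lemma sp_bilinear: "sp (x + x') y = sp x y + sp x' y" "sp x (y + y') = sp x y + sp x y'"
  "sp (c *s x) y = c * sp x y" "sp x (c *s y) = c * sp x y"
  by (simp_all add: sp_def bdot_distribs matrix_vector_right_distrib)

lemma sp_antisym: "sp x y = - sp y x"
  by (rule vec2_cases[of x], rule vec2_cases[of y]) (simp add: sp_def bdot_commute)

lemma sp_cnj: "cnj (sp x y) = sp (map_vec cnj x) (map_vec cnj y)"
  by (simp add: sp_def cnj_simps)

text \<open>The link between the polarisation and the Siegel space: the Hermitian form of
  \<open>sp\<close> on \<open>F^0\<close> is definite because the imaginary part of \<tau>
  is.\<close>

lemma sp_ev_cnj: "sp (ev \<tau> a) (map_vec cnj (ev \<tau> a)) = - 2 * \<i> * of_real (Im (bdot (map_vec cnj a) (\<tau> *v a)))"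
proof -
  let ?s = "bdot (map_vec cnj a) (\<tau> *v a)"
  have "cnj ?s = bdot a (map_vec cnj (\<tau> *v a))"
    by (simp only: map_vec_linear(6)[OF field_aut_cnj] map_vec_cnj_cnj)
  then have "sp (ev \<tau> a) (map_vec cnj (ev \<tau> a)) = cnj ?s - ?s"
    by (simp add: sp_def ev_def bdot_commute[of "\<tau> *v a"])
  then show ?thesis by (simp add: complex_eq_iff)
qed

lemma sp_similitude: "transpose g ** J_mat ** g = mat \<mu> ** J_mat \<longleftrightarrow> (\<forall>x y. sp (g *v x) (g *v y) = \<mu> * sp x y)"
proof -
  have 1: "sp (g *v x) (g *v y) = bdot x ((transpose g ** J_mat ** g) *v y)" for x y
    unfolding sp_def by (simp add: matrix_vector_mul_assoc[symmetric] bdot_matrix_left)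
  have 2: "\<mu> * sp x y = bdot x ((mat \<mu> ** J_mat) *v y)" for x y
    unfolding sp_def by (simp add: matrix_vector_mul_assoc[symmetric])
  show ?thesis unfolding bilinear_matrix_eq[symmetric] 1 2 ..
qed

context
  fixes \<tau> :: "complex^'d^'d::finite"
  assumes \<tau>: "\<tau> \<in> siegel"
begin

lemma invertible_Im: "invertible (map_mat cnj \<tau> - \<tau>)"
proof -
  have "a = 0" if "(map_mat cnj \<tau> - \<tau>) *v a = 0" for a
  proof (rule ccontr)
    assume "a \<noteq> 0"
    let ?s = "bdot (map_vec cnj a) (\<tau> *v a)"
    have "cnj ?s = bdot (map_vec cnj a) (map_mat cnj \<tau> *v a)"
    proof -
      have "cnj ?s = bdot a (map_mat cnj \<tau> *v map_vec cnj a)" by (simp add: cnj_simps)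
      also have "\<dots> = cnj (bdot (map_vec cnj a) (a v* transpose \<tau>))"
        by (simp add: cnj_simps)
      also have "\<dots> = cnj (bdot (map_vec cnj a v* \<tau>) a)" by (simp add: bdot_matrix)
      also have "\<dots> = cnj (bdot (\<tau> *v map_vec cnj a) a)" by (simp add: siegel_sym[OF \<tau>])
      also have "\<dots> = bdot (map_mat cnj \<tau> *v a) (map_vec cnj a)" by (simp add: cnj_simps)
      finally show ?thesis by (simp add: bdot_commute)
    qed
    then have "?s - cnj ?s = - bdot (map_vec cnj a) ((map_mat cnj \<tau> - \<tau>) *v a)"
      by (simp add: matrix_vector_mult_diff_rdistrib bdot_distribs)
    then have "Im ?s = 0" using that by (simp add: complex_eq_iff)
    then show False using siegel_Im_pos[OF \<tau> \<open>a \<noteq> 0\<close>] by simp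
  qed
  then show ?thesis
    using matrix_left_invertible_ker[of "map_mat cnj \<tau> - \<tau>"] matrix_inv_eqI(2) matrix_left_right_inverse by metis
qed

lemma proj_m10_mv: "proj_m10 \<tau> *v x = evbar \<tau> (matrix_inv (map_mat cnj \<tau> - \<tau>) *v projA \<tau> x)"
proof -
  have "clinear_map (\<lambda>x. evbar \<tau> (matrix_inv (map_mat cnj \<tau> - \<tau>) *v projA \<tau> x))"
    by (rule clinearI) (simp_all add: evbar_def projA_linear matrix_vector_right_distrib)
  then show ?thesis unfolding proj_m10_def clinear_map_def by (rule matrix_works)
qed

lemma proj_m10_ev: "proj_m10 \<tau> *v ev \<tau> a = 0"
  unfolding proj_m10_mv by (simp add: ev_def evbar_def)

lemma projA_evbar: "projA \<tau> (evbar \<tau> a) = (map_mat cnj \<tau> - \<tau>) *v a"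
  by (simp add: evbar_def matrix_vector_mult_diff_rdistrib)

lemma proj_m10_evbar: "proj_m10 \<tau> *v evbar \<tau> a = evbar \<tau> a"
  unfolding proj_m10_mv projA_evbar by (simp add: matrix_vector_mul_assoc matrix_inv_left[OF invertible_Im])

lemma ev_cases: obtains a b where "x = ev \<tau> a + evbar \<tau> b"
proof -
  obtain b where b: "proj_m10 \<tau> *v x = evbar \<tau> b" unfolding proj_m10_mv by blast
  have "projA \<tau> (x - proj_m10 \<tau> *v x) = 0"
    unfolding projA_linear proj_m10_mv projA_evbar
    by (simp add: matrix_vector_mul_assoc matrix_inv_right[OF invertible_Im])
  then obtain a where "x - proj_m10 \<tau> *v x = ev \<tau> a" unfolding projA_eq_0_iff by blast
  then have "x = ev \<tau> a + evbar \<tau> b" using b by (metis diff_add_cancel)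
  then show thesis by (rule that)
qed

lemma ev_eqI: "(\<And>a. A *v ev \<tau> a = B *v ev \<tau> a) \<Longrightarrow> (\<And>a. A *v evbar \<tau> a = B *v evbar \<tau> a) \<Longrightarrow> A = B"
proof (rule matrix_eqI)
  fix x assume *: "\<And>a. A *v ev \<tau> a = B *v ev \<tau> a" "\<And>a. A *v evbar \<tau> a = B *v evbar \<tau> a"
  show "A *v x = B *v x" by (rule ev_cases[of x]) (simp add: matrix_vector_right_distrib *)
qed

lemma deligne_gr_ev: "deligne_gr \<tau> z1 z2 *v ev \<tau> a = z2 *s ev \<tau> a"
  and deligne_gr_evbar: "deligne_gr \<tau> z1 z2 *v evbar \<tau> a = z1 *s evbar \<tau> a"
  unfolding deligne_gr_def
  by (simp_all add: matrix_vector_mult_add_rdistrib matrix_vector_mul_assoc[symmetric]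
      matrix_vector_mult_diff_rdistrib proj_m10_ev proj_m10_evbar)

lemma deligne_gr_mult: "deligne_gr \<tau> z1 z2 ** deligne_gr \<tau> w1 w2 = deligne_gr \<tau> (z1 * w1) (z2 * w2)"
  by (rule ev_eqI) (simp_all add: matrix_vector_mul_assoc[symmetric] deligne_gr_ev deligne_gr_evbar mult_ac)

lemma deligne_gr_scalar: "deligne_gr \<tau> t t = mat t"
  by (rule ev_eqI) (simp_all add: deligne_gr_ev deligne_gr_evbar)

lemma deligne_gr_inv:
  assumes "z1 \<noteq> 0" "z2 \<noteq> 0"
  shows "invertible (deligne_gr \<tau> z1 z2)" "matrix_inv (deligne_gr \<tau> z1 z2) = deligne_gr \<tau> (inverse z1) (inverse z2)"
proof -
  have "deligne_gr \<tau> z1 z2 ** deligne_gr \<tau> (inverse z1) (inverse z2) = mat 1" using assms by (simp add: deligne_gr_mult deligne_gr_scalar)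
  then show "invertible (deligne_gr \<tau> z1 z2)" "matrix_inv (deligne_gr \<tau> z1 z2) = deligne_gr \<tau> (inverse z1) (inverse z2)"
    by (rule matrix_inv_eqI)+
qed

lemma cnj_deligne_gr: "map_mat cnj (deligne_gr \<tau> z1 z2) = deligne_gr \<tau> (cnj z2) (cnj z1)"
proof (rule ev_eqI)
  fix a
  have "map_mat cnj (deligne_gr \<tau> z1 z2) *v ev \<tau> a = map_vec cnj (deligne_gr \<tau> z1 z2 *v evbar \<tau> (map_vec cnj a))"
    by (simp add: cnj_simps cnj_evbar)
  then show "map_mat cnj (deligne_gr \<tau> z1 z2) *v ev \<tau> a = deligne_gr \<tau> (cnj z2) (cnj z1) *v ev \<tau> a"
    by (simp add: deligne_gr_evbar deligne_gr_ev cnj_simps cnj_evbar)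
  have "map_mat cnj (deligne_gr \<tau> z1 z2) *v evbar \<tau> a = map_vec cnj (deligne_gr \<tau> z1 z2 *v ev \<tau> (map_vec cnj a))"
    by (simp add: cnj_simps cnj_ev)
  then show "map_mat cnj (deligne_gr \<tau> z1 z2) *v evbar \<tau> a = deligne_gr \<tau> (cnj z2) (cnj z1) *v evbar \<tau> a"
    by (simp add: deligne_gr_evbar deligne_gr_ev cnj_simps cnj_ev)
qed

lemma sp_ev: "sp (ev \<tau> a) (ev \<tau> b) = 0"
  using bdot_matrix[of a \<tau> b]
  by (simp add: sp_def ev_def siegel_sym[OF \<tau>])

lemma sp_evbar: "sp (evbar \<tau> a) (evbar \<tau> b) = 0"
  using sp_cnj[of "ev \<tau> (map_vec cnj a)" "ev \<tau> (map_vec cnj b)"] by (simp add: sp_ev cnj_ev)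

lemma deligne_gr_sp: "sp (deligne_gr \<tau> z1 z2 *v x) (deligne_gr \<tau> z1 z2 *v y) = z1 * z2 * sp x y"
  by (rule ev_cases[of x], rule ev_cases[of y])
     (simp add: matrix_vector_right_distrib deligne_gr_ev deligne_gr_evbar sp_bilinear sp_ev sp_evbar algebra_simps)

lemma ann_iff: "(\<forall>a. bdot m (ev \<tau> a) = 0) \<longleftrightarrow> (\<exists>b. m = ann \<tau> b)"
proof
  assume m: "\<forall>a. bdot m (ev \<tau> a) = 0"
  obtain p q where pq: "m = vec2 p q" by (rule vec2_cases)
  have "q = - (\<tau> *v p)"
  proof (rule bdot_eqI)
    fix a
    have "bdot p (\<tau> *v a) + bdot q a = 0" using m by (simp add: pq ev_def)
    then show "bdot q a = bdot (- (\<tau> *v p)) a"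
      by (simp add: bdot_matrix siegel_sym[OF \<tau>] eq_neg_iff_add_eq_0 add.commute)
  qed
  then show "\<exists>b. m = ann \<tau> b" by (auto simp: pq ann_def)
next
  assume "\<exists>b. m = ann \<tau> b"
  then show "\<forall>a. bdot m (ev \<tau> a) = 0"
    by (auto simp: ann_def ev_def bdot_matrix siegel_sym[OF \<tau>])
qed

text \<open>Split m into m1, which annihilates \<open>F^0\<close>, and m2, which annihilates its
  conjugate. The transpose acts on m1 by z1, while compatibility puts A m1 into \<open>F^0\<close>,
  where the torus acts by z2; for m2 the roles are exchanged, as A is real. Either way the product
  is z1 z2.\<close>

lemma deligne_gr_compatible:
  assumes A: "compatible \<tau> A" "map_mat cnj A = A"
  shows "deligne_gr \<tau> z1 z2 ** A ** transpose (deligne_gr \<tau> z1 z2) = mat (z1 * z2) ** A"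
proof (rule matrix_eqI)
  fix m
  let ?h = "deligne_gr \<tau> z1 z2"
  have E: "A *v n = ev \<tau> (vsnd (A *v n))" if "\<forall>a. bdot n (ev \<tau> a) = 0" for n
  proof -
    have "projA \<tau> (A *v n) = 0" using that A(1) unfolding ann_iff compatible_def by auto
    then show ?thesis unfolding projA_eq_0_iff by (auto simp: ev_def)
  qed
  have Ebar: "A *v n = evbar \<tau> (vsnd (A *v n))" if n: "\<forall>a. bdot n (evbar \<tau> a) = 0" for n
  proof -
    have "bdot (map_vec cnj n) (ev \<tau> a) = cnj (bdot n (evbar \<tau> (map_vec cnj a)))" for a
      by (simp add: cnj_simps cnj_evbar)
    then have "\<forall>a. bdot (map_vec cnj n) (ev \<tau> a) = 0" using n by simp
    from E[OF this] have "map_vec cnj (A *v map_vec cnj n) = evbar \<tau> (map_vec cnj (vsnd (A *v map_vec cnj n)))"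
      by (metis cnj_ev)
    moreover have "map_vec cnj (A *v map_vec cnj n) = A *v n" by (simp add: cnj_simps A(2))
    ultimately show ?thesis by (metis evbar_def vec2_halves(2))
  qed
  define m1 m2 where "m1 = m v* proj_m10 \<tau>" and "m2 = m - m1"
  have m1: "\<forall>a. bdot m1 (ev \<tau> a) = 0" by (simp add: m1_def bdot_matrix[symmetric] proj_m10_ev)
  have m2: "\<forall>a. bdot m2 (evbar \<tau> a) = 0"
    by (simp add: m1_def m2_def bdot_distribs bdot_matrix[symmetric] proj_m10_evbar)
  have h1: "m1 v* ?h = z1 *s m1"
  proof (rule bdot_eqI)
    fix y show "bdot (m1 v* ?h) y = bdot (z1 *s m1) y"
      by (rule ev_cases[of y]) (simp add: bdot_matrix[symmetric] matrix_vector_right_distrib deligne_gr_ev deligne_gr_evbar bdot_distribs m1)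
  qed
  have h2: "m2 v* ?h = z2 *s m2"
  proof (rule bdot_eqI)
    fix y show "bdot (m2 v* ?h) y = bdot (z2 *s m2) y"
      by (rule ev_cases[of y]) (simp add: bdot_matrix[symmetric] matrix_vector_right_distrib deligne_gr_ev deligne_gr_evbar bdot_distribs m2)
  qed
  have hm1: "?h *v (A *v m1) = z2 *s (A *v m1)" by (subst (1 2) E[OF m1]) (rule deligne_gr_ev)
  have hm2: "?h *v (A *v m2) = z1 *s (A *v m2)" by (subst (1 2) Ebar[OF m2]) (rule deligne_gr_evbar)
  have "m = m1 + m2" by (simp add: m2_def)
  then show "(?h ** A ** transpose ?h) *v m = (mat (z1 * z2) ** A) *v m"
    by (simp add: matrix_vector_mul_assoc[symmetric] vec_matrix_add matrix_vector_right_distrib h1 h2 hm1 hm2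
      vec.scale_right_distrib mult_ac)
qed

lemma deligne_gr_G_full:
  assumes "compatible \<tau> (cim \<alpha>)" "z1 \<noteq> 0" "z2 \<noteq> 0"
  shows "deligne_gr \<tau> z1 z2 \<in> G_full \<alpha>" "multiplier (deligne_gr \<tau> z1 z2) = z1 * z2"
proof -
  have "transpose (deligne_gr \<tau> z1 z2) ** J_mat ** deligne_gr \<tau> z1 z2 = mat (z1 * z2) ** J_mat"
    unfolding sp_similitude by (simp add: deligne_gr_sp)
  then show "deligne_gr \<tau> z1 z2 \<in> G_full \<alpha>" "multiplier (deligne_gr \<tau> z1 z2) = z1 * z2"
    using G_fullI[OF deligne_gr_inv(1)[OF assms(2,3)] _ _ deligne_gr_compatible[OF assms(1) map_mat_cim[OF field_aut_cnj]]] assms(2,3)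
    by auto
qed

text \<open>The torus is the continuous image of a product of two punctured planes, which is
  connected and contains (1, 1); so it lies in the identity component of the stabiliser.\<close>

lemma deligne_gr_G_alpha:
  assumes "compatible \<tau> (cim \<alpha>)" "z1 \<noteq> 0" "z2 \<noteq> 0"
  shows "deligne_gr \<tau> z1 z2 \<in> G_alpha \<alpha>"
proof -
  let ?X = "(- {0 :: complex}) \<times> (- {0 :: complex})"
  let ?T = "(\<lambda>z. deligne_gr \<tau> (fst z) (snd z)) ` ?X"
  have "connected (- {0 :: complex})" by (intro connected_punctured_universe) simp
  then have "connected ?X" by (intro connected_Times)
  moreover have "continuous_on ?X (\<lambda>z. deligne_gr \<tau> (fst z) (snd z))"
    unfolding deligne_gr_def
    by (intro continuous_on_vecI) (simp, intro continuous_intros)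
  ultimately have "connectedin zariski ?T" by (intro connectedin_zariski connected_continuous_image)
  moreover have "?T \<subseteq> G_full \<alpha>" by (auto intro!: deligne_gr_G_full(1)[OF assms(1)])
  moreover have "mat 1 \<in> ?T" using deligne_gr_scalar[of 1] by (force intro: image_eqI[of _ _ "(1, 1)"])
  ultimately have "?T \<subseteq> G_alpha \<alpha>" unfolding G_alpha_eq by (intro id_component_maximal)
  then show ?thesis using assms(2,3) by (force intro: image_eqI[of _ _ "(z1, z2)"])
qed

text \<open>The positive definite Hermitian form attached to the polarisation and to its Weil operator.\<close>

definition weil_form :: "complex^('d + 'd) \<Rightarrow> complex^('d + 'd) \<Rightarrow> complex" where
  "weil_form x y = sp x (deligne_gr \<tau> \<i> (- \<i>) *v map_vec cnj y)"

lemma pos_form_weil_form: "pos_form weil_form"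
proof
  let ?c = "deligne_gr \<tau> \<i> (- \<i>)"
  show "weil_form (x + x') y = weil_form x y + weil_form x' y" "weil_form (c *s x) y = c * weil_form x y" for x x' y c
    by (simp_all add: weil_form_def sp_bilinear)
  have cc: "?c *v (?c *v v) = - v" for v
    by (simp add: matrix_vector_mul_assoc deligne_gr_mult deligne_gr_scalar)
  have c_real: "map_mat cnj ?c = ?c" by (simp add: cnj_deligne_gr)
  show "weil_form y x = cnj (weil_form x y)" for x y
  proof -
    have "sp y (?c *v map_vec cnj x) = sp (?c *v y) (?c *v (?c *v map_vec cnj x))"
      unfolding deligne_gr_sp by simp
    also have "\<dots> = sp (map_vec cnj x) (?c *v y)"
      unfolding cc using sp_antisym[of "?c *v y" "map_vec cnj x"] sp_bilinear(4)[of "?c *v y" "-1" "map_vec cnj x"]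
      by (simp add: vec.scale_minus_left[of 1, simplified])
    finally show ?thesis by (simp add: weil_form_def sp_cnj cnj_simps c_real)
  qed
  fix x :: "complex^('d + 'd)" assume x0: "x \<noteq> 0"
  obtain a b where x: "x = ev \<tau> a + evbar \<tau> b" by (rule ev_cases)
  let ?b = "map_vec cnj b"
  let ?ra = "Im (bdot (map_vec cnj a) (\<tau> *v a))" and ?rb = "Im (bdot (map_vec cnj ?b) (\<tau> *v ?b))"
  have e1: "?c *v map_vec cnj x = \<i> *s evbar \<tau> (map_vec cnj a) + (- \<i>) *s ev \<tau> ?b"
    by (simp only: x cnj_simps cnj_ev cnj_evbar matrix_vector_right_distrib deligne_gr_ev deligne_gr_evbar)
  have s1: "sp (ev \<tau> a) (evbar \<tau> (map_vec cnj a)) = - 2 * \<i> * of_real ?ra"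
    using sp_ev_cnj[of \<tau> a] by (simp only: cnj_ev)
  have "sp (ev \<tau> ?b) (evbar \<tau> b) = - 2 * \<i> * of_real ?rb"
    using sp_ev_cnj[of \<tau> ?b] by (simp only: cnj_ev map_vec_cnj_cnj)
  then have s2: "sp (evbar \<tau> b) (ev \<tau> ?b) = 2 * \<i> * of_real ?rb"
    using sp_antisym[of "evbar \<tau> b" "ev \<tau> ?b"] by simp
  have "weil_form x x = of_real (2 * ?ra + 2 * ?rb)"
    unfolding weil_form_def e1 unfolding x sp_bilinear sp_ev sp_evbar s1 s2 by (simp add: algebra_simps)
  moreover have "2 * ?ra + 2 * ?rb > 0"
  proof -
    have "Im (bdot (map_vec cnj a) (\<tau> *v a)) \<ge> 0" for a
      using siegel_Im_pos[OF \<tau>, of a] by (cases "a = 0") auto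
    then have "?ra \<ge> 0" "?rb \<ge> 0" by blast+
    moreover have "a \<noteq> 0 \<or> ?b \<noteq> 0"
    proof (rule ccontr)
      assume "\<not> ?thesis"
      then have "a = 0" "b = 0" using map_vec_cnj_cnj[of b] by (auto simp: cnj_simps)
      then show False using x x0 by (simp add: ev_def evbar_def)
    qed
    ultimately show ?thesis using siegel_Im_pos[OF \<tau>, of a] siegel_Im_pos[OF \<tau>, of ?b] by linarith
  qed
  ultimately show "\<exists>r>0. weil_form x x = of_real r" by blast
qed

text \<open>Moving g across \<open>sp\<close> gives \<mu> times its inverse, the conjugation in the
  second argument replaces g by its complex conjugate, and moving the result past the Weil operator
  c conjugates it by c; the minus sign is c^-1 = - c. The adjoint is thus built from operations
  under which \<open>G_alpha\<close> is stable.\<close>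

lemma weil_form_adj:
  assumes g: "invertible g" "\<And>x y. sp (g *v x) (g *v y) = \<mu> * sp x y"
  shows "weil_form (g *v x) y = weil_form x ((mat (- cnj \<mu>) ** (deligne_gr \<tau> \<i> (- \<i>) ** matrix_inv (map_mat cnj g) ** deligne_gr \<tau> \<i> (- \<i>))) *v y)"
proof -
  let ?c = "deligne_gr \<tau> \<i> (- \<i>)"
  have c_real: "map_mat cnj ?c = ?c" by (simp add: cnj_deligne_gr)
  have inv: "map_mat cnj (matrix_inv (map_mat cnj g)) = matrix_inv g"
    using map_mat_matrix_inv[OF field_aut_cnj g(1)] by simp
  have cc: "?c *v (?c *v v) = - v" for v
    by (simp add: matrix_vector_mul_assoc deligne_gr_mult deligne_gr_scalar)
  have "?c *v map_vec cnj ((mat (- cnj \<mu>) ** (?c ** matrix_inv (map_mat cnj g) ** ?c)) *v y) =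
     \<mu> *s (matrix_inv g *v (?c *v map_vec cnj y))"
    by (simp add: cnj_simps matrix_vector_mul_assoc[symmetric] inv c_real cc)
  moreover have "sp (g *v x) (?c *v map_vec cnj y) = \<mu> * sp x (matrix_inv g *v (?c *v map_vec cnj y))"
  proof -
    have "g *v (matrix_inv g *v w) = w" for w
      by (simp add: matrix_vector_mul_assoc matrix_inv_right[OF g(1)])
    then show ?thesis using g(2)[of x "matrix_inv g *v (?c *v map_vec cnj y)"] by simp
  qed
  ultimately show ?thesis by (simp add: weil_form_def sp_bilinear)
qed

end

section \<open>Unipotent radical, centre and Cartan involution\<close>

lemma unipotent_blk:
  assumes "unipotent_mat (blk m x z g y)" shows "unipotent_mat g" "m = 1"
proof -
  let ?A = "blk m x z g y"
  obtain k where k: "((\<lambda>B. (?A - mat 1) ** B) ^^ k) (mat 1) = 0"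
    using assms by (auto simp: unipotent_mat_def)
  have pow: "((\<lambda>B. N ** B) ^^ j) (mat 1) *v v = ((\<lambda>y. N *v y) ^^ j) v" for N :: "complex^'n^'n" and j v
    by (induction j) (simp_all add: matrix_vector_mul_assoc[symmetric])
  have N: "(?A - mat 1) *v vec3 a b 0 = vec3 ((m - 1) * a + bdot x b) ((g - mat 1) *v b) 0" for a b
    by (simp add: matrix_vector_mult_diff_rdistrib algebra_simps)
  have "\<exists>a'. ((\<lambda>v. (?A - mat 1) *v v) ^^ j) (vec3 a b 0) = vec3 a' (((\<lambda>v. (g - mat 1) *v v) ^^ j) b) 0" for j a b
    by (induction j) (auto simp: N)
  then have "((\<lambda>v. (g - mat 1) *v v) ^^ k) b = 0" for b
    using k by (metis pow matrix_vector_mult_0 vec3_eq vec3_zero)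
  then have "((\<lambda>B. (g - mat 1) ** B) ^^ k) (mat 1) = 0" by (intro matrix_eqI) (simp add: pow)
  then show "unipotent_mat g" unfolding unipotent_mat_def by blast
  have "((\<lambda>v. (?A - mat 1) *v v) ^^ j) (vec3 1 0 0) = vec3 ((m - 1) ^ j) 0 0" for j
    by (induction j) (auto simp: N)
  then have "(m - 1) ^ k = 0" using k by (metis pow matrix_vector_mult_0 vec3_eq vec3_zero)
  then show "m = 1" by simp
qed

lemma mult_scalar: "multiplier (mat t) = t ^ 2"
  by (rule multiplier_eq) (simp add: power2_eq_square mat_times, metis mat_commute matrix_mul_assoc)

lemma levi_mult:
  assumes "g \<in> G_alpha \<alpha>" "h \<in> G_alpha \<alpha>" shows "levi g ** levi h = levi (g ** h)"
  by (simp add: levi_def G_alpha_mult[OF assms])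

text \<open>The homomorphism attached to \<open>pt \<tau> 0 0 0\<close>, whose mixed Hodge structure
  is split; \<open>D_hom_act\<close> proves that it agrees with \<open>hodge_hom\<close>.\<close>

definition x0 :: "complex^'d^'d \<Rightarrow> complex \<Rightarrow> complex \<Rightarrow> complex^('d::finite ix)^('d ix)" where
  "x0 \<tau> z1 z2 = (if z1 = 0 \<or> z2 = 0 then 0 else blk (z1 * z2) 0 0 (deligne_gr \<tau> z1 z2) 0)"

locale shimura = p_group \<alpha> G for \<alpha> :: "int^('d::finite + 'd)^('d + 'd)" and G +
  fixes \<tau> :: "complex^'d^'d"
  assumes \<tau>: "\<tau> \<in> siegel" and comp: "compatible \<tau> (cim \<alpha>)"
begin

abbreviation W where "W \<equiv> u_part G"
abbreviation U where "U \<equiv> U_grp \<inter> G"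
abbreviation Ga where "Ga \<equiv> G_alpha \<alpha>"
abbreviation h where "h \<equiv> deligne_gr \<tau>"

sublocale H: pos_form "weil_form \<tau>" by (rule pos_form_weil_form[OF \<tau>])

lemmas Ga = mat_group_closed[OF G_alpha_group[of \<alpha>]]
lemmas GG = mat_group_closed[OF G_group]

lemma h_Ga: "z1 \<noteq> 0 \<Longrightarrow> z2 \<noteq> 0 \<Longrightarrow> h z1 z2 \<in> Ga"
  and mult_h: "z1 \<noteq> 0 \<Longrightarrow> z2 \<noteq> 0 \<Longrightarrow> multiplier (h z1 z2) = z1 * z2"
  using deligne_gr_G_alpha[OF \<tau> comp] deligne_gr_G_full(2)[OF \<tau> comp] by blast+

lemma scalar_Ga: "t \<noteq> 0 \<Longrightarrow> mat t \<in> Ga"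
  using h_Ga[of t t] by (simp add: deligne_gr_scalar[OF \<tau>])

lemma x0_levi: "z1 \<noteq> 0 \<Longrightarrow> z2 \<noteq> 0 \<Longrightarrow> x0 \<tau> z1 z2 = levi (h z1 z2)"
  by (simp add: x0_def levi_def mult_h)

lemma x0_G: "z1 \<noteq> 0 \<Longrightarrow> z2 \<noteq> 0 \<Longrightarrow> x0 \<tau> z1 z2 \<in> G"
  using levi_G h_Ga x0_levi by metis

lemma g_of_mult: "A \<in> G \<Longrightarrow> B \<in> G \<Longrightarrow> g_of (A ** B) = g_of A ** g_of B"
  using G_cases[of A] G_cases[of B] by auto

lemma g_of_inv: assumes "A \<in> G" shows "g_of (matrix_inv A) = matrix_inv (g_of A)"
proof -
  have "g_of A ** g_of (matrix_inv A) = mat 1"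
    using g_of_mult[OF assms GG(3)[OF assms]] GG(4)[OF assms] by (simp add: matrix_inv_right blk_1)
  then have "matrix_inv (g_of A) = g_of (matrix_inv A)" by (rule matrix_inv_eqI)
  then show ?thesis by simp
qed

lemma g_of_levi [simp]: "g_of (levi g) = g" by (simp add: levi_def)

lemma W_iff: "A \<in> W \<longleftrightarrow> A \<in> G \<and> g_of A = mat 1"
  unfolding u_part_def using mu_of_G by auto

lemma W_group: "mat_group W"
proof (rule mat_groupI)
  show "mat 1 \<in> W" using G_ne by (simp add: W_iff blk_1)
  show "invertible A" if "A \<in> W" for A using that GG(4) W_iff by blast
  show "matrix_inv A ** B \<in> W" if "A \<in> W" "B \<in> W" for A B
    using that GG(2,3) by (auto simp: W_iff g_of_mult g_of_inv matrix_inv_eqI(1))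
qed

lemma closed_G: obtains Z where "closedin zariski Z" "G = Z \<inter> {A. invertible A}"
  using alg_group_over_QD(1)[OF G_Q] unfolding alg_group_def by blast

lemma closed_Ga: obtains Z where "closedin zariski Z" "Ga = Z \<inter> {A. invertible A}"
  using alg_group_over_QD(1)[OF G_alpha_over_Q[of \<alpha>]] unfolding alg_group_def by blast

lemma alg_group_over_Q_sub:
  assumes mg: "mat_group H" and H: "H = {A \<in> G. Q A}" and cl: "closedin zariski {A. Q A}"
    and aut: "\<And>s A. field_aut s \<Longrightarrow> A \<in> G \<Longrightarrow> Q A \<Longrightarrow> Q (map_mat s A)"
  shows "alg_group_over_Q H"
proof (rule alg_group_over_QI)
  obtain Z where "closedin zariski Z" "G = Z \<inter> {A. invertible A}" by (rule closed_G)
  then show "alg_group H"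
    by (intro alg_groupI[OF mg, of "Z \<inter> {A. Q A}"]) (auto simp: H intro: cl)
qed (use aut alg_group_over_QD(3)[OF G_Q] in \<open>auto simp: H\<close>)

lemma map_mat_g_of: "g_of (map_mat s A) = map_mat s (g_of A)"
  by (simp add: g_of_def map_mat_def vec_eq_iff)

lemma W_over_Q: "alg_group_over_Q W"
proof (rule alg_group_over_Q_sub[OF W_group, of "\<lambda>A. g_of A = mat 1"])
  show "closedin zariski {A. g_of A = (mat 1 :: complex^('d + 'd)^('d + 'd))}"
    by (intro closedin_zariski_eq_map poly_map_of_intros)
qed (auto simp: W_iff map_mat_g_of field_aut_props)

lemma U_iff: "A \<in> U \<longleftrightarrow> A \<in> G \<and> A = blk 1 0 (z_of A) (mat 1) 0"
proof
  assume "A \<in> U" then show "A \<in> G \<and> A = blk 1 0 (z_of A) (mat 1) 0" by (auto simp: U_grp_def)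
next
  assume "A \<in> G \<and> A = blk 1 0 (z_of A) (mat 1) 0"
  then show "A \<in> U" unfolding U_grp_def by blast
qed

lemma U_group: "mat_group U"
proof (rule mat_groupI)
  have "blk 1 0 0 (mat 1) 0 \<in> U_grp" unfolding U_grp_def by blast
  then show "mat 1 \<in> U" using G_ne blk_1 by (metis IntI)
  show "invertible A" if "A \<in> U" for A using that GG(4) by blast
  fix A B assume AB: "A \<in> U" "B \<in> U"
  then obtain z z' where z: "A = blk 1 0 z (mat 1) 0" "B = blk 1 0 z' (mat 1) 0" by (auto simp: U_grp_def)
  have "matrix_inv (mat 1) = (mat 1 :: complex^('d + 'd)^('d + 'd))" by (rule matrix_inv_eqI) simp
  then have "matrix_inv A ** B = blk 1 0 (z' - z) (mat 1) 0" unfolding z by (simp add: blk_inv)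
  moreover have "matrix_inv A ** B \<in> G" using AB GG(2,3) by blast
  ultimately show "matrix_inv A ** B \<in> U" by (auto simp: U_grp_def)
qed

lemma U_over_Q: "alg_group_over_Q U"
proof (rule alg_group_over_Q_sub[OF U_group])
  show "U = {A \<in> G. A = blk 1 0 (z_of A) (mat 1) 0}" using U_iff by blast
  show "closedin zariski {A. A = blk 1 0 (z_of A) (mat 1) (0 :: complex^('d + 'd))}"
    by (intro closedin_zariski_eq_map poly_map_of_intros polyfuns.const)
  fix s :: "complex \<Rightarrow> complex" and A :: "complex^('d ix)^('d ix)" assume s: "field_aut s" and "A = blk 1 0 (z_of A) (mat 1) 0"
  then have "map_mat s A = map_mat s (blk 1 0 (z_of A) (mat 1) 0)" by simp
  then have "map_mat s A = blk 1 0 (s (z_of A)) (mat 1) 0"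
    using s by (simp add: field_aut_props map_vec_linear)
  then show "map_mat s A = blk 1 0 (z_of (map_mat s A)) (mat 1) 0" by simp
qed

lemma U_W: "U \<subseteq> W"
  by (auto simp: W_iff U_grp_def)

lemma normal_W: "normal_in W G"
  unfolding normal_in_def
  using GG(2,3) by (auto simp: W_iff g_of_mult g_of_inv Ga(4)[OF g_of_G] matrix_inv_right)

lemma normal_U: "normal_in U G"
  unfolding normal_in_def
proof (intro conjI ballI)
  fix A B assume A: "A \<in> G" and B: "B \<in> U"
  obtain x z g y where Ab: "A = blk (multiplier g) x z g y" "g \<in> Ga" using G_cases[OF A] by blast
  obtain z' where Bb: "B = blk 1 0 z' (mat 1) 0" using B by (auto simp: U_grp_def)
  have "A ** B = blk 1 0 (multiplier g * z') (mat 1) 0 ** A" unfolding Ab Bb by (simp add: add.commute)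
  then have "A ** B ** matrix_inv A = blk 1 0 (multiplier g * z') (mat 1) 0 ** (A ** matrix_inv A)"
    by (simp add: matrix_mul_assoc)
  then have "A ** B ** matrix_inv A = blk 1 0 (multiplier g * z') (mat 1) 0"
    using GG(4)[OF A] by (simp add: matrix_inv_right)
  moreover have "A ** B ** matrix_inv A \<in> G" using A B GG(2,3) by blast
  ultimately show "A ** B ** matrix_inv A \<in> U" by (auto simp: U_grp_def)
qed auto

lemma W_cases: assumes "A \<in> W" obtains x z y where "A = blk 1 x z (mat 1) y"
  using assms G_cases[of A] by (auto simp: W_iff)

lemma connected_W: "connectedin zariski W"
proof -
  define S where "S A = (\<lambda>t. blk 1 (t *s x_of A) (t ^ 2 * z_of A) (mat 1) (t *s y_of A)) ` UNIV" for A :: "complex^('d ix)^('d ix)"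
  have SA: "connectedin zariski (S A) \<and> mat 1 \<in> S A \<and> A \<in> S A \<and> S A \<subseteq> W" if A: "A \<in> W" for A
  proof -
    obtain x z y where Ab: "A = blk 1 x z (mat 1) y" using W_cases[OF A] .
    have "blk 1 (t *s x) (t ^ 2 * z) (mat 1) (t *s y) \<in> G" for t
      using A scale_G unfolding W_iff Ab by blast
    then have "S A \<subseteq> W" unfolding S_def Ab by (auto simp: W_iff)
    moreover have "mat 1 \<in> S A" unfolding S_def by (auto simp: blk_1 intro!: image_eqI[of _ _ 0])
    moreover have "A \<in> S A" unfolding S_def Ab by (auto intro!: image_eqI[of _ _ 1])
    moreover have "connectedin zariski (S A)" unfolding S_def by (rule connectedin_segment_zariski)
    ultimately show ?thesis by blast
  qed
  have "connectedin zariski (\<Union>(S ` W))"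
    by (rule connectedin_Union) (use SA mat_group_closed(1)[OF W_group] in auto)
  moreover have "\<Union>(S ` W) = W" using SA by blast
  ultimately show ?thesis by simp
qed

lemma adj_Ga:
  assumes g: "g \<in> Ga"
  defines "g' \<equiv> mat (- cnj (multiplier g)) ** (h \<i> (- \<i>) ** matrix_inv (map_mat cnj g) ** h \<i> (- \<i>))"
  shows "H.adj g g'" "g' \<in> Ga"
proof -
  have "\<And>x y. sp (g *v x) (g *v y) = multiplier g * sp x y"
    using G_alphaD(3)[OF g] sp_similitude GSp_iff by blast
  then show "H.adj g g'" unfolding H.adj_def g'_def using weil_form_adj[OF \<tau> Ga(4)[OF g]] by blast
  have "map_mat cnj g \<in> Ga" using alg_group_over_QD(3)[OF G_alpha_over_Q field_aut_cnj g] .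
  then show "g' \<in> Ga"
    unfolding g'_def using G_alphaD(2)[OF g] by (intro Ga(2,3) scalar_Ga h_Ga) auto
qed

lemma unipotent_radical: "unipotent_radical W G"
  unfolding unipotent_radical_def
proof (intro conjI allI impI)
  have uni: "unipotent_mat A" if "A \<in> W" for A
  proof -
    obtain x z y where Ab: "A = blk 1 x z (mat 1) y" using W_cases[OF \<open>A \<in> W\<close>] .
    have N: "(A - mat 1) *v vec3 a b c = vec3 (bdot x b + z * c) (c *s y) 0" for a b c
      unfolding Ab by (simp add: matrix_vector_mult_diff_rdistrib algebra_simps)
    \<comment> \<open>A - 1 lowers the three-step weight filtration, hence its cube is 0.\<close>
    have "(A - mat 1) ** ((A - mat 1) ** ((A - mat 1) ** mat 1)) = 0"
      by (rule matrix_eqI, rule_tac v=x in vec3_cases)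
         (simp add: matrix_vector_mul_assoc[symmetric] N)
    then show ?thesis unfolding unipotent_mat_def
      by (intro exI[of _ 3]) (simp add: numeral_3_eq_3)
  qed
  then show "normal_unipotent W G"
    unfolding normal_unipotent_def using alg_group_over_QD(1)[OF W_over_Q] connected_W normal_W by blast
  fix N assume N: "normal_unipotent N G"
  then have NG: "N \<subseteq> G" and Nn: "\<And>A B. A \<in> G \<Longrightarrow> B \<in> N \<Longrightarrow> A ** B ** matrix_inv A \<in> N"
    and Nu: "\<And>A. A \<in> N \<Longrightarrow> unipotent_mat A" and Ng: "mat_group N"
    by (auto simp: normal_unipotent_def normal_in_def alg_group_def)
  show "N \<subseteq> W"
  proof
    fix A assume A: "A \<in> N"
    then have AG: "A \<in> G" using NG by blast
    have ug: "unipotent_mat (g_of B)" if B: "B \<in> N" for B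
    proof -
      obtain x z g y where "B = blk (multiplier g) x z g y" using G_cases[OF subsetD[OF NG B]] by blast
      then show ?thesis using Nu[OF B] unipotent_blk(1) by auto
    qed
    let ?g = "g_of A"
    have g: "?g \<in> Ga" using g_of_G[OF AG] .
    obtain g' where g': "H.adj ?g g'" "g' \<in> Ga" using adj_Ga[OF g] by blast
    let ?B = "levi g'"
    have B: "?B \<in> G" using levi_G[OF g'(2)] .
    \<comment> \<open>The commutator of A with a lift of the adjoint of its image. It lies in N, so
      its image is unipotent, as \<open>unipotent_commutator\<close> requires.\<close>
    let ?C = "A ** (?B ** matrix_inv A ** matrix_inv ?B)"
    have "?C \<in> N" using Nn[OF B mat_group_closed(3)[OF Ng A]] mat_group_closed(2)[OF Ng A] by blast
    from ug[OF this] have "unipotent_mat (?g ** (g' ** matrix_inv ?g ** matrix_inv g'))"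
      using AG B GG(2,3) by (simp add: g_of_mult g_of_inv)
    then have "?g = mat 1"
      using H.unipotent_commutator[OF g'(1) Ga(4)[OF g] Ga(4)[OF g'(2)] ug[OF A]] by (simp add: matrix_mul_assoc)
    then show "A \<in> W" using AG W_iff by blast
  qed
qed

text \<open>W is the kernel of \<open>g_of\<close> on G, and \<open>g_of\<close> maps G onto
  \<open>G_alpha\<close>; so commuting modulo W means commuting in \<open>G_alpha\<close>.\<close>

lemma centre_mod_eq: "centre_mod G W = {Z \<in> G. \<forall>g\<in>Ga. g_of Z ** g = g ** g_of Z}"
proof (intro subset_antisym subsetI)
  fix Z assume "Z \<in> centre_mod G W"
  then have Z: "Z \<in> G" "\<And>A. A \<in> G \<Longrightarrow> Z ** A ** matrix_inv Z ** matrix_inv A \<in> W" by (auto simp: centre_mod_def)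
  have "g_of Z ** g = g ** g_of Z" if g: "g \<in> Ga" for g
  proof -
    have "g_of (Z ** levi g ** matrix_inv Z ** matrix_inv (levi g)) = mat 1"
      using Z(2)[OF levi_G[OF g]] W_iff by blast
    then have e: "g_of Z ** g ** matrix_inv (g_of Z) ** matrix_inv g = mat 1"
      using Z(1) levi_G[OF g] GG(2,3) by (simp add: g_of_mult g_of_inv)
    have "g_of Z ** g = (g_of Z ** g ** matrix_inv (g_of Z) ** matrix_inv g) ** (g ** g_of Z)"
      using matrix_inv_left[OF Ga(4)[OF g]] matrix_inv_left[OF Ga(4)[OF g_of_G[OF Z(1)]]]
      by (metis matrix_mul_assoc matrix_mul_rid)
    then show ?thesis by (simp add: e)
  qed
  then show "Z \<in> {Z \<in> G. \<forall>g\<in>Ga. g_of Z ** g = g ** g_of Z}" using Z(1) by blast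
next
  fix Z assume "Z \<in> {Z \<in> G. \<forall>g\<in>Ga. g_of Z ** g = g ** g_of Z}"
  then have Z: "Z \<in> G" "\<And>g. g \<in> Ga \<Longrightarrow> g_of Z ** g = g ** g_of Z" by auto
  have "Z ** A ** matrix_inv Z ** matrix_inv A \<in> W" if A: "A \<in> G" for A
  proof -
    have "g_of (Z ** A ** matrix_inv Z ** matrix_inv A) = g_of A ** (g_of Z ** matrix_inv (g_of Z)) ** matrix_inv (g_of A)"
      using Z A GG(2,3) by (simp add: g_of_mult g_of_inv g_of_G matrix_mul_assoc)
    also have "\<dots> = mat 1"
      using matrix_inv_right[OF Ga(4)[OF g_of_G[OF A]]] matrix_inv_right[OF Ga(4)[OF g_of_G[OF Z(1)]]] by simp
    finally show ?thesis using Z(1) A GG(2,3) by (simp add: W_iff)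
  qed
  then show "Z \<in> centre_mod G W" using Z(1) by (simp add: centre_mod_def)
qed

lemma compact_unitary_Ga: "compact {g \<in> Ga. \<forall>x y. weil_form \<tau> (g *v x) (g *v y) = weil_form \<tau> x y}"
proof -
  obtain Z where Z: "closedin zariski Z" "Ga = Z \<inter> {A. invertible A}" by (rule closed_Ga)
  let ?K = "{g. \<forall>x y. weil_form \<tau> (g *v x) (g *v y) = weil_form \<tau> x y}"
  have "invertible g" if "g \<in> ?K" for g
  proof -
    have "x = 0" if "g *v x = 0" for x
    proof -
      have "weil_form \<tau> (g *v x) (g *v x) = weil_form \<tau> x x" using \<open>g \<in> ?K\<close> by blast
      then show ?thesis using that by simp
    qed
    then show ?thesis using matrix_left_invertible_ker[of g] matrix_inv_eqI(2) matrix_left_right_inverse by metis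
  qed
  then have "{g \<in> Ga. \<forall>x y. weil_form \<tau> (g *v x) (g *v y) = weil_form \<tau> x y} = ?K \<inter> Z" using Z(2) by auto
  then show ?thesis using compact_Int_closed[OF H.compact_unitary closed_zariski[OF Z(1)]] by simp
qed

text \<open>The adjoint g' of the image g of A is, up to a scalar, the inverse of the twisted
  conjugate of g. If A is fixed by the twisted conjugation modulo the centre, then g' g is therefore
  central. In the polar decomposition of g the positive factor is then central too, and the unitary
  factor ranges over a compact set.\<close>

lemma cartan: "cartan_mod G W (x0 \<tau> \<i> (- \<i>))"
  unfolding cartan_mod_def
proof (intro conjI exI[of _ "levi ` {g \<in> Ga. \<forall>x y. weil_form \<tau> (g *v x) (g *v y) = weil_form \<tau> x y}"])
  let ?c = "x0 \<tau> \<i> (- \<i>)" and ?k = "h \<i> (- \<i>)"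
  have c: "?c = levi ?k" "?c \<in> G" and k: "?k \<in> Ga" using x0_levi x0_G h_Ga by auto
  have kk: "?k ** ?k = mat (-1)" by (simp add: deligne_gr_mult[OF \<tau>] deligne_gr_scalar[OF \<tau>])
  show "?c ** ?c \<in> centre_mod G W"
    unfolding centre_mod_eq using c k GG(2) by (auto simp: g_of_mult kk mat_commute)
  show "compact (levi ` {g \<in> Ga. \<forall>x y. weil_form \<tau> (g *v x) (g *v y) = weil_form \<tau> x y})"
    by (rule compact_continuous_image[OF continuous_on_poly_map[OF poly_map_levi] compact_unitary_Ga])
  show "levi ` {g \<in> Ga. \<forall>x y. weil_form \<tau> (g *v x) (g *v y) = weil_form \<tau> x y} \<subseteq> G" using levi_G by blast
  show "{A \<in> G. matrix_inv A ** (?c ** map_mat cnj A ** matrix_inv ?c) \<in> centre_mod G W}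
      \<subseteq> mat_prods (levi ` {g \<in> Ga. \<forall>x y. weil_form \<tau> (g *v x) (g *v y) = weil_form \<tau> x y}) (centre_mod G W)"
  proof
    fix A assume "A \<in> {A \<in> G. matrix_inv A ** (?c ** map_mat cnj A ** matrix_inv ?c) \<in> centre_mod G W}"
    then have A: "A \<in> G" and s_centre: "matrix_inv A ** (?c ** map_mat cnj A ** matrix_inv ?c) \<in> centre_mod G W" by auto
    let ?g = "g_of A"
    have g: "?g \<in> Ga" using g_of_G[OF A] .
    define s where "s = matrix_inv ?g ** (?k ** map_mat cnj ?g ** matrix_inv ?k)"
    have cA: "map_mat cnj A \<in> G" using alg_group_over_QD(3)[OF G_Q field_aut_cnj A] .
    have cg: "map_mat cnj ?g \<in> Ga" using alg_group_over_QD(3)[OF G_alpha_over_Q field_aut_cnj g] .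
    have "g_of (matrix_inv A ** (?c ** map_mat cnj A ** matrix_inv ?c)) = s"
      using A c cA GG(2,3) by (simp add: s_def g_of_mult g_of_inv map_mat_g_of)
    then have s_comm: "s ** g = g ** s" if "g \<in> Ga" for g
      using s_centre that unfolding centre_mod_eq by auto
    have s: "s \<in> Ga" unfolding s_def using g cg k by (intro Ga(2,3)) auto
    define g' where "g' = mat (- cnj (multiplier ?g)) ** (?k ** matrix_inv (map_mat cnj ?g) ** ?k)"
    have g': "H.adj ?g g'" "g' \<in> Ga" using adj_Ga[OF g] by (simp_all add: g'_def)
    define \<zeta> where "\<zeta> = g' ** ?g"
    have \<zeta>: "\<zeta> \<in> Ga" unfolding \<zeta>_def using g g' Ga(2) by blast
    have "\<zeta> ** s = mat (cnj (multiplier ?g))"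
    proof -
      have "\<zeta> ** s = mat (- cnj (multiplier ?g)) ** (?k ** matrix_inv (map_mat cnj ?g) ** ?k)
          ** (?g ** matrix_inv ?g) ** ?k ** map_mat cnj ?g ** matrix_inv ?k"
        by (simp add: \<zeta>_def g'_def s_def matrix_mul_assoc)
      also have "\<dots> = mat (- cnj (multiplier ?g)) ** (?k ** matrix_inv (map_mat cnj ?g) ** (?k ** ?k)
          ** map_mat cnj ?g ** matrix_inv ?k)"
        using matrix_inv_right[OF Ga(4)[OF g]] by (simp add: matrix_mul_assoc)
      also have "?k ** matrix_inv (map_mat cnj ?g) ** (?k ** ?k) ** map_mat cnj ?g ** matrix_inv ?k
          = mat (-1) ** (?k ** (matrix_inv (map_mat cnj ?g) ** map_mat cnj ?g) ** matrix_inv ?k)"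
        using mat_pull[of "?k ** matrix_inv (map_mat cnj ?g)" "-1" "map_mat cnj ?g" "matrix_inv ?k"]
        by (simp add: kk matrix_mul_assoc)
      also have "\<dots> = mat (-1)"
        using matrix_inv_left[OF Ga(4)[OF cg]] matrix_inv_right[OF Ga(4)[OF k]] by simp
      finally show ?thesis by (simp add: mat_times[symmetric])
    qed
    then have \<zeta>_eq: "\<zeta> = mat (cnj (multiplier ?g)) ** matrix_inv s"
      using matrix_inv_right[OF Ga(4)[OF s]] by (metis matrix_mul_assoc matrix_mul_rid)
    have \<zeta>_comm: "\<zeta> ** g = g ** \<zeta>" if "g \<in> Ga" for g
    proof -
      have "g ** matrix_inv s = matrix_inv s ** (s ** g) ** matrix_inv s"
        by (simp add: matrix_mul_assoc matrix_inv_left[OF Ga(4)[OF s]])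
      also have "\<dots> = matrix_inv s ** g ** (s ** matrix_inv s)"
        by (simp add: s_comm[OF that] matrix_mul_assoc)
      finally have "g ** matrix_inv s = matrix_inv s ** g"
        by (simp add: matrix_inv_right[OF Ga(4)[OF s]])
      then show ?thesis unfolding \<zeta>_eq by (metis mat_commute matrix_mul_assoc)
    qed
    have adj\<zeta>: "H.adj \<zeta> \<zeta>" unfolding \<zeta>_def by (rule H.adj_mult[OF H.adj_sym[OF g'(1)] g'(1)])
    have pos\<zeta>: "\<exists>r>0. weil_form \<tau> (\<zeta> *v x) x = of_real r" if "x \<noteq> 0" for x
    proof -
      have "weil_form \<tau> (\<zeta> *v x) x = weil_form \<tau> (?g *v x) (?g *v x)"
        using H.adj_sym[OF g'(1)] unfolding H.adj_def \<zeta>_def by (simp add: matrix_vector_mul_assoc[symmetric])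
      moreover have "?g *v x \<noteq> 0"
        using that by (metis Ga(4)[OF g] matrix_inv_left matrix_vector_mul_assoc matrix_vector_mul_lid matrix_vector_mult_0_right)
      ultimately show ?thesis using H.H_pos by simp
    qed
    obtain \<gamma> where \<gamma>: "\<gamma> 1 = \<zeta>" "\<gamma> 0 = mat 1" "\<And>s t. \<gamma> (s + t) = \<gamma> s ** \<gamma> t" "\<And>s. H.adj (\<gamma> s) (\<gamma> s)"
      "\<And>i j. (\<lambda>s. \<gamma> s $ i $ j) \<in> expsums"
      using H.real_powers[OF adj\<zeta> pos\<zeta>] by blast
    obtain Z where Z: "closedin zariski Z" "Ga = Z \<inter> {A. invertible A}" by (rule closed_Ga)
    \<comment> \<open>Lying in Z and centralising \<open>G_alpha\<close> are imposed together, so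
      that all real powers of \<zeta> become central in \<open>G_alpha\<close>; their invertibility
      is recovered from the opposite power.\<close>
    let ?Z = "Z \<inter> {A. \<forall>g. g \<in> Ga \<longrightarrow> A ** g = g ** A}"
    have "closedin zariski ?Z"
      by (intro closedin_Int Z(1) closedin_zariski_all closedin_zariski_imp closedin_zariski_eq_map poly_map_intros)
    moreover have "\<gamma> (real n) \<in> Ga \<and> (\<forall>g. g \<in> Ga \<longrightarrow> \<gamma> (real n) ** g = g ** \<gamma> (real n))" for n
    proof (induction n)
      case 0 show ?case using Ga(1) by (simp add: \<gamma>(2))
    next
      case (Suc n)
      have e: "\<gamma> (real (Suc n)) = \<gamma> (real n) ** \<zeta>" using \<gamma>(3)[of "real n" 1] by (simp add: \<gamma>(1) add.commute)
      show ?case unfolding e using Suc \<zeta> \<zeta>_comm Ga(2) by (metis matrix_mul_assoc)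
    qed
    then have "\<gamma> (real n) \<in> ?Z" for n using Z(2) by blast
    ultimately have rZ: "\<gamma> t \<in> ?Z" for t using zariski_closed_expsums[OF _ \<gamma>(5)] by blast
    have inv: "\<gamma> (- t) ** \<gamma> t = mat 1" "\<gamma> t ** \<gamma> (- t) = mat 1" for t
      using \<gamma>(3)[of "- t" t] \<gamma>(3)[of t "- t"] by (simp_all add: \<gamma>(2))
    have rGa: "\<gamma> t \<in> Ga" for t using rZ[of t] matrix_inv_eqI(2)[OF inv(2)] Z(2) by blast
    \<comment> \<open>The square root of \<zeta> and its inverse; u below is the unitary factor of
      the polar decomposition.\<close>
    let ?r = "\<gamma> (1/2)" and ?ri = "\<gamma> (- (1/2))"
    define u where "u = ?g ** ?ri"
    have uGa: "u \<in> Ga" unfolding u_def using g rGa Ga(2) by blast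
    have uu: "weil_form \<tau> (u *v x) (u *v y) = weil_form \<tau> x y" for x y
    proof -
      have "weil_form \<tau> (u *v x) (u *v y) = weil_form \<tau> (?ri *v x) (\<zeta> *v (?ri *v y))"
        using g'(1) unfolding H.adj_def u_def \<zeta>_def by (simp add: matrix_vector_mul_assoc[symmetric])
      also have "\<zeta> ** ?ri = ?r" using \<gamma>(3)[of 1 "- (1/2)"] by (simp add: \<gamma>(1))
      then have "\<zeta> *v (?ri *v y) = ?r *v y" by (simp add: matrix_vector_mul_assoc)
      also have "weil_form \<tau> (?ri *v x) (?r *v y) = weil_form \<tau> (?r *v (?ri *v x)) y" using \<gamma>(4) unfolding H.adj_def by simp
      also have "?r *v (?ri *v x) = x" by (simp add: matrix_vector_mul_assoc inv)
      finally show ?thesis .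
    qed
    have lu: "levi u \<in> G" using levi_G[OF uGa] .
    have "A = levi u ** (matrix_inv (levi u) ** A)"
      using matrix_inv_right[OF GG(4)[OF lu]] by (simp add: matrix_mul_assoc)
    moreover have "matrix_inv (levi u) ** A \<in> centre_mod G W"
    proof -
      have "matrix_inv u ** ?g = ?r"
      proof -
        have "u ** ?r = ?g" unfolding u_def by (simp add: matrix_mul_assoc[symmetric] inv)
        then show ?thesis using matrix_inv_left[OF Ga(4)[OF uGa]] by (metis matrix_mul_assoc matrix_mul_lid)
      qed
      then have "g_of (matrix_inv (levi u) ** A) = ?r" using lu A GG(3) by (simp add: g_of_mult g_of_inv)
      then show ?thesis unfolding centre_mod_eq using rZ[of "1/2"] lu A GG(2,3) by auto
    qed
    ultimately show "A \<in> mat_prods (levi ` {g \<in> Ga. \<forall>x y. weil_form \<tau> (g *v x) (g *v y) = weil_form \<tau> x y}) (centre_mod G W)"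
      unfolding mat_prods_def using uGa uu by blast
  qed
qed

end

section \<open>The connected centre: split and compact part\<close>

context shimura
begin

abbreviation Z where "Z \<equiv> centre_mod G W"

lemma centre_mod_over_Q: "alg_group_over_Q Z"
proof (rule alg_group_over_Q_sub[OF _ centre_mod_eq])
  show "mat_group Z" unfolding centre_mod_eq
  proof (rule mat_groupI)
    show "mat 1 \<in> {Z \<in> G. \<forall>g\<in>Ga. g_of Z ** g = g ** g_of Z}" using G_ne by (simp add: blk_1)
    show "invertible A" if "A \<in> {Z \<in> G. \<forall>g\<in>Ga. g_of Z ** g = g ** g_of Z}" for A using that GG(4) by blast
    fix A B assume "A \<in> {Z \<in> G. \<forall>g\<in>Ga. g_of Z ** g = g ** g_of Z}" "B \<in> {Z \<in> G. \<forall>g\<in>Ga. g_of Z ** g = g ** g_of Z}"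
    then have A: "A \<in> G" "\<And>g. g \<in> Ga \<Longrightarrow> g_of A ** g = g ** g_of A"
      and B: "B \<in> G" "\<And>g. g \<in> Ga \<Longrightarrow> g_of B ** g = g ** g_of B" by auto
    let ?a = "g_of A" and ?b = "g_of B"
    have a: "?a ** matrix_inv ?a = mat 1" "matrix_inv ?a ** ?a = mat 1"
      using Ga(4)[OF g_of_G[OF A(1)]] by (simp_all add: matrix_inv_right matrix_inv_left)
    have "matrix_inv ?a ** ?b ** g = g ** (matrix_inv ?a ** ?b)" if g: "g \<in> Ga" for g
    proof -
      have "matrix_inv ?a ** g = matrix_inv ?a ** (g ** ?a) ** matrix_inv ?a" by (simp add: matrix_mul_assoc[symmetric] a)
      also have "\<dots> = (matrix_inv ?a ** ?a) ** g ** matrix_inv ?a" by (simp add: A(2)[OF g, symmetric] matrix_mul_assoc)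
      finally have "matrix_inv ?a ** g = g ** matrix_inv ?a" by (simp add: a)
      then show ?thesis using B(2)[OF g] by (metis matrix_mul_assoc)
    qed
    then show "matrix_inv A ** B \<in> {Z \<in> G. \<forall>g\<in>Ga. g_of Z ** g = g ** g_of Z}"
      using A(1) B(1) GG(2,3) by (simp add: g_of_mult g_of_inv)
  qed
  have "closedin zariski {A. \<forall>g. g \<in> Ga \<longrightarrow> g_of A ** g = g ** g_of A}"
    by (intro closedin_zariski_all closedin_zariski_imp closedin_zariski_eq_map poly_map_of_intros)
  then show "closedin zariski {A. \<forall>g\<in>Ga. g_of A ** g = g ** g_of A}" by (simp add: Ball_def)
  fix s :: "complex \<Rightarrow> complex" and A :: "complex^('d ix)^('d ix)"
  assume s: "field_aut s" and A: "\<forall>g\<in>Ga. g_of A ** g = g ** g_of A"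
  show "\<forall>g\<in>Ga. g_of (map_mat s A) ** g = g ** g_of (map_mat s A)"
  proof
    fix g assume g: "g \<in> Ga"
    \<comment> \<open>As s permutes \<open>G_alpha\<close>, commuting with g after applying s
      amounts to commuting with the preimage of g before.\<close>
    have "map_mat (inv s) g \<in> Ga" using alg_group_over_QD(3)[OF G_alpha_over_Q field_aut_inv[OF s] g] .
    then have "map_mat s (g_of A ** map_mat (inv s) g) = map_mat s (map_mat (inv s) g ** g_of A)" using A by simp
    then show "g_of (map_mat s A) ** g = g ** g_of (map_mat s A)" by (simp add: map_mat_mult[OF s] s map_mat_g_of)
  qed
qed

text \<open>Lifts of the homotheties of the graded piece of weight -1; the first corner is t^2, the
  multiplier of \<open>mat t\<close>.\<close>

definition S :: "(complex^('d ix)^('d ix)) set" where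
  "S = (\<lambda>t. levi (mat t)) ` (- {0 :: complex})"

lemma levi_scalar: "levi (mat t) = blk (t ^ 2) 0 0 (mat t) 0"
  by (simp add: levi_def mult_scalar)

lemma S_centre: "S \<subseteq> Z"
  unfolding S_def centre_mod_eq using levi_G scalar_Ga by (auto simp: mat_commute)

lemma connected_S: "connectedin zariski S"
proof -
  have "connected (- {0 :: complex})" by (intro connected_punctured_universe) simp
  moreover have "continuous_on (- {0}) (\<lambda>t. mat t :: complex^('d + 'd)^('d + 'd))"
  proof (intro continuous_on_vecI)
    fix i j
    show "continuous_on (- {0}) (\<lambda>t :: complex. (mat t :: complex^('d + 'd)^('d + 'd)) $ i $ j)"
      by (cases "i = j") (simp_all add: mat_def)
  qed
  then have "continuous_on (- {0}) (\<lambda>t. levi (mat t :: complex^('d + 'd)^('d + 'd)))"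
    by (rule continuous_on_compose2[OF continuous_on_poly_map[OF poly_map_levi, of UNIV]]) auto
  ultimately show ?thesis unfolding S_def by (intro connectedin_zariski connected_continuous_image)
qed

lemma split_torus_S: "split_torus_over_Q S"
  unfolding split_torus_over_Q_def
proof (intro conjI exI[of _ "mat 1"] ballI allI impI connected_S)
  \<comment> \<open>An arbitrary diagonal entry of the middle block, from which t is read off
    polynomially.\<close>
  define t_of :: "complex^('d ix)^('d ix) \<Rightarrow> complex" where "t_of p = p $ mid_ix (Inl undefined) $ mid_ix (Inl undefined)" for p
  have t_of: "t_of (blk m x z (mat t) y) = t" for m x z t y by (simp add: t_of_def blk_def) (simp add: mat_def)
  have mg: "mat_group S"
  proof (rule mat_groupI)
    show "mat 1 \<in> S" unfolding S_def by (intro image_eqI[of _ _ 1]) (simp_all add: levi_scalar blk_1)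
    show "invertible A" if "A \<in> S" for A using that S_centre GG(4) unfolding centre_mod_eq by blast
    fix A B assume "A \<in> S" "B \<in> S"
    then obtain s t where st: "s \<noteq> 0" "t \<noteq> 0" "A = levi (mat s)" "B = levi (mat t)" unfolding S_def by auto
    have "A ** levi (mat (inverse s)) = mat 1"
      using st by (simp add: levi_mult[OF scalar_Ga scalar_Ga] mat_times[symmetric]) (simp add: levi_scalar blk_1)
    then have "matrix_inv A = levi (mat (inverse s))" by (rule matrix_inv_eqI)
    then have "matrix_inv A ** B = levi (mat (inverse s * t))"
      using st by (simp add: levi_mult[OF scalar_Ga scalar_Ga] mat_times)
    then show "matrix_inv A ** B \<in> S" unfolding S_def using st by auto
  qed
  show "alg_group_over_Q S"
  proof (rule alg_group_over_QI)
    show "alg_group S"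
    proof (rule alg_groupI[OF mg])
      have "t_of \<in> polyfuns" unfolding t_of_def by (intro polyfuns.coord)
      then show "closedin zariski {p. p = blk (t_of p * t_of p) 0 0 (mat (t_of p)) 0}"
        by (intro closedin_zariski_eq_map poly_map_of_intros polyfuns.const polyfuns.mult)
      show "S = {p. p = blk (t_of p * t_of p) 0 0 (mat (t_of p)) 0} \<inter> {A. invertible A}"
      proof (intro subset_antisym subsetI)
        fix p assume "p \<in> {p. p = blk (t_of p * t_of p) 0 0 (mat (t_of p)) 0} \<inter> {A. invertible A}"
        then have p: "p = blk (t_of p * t_of p) 0 0 (mat (t_of p)) 0" "invertible p" by auto
        then have "t_of p \<noteq> 0" using blk_invertibleD(1) by (metis mult_zero_left)
        then show "p \<in> S" unfolding S_def levi_scalar using p(1) by (intro image_eqI[of _ _ "t_of p"]) (auto simp: power2_eq_square)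
      next
        fix p assume "p \<in> S"
        then show "p \<in> {p. p = blk (t_of p * t_of p) 0 0 (mat (t_of p)) 0} \<inter> {A. invertible A}"
          using mat_group_closed(4)[OF mg] unfolding S_def levi_scalar by (auto simp: t_of power2_eq_square)
      qed
    qed
    fix s :: "complex \<Rightarrow> complex" and A assume s: "field_aut s" and "A \<in> S"
    then obtain t where t: "t \<noteq> 0" "A = levi (mat t)" unfolding S_def by auto
    have "map_mat s A = levi (mat (s t))" unfolding t levi_scalar
      by (simp add: s field_aut_props[OF s] map_vec_linear[OF s] power2_eq_square)
    then show "map_mat s A \<in> S" unfolding S_def using t field_aut_props(8)[OF s] by auto
  qed
  show "invertible (mat 1 :: complex^('d ix)^('d ix))" by simp
  show "mat 1 $ i $ j \<in> \<rat>" for i j :: "'d ix" by (simp add: mat_def)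
  fix A and i j :: "'d ix" assume "A \<in> S" "i \<noteq> j"
  then obtain t where t: "A = blk (t ^ 2) 0 0 (mat t) 0" unfolding S_def levi_scalar by auto
  have "A $ i $ j = 0"
    using ix_cases[of i] ix_cases[of j] \<open>i \<noteq> j\<close> unfolding t by (auto simp: blk_def mat_def split: if_splits)
  then show "(mat 1 ** A ** matrix_inv (mat 1)) $ i $ j = 0" using matrix_inv_eqI(1)[of "mat 1" "mat 1 :: complex^('d ix)^('d ix)"] by simp
qed

text \<open>Fixing the multiplier separates T from the homotheties, on which it is t^2; only t = 1
  and t = -1 remain in the intersection with S.\<close>

definition T where "T = {p \<in> id_component Z. mu_of p = 1}"

lemma mu_of_mult: "A \<in> G \<Longrightarrow> B \<in> G \<Longrightarrow> mu_of (A ** B) = mu_of A * mu_of B"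
  using G_cases[of A] G_cases[of B] by auto

lemma mu_of_inv: assumes "A \<in> G" shows "mu_of (matrix_inv A) = inverse (mu_of A)"
proof -
  have "mu_of A * mu_of (matrix_inv A) = 1"
    using mu_of_mult[OF assms GG(3)[OF assms]] GG(4)[OF assms] by (simp add: matrix_inv_right blk_1)
  then show ?thesis by (metis inverse_unique)
qed

lemma Z_G: "Z \<subseteq> G" by (auto simp: centre_mod_def)

lemma idZ: "id_component Z \<subseteq> Z" "alg_group_over_Q (id_component Z)"
  using id_component_subset alg_group_over_Q_id_component[OF centre_mod_over_Q] by auto

lemmas idZg = mat_group_closed[OF alg_group_over_QD(2)[OF idZ(2)]]

lemma T_over_Q: "alg_group_over_Q T"
proof (rule alg_group_over_QI)
  have TG: "A \<in> G" if "A \<in> id_component Z" for A using that idZ(1) Z_G by blast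
  have mg: "mat_group T"
  proof (rule mat_groupI)
    show "mat 1 \<in> T" unfolding T_def using idZg(1) by (simp add: blk_1)
    show "invertible A" if "A \<in> T" for A using that idZg(4) by (simp add: T_def)
    show "matrix_inv A ** B \<in> T" if "A \<in> T" "B \<in> T" for A B
      using that idZg(2,3) TG GG(3) by (simp add: T_def mu_of_mult mu_of_inv)
  qed
  obtain C where C: "closedin zariski C" "id_component Z = C \<inter> {A. invertible A}"
    using alg_group_over_QD(1)[OF idZ(2)] unfolding alg_group_def by blast
  show "alg_group T"
  proof (rule alg_groupI[OF mg])
    show "closedin zariski (C \<inter> {A. mu_of A = 1})"
      by (intro closedin_Int C(1) closedin_zariski_eq poly_map_of polyfuns.const)
    show "T = C \<inter> {A. mu_of A = 1} \<inter> {A. invertible A}" using C(2) by (auto simp: T_def)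
  qed
  show "map_mat s A \<in> T" if "field_aut s" "A \<in> T" for s A
    using that alg_group_over_QD(3)[OF idZ(2)] by (simp add: T_def mu_of_def map_mat_def field_aut_props)
qed

lemma W_T: "W \<subseteq> T"
proof -
  have "W \<subseteq> Z" unfolding centre_mod_eq by (auto simp: W_iff)
  then have "W \<subseteq> id_component Z"
    by (intro id_component_maximal connected_W mat_group_closed(1)[OF W_group])
  then show ?thesis by (auto simp: T_def u_part_def)
qed

text \<open>Dividing by the homothety for a square root of the multiplier moves an element of the
  connected centre into T. The image of a real element of T commutes with the Weil operator and has
  multiplier 1, so its adjoint is its inverse: it is unitary, and the unitary elements form a
  compact set.\<close>

lemma centre_split_compact: "centre_split_compact G W"
  unfolding centre_split_compact_def
proof (rule exI[of _ S], rule exI[of _ T], intro conjI split_torus_S T_over_Q W_T)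
  have S1: "mat 1 \<in> S"
    using mat_group_closed(1) split_torus_S alg_group_over_QD(2) unfolding split_torus_over_Q_def by blast
  have SZ: "S \<subseteq> id_component Z" by (rule id_component_maximal[OF connected_S S_centre S1])
  have ZG: "A \<in> G" if "A \<in> id_component Z" for A using that idZ(1) Z_G by blast
  show "mat_prods S T = id_component Z"
  proof (intro subset_antisym subsetI)
    fix p assume "p \<in> mat_prods S T"
    then show "p \<in> id_component Z" unfolding mat_prods_def T_def using SZ idZg(2) by blast
  next
    fix p assume p: "p \<in> id_component Z"
    have "mu_of p \<noteq> 0" using mu_of_G[OF ZG[OF p]] G_alphaD(2)[OF g_of_G[OF ZG[OF p]]] by simp
    then have t: "csqrt (mu_of p) \<noteq> 0" by simp
    let ?s = "levi (mat (csqrt (mu_of p))) :: complex^('d ix)^('d ix)"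
    have s: "?s \<in> S" unfolding S_def using t by blast
    have sZ: "?s \<in> id_component Z" using s SZ by blast
    have "mu_of ?s = mu_of p" by (simp add: levi_scalar)
    then have "mu_of (matrix_inv ?s ** p) = 1"
      unfolding mu_of_mult[OF GG(3)[OF ZG[OF sZ]] ZG[OF p]] mu_of_inv[OF ZG[OF sZ]]
      using left_inverse[OF \<open>mu_of p \<noteq> 0\<close>] by (simp only:)
    then have "matrix_inv ?s ** p \<in> T" unfolding T_def using idZg(2,3) sZ p by blast
    moreover have "p = ?s ** (matrix_inv ?s ** p)"
      using matrix_inv_right[OF idZg(4)[OF sZ]] by (simp add: matrix_mul_assoc)
    ultimately show "p \<in> mat_prods S T" unfolding mat_prods_def using s by blast
  qed
  have "S \<inter> T \<subseteq> {levi (mat 1), levi (mat (-1))}"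
    unfolding S_def T_def levi_scalar by (auto simp: power2_eq_1_iff)
  then show "finite (S \<inter> T)" by (rule finite_subset) simp
  have mgT: "mat_group T" using alg_group_over_QD(2)[OF T_over_Q] .
  let ?u = "\<lambda>g. \<forall>x y. weil_form \<tau> (g *v x) (g *v y) = weil_form \<tau> x y"
  let ?L = "levi ` {g \<in> Ga. ?u g}"
  \<comment> \<open>Levi lifts only: the remaining factor of an element of
    \<open>pts \<real> T\<close> lies in W.\<close>
  let ?K = "{p \<in> ?L. p \<in> T \<and> map_mat cnj p = p}"
  have "compact ?K"
  proof -
    obtain C where C: "closedin zariski C" "T = C \<inter> {A. invertible A}"
      using alg_group_over_QD(1)[OF T_over_Q] unfolding alg_group_def by blast
    have K: "?K = ?L \<inter> (C \<inter> {p. map_mat cnj p = p})" using C(2) GG(4)[OF levi_G] by auto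
    have cl: "closed {p :: complex^('d ix)^('d ix). map_mat cnj p = p}"
    proof -
      have eq: "{p :: complex^('d ix)^('d ix). map_mat cnj p = p} = (\<Inter>i. \<Inter>j. {p. cnj (p $ i $ j) = p $ i $ j})"
        by (simp add: set_eq_iff map_mat_def vec_eq_iff)
      show ?thesis unfolding eq by (intro closed_INT ballI closed_Collect_eq continuous_intros)
    qed
    have K0: "compact ?L"
      by (rule compact_continuous_image[OF continuous_on_poly_map[OF poly_map_levi] compact_unitary_Ga])
    have "compact (?L \<inter> (C \<inter> {p. map_mat cnj p = p}))"
      by (rule compact_Int_closed[OF K0 closed_Int[OF closed_zariski[OF C(1)] cl]])
    then show ?thesis by (rule subst[OF K[symmetric]])
  qed
  moreover have "?K \<subseteq> pts \<real> T" unfolding pts_real[OF mgT] by blast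
  moreover have "pts \<real> T \<subseteq> mat_prods ?K W"
  proof
    fix A assume "A \<in> pts \<real> T"
    then have A: "A \<in> T" "map_mat cnj A = A" unfolding pts_real[OF mgT] by auto
    then have AZ: "A \<in> Z" and mu: "mu_of A = 1" using idZ(1) by (auto simp: T_def)
    then have AG: "A \<in> G" using Z_G by blast
    let ?g = "g_of A" and ?k = "h \<i> (- \<i>)"
    have g: "?g \<in> Ga" using g_of_G[OF AG] .
    have mg: "multiplier ?g = 1" using mu mu_of_G[OF AG] by simp
    have k: "?k \<in> Ga" by (rule h_Ga) auto
    have gr: "map_mat cnj ?g = ?g" using A(2) map_mat_g_of by metis
    have gc: "?g ** ?k = ?k ** ?g" using AZ k unfolding centre_mod_eq by blast
    have kk: "?k ** ?k = mat (-1)" by (simp add: deligne_gr_mult[OF \<tau>] deligne_gr_scalar[OF \<tau>])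
    have gi: "matrix_inv ?g ** ?g = mat 1" "?g ** matrix_inv ?g = mat 1"
      using Ga(4)[OF g] by (simp_all add: matrix_inv_left matrix_inv_right)
    have "?k ** matrix_inv ?g ** ?k = matrix_inv ?g ** (?g ** ?k) ** matrix_inv ?g ** ?k"
      by (simp add: matrix_mul_assoc gi)
    also have "\<dots> = matrix_inv ?g ** ?k ** (?g ** matrix_inv ?g) ** ?k" by (simp add: gc matrix_mul_assoc)
    also have "\<dots> = matrix_inv ?g ** mat (-1)" by (simp add: gi matrix_mul_assoc[symmetric] kk)
    finally have e: "?k ** matrix_inv ?g ** ?k = mat (-1) ** matrix_inv ?g" by (simp add: mat_commute)
    have "mat (- cnj (multiplier ?g)) ** (?k ** matrix_inv (map_mat cnj ?g) ** ?k) = matrix_inv ?g"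
      unfolding gr e by (simp add: mg matrix_mul_assoc mat_times[symmetric])
    then have adj: "H.adj ?g (matrix_inv ?g)" using adj_Ga(1)[OF g] by metis
    have "?u ?g"
    proof (intro allI)
      fix x y
      have "weil_form \<tau> (?g *v x) (?g *v y) = weil_form \<tau> x (matrix_inv ?g *v (?g *v y))" using adj unfolding H.adj_def by blast
      then show "weil_form \<tau> (?g *v x) (?g *v y) = weil_form \<tau> x y" by (simp add: matrix_vector_mul_assoc gi)
    qed
    then have l0: "levi ?g \<in> ?L" using g by blast
    have lG: "levi ?g \<in> G" using levi_G[OF g] .
    have w: "matrix_inv (levi ?g) ** A \<in> W"
      using lG AG GG(2,3) by (simp add: W_iff g_of_mult g_of_inv gi)
    have Aeq: "A = levi ?g ** (matrix_inv (levi ?g) ** A)"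
      using matrix_inv_right[OF GG(4)[OF lG]] by (simp add: matrix_mul_assoc)
    have "levi ?g = A ** matrix_inv (matrix_inv (levi ?g) ** A)"
    proof -
      have "A ** matrix_inv (matrix_inv (levi ?g) ** A) = A ** (matrix_inv A ** levi ?g)"
        using GG(4)[OF lG] GG(4)[OF AG] by (simp add: matrix_inv_mult invertible_matrix_inv matrix_inv_inv)
      then show ?thesis using matrix_inv_right[OF GG(4)[OF AG]] by (simp add: matrix_mul_assoc)
    qed
    moreover have "A ** matrix_inv (matrix_inv (levi ?g) ** A) \<in> T"
      by (intro mat_group_closed(2,3)[OF mgT] A(1) subsetD[OF W_T w])
    ultimately have "levi ?g \<in> T" by simp
    moreover have "map_mat cnj (levi ?g) = levi ?g"
      using gr by (simp add: levi_def mg map_vec_linear field_aut_cnj)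
    ultimately have "levi ?g \<in> ?K" using l0 by blast
    then show "A \<in> mat_prods ?K W" unfolding mat_prods_def using w Aeq by blast
  qed
  ultimately show "\<exists>K. compact K \<and> K \<subseteq> pts \<real> T \<and> pts \<real> T \<subseteq> mat_prods K W" by blast
qed

end

section \<open>The bigrading of block triangular matrices under the adjoint action\<close>

text \<open>Applying t - e j to the sum kills f j and multiplies every other f i by the nonzero
  number e i - e j, so the induction hypothesis applies to the remaining summands.\<close>

lemma eigen_parts_in_subspace:
  fixes f :: "'i \<Rightarrow> complex^'k"
  assumes V: "vec.subspace V" and T: "\<And>v. v \<in> V \<Longrightarrow> t v \<in> V" "\<And>x y. t (x + y) = t x + t y" "\<And>c x. t (c *s x) = c *s t x"
    and "finite I" "\<And>i. i \<in> I \<Longrightarrow> t (f i) = e i *s f i" "inj_on e I" "(\<Sum>i\<in>I. f i) \<in> V" "i \<in> I"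
  shows "f i \<in> V"
  using assms(5-9)
proof (induction I arbitrary: f i)
  case (insert j I)
  have t_sum: "t (\<Sum>i\<in>J. f i) = (\<Sum>i\<in>J. t (f i))" for J
    using T(2) T(3)[of 0 0] by (induction J rule: infinite_finite_induct) auto
  have "t (\<Sum>i\<in>insert j I. f i) - e j *s (\<Sum>i\<in>insert j I. f i) \<in> V"
    using insert.prems(3) V T(1) vec.subspace_diff vec.subspace_scale by blast
  also have "t (\<Sum>i\<in>insert j I. f i) - e j *s (\<Sum>i\<in>insert j I. f i) = (\<Sum>i\<in>I. (e i - e j) *s f i)"
    using insert.prems(1) insert.hyps
    by (simp add: t_sum T(2) vec.scale_right_distrib vec.scale_sum_right vec.scale_left_diff_distrib sum_subtractf)
  finally have 1: "(\<Sum>i\<in>I. (e i - e j) *s f i) \<in> V" .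
  have "(e k - e j) *s f k \<in> V" if "k \<in> I" for k
  proof (rule insert.IH[of "\<lambda>i. (e i - e j) *s f i", OF _ _ 1 that])
    show "inj_on e I" using insert.prems(2) by simp
    fix i assume "i \<in> I"
    then have "t (f i) = e i *s f i" using insert.prems(1) by blast
    then show "t ((e i - e j) *s f i) = e i *s ((e i - e j) *s f i)"
      unfolding T(3) by (simp only: vec.scale_scale mult.commute)
  qed
  moreover have "e k - e j \<noteq> 0" if "k \<in> I" for k
    using insert.prems(2) insert.hyps(2) that by (auto simp: inj_on_def)
  ultimately have fk: "f k \<in> V" if "k \<in> I" for k
  proof -
    have "inverse (e k - e j) *s ((e k - e j) *s f k) \<in> V"
      using \<open>\<And>k. k \<in> I \<Longrightarrow> (e k - e j) *s f k \<in> V\<close>[OF that] by (rule vec.subspace_scale[OF V])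
    then show ?thesis
      by (simp only: vec.scale_scale left_inverse[OF \<open>\<And>k. k \<in> I \<Longrightarrow> e k - e j \<noteq> 0\<close>[OF that]] vec.scale_one)
  qed
  have "(\<Sum>i\<in>I. f i) \<in> V" using fk by (intro vec.subspace_sum[OF V])
  then have "(\<Sum>i\<in>insert j I. f i) - (\<Sum>i\<in>I. f i) \<in> V" using insert.prems(3) V vec.subspace_diff by blast
  then have "f j \<in> V" using insert.hyps by simp
  then show ?case using fk insert.prems(4) by blast
qed simp

text \<open>\<open>blk\<close> has the entry 1 in its last corner; removing it gives the shape of
  the tangent vectors of P.\<close>

definition upper_blk :: "complex \<Rightarrow> complex^('d::finite + 'd) \<Rightarrow> complex \<Rightarrow> complex^('d + 'd)^('d + 'd) \<Rightarrow>
    complex^('d + 'd) \<Rightarrow> complex^('d ix)^('d ix)" where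
  "upper_blk m x z g y = blk m x z g y - blk 0 0 0 0 0"

lemma upper_blk_vec3: "upper_blk m x z g y *v vec3 a b c = vec3 (m * a + bdot x b + z * c) (g *v b + c *s y) 0"
  by (simp add: upper_blk_def matrix_vector_mult_diff_rdistrib)

lemma upper_blk_nth [simp]: "mu_of (upper_blk m x z g y) = m" "x_of (upper_blk m x z g y) = x" "z_of (upper_blk m x z g y) = z"
  "g_of (upper_blk m x z g y) = g" "y_of (upper_blk m x z g y) = y"
  by (simp_all add: upper_blk_def mu_of_def x_of_def z_of_def g_of_def y_of_def blk_def vec_eq_iff)

lemma upper_blk_eq: "upper_blk m x z g y = upper_blk m' x' z' g' y' \<longleftrightarrow> m = m' \<and> x = x' \<and> z = z' \<and> g = g' \<and> y = y'"
  by (metis upper_blk_nth)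

lemma of_add:
  "mu_of (A + B) = mu_of A + mu_of B" "x_of (A + B) = x_of A + x_of B" "z_of (A + B) = z_of A + z_of B"
  "g_of (A + B) = g_of A + g_of B" "y_of (A + B) = y_of A + y_of B"
  by (simp_all add: mu_of_def x_of_def z_of_def g_of_def y_of_def vec_eq_iff)

lemma of_scale:
  "mu_of (mat c ** A) = c * mu_of A" "x_of (mat c ** A) = c *s x_of A" "z_of (mat c ** A) = c * z_of A"
  "g_of (mat c ** A) = mat c ** g_of A" "y_of (mat c ** A) = c *s y_of A"
  by (simp_all add: mu_of_def x_of_def z_of_def g_of_def y_of_def vec_eq_iff)

lemma upper_blk_add: "upper_blk m x z g y + upper_blk m' x' z' g' y' = upper_blk (m + m') (x + x') (z + z') (g + g') (y + y')"
  and upper_blk_scale: "mat c ** upper_blk m x z g y = upper_blk (c * m) (c *s x) (c * z) (mat c ** g) (c *s y)"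
proof -
  show "upper_blk m x z g y + upper_blk m' x' z' g' y' = upper_blk (m + m') (x + x') (z + z') (g + g') (y + y')"
  proof (rule matrix_eqI)
    fix v :: "complex^('a ix)"
    show "(upper_blk m x z g y + upper_blk m' x' z' g' y') *v v = upper_blk (m + m') (x + x') (z + z') (g + g') (y + y') *v v"
      by (rule vec3_cases[of v])
         (simp add: upper_blk_vec3 matrix_vector_mult_add_rdistrib bdot_distribs ring_distribs vec.scale_right_distrib)
  qed
  show "mat c ** upper_blk m x z g y = upper_blk (c * m) (c *s x) (c * z) (mat c ** g) (c *s y)"
  proof (rule matrix_eqI)
    fix v :: "complex^('a ix)"
    show "(mat c ** upper_blk m x z g y) *v v = upper_blk (c * m) (c *s x) (c * z) (mat c ** g) (c *s y) *v v"
      by (rule vec3_cases[of v])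
         (simp add: upper_blk_vec3 matrix_vector_mul_assoc[symmetric] ring_distribs vec.scale_right_distrib mult_ac)
  qed
qed

lemma upper_blk_0: "upper_blk 0 0 0 0 0 = 0"
  by (simp add: upper_blk_def)

lemma upper_blk_shape:
  assumes "\<And>k. X $ mid_ix k $ top_ix = 0" "\<And>j. X $ bot_ix $ j = 0"
  shows "X = upper_blk (mu_of X) (x_of X) (z_of X) (g_of X) (y_of X)"
  unfolding vec_eq_iff
proof (intro allI)
  fix i j
  show "X $ i $ j = upper_blk (mu_of X) (x_of X) (z_of X) (g_of X) (y_of X) $ i $ j"
    using ix_cases[of i] ix_cases[of j] assms
    by (auto simp: upper_blk_def blk_def mu_of_def x_of_def z_of_def g_of_def y_of_def)
qed

definition mat_of_vec :: "complex^('n \<times> 'n) \<Rightarrow> complex^'n^'n" where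
  "mat_of_vec v = (\<chi> i j. v $ (i, j))"

lemma mat_of_vec_inv [simp]: "mat_of_vec (vec_of_mat A) = A" "vec_of_mat (mat_of_vec v) = v"
  by (simp_all add: vec_eq_iff vec_of_mat_def mat_of_vec_def)

lemma mat_of_vec_linear: "mat_of_vec (v + w) = mat_of_vec v + mat_of_vec w" "mat_of_vec (c *s v) = mat c ** mat_of_vec v"
  by (simp_all add: vec_eq_iff mat_of_vec_def)

definition types :: "(int \<times> int) set" where
  "types = {(-1,1), (0,0), (1,-1), (-1,0), (0,-1), (-1,-1)}"

text \<open>The component of bidegree \<open>(p, q)\<close> of the block triangular matrix \<open>X\<close>; the projections to the
  components of bidegree \<open>(-1,0)\<close> and \<open>(0,-1)\<close> of the middle block are \<open>deligne_gr \<tau> 1 0\<close> and \<open>deligne_gr \<tau> 0 1\<close>.\<close>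

definition ad_proj :: "complex^'d^'d \<Rightarrow> int \<Rightarrow> int \<Rightarrow> complex^('d::finite ix)^('d ix) \<Rightarrow> complex^('d ix)^('d ix)" where
  "ad_proj \<tau> p q X = (let a = deligne_gr \<tau> 1 0; b = deligne_gr \<tau> 0 1; g = g_of X in
     if (p, q) = (-1, -1) then upper_blk 0 0 (z_of X) 0 0
     else if (p, q) = (-1, 0) then upper_blk 0 (x_of X v* b) 0 0 (a *v y_of X)
     else if (p, q) = (0, -1) then upper_blk 0 (x_of X v* a) 0 0 (b *v y_of X)
     else if (p, q) = (0, 0) then upper_blk (mu_of X) 0 0 (a ** g ** a + b ** g ** b) 0
     else if (p, q) = (-1, 1) then upper_blk 0 0 0 (a ** g ** b) 0
     else if (p, q) = (1, -1) then upper_blk 0 0 0 (b ** g ** a) 0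
     else 0)"

lemma ad_proj_types: "(p, q) \<notin> types \<Longrightarrow> ad_proj \<tau> p q X = 0"
  by (auto simp: ad_proj_def types_def Let_def)

lemma ad_proj_simps:
  "ad_proj \<tau> (-1) (-1) X = upper_blk 0 0 (z_of X) 0 0"
  "ad_proj \<tau> (-1) 0 X = upper_blk 0 (x_of X v* deligne_gr \<tau> 0 1) 0 0 (deligne_gr \<tau> 1 0 *v y_of X)"
  "ad_proj \<tau> 0 (-1) X = upper_blk 0 (x_of X v* deligne_gr \<tau> 1 0) 0 0 (deligne_gr \<tau> 0 1 *v y_of X)"
  "ad_proj \<tau> 0 0 X = upper_blk (mu_of X) 0 0 (deligne_gr \<tau> 1 0 ** g_of X ** deligne_gr \<tau> 1 0 + deligne_gr \<tau> 0 1 ** g_of X ** deligne_gr \<tau> 0 1) 0"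
  "ad_proj \<tau> (-1) 1 X = upper_blk 0 0 0 (deligne_gr \<tau> 1 0 ** g_of X ** deligne_gr \<tau> 0 1) 0"
  "ad_proj \<tau> 1 (-1) X = upper_blk 0 0 0 (deligne_gr \<tau> 0 1 ** g_of X ** deligne_gr \<tau> 1 0) 0"
  by (simp_all add: ad_proj_def Let_def)

lemma types_cases:
  obtains "(p, q) \<notin> types" | "p = -1" "q = -1" | "p = -1" "q = 0" | "p = 0" "q = -1" | "p = 0" "q = 0"
    | "p = -1" "q = 1" | "p = 1" "q = -1"
  unfolding types_def by auto

lemma mat_mid: "B ** (mat c ** A) = mat c ** (B ** A)" for A B :: "complex^'n^'n"
  by (metis mat_commute matrix_mul_assoc)

lemma ad_proj_add: "ad_proj \<tau> p q (X + Y) = ad_proj \<tau> p q X + ad_proj \<tau> p q Y"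
  by (cases rule: types_cases[of p q])
     (simp_all add: ad_proj_types ad_proj_simps of_add upper_blk_add vec_matrix_add matrix_vector_right_distrib matrix_distribs add_ac)

lemma ad_proj_scale: "ad_proj \<tau> p q (mat c ** X) = mat c ** ad_proj \<tau> p q X"
proof -
  have z: "mat c ** 0 = (0 :: complex^('a ix)^('a ix))" "mat c ** 0 = (0 :: complex^('a + 'a)^('a + 'a))"
    by (simp_all add: vec_eq_iff)
  show ?thesis
    by (cases rule: types_cases[of p q])
       (simp_all add: ad_proj_types ad_proj_simps of_scale upper_blk_scale z upper_blk_eq matrix_distribs mat_mid matrix_mul_assoc[symmetric])
qed

context
  fixes \<tau> :: "complex^'d^'d::finite"
  assumes \<tau>: "\<tau> \<in> siegel"
begin

lemma deligne_gr_deligne_gr_v [simp]: "deligne_gr \<tau> a b *v (deligne_gr \<tau> c d *v v) = deligne_gr \<tau> (a * c) (b * d) *v v"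
  by (simp add: matrix_vector_mul_assoc deligne_gr_mult[OF \<tau>])

lemma v_deligne_gr_deligne_gr [simp]: "v v* deligne_gr \<tau> a b v* deligne_gr \<tau> c d = v v* deligne_gr \<tau> (a * c) (b * d)"
  by (simp add: vector_matrix_mul_assoc deligne_gr_mult[OF \<tau>])

lemma deligne_gr_0 [simp]: "deligne_gr \<tau> 0 0 = 0"
  by (simp add: deligne_gr_scalar[OF \<tau>] vec_eq_iff mat_def)

lemma deligne_gr_add: "deligne_gr \<tau> a b + deligne_gr \<tau> c d = deligne_gr \<tau> (a + c) (b + d)"
  by (simp add: deligne_gr_def mat_add matrix_distribs add_ac)

lemma deligne_gr_scale: "deligne_gr \<tau> (c * a) (c * b) = mat c ** deligne_gr \<tau> a b"
  by (simp add: deligne_gr_scalar[OF \<tau>, symmetric] deligne_gr_mult[OF \<tau>])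

lemma deligne_gr_z0: "deligne_gr \<tau> z 0 = mat z ** deligne_gr \<tau> 1 0" and deligne_gr_0z: "deligne_gr \<tau> 0 z = mat z ** deligne_gr \<tau> 0 1"
  using deligne_gr_scale[of z 1 0] deligne_gr_scale[of z 0 1] by simp_all

lemma ad_proj_ad_proj: "ad_proj \<tau> p q (ad_proj \<tau> p' q' X) = (if p = p' \<and> q = q' then ad_proj \<tau> p q X else 0)"
proof -
  have m: "A ** deligne_gr \<tau> a b ** deligne_gr \<tau> c d = A ** deligne_gr \<tau> (a * c) (b * d)" for A a b c d
    by (simp add: matrix_mul_assoc[symmetric] deligne_gr_mult[OF \<tau>])
  have z: "A ** 0 = 0" "0 ** A = 0" for A :: "complex^('d + 'd)^('d + 'd)"
    by (simp_all add: matrix_matrix_mult_def vec_eq_iff)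
  have zo: "mu_of 0 = 0" "x_of 0 = 0" "z_of 0 = 0" "g_of 0 = 0" "y_of 0 = 0"
    by (simp_all add: mu_of_def x_of_def z_of_def g_of_def y_of_def vec_eq_iff)
  have z0: "ad_proj \<tau> p q 0 = 0" for p q
    by (cases rule: types_cases[of p q]) (simp_all add: ad_proj_types ad_proj_simps zo z upper_blk_0)
  show ?thesis
  proof (cases "(p, q) \<in> types \<and> (p', q') \<in> types")
    case False
    then show ?thesis by (auto simp: ad_proj_types z0)
  next
    case True
    then have "p = -1 \<and> q = -1 \<or> p = -1 \<and> q = 0 \<or> p = 0 \<and> q = -1 \<or> p = 0 \<and> q = 0 \<or> p = -1 \<and> q = 1 \<or> p = 1 \<and> q = -1"
      "p' = -1 \<and> q' = -1 \<or> p' = -1 \<and> q' = 0 \<or> p' = 0 \<and> q' = -1 \<or> p' = 0 \<and> q' = 0 \<or> p' = -1 \<and> q' = 1 \<or> p' = 1 \<and> q' = -1"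
      by (auto simp: types_def)
    then show ?thesis
      by (elim disjE conjE; simp only: ad_proj_simps upper_blk_nth; simp add: matrix_distribs matrix_mul_assoc m deligne_gr_mult[OF \<tau>] z upper_blk_0)
  qed
qed

lemma ad_proj_sum:
  assumes "X = upper_blk (mu_of X) (x_of X) (z_of X) (g_of X) (y_of X)"
  shows "(\<Sum>(p, q)\<in>types. ad_proj \<tau> p q X) = X"
proof -
  have one: "deligne_gr \<tau> 1 0 + deligne_gr \<tau> 0 1 = mat 1" using deligne_gr_add[of 1 0 0 1] deligne_gr_scalar[OF \<tau>, of 1] by simp
  have x: "v v* deligne_gr \<tau> 0 1 + v v* deligne_gr \<tau> 1 0 = v" for v
  proof -
    have "v v* deligne_gr \<tau> 0 1 + v v* deligne_gr \<tau> 1 0 = v v* (deligne_gr \<tau> 1 0 + deligne_gr \<tau> 0 1)"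
      by (simp add: vector_matrix_mult_add_rdistrib add.commute)
    then show ?thesis by (simp add: one)
  qed
  have y: "deligne_gr \<tau> 1 0 *v v + deligne_gr \<tau> 0 1 *v v = v" for v
    using one by (simp add: matrix_vector_mult_add_rdistrib[symmetric])
  have g: "deligne_gr \<tau> 1 0 ** A ** deligne_gr \<tau> 0 1 + (deligne_gr \<tau> 1 0 ** A ** deligne_gr \<tau> 1 0 + deligne_gr \<tau> 0 1 ** A ** deligne_gr \<tau> 0 1 + deligne_gr \<tau> 0 1 ** A ** deligne_gr \<tau> 1 0) = A" for A
  proof -
    have "(deligne_gr \<tau> 1 0 + deligne_gr \<tau> 0 1) ** A ** (deligne_gr \<tau> 1 0 + deligne_gr \<tau> 0 1) = A" by (simp add: one)
    then show ?thesis by (simp add: matrix_distribs add_ac)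
  qed
  have "(\<Sum>(p, q)\<in>types. ad_proj \<tau> p q X) = upper_blk (mu_of X) (x_of X) (z_of X) (g_of X) (y_of X)"
    unfolding types_def by (simp add: ad_proj_simps upper_blk_add upper_blk_eq x y g)
  then show ?thesis using assms by simp
qed

lemma cnj_ad_proj: "map_mat cnj (ad_proj \<tau> p q X) = ad_proj \<tau> q p (map_mat cnj X)"
proof -
  have upper_blk: "map_mat cnj (upper_blk m x z g y) = upper_blk (cnj m) (map_vec cnj x) (cnj z) (map_mat cnj g) (map_vec cnj y)"
    for m x z g and y :: "complex^('d + 'd)"
  proof -
    have "map_mat cnj (A - B) = map_mat cnj A - map_mat cnj B" for A B :: "complex^('d ix)^('d ix)"
      by (simp add: map_mat_def vec_eq_iff)
    moreover have "map_mat cnj 0 = (0 :: complex^('d + 'd)^('d + 'd))" by (simp add: map_mat_def vec_eq_iff)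
    ultimately show ?thesis by (simp add: upper_blk_def cnj_simps)
  qed
  have o: "mu_of (map_mat cnj X) = cnj (mu_of X)" "x_of (map_mat cnj X) = map_vec cnj (x_of X)"
    "z_of (map_mat cnj X) = cnj (z_of X)" "g_of (map_mat cnj X) = map_mat cnj (g_of X)"
    "y_of (map_mat cnj X) = map_vec cnj (y_of X)"
    by (simp_all add: mu_of_def x_of_def z_of_def g_of_def y_of_def map_mat_def map_vec_def)
  have add: "map_mat cnj (A + B) = map_mat cnj A + map_mat cnj B" for A B :: "complex^('d + 'd)^('d + 'd)"
    by (simp add: map_mat_def vec_eq_iff)
  have z: "map_mat cnj 0 = (0 :: complex^'n^'n)" by (simp add: map_mat_def vec_eq_iff)
  show ?thesis
  proof (cases rule: types_cases[of p q])
    case 1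
    then have "(q, p) \<notin> types" by (auto simp: types_def)
    then show ?thesis using 1 by (simp add: ad_proj_types z)
  qed (simp_all add: ad_proj_simps upper_blk o cnj_simps cnj_deligne_gr[OF \<tau>] add z map_vec_vm[OF field_aut_cnj] upper_blk_eq add.commute)
qed

lemma Ad_ad_proj:
  assumes z: "z1 \<noteq> 0" "z2 \<noteq> 0"
  shows "x0 \<tau> z1 z2 ** ad_proj \<tau> p q X ** matrix_inv (x0 \<tau> z1 z2) = mat (z1 powi (- p) * z2 powi (- q)) ** ad_proj \<tau> p q X"
proof -
  have Ad: "x0 \<tau> z1 z2 ** upper_blk m x z g y ** matrix_inv (x0 \<tau> z1 z2) =
     upper_blk m ((z1 * z2) *s (x v* deligne_gr \<tau> (inverse z1) (inverse z2))) (z1 * z2 * z)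
       (deligne_gr \<tau> z1 z2 ** g ** deligne_gr \<tau> (inverse z1) (inverse z2)) (deligne_gr \<tau> z1 z2 *v y)" for m x z' g y z
    using z
    by (intro matrix_eqI, rule_tac v=xa in vec3_cases)
       (simp add: x0_def blk_inv(2) deligne_gr_inv[OF \<tau>] upper_blk_vec3 matrix_vector_mul_assoc[symmetric] bdot_matrix matrix_vector_right_distrib
         field_simps)
  have g: "deligne_gr \<tau> z1 z2 ** (deligne_gr \<tau> a b ** g ** deligne_gr \<tau> c d) ** deligne_gr \<tau> (inverse z1) (inverse z2) =
      deligne_gr \<tau> (z1 * a) (z2 * b) ** g ** deligne_gr \<tau> (c * inverse z1) (d * inverse z2)" for a b c d g
  proof -
    have "deligne_gr \<tau> z1 z2 ** (deligne_gr \<tau> a b ** g ** deligne_gr \<tau> c d) ** deligne_gr \<tau> (inverse z1) (inverse z2) =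
      (deligne_gr \<tau> z1 z2 ** deligne_gr \<tau> a b) ** g ** (deligne_gr \<tau> c d ** deligne_gr \<tau> (inverse z1) (inverse z2))"
      by (simp only: matrix_mul_assoc)
    then show ?thesis by (simp only: deligne_gr_mult[OF \<tau>])
  qed
  have hv: "deligne_gr \<tau> z 0 *v v = z *s (deligne_gr \<tau> 1 0 *v v)" "deligne_gr \<tau> 0 z *v v = z *s (deligne_gr \<tau> 0 1 *v v)"
    "v v* deligne_gr \<tau> z 0 = z *s (v v* deligne_gr \<tau> 1 0)" "v v* deligne_gr \<tau> 0 z = z *s (v v* deligne_gr \<tau> 0 1)" for z v
    unfolding deligne_gr_z0[of z] deligne_gr_0z[of z]
    by (simp_all add: matrix_vector_mul_assoc[symmetric] vector_matrix_mul_assoc[symmetric])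
  have sc: "(mat a ** B) ** C ** (mat c ** D) = mat (a * c) ** (B ** C ** D)"
    for a c and B C D :: "complex^('d + 'd)^('d + 'd)"
  proof -
    have "B ** C ** (mat c ** D) = mat c ** (B ** C ** D)" by (rule mat_mid)
    then show ?thesis by (simp add: mat_times matrix_mul_assoc[symmetric])
  qed
  have hgh: "deligne_gr \<tau> z 0 ** C ** deligne_gr \<tau> w 0 = mat (z * w) ** (deligne_gr \<tau> 1 0 ** C ** deligne_gr \<tau> 1 0)"
    "deligne_gr \<tau> 0 z ** C ** deligne_gr \<tau> 0 w = mat (z * w) ** (deligne_gr \<tau> 0 1 ** C ** deligne_gr \<tau> 0 1)"
    "deligne_gr \<tau> z 0 ** C ** deligne_gr \<tau> 0 w = mat (z * w) ** (deligne_gr \<tau> 1 0 ** C ** deligne_gr \<tau> 0 1)"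
    "deligne_gr \<tau> 0 z ** C ** deligne_gr \<tau> w 0 = mat (z * w) ** (deligne_gr \<tau> 0 1 ** C ** deligne_gr \<tau> 1 0)" for z w C
    unfolding deligne_gr_z0[of z] deligne_gr_0z[of z] deligne_gr_z0[of w] deligne_gr_0z[of w] sc by simp_all
  note hz = hv[where z=z1] hv[where z=z2] hv[where z="inverse z1"] hv[where z="inverse z2"]
    hgh[where z=z1 and w="inverse z1"] hgh[where z=z1 and w="inverse z2"]
    hgh[where z=z2 and w="inverse z1"] hgh[where z=z2 and w="inverse z2"]
  show ?thesis
  proof (cases rule: types_cases[of p q])
    case 1 then show ?thesis by (simp add: ad_proj_types)
  next
    case 5
    show ?thesis unfolding 5 ad_proj_simps Ad upper_blk_scale upper_blk_eq using z
      by (simp only: matrix_distribs g) (simp add: hz del: inverse_mult_distrib)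
  qed (simp only: ad_proj_simps Ad upper_blk_scale upper_blk_eq g v_deligne_gr_deligne_gr deligne_gr_deligne_gr_v mult_zero_left mult_zero_right mult_1_left mult_1_right hz
      vec.scale_scale, use z in \<open>simp add: power_int_minus field_simps\<close>)+
qed

end

section \<open>The mixed Hodge structure on the Lie algebra\<close>

lemma powi_2_inject: "(2 :: complex) powi m = 2 powi n \<Longrightarrow> m = n"
proof (rule ccontr)
  assume eq: "(2 :: complex) powi m = 2 powi n" and "m \<noteq> n"
  then have "norm ((2 :: complex) powi m) = norm ((2 :: complex) powi n)" by simp
  then have "(2 :: real) powi m = 2 powi n" by (simp add: norm_power_int)
  moreover have "(2 :: real) powi m < 2 powi n \<or> (2 :: real) powi n < 2 powi m"
    using \<open>m \<noteq> n\<close> power_int_strict_increasing[of m n "2 :: real"] power_int_strict_increasing[of n m "2 :: real"]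
    by (cases "m < n") auto
  ultimately show False by simp
qed

text \<open>The weight filtration singles out the elements of \<open>lie G\<close> with vanishing
  diagonal blocks. That they are tangent to W or U is not formal, as \<open>lie\<close> is defined
  by polynomial equations; it needs curves inside W and U, which differ for the two groups.\<close>

locale shimura_lie = shimura \<alpha> G \<tau> for \<alpha> :: "int^('d::finite + 'd)^('d + 'd)" and G and \<tau> +
  assumes lieW: "upper_blk 0 x z 0 y \<in> lie G \<Longrightarrow> upper_blk 0 x z 0 y \<in> lie (u_part G)"
    and lieU: "upper_blk 0 0 z 0 0 \<in> lie G \<Longrightarrow> upper_blk 0 0 z 0 0 \<in> lie (U_grp \<inter> G)"
begin

lemma lie_shape:
  assumes X: "X \<in> lie G" shows "X = upper_blk (mu_of X) (x_of X) (z_of X) (g_of X) (y_of X)"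
proof (rule upper_blk_shape)
  have e: "A $ mid_ix k $ top_ix = 0" "A $ bot_ix $ j = (if j = bot_ix then 1 else 0)" if "A \<in> G" for A k j
    using G_cases[OF that] ix_cases[of j] by (auto simp: blk_def)
  show "X $ mid_ix k $ top_ix = 0" for k by (rule lie_coord[OF X e(1)])
  show "X $ bot_ix $ j = 0" for j by (rule lie_coord[OF X e(2)])
qed

lemma lie_mono: "H \<subseteq> H' \<Longrightarrow> lie H \<subseteq> lie H'"
  unfolding lie_def by blast

lemma lie_W_shape:
  assumes X: "X \<in> lie W" shows "X = upper_blk 0 (x_of X) (z_of X) 0 (y_of X)"
proof -
  have "W \<subseteq> G" by (auto simp: W_iff)
  then have XG: "X \<in> lie G" using lie_mono X by blast
  have "mu_of X = 0" unfolding mu_of_def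
    by (rule lie_coord[OF X, of _ _ 1]) (auto simp: u_part_def mu_of_def)
  moreover have "g_of X = 0"
  proof -
    have "X $ mid_ix i $ mid_ix j = 0" for i j
    proof (rule lie_coord[OF X])
      fix A assume "A \<in> W"
      then have "g_of A $ i $ j = mat 1 $ i $ j" by (simp add: W_iff)
      then show "A $ mid_ix i $ mid_ix j = mat 1 $ i $ j" by (simp add: g_of_def)
    qed
    then show ?thesis by (simp add: g_of_def vec_eq_iff)
  qed
  ultimately show ?thesis using lie_shape[OF XG] by simp
qed

lemma lie_U_shape:
  assumes X: "X \<in> lie U" shows "X = upper_blk 0 0 (z_of X) 0 0"
proof -
  have XW: "X \<in> lie W" using lie_mono[OF U_W] X by blast
  have "X $ top_ix $ mid_ix k = 0" "X $ mid_ix k $ bot_ix = 0" for k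
    by (rule lie_coord[OF X, of _ _ 0], force simp: U_grp_def blk_def)+
  then have "x_of X = 0" "y_of X = 0" by (simp_all add: x_of_def y_of_def vec_eq_iff)
  then show ?thesis using lie_W_shape[OF XW] by simp
qed

abbreviation L where "L \<equiv> vec_of_mat ` lie G"
abbreviation \<pi> where "\<pi> p q v \<equiv> vec_of_mat (ad_proj \<tau> p q (mat_of_vec v))"

lemma Ad_lie: "X \<in> lie G \<Longrightarrow> z1 \<noteq> 0 \<Longrightarrow> z2 \<noteq> 0 \<Longrightarrow> x0 \<tau> z1 z2 ** X ** matrix_inv (x0 \<tau> z1 z2) \<in> lie G"
  by (rule lie_conj[OF G_group x0_G])

lemma vec_of_mat_sum: "vec_of_mat (sum f I) = (\<Sum>i\<in>I. vec_of_mat (f i))"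
  by (induction I rule: infinite_finite_induct) (simp_all add: vec_of_mat_linear)

lemma lie_sum: "X \<in> lie G \<Longrightarrow> (\<Sum>(p, q)\<in>types. ad_proj \<tau> p q X) = X"
  using ad_proj_sum[OF \<tau> lie_shape] .

lemma ad_proj_lie:
  assumes X: "X \<in> lie G" shows "ad_proj \<tau> p q X \<in> lie G"
proof (cases "(p, q) \<in> types")
  case True
  \<comment> \<open>A single element separating the six bidegrees: in the order of
    \<open>types\<close> its eigenvalues 2^(-p) 8^(-q) are 1/4, 1, 4, 2, 8 and 16.\<close>
  let ?A = "x0 \<tau> 2 8"
  let ?f = "\<lambda>(p, q). vec_of_mat (ad_proj \<tau> p q X)"
  let ?e = "\<lambda>(p, q). 2 powi (- p) * 8 powi (- q) :: complex"
  have "?f (p, q) \<in> L"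
  proof (rule eigen_parts_in_subspace[of L "\<lambda>v. vec_of_mat (?A ** mat_of_vec v ** matrix_inv ?A)" types ?f ?e])
    show "vec.subspace L" by (rule subspace_lie)
    show "vec_of_mat (?A ** mat_of_vec v ** matrix_inv ?A) \<in> L" if "v \<in> L" for v
      using that Ad_lie by auto
    show "vec_of_mat (?A ** mat_of_vec (x + y) ** matrix_inv ?A) =
      vec_of_mat (?A ** mat_of_vec x ** matrix_inv ?A) + vec_of_mat (?A ** mat_of_vec y ** matrix_inv ?A)" for x y
      by (simp add: mat_of_vec_linear matrix_distribs vec_of_mat_linear)
    show "vec_of_mat (?A ** mat_of_vec (c *s x) ** matrix_inv ?A) = c *s vec_of_mat (?A ** mat_of_vec x ** matrix_inv ?A)" for c x
      by (simp add: mat_of_vec_linear vec_of_mat_linear[symmetric] mat_pull)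
    show "vec_of_mat (?A ** mat_of_vec (?f i) ** matrix_inv ?A) = ?e i *s ?f i" if "i \<in> types" for i
      using Ad_ad_proj[OF \<tau>, of 2 8] by (cases i) (simp add: vec_of_mat_linear)
    show "inj_on ?e types" unfolding types_def by (simp add: power_int_minus)
    have "(\<Sum>i\<in>types. ?f i) = vec_of_mat (\<Sum>(p, q)\<in>types. ad_proj \<tau> p q X)"
      unfolding vec_of_mat_sum by (intro sum.cong) auto
    then show "(\<Sum>i\<in>types. ?f i) \<in> L" unfolding lie_sum[OF X] using X by blast
    show "finite types" by (simp add: types_def)
  qed (fact True)
  then show ?thesis by auto
next
  case False then show ?thesis by (simp add: ad_proj_types lie_closed)
qed

lemma ad_component_eq: "ad_component G (x0 \<tau>) p q = {v \<in> L. \<pi> p q v = v}"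
proof (intro subset_antisym subsetI)
  fix v assume "v \<in> {v \<in> L. \<pi> p q v = v}"
  then obtain X where X: "v = vec_of_mat X" "X \<in> lie G" "ad_proj \<tau> p q X = X" by auto
  have "x0 \<tau> z1 z2 ** X ** matrix_inv (x0 \<tau> z1 z2) = mat (z1 powi (- p) * z2 powi (- q)) ** X"
    if "z1 \<noteq> 0" "z2 \<noteq> 0" for z1 z2
    using Ad_ad_proj[OF \<tau> that, of p q X] X(3) by simp
  then show "v \<in> ad_component G (x0 \<tau>) p q" unfolding ad_component_def using X by blast
next
  fix v assume "v \<in> ad_component G (x0 \<tau>) p q"
  then obtain X where X: "v = vec_of_mat X" "X \<in> lie G" and Ad: "\<And>z1 z2. z1 \<noteq> 0 \<Longrightarrow> z2 \<noteq> 0 \<Longrightarrow>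
      x0 \<tau> z1 z2 ** X ** matrix_inv (x0 \<tau> z1 z2) = mat (z1 powi (- p) * z2 powi (- q)) ** X"
    unfolding ad_component_def by blast
  have zero: "ad_proj \<tau> p' q' X = 0" if ne: "\<not> (p' = p \<and> q' = q)" for p' q'
  proof -
    \<comment> \<open>Different bidegrees give different characters of the torus, already at (2, 1)
      or at (1, 2).\<close>
    obtain z1 z2 :: complex where z: "z1 \<noteq> 0" "z2 \<noteq> 0" "z1 powi (- p) * z2 powi (- q) \<noteq> z1 powi (- p') * z2 powi (- q')"
    proof (cases "p' = p")
      case False
      have "(2 :: complex) powi (- p) \<noteq> 2 powi (- p')" using False powi_2_inject by fastforce
      then show ?thesis using that[of 2 1] by simp
    next
      case True
      then have "q' \<noteq> q" using ne by blast
      have "(2 :: complex) powi (- q) \<noteq> 2 powi (- q')" using \<open>q' \<noteq> q\<close> powi_2_inject by fastforce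
      then show ?thesis using that[of 1 2] by simp
    qed
    let ?c = "\<lambda>p q. z1 powi (- p) * z2 powi (- q)" and ?Ad = "\<lambda>Y. x0 \<tau> z1 z2 ** Y ** matrix_inv (x0 \<tau> z1 z2)"
    have ad_proj_sum_gen: "ad_proj \<tau> p' q' (sum f I) = (\<Sum>i\<in>I. ad_proj \<tau> p' q' (f i))" for f and I :: "(int \<times> int) set"
    proof (induction I rule: infinite_finite_induct)
      case empty show ?case using ad_proj_scale[of \<tau> p' q' 0 0] by simp
    next
      case (infinite A) show ?case using ad_proj_scale[of \<tau> p' q' 0 0] infinite by simp
    qed (simp add: ad_proj_add)
    have Ad_sum: "?Ad (sum f I) = (\<Sum>i\<in>I. ?Ad (f i))" for f and I :: "(int \<times> int) set"
      by (induction I rule: infinite_finite_induct)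
         (simp_all add: matrix_distribs)
    have "?Ad X = (\<Sum>(a, b)\<in>types. mat (?c a b) ** ad_proj \<tau> a b X)"
      by (subst lie_sum[OF X(2), symmetric], subst Ad_sum) (intro sum.cong refl, auto simp: Ad_ad_proj[OF \<tau> z(1,2)])
    then have "ad_proj \<tau> p' q' (?Ad X) = (\<Sum>i\<in>types. if i = (p', q') then mat (?c p' q') ** ad_proj \<tau> p' q' X else 0)"
      unfolding ad_proj_sum_gen
      by (auto simp: ad_proj_sum_gen ad_proj_scale ad_proj_ad_proj[OF \<tau>] intro!: sum.cong)
    also have "\<dots> = mat (?c p' q') ** ad_proj \<tau> p' q' X"
    proof -
      have "finite types" by (simp add: types_def)
      then show ?thesis using ad_proj_types[of p' q' \<tau> X] by (cases "(p', q') \<in> types") auto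
    qed
    finally have "mat (?c p q) ** ad_proj \<tau> p' q' X = mat (?c p' q') ** ad_proj \<tau> p' q' X"
      unfolding Ad[OF z(1,2)] ad_proj_scale .
    then show ?thesis using z(3) by (auto simp: vec_eq_iff)
  qed
  have "(\<Sum>(a, b)\<in>types. ad_proj \<tau> a b X) = (\<Sum>i\<in>types. if i = (p, q) then ad_proj \<tau> p q X else 0)"
    using zero by (intro sum.cong) auto
  also have "\<dots> = ad_proj \<tau> p q X"
  proof -
    have "finite types" by (simp add: types_def)
    then show ?thesis using ad_proj_types[of p q \<tau> X] by (cases "(p, q) \<in> types") auto
  qed
  finally have "ad_proj \<tau> p q X = X" using lie_sum[OF X(2)] by simp
  then show "v \<in> {v \<in> L. \<pi> p q v = v}" using X by auto
qed

sublocale bg: bigrading L "ad_component G (x0 \<tau>)" types \<pi>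
proof
  show "finite types" by (simp add: types_def)
  show "vec.subspace L" by (rule subspace_lie)
  show "\<pi> p q (v + v') = \<pi> p q v + \<pi> p q v'" for p q v v'
    by (simp add: mat_of_vec_linear ad_proj_add vec_of_mat_linear)
  show "\<pi> p q (c *s v) = c *s \<pi> p q v" for p q c v
    by (simp add: mat_of_vec_linear ad_proj_scale vec_of_mat_linear)
  show "\<pi> p q v \<in> L" if "v \<in> L" for p q v using that ad_proj_lie by auto
  show "\<pi> p q (\<pi> p' q' v) = (if p = p' \<and> q = q' then \<pi> p q v else 0)" for p q p' q' v
    by (simp add: ad_proj_ad_proj[OF \<tau>] vec_of_mat_linear)
  show "\<pi> p q v = 0" if "(p, q) \<notin> types" for p q v using that by (simp add: ad_proj_types vec_of_mat_linear)
  show "v = (\<Sum>(p, q)\<in>types. \<pi> p q v)" if v: "v \<in> L" for v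
  proof -
    obtain X where X: "v = vec_of_mat X" "X \<in> lie G" using v by blast
    have "(\<Sum>(p, q)\<in>types. \<pi> p q v) = vec_of_mat (\<Sum>(p, q)\<in>types. ad_proj \<tau> p q X)"
      unfolding vec_of_mat_sum X(1) by (intro sum.cong) auto
    then show ?thesis by (simp add: lie_sum[OF X(2)] X(1))
  qed
  show "ad_component G (x0 \<tau>) p q = {v \<in> L. \<pi> p q v = v}" for p q by (rule ad_component_eq)
  have vm: "map_vec cnj (vec_of_mat X) = vec_of_mat (map_mat cnj X)" for X :: "complex^('d ix)^('d ix)"
    by (simp add: vec_eq_iff map_vec_def vec_of_mat_def map_mat_def)
  show "map_vec cnj v \<in> L" if "v \<in> L" for v
    using that lie_field_aut[OF field_aut_cnj alg_group_over_QD(3)[OF G_Q field_aut_cnj]] by (auto simp: vm)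
  have mv: "mat_of_vec (map_vec cnj v) = map_mat cnj (mat_of_vec v)" for v :: "complex^('d ix \<times> 'd ix)"
    by (simp add: vec_eq_iff map_vec_def mat_of_vec_def map_mat_def)
  show "map_vec cnj (\<pi> p q v) = \<pi> q p (map_vec cnj v)" for p q v
    by (simp add: vm mv cnj_ad_proj[OF \<tau>])
qed

lemma ad_W_eq: "ad_W G (x0 \<tau>) = bg.W" and ad_F_eq: "ad_F G (x0 \<tau>) = bg.F"
  by (auto simp: fun_eq_iff ad_W_def ad_F_def bg.W_def bg.F_def)

lemma sub_cases:
  assumes v: "v \<in> bg.sub Q"
  obtains X where "v = vec_of_mat X" "X \<in> lie G" "\<And>p q. \<not> Q p q \<Longrightarrow> ad_proj \<tau> p q X = 0"
proof -
  obtain X where X: "v = vec_of_mat X" "X \<in> lie G" using v unfolding bg.sub_def by blast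
  have "ad_proj \<tau> p q X = 0" if "\<not> Q p q" for p q
    using v that vec_of_mat_inject[of "ad_proj \<tau> p q X" 0] unfolding bg.sub_def X(1) by (simp add: vec_of_mat_linear)
  then show thesis using that X by blast
qed

lemma bg_W:
  "bg.W n = (if n < -2 then {0} else if n = -2 then vec_of_mat ` lie U
              else if n = -1 then vec_of_mat ` lie W else L)"
proof -
  have WG: "W \<subseteq> G" by (auto simp: W_iff)
  consider "n < -2" | "n = -2" | "n = -1" | "n \<ge> 0" by linarith
  then show ?thesis
  proof cases
    case 1
    then have "bg.W n = {0}" unfolding bg.W_sub by (intro bg.sub_False) (auto simp: types_def)
    then show ?thesis using 1 by simp
  next
    case 2
    have "bg.sub (\<lambda>p q. p + q \<le> -2) = vec_of_mat ` lie U"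
    proof (intro subset_antisym subsetI)
      fix v assume "v \<in> bg.sub (\<lambda>p q. p + q \<le> -2)"
      then obtain X where X: "v = vec_of_mat X" "X \<in> lie G" "\<And>p q. \<not> p + q \<le> -2 \<Longrightarrow> ad_proj \<tau> p q X = 0"
        using sub_cases by blast
      have "X = ad_proj \<tau> (-1) (-1) X" using lie_sum[OF X(2)] X(3) by (simp add: types_def)
      then have "X = upper_blk 0 0 (z_of X) 0 0" by (simp add: ad_proj_simps)
      then have "X \<in> lie U" using lieU X(2) by metis
      then show "v \<in> vec_of_mat ` lie U" using X(1) by blast
    next
      fix v assume "v \<in> vec_of_mat ` lie U"
      then obtain X where X: "v = vec_of_mat X" "X \<in> lie U" by blast
      have s: "X = upper_blk 0 0 (z_of X) 0 0" by (rule lie_U_shape[OF X(2)])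
      have "ad_proj \<tau> p q X = 0" if "\<not> p + q \<le> -2" for p q
        using that by (subst s, cases rule: types_cases[of p q]) (simp_all add: ad_proj_types ad_proj_simps upper_blk_0)
      moreover have "X \<in> lie G" using lie_mono[of U G] X(2) by auto
      ultimately show "v \<in> bg.sub (\<lambda>p q. p + q \<le> -2)" unfolding bg.sub_def X(1) by (auto simp: vec_of_mat_linear)
    qed
    then show ?thesis using 2 unfolding bg.W_sub by simp
  next
    case 3
    have "bg.sub (\<lambda>p q. p + q \<le> -1) = vec_of_mat ` lie W"
    proof (intro subset_antisym subsetI)
      fix v assume "v \<in> bg.sub (\<lambda>p q. p + q \<le> -1)"
      then obtain X where X: "v = vec_of_mat X" "X \<in> lie G" "\<And>p q. \<not> p + q \<le> -1 \<Longrightarrow> ad_proj \<tau> p q X = 0"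
        using sub_cases by blast
      have "X = ad_proj \<tau> (-1) 0 X + (ad_proj \<tau> 0 (-1) X + ad_proj \<tau> (-1) (-1) X)" using lie_sum[OF X(2)] X(3) by (simp add: types_def)
      moreover have "\<dots> = upper_blk 0 (x_of X v* deligne_gr \<tau> 0 1 + x_of X v* deligne_gr \<tau> 1 0) (z_of X) 0 (deligne_gr \<tau> 1 0 *v y_of X + deligne_gr \<tau> 0 1 *v y_of X)"
        by (simp add: ad_proj_simps upper_blk_add)
      ultimately have "X \<in> lie W" using lieW X(2) by metis
      then show "v \<in> vec_of_mat ` lie W" using X(1) by blast
    next
      fix v assume "v \<in> vec_of_mat ` lie W"
      then obtain X where X: "v = vec_of_mat X" "X \<in> lie W" by blast
      have s: "X = upper_blk 0 (x_of X) (z_of X) 0 (y_of X)" by (rule lie_W_shape[OF X(2)])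
      have "ad_proj \<tau> p q X = 0" if "\<not> p + q \<le> -1" for p q
        using that by (subst s, cases rule: types_cases[of p q]) (simp_all add: ad_proj_types ad_proj_simps upper_blk_0)
      moreover have "X \<in> lie G" using lie_mono[OF WG] X(2) by auto
      ultimately show "v \<in> bg.sub (\<lambda>p q. p + q \<le> -1)" unfolding bg.sub_def X(1) by (auto simp: vec_of_mat_linear)
    qed
    then show ?thesis using 3 unfolding bg.W_sub by simp
  next
    case 4
    then have "bg.W n = L" unfolding bg.W_sub by (intro bg.sub_True) (auto simp: types_def)
    then show ?thesis using 4 by simp
  qed
qed

lemma subspace_over_Q_0: "subspace_over_Q {0}"
  unfolding subspace_over_Q_def by (auto simp: map_vec_linear vec.subspace_def)

lemma S_hom_x0: "S_hom G (x0 \<tau>)"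
  unfolding S_hom_def
proof (intro conjI allI impI)
  show "x0 \<tau> z1 z2 = 0" if "z1 = 0 \<or> z2 = 0" for z1 z2 using that by (auto simp: x0_def)
  show "x0 \<tau> z1 z2 \<in> G" if "z1 \<noteq> 0" "z2 \<noteq> 0" for z1 z2 using that by (rule x0_G)
  show "x0 \<tau> (z1 * w1) (z2 * w2) = x0 \<tau> z1 z2 ** x0 \<tau> w1 w2"
    if "z1 \<noteq> 0" "z2 \<noteq> 0" "w1 \<noteq> 0" "w2 \<noteq> 0" for z1 z2 w1 w2
    using that by (simp add: x0_def deligne_gr_mult[OF \<tau>] mult_ac)
  \<comment> \<open>The entries of \<open>x0\<close> are polynomials: z1 z2 in the first corner, a
    combination of z1 and z2 in the middle block, the constant 1 in the last corner. The subtraction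
    in the coefficient of z1 z2 removes the last corner of \<open>blk\<close>.\<close>
  let ?c = "\<lambda>a b i j. if a = 1 \<and> b = 1 then blk 1 0 0 0 0 $ i $ j - blk 0 0 0 0 0 $ i $ j
     else if a = 1 \<and> b = 0 then upper_blk 0 0 0 (deligne_gr \<tau> 1 0) 0 $ i $ j
     else if a = 0 \<and> b = 1 then upper_blk 0 0 0 (deligne_gr \<tau> 0 1) 0 $ i $ j
     else if a = 0 \<and> b = 0 then blk 0 0 0 0 (0 :: complex^('d + 'd)) $ i $ j else (0 :: complex)"
  show "\<exists>N m c. \<forall>z1 z2. z1 \<noteq> 0 \<longrightarrow> z2 \<noteq> 0 \<longrightarrow> (\<forall>i j.
        (z1 * z2) ^ N * x0 \<tau> z1 z2 $ i $ j = (\<Sum>a\<le>m. \<Sum>b\<le>(m::nat). c a b i j * z1 ^ a * z2 ^ b))"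
  proof (rule exI[of _ 0], rule exI[of _ 1], rule exI[of _ ?c], intro allI impI)
    fix z1 z2 :: complex and i j :: "'d ix" assume z: "z1 \<noteq> 0" "z2 \<noteq> 0"
    have "deligne_gr \<tau> z1 z2 = mat z1 ** deligne_gr \<tau> 1 0 + mat z2 ** deligne_gr \<tau> 0 1"
      using deligne_gr_add[OF \<tau>, of z1 0 0 z2] by (simp add: deligne_gr_z0[OF \<tau>, of z1] deligne_gr_0z[OF \<tau>, of z2])
    then have "deligne_gr \<tau> z1 z2 $ k $ l = z1 * deligne_gr \<tau> 1 0 $ k $ l + z2 * deligne_gr \<tau> 0 1 $ k $ l" for k l by simp
    then show "(z1 * z2) ^ 0 * x0 \<tau> z1 z2 $ i $ j = (\<Sum>a\<le>1. \<Sum>b\<le>(1::nat). ?c a b i j * z1 ^ a * z2 ^ b)"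
      using ix_cases[of i] ix_cases[of j] z by (auto simp: x0_def upper_blk_def blk_def)
  qed
qed

theorem connected_msd: "connected_msd G (hom_orbit (mat_prods (real_plus G) U) (x0 \<tau>))"
  unfolding connected_msd_def
proof (rule conjI[OF G_Q], rule conjI[OF connected_G], rule exI[of _ W], rule exI[of _ U], rule exI[of _ "x0 \<tau>"],
    intro conjI unipotent_radical U_over_Q U_W normal_U S_hom_x0 refl cartan centre_split_compact allI impI)
  show "matrix_inv (map_mat cnj (x0 \<tau> z1 z2)) ** x0 \<tau> (cnj z2) (cnj z1) \<in> U" if "z1 \<noteq> 0" "z2 \<noteq> 0" for z1 z2
  proof -
    have "map_mat cnj (x0 \<tau> z1 z2) = x0 \<tau> (cnj z2) (cnj z1)"
      using that by (simp add: x0_def cnj_simps cnj_deligne_gr[OF \<tau>] mult.commute)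
    moreover have "invertible (x0 \<tau> (cnj z2) (cnj z1))" using that GG(4)[OF x0_G] by simp
    ultimately show ?thesis using mat_group_closed(1)[OF U_group] by (simp add: matrix_inv_left)
  qed
  have "subspace_over_Q (bg.W n)" for n
    unfolding bg_W using subspace_over_Q_0 subspace_over_Q_lie U_over_Q W_over_Q G_Q by auto
  then show "mixed_hodge L (ad_W G (x0 \<tau>)) (ad_F G (x0 \<tau>))"
    unfolding ad_W_eq ad_F_eq by (rule bg.mixed_hodge[of 2]) (auto simp: types_def)
  show "hodge_type (ad_W G (x0 \<tau>)) (ad_F G (x0 \<tau>)) {(-1,1), (0,0), (1,-1), (-1,0), (0,-1), (-1,-1)}"
    unfolding ad_W_eq ad_F_eq using bg.hodge_type by (simp add: types_def)
  show "ad_W G (x0 \<tau>) n = (if n < -2 then {0} else if n = -2 then vec_of_mat ` lie U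
              else if n = -1 then vec_of_mat ` lie W else L)" for n
    unfolding ad_W_eq by (rule bg_W)
qed

end

section \<open>The mixed Shimura data of \<open>P_alpha\<close> and \<open>P_tilde\<close>\<close>

lemma mat_1_plus_upper_blk: "mat 1 + mat t ** upper_blk 0 x z 0 y = blk 1 (t *s x) (t * z) (mat 1) (t *s y)"
proof (rule matrix_eqI)
  fix v :: "complex^('a ix)"
  show "(mat 1 + mat t ** upper_blk 0 x z 0 y) *v v = blk 1 (t *s x) (t * z) (mat 1) (t *s y) *v v"
    by (rule vec3_cases[of v])
       (simp add: matrix_vector_mult_add_rdistrib matrix_vector_mul_assoc[symmetric] upper_blk_vec3 ring_distribs
         vec.scale_right_distrib mult_ac)
qed

lemma line_in_lie:
  assumes "\<And>t. blk 1 (t *s x) (t * z) (mat 1) (t *s y) \<in> H" shows "upper_blk 0 x z 0 y \<in> lie H"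
proof (rule lie_curve)
  show "mat 1 + mat t ** upper_blk 0 x z 0 y \<in> H" for t unfolding mat_1_plus_upper_blk by (rule assms)
  show "((\<lambda>t. mat 1 + mat t ** upper_blk 0 x z 0 y) has_derivative (\<lambda>t. mat t ** upper_blk 0 x z 0 y)) (at 0)"
    using bounded_linear.has_derivative[OF bounded_linear_mat_times has_derivative_ident]
    by (auto intro!: derivative_eq_intros)
qed simp

lemma shimura_lie_P_alpha:
  assumes "\<tau> \<in> siegel" "compatible \<tau> (cim \<alpha>)" shows "shimura_lie \<alpha> (P_alpha \<alpha>) \<tau>"
proof (intro shimura_lie.intro shimura.intro p_group_P_alpha shimura_axioms.intro shimura_lie_axioms.intro assms)
  show "upper_blk 0 x z 0 y \<in> lie (u_part (P_alpha \<alpha>))" for x z y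
    by (rule line_in_lie) (auto simp: u_part_P_alpha)
  have "U_grp \<inter> P_alpha \<alpha> = U_grp"
    using mat_group_closed(1)[OF G_alpha_group[of \<alpha>]] unfolding U_grp_def P_alpha_eq by fastforce
  then show "upper_blk 0 0 z 0 0 \<in> lie (U_grp \<inter> P_alpha \<alpha>)" for z
    by (intro line_in_lie) (auto simp: U_grp_def)
qed

context symm_pair
begin

lemma lie_has_field_derivative:
  "X \<in> lie G \<Longrightarrow> p \<in> polyfuns \<Longrightarrow> (\<And>A. A \<in> G \<Longrightarrow> p A = 0) \<Longrightarrow>
    ((\<lambda>t. p (mat 1 + mat t ** X)) has_field_derivative 0) (at 0)"
  by (simp add: lie_def)

text \<open>The defining relations of \<open>P_tilde\<close> are differentiated along the line of
  the tangent vector. In the first one x enters quadratically and leaves no derivative, so z = 0; in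
  the second one it enters linearly.\<close>

lemma lie_P_tilde_upper:
  assumes X: "upper_blk 0 x z 0 y \<in> lie (P_tilde f \<alpha>)"
  shows "z = 0" "y = cim \<alpha> *v x"
proof -
  let ?p = "\<lambda>A. mu_of A * z_of A - bdot (x_of A) (cim f *v x_of A)"
  have "?p \<in> polyfuns" by (intro polyfuns_diff polyfuns.mult poly_map_of_intros)
  moreover have "?p A = 0" if A': "A \<in> P_tilde f \<alpha>" for A
  proof -
    obtain x' g where A: "A = tilde_blk f \<alpha> x' g" and g: "g \<in> G_alpha \<alpha>" using A' unfolding P_tilde_eq by blast
    then show ?thesis using G_alphaD(2)[OF g] by (simp add: tilde_blk_def)
  qed
  ultimately have "((\<lambda>t. ?p (mat 1 + mat t ** upper_blk 0 x z 0 y)) has_field_derivative 0) (at 0)"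
    by (intro lie_has_field_derivative[OF X]) blast+
  then have "((\<lambda>t. t * z - t * (t * bdot x (cim f *v x))) has_field_derivative 0) (at 0)"
    unfolding mat_1_plus_upper_blk by simp
  moreover have "((\<lambda>t. t * z - t * (t * bdot x (cim f *v x))) has_field_derivative z) (at 0)"
    by (auto intro!: derivative_eq_intros)
  ultimately show "z = 0" using DERIV_unique by blast
  have "y $ k = (cim \<alpha> *v x) $ k" for k
  proof -
    let ?p = "\<lambda>A. (mu_of A *s y_of A) $ k - (g_of A *v (cim \<alpha> *v x_of A)) $ k"
    have "poly_vec (\<lambda>A. mu_of A *s y_of A)" "poly_vec (\<lambda>A. g_of A *v (cim \<alpha> *v x_of A))"
      by (intro poly_map_of_intros)+
    then have "?p \<in> polyfuns" unfolding poly_vec_def by (intro polyfuns_diff) blast+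
    moreover have "?p A = 0" if A': "A \<in> P_tilde f \<alpha>" for A
    proof -
    obtain x' g where A: "A = tilde_blk f \<alpha> x' g" and g: "g \<in> G_alpha \<alpha>" using A' unfolding P_tilde_eq by blast
    then show ?thesis using G_alphaD(2)[OF g] by (simp add: tilde_blk_def)
  qed
    ultimately have "((\<lambda>t. ?p (mat 1 + mat t ** upper_blk 0 x z 0 y)) has_field_derivative 0) (at 0)"
      by (intro lie_has_field_derivative[OF X]) blast+
    then have "((\<lambda>t. t * y $ k - t * (cim \<alpha> *v x) $ k) has_field_derivative 0) (at 0)"
      unfolding mat_1_plus_upper_blk by simp
    moreover have "((\<lambda>t. t * y $ k - t * (cim \<alpha> *v x) $ k) has_field_derivative y $ k - (cim \<alpha> *v x) $ k) (at 0)"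
      by (auto intro!: derivative_eq_intros)
    ultimately have "y $ k - (cim \<alpha> *v x) $ k = 0" using DERIV_unique by blast
    then show ?thesis by simp
  qed
  then show "y = cim \<alpha> *v x" by (simp add: vec_eq_iff)
qed

lemma shimura_lie_P_tilde:
  assumes "\<tau> \<in> siegel" "compatible \<tau> (cim \<alpha>)" shows "shimura_lie \<alpha> (P_tilde f \<alpha>) \<tau>"
proof (intro shimura_lie.intro shimura.intro p_group_P_tilde shimura_axioms.intro shimura_lie_axioms.intro assms)
  fix x z y assume X: "upper_blk 0 x z 0 y \<in> lie (P_tilde f \<alpha>)"
  let ?X = "upper_blk 0 x z 0 y" and ?Y = "upper_blk 0 0 (bdot x (cim f *v x)) 0 0"
  show "?X \<in> lie (u_part (P_tilde f \<alpha>))"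
  proof (rule lie_curve)
    have "mat 1 + (mat t ** ?X + mat (t * t) ** ?Y) = blk 1 (t *s x) (bdot (t *s x) (cim f *v (t *s x))) (mat 1) (cim \<alpha> *v (t *s x))" for t
    proof -
      have "mat t ** ?X + mat (t * t) ** ?Y = mat 1 ** upper_blk 0 (t *s x) (t * t * bdot x (cim f *v x)) 0 (t *s (cim \<alpha> *v x))"
        using lie_P_tilde_upper[OF X] by (simp add: upper_blk_scale upper_blk_add)
      then show ?thesis using mat_1_plus_upper_blk[of 1] by (simp add: mult_ac)
    qed
    then show "mat 1 + (mat t ** ?X + mat (t * t) ** ?Y) \<in> u_part (P_tilde f \<alpha>)" for t
      unfolding u_part_P_tilde by blast
    have "((\<lambda>t. mat t ** ?X) has_derivative (\<lambda>t. mat t ** ?X)) (at 0)"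
      by (rule bounded_linear.has_derivative[OF bounded_linear_mat_times has_derivative_ident])
    moreover have "((\<lambda>t :: complex. t * t) has_derivative (\<lambda>t. 0)) (at 0)"
      by (auto intro!: derivative_eq_intros)
    then have "((\<lambda>t. mat (t * t) ** ?Y) has_derivative (\<lambda>t. mat 0 ** ?Y)) (at 0)"
      by (rule bounded_linear.has_derivative[OF bounded_linear_mat_times])
    ultimately show "((\<lambda>t. mat 1 + (mat t ** ?X + mat (t * t) ** ?Y)) has_derivative (\<lambda>t. mat t ** ?X)) (at 0)"
      by (auto intro!: derivative_eq_intros)
  qed simp
next
  fix z assume "upper_blk 0 0 z 0 0 \<in> lie (P_tilde f \<alpha>)"
  then have "z = 0" by (rule lie_P_tilde_upper)
  then show "upper_blk 0 0 z 0 0 \<in> lie (U_grp \<inter> P_tilde f \<alpha>)" by (simp add: upper_blk_0 lie_closed)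
qed

text \<open>For x = 0 the coordinate z vanishes. So the part of weight -2 of this datum is trivial,
  and its domain is an orbit of real points alone.\<close>

lemma U_P_tilde: "U_grp \<inter> P_tilde f \<alpha> = {mat 1}"
proof -
  have "mat 1 \<in> P_tilde f \<alpha>" using p_group.G_ne[OF p_group_P_tilde] .
  then show ?thesis
    unfolding U_grp_def P_tilde_eq tilde_blk_def by (auto simp: blk_1)
qed

end

lemma U_P_alpha: "U_grp \<inter> P_alpha \<alpha> = U_grp"
  using mat_group_closed(1)[OF G_alpha_group[of \<alpha>]] unfolding U_grp_def P_alpha_eq by fastforce

section \<open>The homomorphism from the Deligne torus\<close>

lemma wt_cases:
  "n \<le> -3 \<Longrightarrow> wt n = {0}" "wt (-2) = {v. \<exists>a. v = vec3 a 0 0}" "wt (-1) = {v. \<exists>a b. v = vec3 a b 0}"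
  "n \<ge> 0 \<Longrightarrow> wt n = UNIV"
  by (auto simp: wt_def)

lemma wt_mono: "n \<le> m \<Longrightarrow> wt n \<subseteq> wt m"
  by (auto simp: wt_def)

lemma filt_cases: "p < 0 \<Longrightarrow> filt F p = UNIV" "filt F 0 = F" "p > 0 \<Longrightarrow> filt F p = {0}"
  by (auto simp: filt_def)

lemma subspace_vec3:
  assumes "clinear_map e"
  shows "vec.subspace {v. \<exists>a. v = vec3 0 (e a) 0}" "vec.subspace {v. \<exists>c a. v = vec3 c (e a) 0}"
    "vec.subspace {v. \<exists>c a b. v = vec3 c (e a) b}"
proof -
  note e = clinearD[OF assms]
  have z: "vec3 0 (e 0) 0 = 0" by (simp add: e)
  show "vec.subspace {v. \<exists>a. v = vec3 0 (e a) 0}" "vec.subspace {v. \<exists>c a. v = vec3 c (e a) 0}"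
    "vec.subspace {v. \<exists>c a b. v = vec3 c (e a) b}"
    unfolding vec.subspace_def using z[symmetric]
    by (auto simp: e(1,2)[symmetric])
qed

definition hodge_op :: "(complex^('d::finite ix)) set \<Rightarrow> complex \<Rightarrow> complex \<Rightarrow> complex^('d ix)^('d ix) \<Rightarrow> bool" where
  "hodge_op F z1 z2 A \<longleftrightarrow> (\<forall>p q. \<forall>v\<in>deligne_bigrading wt (filt F) p q. A *v v = (z1 powi (- p) * z2 powi (- q)) *s v)"

lemma D_hom_eqI:
  assumes "\<And>z1 z2. z1 = 0 \<or> z2 = 0 \<Longrightarrow> x z1 z2 = 0"
    and "\<And>z1 z2. z1 \<noteq> 0 \<Longrightarrow> z2 \<noteq> 0 \<Longrightarrow> hodge_op F z1 z2 (x z1 z2)"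
    and "\<And>z1 z2 A B. z1 \<noteq> 0 \<Longrightarrow> z2 \<noteq> 0 \<Longrightarrow> hodge_op F z1 z2 A \<Longrightarrow> hodge_op F z1 z2 B \<Longrightarrow> A = B"
  shows "D_hom F = x"
proof (intro ext)
  fix z1 z2
  show "D_hom F z1 z2 = x z1 z2"
    unfolding D_hom_def hodge_hom_def hodge_op_def[symmetric]
    using assms(1)[of z1 z2] assms(2,3)[of z1 z2] by (auto intro!: the_equality)
qed

context
  fixes \<tau> :: "complex^'d^'d::finite" and w :: complex
  assumes \<tau>: "\<tau> \<in> siegel"
begin

abbreviation F_pt :: "(complex^('d ix)) set" where "F_pt \<equiv> {v. \<exists>a b. v = vec3 (w * b) (ev \<tau> a) b}"

lemma F_pt_pt: "pt \<tau> 0 0 (tpi * w) = F_pt"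
  unfolding pt_def by (simp add: ev_def)

lemma conj_F_pt: "conj_set F_pt = {v. \<exists>a b. v = vec3 (cnj w * b) (evbar \<tau> a) b}"
proof -
  have "\<exists>a' b'. v = map_vec cnj (vec3 (w * b') (ev \<tau> a') b')" if "v = vec3 (cnj w * b) (evbar \<tau> a) b" for v a b
    using that by (intro exI[of _ "map_vec cnj a"] exI[of _ "cnj b"]) (simp add: cnj_ev)
  then have "{v. \<exists>a b. v = vec3 (cnj w * b) (evbar \<tau> a) b} \<subseteq> conj_set F_pt" unfolding conj_set_def by blast
  moreover have "conj_set F_pt \<subseteq> {v. \<exists>a b. v = vec3 (cnj w * b) (evbar \<tau> a) b}"
    unfolding conj_set_def by (auto simp: cnj_ev)
  ultimately show ?thesis by (rule antisym[rotated])
qed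

lemma ev_clinear: "clinear_map (ev \<tau>)" "clinear_map (evbar \<tau>)"
  by (rule clinearI, simp_all add: ev_def evbar_def matrix_vector_right_distrib)+

lemma ev_evbar_0:
  assumes "ev \<tau> a = evbar \<tau> b" shows "ev \<tau> a = 0"
  using proj_m10_ev[OF \<tau>, of a] proj_m10_evbar[OF \<tau>, of b] assms by simp

lemma conj_set_triv: "conj_set UNIV = UNIV" "conj_set {0} = {0}"
  unfolding conj_set_def by (auto simp: cnj_simps image_iff) (metis map_vec_cnj_cnj)

definition deligne_span :: "int \<Rightarrow> int \<Rightarrow> (complex^('d ix)) set" where
  "deligne_span p q = vec.span ((conj_set (filt F_pt q) \<inter> wt (p + q)) \<union>
               (\<Union>i::nat. conj_set (filt F_pt (q - 1 - int i)) \<inter> wt (p + q - 2 - int i)))"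

lemma deligne_deligne_span: "deligne_bigrading wt (filt F_pt) p q = filt F_pt p \<inter> wt (p + q) \<inter> deligne_span p q"
  by (simp add: deligne_bigrading_def deligne_span_def)

text \<open>The union over i is indexed by j = q - 1 - i instead, which turns the weight p + q - 2 -
  i into p + j - 1.\<close>

lemma deligne_span_subset:
  assumes V: "vec.subspace V" and "conj_set (filt F_pt q) \<inter> wt (p + q) \<subseteq> V"
    and "\<And>j. j < q \<Longrightarrow> conj_set (filt F_pt j) \<inter> wt (p + j - 1) \<subseteq> V"
  shows "deligne_span p q \<subseteq> V"
  unfolding deligne_span_def
proof (rule vec.span_minimal[OF _ V], intro Un_least UN_least)
  show "conj_set (filt F_pt (q - 1 - int i)) \<inter> wt (p + q - 2 - int i) \<subseteq> V" for i
    using assms(3)[of "q - 1 - int i"] by (simp add: algebra_simps)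
qed (fact assms(2))

text \<open>The conjugate of \<open>x0\<close> by the element of \<open>U_grp\<close> with
  coordinate w, see \<open>conj_hom_U\<close>.\<close>

definition deligne_pt :: "complex \<Rightarrow> complex \<Rightarrow> complex^('d ix)^('d ix)" where
  "deligne_pt z1 z2 = blk (z1 * z2) 0 (w * (1 - z1 * z2)) (deligne_gr \<tau> z1 z2) 0"

text \<open>Upper bounds for the components of Deligne's bigrading suffice, since the operator acts
  by the right scalar on the bounding subspaces. Outside the four bidegrees of the type the vectors
  turn out to be 0.\<close>

lemma hodge_op_deligne_pt:
  assumes z: "z1 \<noteq> 0" "z2 \<noteq> 0" shows "hodge_op F_pt z1 z2 (deligne_pt z1 z2)"
  unfolding hodge_op_def deligne_deligne_span
proof (intro allI ballI)
  fix p q v assume v: "v \<in> filt F_pt p \<inter> wt (p + q) \<inter> deligne_span p q"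
  have zero: "deligne_pt z1 z2 *v v = (z1 powi (- p) * z2 powi (- q)) *s v" if "v = 0" using that by simp
  consider "p > 0" | "p = 0" | "p = -1" | "p \<le> -2" by linarith
  then show "deligne_pt z1 z2 *v v = (z1 powi (- p) * z2 powi (- q)) *s v"
  proof cases
    case 1 then show ?thesis using v zero by (simp add: filt_cases)
  next
    case 2
    then obtain a b where vab: "v = vec3 (w * b) (ev \<tau> a) b" using v by (auto simp: filt_cases)
    consider "q \<le> -3" | "q = -2" | "q = -1" | "q = 0" | "q \<ge> 1" by linarith
    then show ?thesis
    proof cases
      case 1 then show ?thesis using v 2 zero by (simp add: wt_cases)
    next
      case i: 2 then show ?thesis using v 2 zero vab by (auto simp: wt_cases)
    next
      case 3
      then have "b = 0" using v 2 vab by (auto simp: wt_cases)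
      then show ?thesis using 2 3 by (simp add: vab deligne_pt_def deligne_gr_ev[OF \<tau>])
    next
      case 4
      \<comment> \<open>Elements of \<open>F_pt\<close> have their middle part in the range of
        \<open>ev \<tau>\<close>, those of the span in the range of \<open>evbar \<tau>\<close>, so
        the middle part of v vanishes.\<close>
      have "deligne_span 0 0 \<subseteq> {v. \<exists>c a b. v = vec3 c (evbar \<tau> a) b}"
      proof (rule deligne_span_subset[OF subspace_vec3(3)[OF ev_clinear(2)]])
        show "conj_set (filt F_pt 0) \<inter> wt (0 + 0) \<subseteq> {v. \<exists>c a b. v = vec3 c (evbar \<tau> a) b}"
          unfolding filt_cases conj_F_pt by blast
        fix j :: int assume "j < 0"
        then have "wt (0 + j - 1) \<subseteq> wt (-2)" by (intro wt_mono) simp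
        also have "\<dots> \<subseteq> {v. \<exists>c a b. v = vec3 c (evbar \<tau> a) b}"
          unfolding wt_cases using clinearD(3)[OF ev_clinear(2)] by auto
        finally show "conj_set (filt F_pt j) \<inter> wt (0 + j - 1) \<subseteq> {v. \<exists>c a b. v = vec3 c (evbar \<tau> a) b}" by blast
      qed
      then obtain a' where "ev \<tau> a = evbar \<tau> a'" using v 2 4 vab by auto
      then have "ev \<tau> a = 0" by (rule ev_evbar_0)
      then show ?thesis using 2 4 by (simp add: vab deligne_pt_def algebra_simps)
    next
      case 5
      have "deligne_span 0 q \<subseteq> {v. \<exists>c a. v = vec3 c (evbar \<tau> a) 0}"
      proof (rule deligne_span_subset[OF subspace_vec3(2)[OF ev_clinear(2)]])
        have 0: "0 \<in> {v. \<exists>c a. v = vec3 c (evbar \<tau> a) 0}" by (rule vec.subspace_0[OF subspace_vec3(2)[OF ev_clinear(2)]])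
        show "conj_set (filt F_pt q) \<inter> wt (0 + q) \<subseteq> {v. \<exists>c a. v = vec3 c (evbar \<tau> a) 0}"
        proof -
          have "conj_set (filt F_pt q) = {0}" using 5 by (simp add: filt_cases conj_set_triv)
          then show ?thesis using 0 by auto
        qed
        fix j :: int assume "j < q"
        consider "j > 0" | "j = 0" | "j < 0" by linarith
        then show "conj_set (filt F_pt j) \<inter> wt (0 + j - 1) \<subseteq> {v. \<exists>c a. v = vec3 c (evbar \<tau> a) 0}"
        proof cases
          case 1
          then have "conj_set (filt F_pt j) = {0}" by (simp add: filt_cases conj_set_triv)
          then show ?thesis using 0 by auto
        next
          case 2 then show ?thesis by (auto simp: filt_cases conj_F_pt wt_cases)
        next
          case 3
          then have "wt (0 + j - 1) \<subseteq> wt (-2)" by (intro wt_mono) simp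
          also have "\<dots> \<subseteq> {v. \<exists>c a. v = vec3 c (evbar \<tau> a) 0}"
            unfolding wt_cases using clinearD(3)[OF ev_clinear(2)] by auto
          finally show ?thesis by blast
        qed
      qed
      then obtain a' where "ev \<tau> a = evbar \<tau> a'" "b = 0" using v 2 vab by auto
      then have "v = 0" using ev_evbar_0 vab by simp
      then show ?thesis by (rule zero)
    qed
  next
    case 3
    consider "q \<le> -2" | "q = -1" | "q = 0" | "q \<ge> 1" by linarith
    then show ?thesis
    proof cases
      case 1 then show ?thesis using v 3 zero by (simp add: wt_cases)
    next
      case 2
      then obtain a where "v = vec3 a 0 0" using v 3 by (auto simp: wt_cases)
      then show ?thesis using 2 3 by (simp add: deligne_pt_def)
    next
      case i: 3
      have "deligne_span (-1) 0 \<subseteq> {v. \<exists>a. v = vec3 0 (evbar \<tau> a) 0}"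
      proof (rule deligne_span_subset[OF subspace_vec3(1)[OF ev_clinear(2)]])
        show "conj_set (filt F_pt 0) \<inter> wt (- 1 + 0) \<subseteq> {v. \<exists>a. v = vec3 0 (evbar \<tau> a) 0}"
          unfolding filt_cases conj_F_pt by (auto simp: wt_cases)
        fix j :: int assume "j < 0"
        then have w0: "wt (- 1 + j - 1) = {0}" by (intro wt_cases) simp
        show "conj_set (filt F_pt j) \<inter> wt (- 1 + j - 1) \<subseteq> {v. \<exists>a. v = vec3 0 (evbar \<tau> a) 0}"
          unfolding w0 using vec.subspace_0[OF subspace_vec3(1)[OF ev_clinear(2)]] by (intro subset_trans[OF Int_lower2]) simp
      qed
      then obtain a where "v = vec3 0 (evbar \<tau> a) 0" using v 3 i by auto
      then show ?thesis using 3 i by (simp add: deligne_pt_def deligne_gr_evbar[OF \<tau>])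
    next
      case 4
      have "deligne_span (-1) q \<subseteq> {0}"
      proof (rule deligne_span_subset)
        show "vec.subspace {0 :: complex^('d ix)}" by (rule vec.subspace_single_0)
        show "conj_set (filt F_pt q) \<inter> wt (- 1 + q) \<subseteq> {0}" using 4 by (simp add: filt_cases conj_set_triv)
        fix j :: int assume "j < q"
        consider "j > 0" | "j = 0" | "j < 0" by linarith
        then show "conj_set (filt F_pt j) \<inter> wt (- 1 + j - 1) \<subseteq> {0}"
          by cases (auto simp: filt_cases conj_set_triv conj_F_pt wt_cases)
      qed
      then show ?thesis using v 3 zero by auto
    qed
  next
    case 4
    have wt0: "conj_set (filt F_pt j) \<inter> wt n \<subseteq> {0}" if nj: "n \<le> -2" "n \<le> j - 2" for j n
    proof -
      consider "j > 0" | "n \<le> -3" | "j = 0" "n = -2" using nj by linarith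
      then show ?thesis by cases (auto simp: filt_cases conj_set_triv conj_F_pt wt_cases)
    qed
    have "deligne_span p q \<subseteq> {0}"
    proof (rule deligne_span_subset)
      show "vec.subspace {0 :: complex^('d ix)}" by (rule vec.subspace_single_0)
      show "conj_set (filt F_pt q) \<inter> wt (p + q) \<subseteq> {0}"
        using 4 wt0[of "p + q" q] by (cases "q > 0") (auto simp: filt_cases conj_set_triv)
      fix j :: int assume "j < q"
      show "conj_set (filt F_pt j) \<inter> wt (p + j - 1) \<subseteq> {0}"
        using 4 wt0[of "p + j - 1" j] by (cases "j > 0") (auto simp: filt_cases conj_set_triv)
    qed
    then show ?thesis using v zero by auto
  qed
qed

lemma hodge_op_unique:
  assumes A: "hodge_op F_pt z1 z2 A" and B: "hodge_op F_pt z1 z2 B" shows "A = B"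
proof -
  have eq: "A *v v = B *v v" if "v \<in> deligne_bigrading wt (filt F_pt) p q" for v p q
    proof -
    have "A *v v = (z1 powi (- p) * z2 powi (- q)) *s v" "B *v v = (z1 powi (- p) * z2 powi (- q)) *s v"
      using A B that unfolding hodge_op_def by blast+
    then show ?thesis by simp
  qed
  have Sp1: "v \<in> deligne_span p q" if "v \<in> conj_set (filt F_pt q)" "v \<in> wt (p + q)" for v p q
    unfolding deligne_span_def using that by (intro vec.span_base) blast
  have e1: "A *v vec3 a 0 0 = B *v vec3 a 0 0" for a
    by (rule eq[of _ "-1" "-1"], unfold deligne_deligne_span)
       (auto intro!: Sp1 simp: filt_cases wt_cases conj_set_triv)
  have e2: "A *v vec3 0 (evbar \<tau> a) 0 = B *v vec3 0 (evbar \<tau> a) 0" for a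
    by (rule eq[of _ "-1" "0"], unfold deligne_deligne_span)
       (auto intro!: Sp1 simp: filt_cases wt_cases conj_F_pt)
  have e3: "A *v vec3 0 (ev \<tau> a) 0 = B *v vec3 0 (ev \<tau> a) 0" for a
    by (rule eq[of _ "0" "-1"], unfold deligne_deligne_span)
       (auto intro!: Sp1 simp: filt_cases wt_cases conj_set_triv)
  have e4: "A *v vec3 (w * b) 0 b = B *v vec3 (w * b) 0 b" for b
  proof (rule eq[of _ 0 0], unfold deligne_deligne_span, intro IntI)
    have ev0: "ev \<tau> 0 = 0" "evbar \<tau> 0 = 0" using clinearD(3) ev_clinear by auto
    show "vec3 (w * b) 0 b \<in> filt F_pt 0" unfolding filt_cases using ev0 by (metis (mono_tags, lifting) mem_Collect_eq)
    show "vec3 (w * b) 0 b \<in> wt (0 + 0)" by (simp add: wt_cases)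
    have "vec3 (cnj w * b) 0 b \<in> deligne_span 0 0"
      by (rule Sp1) (auto simp: filt_cases conj_F_pt wt_cases ev0(2)[symmetric])
    \<comment> \<open>In general \<open>vec3 (w * b) 0 b\<close> is not in the conjugate of
      \<open>F_pt\<close>; the difference lies in weight -2 and is supplied by the correction term i
      = 0 of Deligne's definition.\<close>
    moreover have "vec3 ((w - cnj w) * b) 0 0 \<in> deligne_span 0 0"
      unfolding deligne_span_def
    proof (rule vec.span_base, rule UnI2, rule UN_I[of 0])
      show "vec3 ((w - cnj w) * b) 0 0 \<in> conj_set (filt F_pt (0 - 1 - int 0)) \<inter> wt (0 + 0 - 2 - int 0)"
        by (simp add: filt_cases conj_set_triv wt_cases)
    qed simp
    ultimately have "vec3 (cnj w * b) 0 b + vec3 ((w - cnj w) * b) 0 0 \<in> deligne_span 0 0"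
      unfolding deligne_span_def by (rule vec.span_add)
    then show "vec3 (w * b) 0 b \<in> deligne_span 0 0" by (simp add: algebra_simps)
  qed
  show ?thesis
  proof (rule matrix_eqI)
    fix v :: "complex^('d ix)"
    obtain a e b where v: "v = vec3 a e b" by (rule vec3_cases)
    obtain a1 a2 where e: "e = ev \<tau> a1 + evbar \<tau> a2" by (rule ev_cases[OF \<tau>])
    have "v = vec3 (a - w * b) 0 0 + vec3 0 (ev \<tau> a1) 0 + vec3 0 (evbar \<tau> a2) 0 + vec3 (w * b) 0 b"
      by (simp add: v e)
    then show "A *v v = B *v v" by (simp only: matrix_vector_right_distrib e1 e2 e3 e4)
  qed
qed

lemma conj_hom_U: "conj_hom (blk 1 0 w (mat 1) 0) (x0 \<tau>) z1 z2 = (if z1 = 0 \<or> z2 = 0 then 0 else deligne_pt z1 z2)"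
proof -
  have "matrix_inv (mat 1) = (mat 1 :: complex^('d + 'd)^('d + 'd))" by (rule matrix_inv_eqI) simp
  then show ?thesis by (simp add: conj_hom_def x0_def deligne_pt_def blk_inv algebra_simps)
qed

end

section \<open>Equivariance of Deligne's bigrading\<close>

lemma act_span: "act B (vec.span X) = vec.span (act B X)"
proof -
  have "Vector_Spaces.linear (*s) (*s) ((*v) B)" by simp
  then show ?thesis unfolding act_def by (rule vec.linear_span_image[symmetric])
qed

lemma inj_mv: "invertible B \<Longrightarrow> inj ((*v) B)" for B :: "complex^'n^'n"
  by (rule injI) (metis matrix_inv_left matrix_vector_mul_assoc matrix_vector_mul_lid)

lemma act_bij:
  assumes "invertible B"
  shows "act B (X \<inter> Y) = act B X \<inter> act B Y" "act B (X \<union> Y) = act B X \<union> act B Y"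
    "act B (\<Union>i. Z i) = (\<Union>i. act B (Z i))" "act B UNIV = UNIV" "act B {0} = {0}"
proof -
  show "act B (X \<inter> Y) = act B X \<inter> act B Y" unfolding act_def by (rule image_Int[OF inj_mv[OF assms]])
  show "act B UNIV = UNIV"
    unfolding act_def by (rule surjI[of _ "(*v) (matrix_inv B)"]) (simp add: matrix_vector_mul_assoc matrix_inv_right[OF assms])
qed (auto simp: act_def)

lemma act_wt:
  assumes "m \<noteq> 0" "invertible g" shows "act (blk m x z g y) (wt n) = wt n"
proof -
  have sub: "act (blk m x z g y) (wt n) \<subseteq> wt n" for m x z g y
    by (auto simp: act_def wt_def)
  have "act (blk m x z g y) (act (matrix_inv (blk m x z g y)) (wt n)) = wt n"
    using assms by (simp add: act_act matrix_inv_right blk_inv(1))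
  moreover have "act (matrix_inv (blk m x z g y)) (wt n) \<subseteq> wt n" unfolding blk_inv(2)[OF assms] by (rule sub)
  ultimately have "wt n \<subseteq> act (blk m x z g y) (wt n)" unfolding act_def by (metis image_mono)
  then show ?thesis using sub by blast
qed

lemma deligne_equivariant:
  assumes B: "B = blk m x z g y" "m \<noteq> 0" "invertible g" and real: "map_mat cnj B = B"
  shows "deligne_bigrading wt (filt (act B F)) p q = act B (deligne_bigrading wt (filt F) p q)"
proof -
  have inv: "invertible B" unfolding B(1) by (rule blk_inv(1)[OF B(2,3)])
  have f: "filt (act B F) p = act B (filt F p)" for p
    by (simp add: filt_def act_bij[OF inv])
  have c: "conj_set (act B X) = act B (conj_set X)" for X
    unfolding conj_set_def act_def image_image by (simp add: cnj_simps real)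
  have wt: "wt n = act B (wt n)" for n unfolding B(1) by (rule act_wt[OF B(2,3), symmetric])
  show ?thesis
    unfolding deligne_bigrading_def f c by (subst (1 2 3) wt) (simp only: act_span act_bij(1-3)[OF inv])
qed

lemma hodge_op_equivariant:
  assumes B: "B = blk m x z g y" "m \<noteq> 0" "invertible g" and real: "map_mat cnj B = B"
  shows "hodge_op (act B F) z1 z2 A \<longleftrightarrow> hodge_op F z1 z2 (matrix_inv B ** A ** B)"
proof -
  have inv: "invertible B" unfolding B(1) by (rule blk_inv(1)[OF B(2,3)])
  have "A *v (B *v v) = c *s (B *v v) \<longleftrightarrow> (matrix_inv B ** A ** B) *v v = c *s v" for v c
  proof
    assume "A *v (B *v v) = c *s (B *v v)"
    then show "(matrix_inv B ** A ** B) *v v = c *s v"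
      by (simp add: matrix_vector_mul_assoc[symmetric])
         (simp add: matrix_vector_mul_assoc matrix_inv_left[OF inv])
  next
    assume "(matrix_inv B ** A ** B) *v v = c *s v"
    then have "B *v ((matrix_inv B ** A ** B) *v v) = c *s (B *v v)" by simp
    then show "A *v (B *v v) = c *s (B *v v)"
      by (simp add: matrix_vector_mul_assoc matrix_mul_assoc matrix_inv_right[OF inv])
  qed
  then show ?thesis
    unfolding hodge_op_def deligne_equivariant[OF B real] by (auto simp: act_def)
qed

lemma conj_hom_mult:
  "invertible A \<Longrightarrow> invertible B \<Longrightarrow> conj_hom (A ** B) x = conj_hom A (conj_hom B x)"
  by (simp add: conj_hom_def matrix_inv_mult matrix_mul_assoc)

theorem D_hom_act:
  assumes \<tau>: "\<tau> \<in> siegel" and B: "B = blk m x z g y" "m \<noteq> 0" "invertible g" and real: "map_mat cnj B = B"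
    and C: "C \<in> U_grp"
  shows "D_hom (act (B ** C) (pt \<tau> 0 0 0)) = conj_hom (B ** C) (x0 \<tau>)"
proof -
  obtain w where w: "C = blk 1 0 w (mat 1) 0" using C by (auto simp: U_grp_def)
  have inv: "invertible B" "invertible C"
    unfolding B(1) w by (rule blk_inv(1)[OF B(2,3)], rule blk_inv(1)) (auto simp: invertible_def intro: exI[of _ "mat 1"])
  have F: "act C (pt \<tau> 0 0 0) = pt \<tau> 0 0 (tpi * w)"
    unfolding w act_unipotent[OF \<tau>] using projA_linear(4)[of \<tau>] projB_linear(4)[of \<tau>] by simp
  have "D_hom (act B (pt \<tau> 0 0 (tpi * w))) = conj_hom B (conj_hom C (x0 \<tau>))"
  proof (rule D_hom_eqI)
    show "conj_hom B (conj_hom C (x0 \<tau>)) z1 z2 = 0" if "z1 = 0 \<or> z2 = 0" for z1 z2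
      using that by (auto simp: conj_hom_def x0_def matrix_matrix_mult_def vec_eq_iff)
    show "hodge_op (act B (pt \<tau> 0 0 (tpi * w))) z1 z2 (conj_hom B (conj_hom C (x0 \<tau>)) z1 z2)"
      if "z1 \<noteq> 0" "z2 \<noteq> 0" for z1 z2
    proof -
      have "matrix_inv B ** conj_hom B (conj_hom C (x0 \<tau>)) z1 z2 ** B = conj_hom C (x0 \<tau>) z1 z2"
        unfolding conj_hom_def[of B] by (rule matrix_cancel2) (simp_all add: matrix_inv_left[OF inv(1)])
      then show ?thesis
        unfolding hodge_op_equivariant[OF B real] F_pt_pt[OF \<tau>] using hodge_op_deligne_pt[OF \<tau> that]
        by (simp add: w conj_hom_U[OF \<tau>] that)
    qed
    fix z1 z2 A A' assume "hodge_op (act B (pt \<tau> 0 0 (tpi * w))) z1 z2 A" "hodge_op (act B (pt \<tau> 0 0 (tpi * w))) z1 z2 A'"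
    then have "matrix_inv B ** A ** B = matrix_inv B ** A' ** B"
      unfolding hodge_op_equivariant[OF B real] F_pt_pt[OF \<tau>] by (rule hodge_op_unique[OF \<tau>])
    then have "B ** (matrix_inv B ** A ** B) ** matrix_inv B = B ** (matrix_inv B ** A' ** B) ** matrix_inv B" by simp
    then show "A = A'" by (simp only: matrix_cancel2[OF matrix_inv_right[OF inv(1)] matrix_inv_right[OF inv(1)]])
  qed
  then show ?thesis unfolding act_act[symmetric] F conj_hom_mult[OF inv] .
qed

section \<open>The action on the Siegel space\<close>

lemma range_ev: "{vec2 (\<tau> *v a) a |a. True} = range (ev \<tau>)"
  by (auto simp: ev_def)

text \<open>If (C, D) is the image of the period columns, the new period matrix is C D^-1. The
  Hermitian form of \<open>sp\<close> is multiplied by r > 0 and stays definite on the image; this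
  makes D injective and gives positivity, while isotropy gives symmetry.\<close>

lemma real_similitude_siegel:
  fixes \<tau> :: "complex^'d^'d::finite"
  assumes \<tau>: "\<tau> \<in> siegel" and g: "map_mat cnj g = g"
    "\<And>x y. sp (g *v x) (g *v y) = of_real r * sp x y" "r > 0"
  obtains \<tau>' where "\<tau>' \<in> siegel" "act g (range (ev \<tau>)) = range (ev \<tau>')"
proof -
  define C where "C = matrix (\<lambda>a. vfst (g *v ev \<tau> a))"
  define D where "D = matrix (\<lambda>a. vsnd (g *v ev \<tau> a))"
  have lin: "clinear_map (\<lambda>a. vfst (g *v ev \<tau> a))" "clinear_map (\<lambda>a. vsnd (g *v ev \<tau> a))"
    by (rule clinearI, simp_all add: ev_linear matrix_vector_right_distrib vec_eq_iff)+
  have C: "C *v a = vfst (g *v ev \<tau> a)" for a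
    unfolding C_def using lin(1) unfolding clinear_map_def by (rule matrix_works)
  have D: "D *v a = vsnd (g *v ev \<tau> a)" for a
    unfolding D_def using lin(2) unfolding clinear_map_def by (rule matrix_works)
  have g_ev: "g *v ev \<tau> a = vec2 (C *v a) (D *v a)" for a
    unfolding C D vfst_vsnd by (rule refl)
  have cnj_g: "map_vec cnj (g *v x) = g *v map_vec cnj x" for x by (simp add: cnj_simps g(1))
  have herm: "sp (g *v ev \<tau> a) (map_vec cnj (g *v ev \<tau> a)) =
      of_real r * (- 2 * \<i> * of_real (Im (bdot (map_vec cnj a) (\<tau> *v a))))" for a
    by (simp only: cnj_g g(2) sp_ev_cnj)
  have "a = 0" if D0: "D *v a = 0" for a
  proof (rule ccontr)
    assume a: "a \<noteq> 0"
    have "sp (g *v ev \<tau> a) (map_vec cnj (g *v ev \<tau> a)) = 0"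
      unfolding g_ev D0 by (simp add: sp_def map_vec_linear(4)[OF field_aut_cnj])
    then show False using herm[of a] siegel_Im_pos[OF \<tau> a] g(3) by simp
  qed
  then have inv: "invertible D"
    using matrix_left_invertible_ker[of D] matrix_inv_eqI(2) matrix_left_right_inverse by metis
  define \<tau>' where "\<tau>' = C ** matrix_inv D"
  have ev': "g *v ev \<tau> a = ev \<tau>' (D *v a)" for a
    unfolding g_ev unfolding ev_def \<tau>'_def
    by (simp add: matrix_vector_mul_assoc matrix_mul_assoc[symmetric] matrix_inv_left[OF inv])
  have surj: "\<exists>a. b = D *v a" for b
    by (rule exI[of _ "matrix_inv D *v b"]) (simp add: matrix_vector_mul_assoc matrix_inv_right[OF inv])
  have "act g (range (ev \<tau>)) = range (ev \<tau>')"
  proof (intro subset_antisym subsetI)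
    fix y assume "y \<in> act g (range (ev \<tau>))"
    then show "y \<in> range (ev \<tau>')" unfolding act_def using ev' by auto
  next
    fix y assume "y \<in> range (ev \<tau>')"
    then obtain b where b: "y = ev \<tau>' b" by blast
    obtain a where "b = D *v a" using surj by blast
    then show "y \<in> act g (range (ev \<tau>))" unfolding act_def b ev'[symmetric] by (simp add: ev'[symmetric])
  qed
  moreover have "\<tau>' \<in> siegel"
  proof (rule siegelI)
    have "bdot b (\<tau>' *v c) = bdot b (transpose \<tau>' *v c)" for b c
    proof -
      obtain a where b: "b = D *v a" using surj by blast
      obtain a' where c: "c = D *v a'" using surj by blast
      have "sp (ev \<tau>' b) (ev \<tau>' c) = 0" unfolding b c ev'[symmetric] g(2) sp_ev[OF \<tau>] by simp
      then have "bdot b (\<tau>' *v c) = bdot (\<tau>' *v b) c" by (simp add: sp_def ev_def)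
      then show ?thesis by (simp add: bdot_matrix_left)
    qed
    then show "transpose \<tau>' = \<tau>'" using bilinear_matrix_eq[of \<tau>' "transpose \<tau>'"] by simp
    fix b :: "complex^'d" assume b0: "b \<noteq> 0"
    obtain a where b: "b = D *v a" using surj by blast
    have a: "a \<noteq> 0" using b b0 by auto
    have "- 2 * \<i> * of_real (Im (bdot (map_vec cnj b) (\<tau>' *v b))) =
        of_real r * (- 2 * \<i> * of_real (Im (bdot (map_vec cnj a) (\<tau> *v a))))"
      using herm[of a] unfolding ev' sp_ev_cnj b[symmetric] .
    then have "Im (bdot (map_vec cnj b) (\<tau>' *v b)) = r * Im (bdot (map_vec cnj a) (\<tau> *v a))"
      by (simp add: complex_eq_iff)
    then show "Im (bdot (map_vec cnj b) (\<tau>' *v b)) > 0" using siegel_Im_pos[OF \<tau> a] g(3) by simp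
  qed
  ultimately show thesis using that by blast
qed

text \<open>On real points the multiplier is real and nonzero, and it is 1 at the identity; by
  connectedness it stays positive.\<close>

lemma real_plus_G_alphaD:
  assumes "g \<in> real_plus (G_alpha \<alpha>)"
  shows "g \<in> G_alpha \<alpha>" "map_mat cnj g = g" "\<exists>r>0. multiplier g = of_real r"
proof -
  have sub: "real_plus (G_alpha \<alpha>) \<subseteq> {A \<in> G_alpha \<alpha>. map_mat cnj A = A}"
    unfolding real_plus_def pts_real[OF G_alpha_group] by (rule connected_component_subset)
  then show "g \<in> G_alpha \<alpha>" "map_mat cnj g = g" using assms by auto
  have real: "multiplier A = of_real (Re (multiplier A))" if "A \<in> real_plus (G_alpha \<alpha>)" for A
  proof -
    have "map_mat cnj A = A" using that sub by blast
    then have "cnj (multiplier A) = multiplier A" using multiplier_map_mat[OF field_aut_cnj, of A] by simp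
    then show ?thesis by (simp add: complex_eq_iff)
  qed
  have conn: "connected ((\<lambda>A. Re (multiplier A)) ` real_plus (G_alpha \<alpha>))"
    unfolding real_plus_def
    by (intro connected_continuous_image connected_connected_component continuous_on_Re
        continuous_on_subset[OF continuous_polyfuns[OF polyfuns_multiplier]]) simp
  have one: "mat 1 \<in> real_plus (G_alpha \<alpha>)"
    unfolding real_plus_def pts_real[OF G_alpha_group] using mat_group_closed(1)[OF G_alpha_group[of \<alpha>]]
    by (simp add: field_aut_cnj)
  have "Re (multiplier g) > 0"
  proof (rule ccontr)
    assume "\<not> Re (multiplier g) > 0"
    then have "0 \<in> (\<lambda>A. Re (multiplier A)) ` real_plus (G_alpha \<alpha>)"
      by (intro connectedD_interval[OF conn imageI[OF assms] imageI[OF one]]) simp_all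
    then obtain A where A: "A \<in> real_plus (G_alpha \<alpha>)" "Re (multiplier A) = 0" by auto
    then have "multiplier A = 0" using real[OF A(1)] by simp
    then show False using G_alphaD(2) A(1) sub by blast
  qed
  then show "\<exists>r>0. multiplier g = of_real r" using real[OF assms] by blast
qed

lemma G_alpha_sp: "g \<in> G_alpha \<alpha> \<Longrightarrow> sp (g *v x) (g *v y) = multiplier g * sp x y"
  using G_alphaD(3) sp_similitude unfolding GSp_iff by blast

lemma H_alpha_iff: "\<tau> \<in> H_alpha \<alpha> \<tau>0 \<longleftrightarrow> \<tau> \<in> siegel \<and>
    (\<exists>g\<in>real_plus (G_alpha \<alpha>). act g (range (ev \<tau>0)) = range (ev \<tau>))"
  unfolding H_alpha_def range_ev by blast

text \<open>The row action of g carries the annihilator of \<open>F^0\<close> at \<tau> into that at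
  \<tau>0, g carries \<open>F^0\<close> back, and \<alpha> is equivariant for these two actions up
  to the multiplier.\<close>

lemma compatible_act:
  assumes \<tau>: "\<tau> \<in> siegel" "\<tau>0 \<in> siegel" and g: "g \<in> G_alpha \<alpha>" and comp: "compatible \<tau>0 (cim \<alpha>)"
    and act: "act g (range (ev \<tau>0)) = range (ev \<tau>)"
  shows "compatible \<tau> (cim \<alpha>)"
  unfolding compatible_def
proof
  fix a
  have in_ev: "\<exists>c. g *v ev \<tau>0 b = ev \<tau> c" for b using act unfolding act_def by blast
  have "bdot (ann \<tau> a) (ev \<tau> c) = 0" for c using ann_iff[OF \<tau>(1)] by blast
  then have "bdot (ann \<tau> a v* g) (ev \<tau>0 b) = 0" for b
    unfolding bdot_matrix[symmetric] using in_ev[of b] by auto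
  then obtain c where c: "ann \<tau> a v* g = ann \<tau>0 c" using ann_iff[OF \<tau>(2)] by blast
  obtain e where e: "cim \<alpha> *v ann \<tau>0 c = ev \<tau>0 e" using comp unfolding compatible_def projA_eq_0_iff by blast
  obtain e' where e': "g *v ev \<tau>0 e = ev \<tau> e'" using in_ev by blast
  have "multiplier g *s (cim \<alpha> *v ann \<tau> a) = (g ** cim \<alpha> ** transpose g) *v ann \<tau> a"
    unfolding G_alphaD(4)[OF g] by (simp add: matrix_vector_mul_assoc[symmetric])
  also have "\<dots> = g *v (cim \<alpha> *v (ann \<tau> a v* g))" by (simp add: matrix_vector_mul_assoc[symmetric])
  also have "\<dots> = ev \<tau> e'" unfolding c e e' ..
  finally have "multiplier g *s projA \<tau> (cim \<alpha> *v ann \<tau> a) = projA \<tau> (ev \<tau> e')" unfolding projA_linear(2)[symmetric] by simp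
  also have "\<dots> = 0" unfolding projA_eq_0_iff by blast
  finally show "projA \<tau> (cim \<alpha> *v ann \<tau> a) = 0" using G_alphaD(2)[OF g] by simp
qed

lemma pt_origin: "pt \<tau> 0 0 0 = (\<lambda>(x, b). vec3 0 x b) ` (range (ev \<tau>) \<times> UNIV)"
  by (auto simp: pt_def ev_def image_iff)

lemma act_levi:
  assumes "act g (range (ev \<tau>0)) = range (ev \<tau>)"
  shows "act (blk m 0 0 g 0) (pt \<tau>0 0 0 0) = pt \<tau> 0 0 0"
proof -
  have "act (blk m 0 0 g 0) (pt \<tau>0 0 0 0) = (\<lambda>(x, b). vec3 0 (g *v x) b) ` (range (ev \<tau>0) \<times> UNIV)"
    unfolding act_def pt_origin image_image by (simp add: case_prod_beta)
  also have "\<dots> = (\<lambda>(x, b). vec3 0 x b) ` (act g (range (ev \<tau>0)) \<times> UNIV)"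
    unfolding act_def by force
  finally show ?thesis unfolding assms pt_origin .
qed

section \<open>The Ribet section\<close>

text \<open>The real vectors \<open>x\<close> parametrise the fibre of \<open>D_tilde\<close> over \<open>\<tau>\<close> by the points
  \<open>(x, z, y)\<close> of \<open>P_tilde\<^sup>u\<close>, applied to \<open>pt \<tau> 0 0 0\<close>. The result only depends on
  \<open>t = projB \<tau> x\<close>, even for complex \<open>x\<close>; taking for \<open>x\<close> the preimage \<open>(0, t / (2 \<pi> \<i>))\<close> of \<open>t\<close> gives
  formulas which are visibly holomorphic in \<open>\<tau>\<close> and \<open>t\<close>.\<close>

definition v_ribet :: "int^('d::finite + 'd)^('d + 'd) \<Rightarrow> complex^'d^'d \<Rightarrow> complex^'d \<Rightarrow> complex^'d" where
  "v_ribet \<alpha> \<tau> t = projA \<tau> (cim \<alpha> *v vec2 0 (inverse tpi *s t))"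

definition w_ribet :: "int^('d::finite + 'd)^('d + 'd) \<Rightarrow> complex^'d \<Rightarrow> complex" where
  "w_ribet \<alpha> t = - (tpi / 2) * bdot (vec2 0 (inverse tpi *s t)) (cim \<alpha> *v vec2 0 (inverse tpi *s t))"

definition ribet_pt :: "int^('d::finite + 'd)^('d + 'd) \<Rightarrow> complex^'d^'d \<Rightarrow> complex^'d \<Rightarrow> (complex^('d ix)) set" where
  "ribet_pt \<alpha> \<tau> t = pt \<tau> t (v_ribet \<alpha> \<tau> t) (w_ribet \<alpha> t)"

lemma vec2_0 [simp]: "vec2 0 0 = 0"
  by simp

lemma ribet_pt_0: "ribet_pt \<alpha> \<tau> 0 = pt \<tau> 0 0 0" "v_ribet \<alpha> \<tau> 0 = 0" "w_ribet \<alpha> 0 = 0"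
  by (simp_all add: ribet_pt_def v_ribet_def w_ribet_def projA_linear)

lemma tpi_cancel: "inverse tpi *s (tpi *s v) = v" "tpi *s (inverse tpi *s v) = v"
  by (simp_all only: vec.scale_scale tpi_inverse vec.scale_one)

lemma projB_split:
  assumes \<tau>: "\<tau> \<in> siegel"
  shows "X = vec2 0 (inverse tpi *s projB \<tau> X) + ann \<tau> (vfst X)"
proof -
  obtain p q where X: "X = vec2 p q" by (rule vec2_cases)
  show ?thesis unfolding X projB_vec2 tpi_cancel by (simp add: ann_def siegel_sym[OF \<tau>])
qed

lemma v_ribet_projB:
  assumes \<tau>: "\<tau> \<in> siegel" and comp: "compatible \<tau> (cim \<alpha>)"
  shows "v_ribet \<alpha> \<tau> (projB \<tau> X) = projA \<tau> (cim \<alpha> *v X)"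
proof -
  have "projA \<tau> (cim \<alpha> *v X) = projA \<tau> (cim \<alpha> *v (vec2 0 (inverse tpi *s projB \<tau> X) + ann \<tau> (vfst X)))"
    using projB_split[OF \<tau>, of X] by simp
  then show ?thesis using comp by (simp add: v_ribet_def matrix_vector_right_distrib projA_linear compatible_def)
qed

lemma projB_surj: "\<exists>X. projB \<tau> X = t"
  by (rule exI[of _ "vec2 0 (inverse tpi *s t)"]) (simp only: projB_vec2 vector_matrix_mult_0 tpi_cancel add_0)

context symm_pair
begin

text \<open>Decompose X = T + n with n in the annihilator of \<open>F^0\<close>, where T depends on
  \<open>projB \<tau> X\<close> only. Compatibility kills n in v. In w, the term X f X is half of X
  \<alpha> X and contains T \<alpha> n once; \<open>act_unipotent\<close> subtracts the same amount,
  and n \<alpha> n = 0.\<close>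

lemma act_tilde_blk:
  assumes \<tau>: "\<tau> \<in> siegel" and comp: "compatible \<tau> (cim \<alpha>)"
  shows "act (tilde_blk f \<alpha> X (mat 1)) (pt \<tau> 0 0 0) = ribet_pt \<alpha> \<tau> (projB \<tau> X)"
proof -
  define T where "T = vec2 0 (inverse tpi *s projB \<tau> X)"
  define n where "n = ann \<tau> (vfst X)"
  have X: "X = T + n" unfolding T_def n_def by (rule projB_split[OF \<tau>])
  have n0: "projA \<tau> (cim \<alpha> *v n) = 0" using comp unfolding n_def compatible_def by blast
  have nn: "bdot n (cim \<alpha> *v n) = 0"
    using bdot_projA[OF \<tau>, of "vfst X" "cim \<alpha> *v n"] n0 unfolding n_def[symmetric] by simp
  have sym: "bdot n (cim \<alpha> *v T) = bdot T (cim \<alpha> *v n)"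
    unfolding bdot_matrix[of n] \<alpha>_sym by (rule bdot_commute)
  have proj: "bdot (projB \<tau> X) (vsnd y) = tpi * bdot T y" for y
  proof -
    have "bdot T y = inverse tpi * bdot (projB \<tau> X) (vsnd y)"
      by (rule vec2_cases[of y]) (simp only: T_def bdot_vec2 bdot_scale_left bdot_zero vec2_halves add_0)
    then show ?thesis by (simp only: tpi_inverse mult.assoc[symmetric] mult_1_left)
  qed
  have "2 * bdot X (cim f *v X) = bdot T (cim \<alpha> *v T) + 2 * bdot T (cim \<alpha> *v n)"
    unfolding bdot_\<alpha>[symmetric] by (simp add: X matrix_vector_right_distrib bdot_distribs sym nn)
  moreover have "bdot T (cim \<alpha> *v X) = bdot T (cim \<alpha> *v T) + bdot T (cim \<alpha> *v n)"
    by (simp add: X matrix_vector_right_distrib bdot_distribs)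
  ultimately have w: "tpi * bdot X (cim f *v X) - tpi * bdot T (cim \<alpha> *v X) = w_ribet \<alpha> (projB \<tau> X)"
    unfolding w_ribet_def T_def[symmetric] by (simp add: field_simps)
  have "act (tilde_blk f \<alpha> X (mat 1)) (pt \<tau> 0 0 0) =
      pt \<tau> (projB \<tau> X) (projA \<tau> (cim \<alpha> *v X)) (tpi * bdot X (cim f *v X) - tpi * bdot T (cim \<alpha> *v X))"
    unfolding tilde_blk_def by (simp add: act_unipotent[OF \<tau>] proj)
  then show ?thesis unfolding w ribet_pt_def v_ribet_projB[OF \<tau> comp] .
qed

lemma act_tilde_blk_ribet_pt:
  assumes \<tau>: "\<tau> \<in> siegel" and comp: "compatible \<tau> (cim \<alpha>)"
  shows "act (tilde_blk f \<alpha> Y (mat 1)) (ribet_pt \<alpha> \<tau> t) = ribet_pt \<alpha> \<tau> (t + projB \<tau> Y)"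
proof -
  have one: "mat 1 \<in> G_alpha \<alpha>" by (rule mat_group_closed(1)[OF G_alpha_group])
  obtain X where X: "projB \<tau> X = t" using projB_surj by blast
  have "act (tilde_blk f \<alpha> Y (mat 1)) (ribet_pt \<alpha> \<tau> t) = act (tilde_blk f \<alpha> (X + Y) (mat 1)) (pt \<tau> 0 0 0)"
    unfolding X[symmetric] act_tilde_blk[OF \<tau> comp, symmetric] act_act tilde_blk_mult[OF one one] by simp
  then show ?thesis unfolding act_tilde_blk[OF \<tau> comp] by (simp add: X projB_linear)
qed

lemma pts_u_part_tilde': "pts \<int> (u_part (P_tilde f \<alpha>)) = range (\<lambda>n. tilde_blk f \<alpha> (civ n) (mat 1))"
  unfolding pts_u_part_tilde tilde_blk_def by auto

lemma tilde_blk_civ_Pu_int: "tilde_blk f \<alpha> (civ n) (mat 1) \<in> Pu_int"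
proof -
  have "tilde_blk f \<alpha> (civ n) (mat 1) \<in> pts \<int> (u_part (P_tilde f \<alpha>))" unfolding pts_u_part_tilde' by blast
  also have "\<dots> \<subseteq> pts \<int> (u_part (P_alpha \<alpha>))" using P_tilde_subset unfolding pts_def u_part_def by blast
  finally show ?thesis unfolding pts_u_part .
qed

lemma orb_tilde_eq:
  assumes \<tau>: "\<tau> \<in> siegel" and comp: "compatible \<tau> (cim \<alpha>)"
  shows "orb (pts \<int> (u_part (P_tilde f \<alpha>))) (ribet_pt \<alpha> \<tau> t) = {ribet_pt \<alpha> \<tau> (t + projB \<tau> (civ n)) |n. True}"
  unfolding orb_def pts_u_part_tilde' image_image act_tilde_blk_ribet_pt[OF \<tau> comp] by auto

lemma orb_Pu_ribet_pt:
  assumes \<tau>: "\<tau> \<in> siegel" and comp: "compatible \<tau> (cim \<alpha>)"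
  shows "orb Pu_int (ribet_pt \<alpha> \<tau> (t + projB \<tau> (civ n))) = orb Pu_int (ribet_pt \<alpha> \<tau> t)"
proof -
  have "orb Pu_int (ribet_pt \<alpha> \<tau> t) = orb Pu_int (ribet_pt \<alpha> \<tau> (t + projB \<tau> (civ n)))"
    unfolding orb_eq_iff[OF Pu_int_group] using act_tilde_blk_ribet_pt[OF \<tau> comp] tilde_blk_civ_Pu_int by metis
  then show ?thesis ..
qed

end

locale ribet = symm_pair f \<alpha> for f \<alpha> :: "int^('d::finite + 'd)^('d + 'd)" +
  fixes \<tau>0 :: "complex^'d^'d"
  assumes \<tau>0: "\<tau>0 \<in> siegel" and comp0: "compatible \<tau>0 (cim \<alpha>)"
begin

lemma H_alphaD:
  assumes "\<tau> \<in> H_alpha \<alpha> \<tau>0" shows "\<tau> \<in> siegel" "compatible \<tau> (cim \<alpha>)"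
  using assms compatible_act[OF _ \<tau>0 _ comp0] real_plus_G_alphaD(1) unfolding H_alpha_iff by blast+

lemma tilde_blk_split:
  assumes g: "g \<in> G_alpha \<alpha>"
  shows "tilde_blk f \<alpha> (X v* g) g = tilde_blk f \<alpha> X (mat 1) ** blk (multiplier g) 0 0 g 0"
proof -
  have "tilde_blk f \<alpha> X (mat 1) ** tilde_blk f \<alpha> 0 g = tilde_blk f \<alpha> (X v* g) g"
    using tilde_blk_mult[OF mat_group_closed(1)[OF G_alpha_group] g] by simp
  then show ?thesis by (simp add: tilde_blk_def)
qed

theorem D_tilde_eq: "D_tilde f \<alpha> \<tau>0 = {ribet_pt \<alpha> \<tau> t |\<tau> t. \<tau> \<in> H_alpha \<alpha> \<tau>0}"
proof (intro subset_antisym subsetI)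
  fix F assume "F \<in> D_tilde f \<alpha> \<tau>0"
  then obtain A where A: "A \<in> real_plus (P_tilde f \<alpha>)" and F: "F = act A (pt \<tau>0 0 0 0)"
    unfolding D_tilde_def orb_def by blast
  then have A': "A \<in> P_tilde f \<alpha>" "g_of A \<in> real_plus (G_alpha \<alpha>)"
    unfolding p_group.real_plus_G[OF p_group_P_tilde] by blast+
  then obtain x g where xg1: "A = tilde_blk f \<alpha> x g" unfolding P_tilde_eq by blast
  then have "g_of A = g" by (simp add: tilde_blk_def)
  then have xg: "A = tilde_blk f \<alpha> x g" "g \<in> real_plus (G_alpha \<alpha>)" using xg1 A'(2) by simp_all
  note g = real_plus_G_alphaD[OF xg(2)]
  obtain r where r: "r > 0" "multiplier g = of_real r" using g(3) by blast
  obtain \<tau> where \<tau>: "\<tau> \<in> siegel" "act g (range (ev \<tau>0)) = range (ev \<tau>)"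
    using real_similitude_siegel[OF \<tau>0 g(2) G_alpha_sp[OF g(1), unfolded r(2)] r(1)] by blast
  have H: "\<tau> \<in> H_alpha \<alpha> \<tau>0" unfolding H_alpha_iff using \<tau> xg(2) by blast
  \<comment> \<open>\<open>tilde_blk_split\<close> puts the unipotent factor to the left of the Levi
    factor, which replaces x by x g^-1.\<close>
  have x: "x = (x v* matrix_inv g) v* g"
    by (simp add: vector_matrix_mul_assoc matrix_inv_left[OF G_alphaD(1)[OF g(1)]])
  have "F = act (tilde_blk f \<alpha> (x v* matrix_inv g) (mat 1)) (pt \<tau> 0 0 0)"
    unfolding F xg(1) act_levi[OF \<tau>(2), of "multiplier g", symmetric] act_act tilde_blk_split[OF g(1), symmetric]
    using x by simp
  then show "F \<in> {ribet_pt \<alpha> \<tau> t |\<tau> t. \<tau> \<in> H_alpha \<alpha> \<tau>0}"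
    unfolding act_tilde_blk[OF H_alphaD[OF H]] using H by blast
next
  fix F assume "F \<in> {ribet_pt \<alpha> \<tau> t |\<tau> t. \<tau> \<in> H_alpha \<alpha> \<tau>0}"
  then obtain \<tau> t where F: "F = ribet_pt \<alpha> \<tau> t" and H: "\<tau> \<in> H_alpha \<alpha> \<tau>0" by blast
  obtain g where g': "g \<in> real_plus (G_alpha \<alpha>)" "act g (range (ev \<tau>0)) = range (ev \<tau>)"
    using H unfolding H_alpha_iff by blast
  note g = real_plus_G_alphaD[OF g'(1)]
  \<comment> \<open>Real coordinates of t give a real X, as \<open>D_tilde\<close> is an orbit of
    real points of \<open>P_tilde\<close>.\<close>
  obtain q where "projB \<tau> (cor (q t)) = t" by (rule projB_real_coords[OF H_alphaD(1)[OF H]]) blast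
  then obtain X where X: "projB \<tau> X = t" "map_vec cnj X = X"
    by (metis (no_types, lifting) cor_def cnj_vec_real vec_lambda_beta Reals_of_real)
  let ?A = "tilde_blk f \<alpha> (X v* g) g"
  have m: "cnj (multiplier g) = multiplier g" using multiplier_map_mat[OF field_aut_cnj, of g] g(2) by simp
  have "map_mat cnj ?A = ?A"
    by (simp add: tilde_blk_def map_mat_blk field_aut_cnj cnj_simps map_vec_vm[OF field_aut_cnj] g(2) X(2) m)
  moreover have Ag: "?A \<in> P_tilde f \<alpha>" "g_of ?A = g" unfolding P_tilde_eq using g(1) by (blast, simp add: tilde_blk_def)
  ultimately have "?A \<in> real_plus (P_tilde f \<alpha>)"
    unfolding p_group.real_plus_G[OF p_group_P_tilde] using Ag g'(1) by simp
  moreover have "act ?A (pt \<tau>0 0 0 0) = F"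
    unfolding tilde_blk_split[OF g(1)] act_act[symmetric] act_levi[OF g'(2)] act_tilde_blk[OF H_alphaD[OF H]] X(1) F ..
  ultimately show "F \<in> D_tilde f \<alpha> \<tau>0" unfolding D_tilde_def orb_def by blast
qed

lemma D_tilde_subset: "D_tilde f \<alpha> \<tau>0 \<subseteq> D_alpha \<alpha> \<tau>0"
proof -
  have "real_plus (P_tilde f \<alpha>) \<subseteq> real_plus (P_alpha \<alpha>)"
    unfolding p_group.real_plus_G[OF p_group_P_tilde] p_group.real_plus_G[OF p_group_P_alpha]
    using P_tilde_subset by blast
  moreover have "mat 1 \<in> U_grp" unfolding U_grp_def blk_1 by blast
  ultimately have "real_plus (P_tilde f \<alpha>) \<subseteq> mat_prods (real_plus (P_alpha \<alpha>)) U_grp"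
    unfolding mat_prods_def by (force intro: exI[of _ "mat 1"])
  then show ?thesis unfolding D_tilde_def D_alpha_def orb_def by blast
qed

section \<open>Special subvarieties\<close>

lemma D_hom_P_alpha:
  assumes B: "B \<in> P_alpha \<alpha>" "map_mat cnj B = B" and C: "C \<in> U_grp"
  shows "D_hom (act (B ** C) (pt \<tau>0 0 0 0)) = conj_hom (B ** C) (x0 \<tau>0)"
proof -
  obtain x z g y where b: "B = blk (multiplier g) x z g y" "g \<in> G_alpha \<alpha>" using B(1) unfolding P_alpha_eq by blast
  show ?thesis by (rule D_hom_act[OF \<tau>0 b(1) G_alphaD(2,1)[OF b(2)] B(2) C])
qed

lemma mat_1_U: "mat 1 \<in> U_grp" unfolding U_grp_def blk_1 by blast

lemma real_plus_P_alpha: "A \<in> real_plus (P_alpha \<alpha>) \<Longrightarrow> A \<in> P_alpha \<alpha> \<and> map_mat cnj A = A"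
  and real_plus_P_tilde: "A \<in> real_plus (P_tilde f \<alpha>) \<Longrightarrow> A \<in> P_alpha \<alpha> \<and> map_mat cnj A = A"
  unfolding p_group.real_plus_G[OF p_group_P_tilde] p_group.real_plus_G[OF p_group_P_alpha]
  using P_tilde_subset by blast+

lemma connected_msd_P_alpha: "connected_msd (P_alpha \<alpha>) (D_hom ` D_alpha \<alpha> \<tau>0)"
proof -
  have "D_hom (act A (pt \<tau>0 0 0 0)) = conj_hom A (x0 \<tau>0)" if "A \<in> mat_prods (real_plus (P_alpha \<alpha>)) U_grp" for A
    using that D_hom_P_alpha real_plus_P_alpha unfolding mat_prods_def by blast
  then have "D_hom ` D_alpha \<alpha> \<tau>0 = hom_orbit (mat_prods (real_plus (P_alpha \<alpha>)) U_grp) (x0 \<tau>0)"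
    unfolding D_alpha_def orb_def hom_orbit_def image_image by (intro image_cong refl)
  then show ?thesis
    using shimura_lie.connected_msd[OF shimura_lie_P_alpha[OF \<tau>0 comp0]] unfolding U_P_alpha by simp
qed

lemma D_hom_tilde:
  "A \<in> real_plus (P_tilde f \<alpha>) \<Longrightarrow> D_hom (act A (pt \<tau>0 0 0 0)) = conj_hom A (x0 \<tau>0)"
  using D_hom_P_alpha[OF _ _ mat_1_U, of A] real_plus_P_tilde[of A] by simp

lemma connected_msd_P_tilde: "connected_msd (P_tilde f \<alpha>) (D_hom ` D_tilde f \<alpha> \<tau>0)"
proof -
  have "D_hom ` D_tilde f \<alpha> \<tau>0 = hom_orbit (real_plus (P_tilde f \<alpha>)) (x0 \<tau>0)"
    unfolding D_tilde_def orb_def hom_orbit_def image_image by (intro image_cong refl D_hom_tilde)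
  moreover have "mat_prods (real_plus (P_tilde f \<alpha>)) {mat 1} = real_plus (P_tilde f \<alpha>)"
    unfolding mat_prods_def by auto
  ultimately show ?thesis
    using shimura_lie.connected_msd[OF shimura_lie_P_tilde[OF \<tau>0 comp0]] unfolding U_P_tilde by simp
qed

lemma hom_orbit_conj:
  assumes \<Gamma>: "mat_group \<Gamma>" and \<gamma>: "\<gamma> \<in> \<Gamma>"
  shows "hom_orbit \<Gamma> (conj_hom \<gamma> x) = hom_orbit \<Gamma> x"
proof -
  have 1: "conj_hom A (conj_hom B x) = conj_hom (A ** B) x" if "A \<in> \<Gamma>" "B \<in> \<Gamma>" for A B
    using conj_hom_mult mat_group_closed(4)[OF \<Gamma>] that by metis
  have 2: "conj_hom A x = conj_hom (A ** matrix_inv \<gamma>) (conj_hom \<gamma> x)" if "A \<in> \<Gamma>" for A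
    using 1[of "A ** matrix_inv \<gamma>" \<gamma>] that \<gamma> mat_group_closed[OF \<Gamma>]
    by (simp add: matrix_mul_assoc[symmetric] matrix_inv_left)
  have cl: "A ** \<gamma> \<in> \<Gamma>" "A ** matrix_inv \<gamma> \<in> \<Gamma>" if "A \<in> \<Gamma>" for A
    using that \<gamma> mat_group_closed[OF \<Gamma>] by blast+
  show ?thesis unfolding hom_orbit_def
  proof (intro subset_antisym subsetI)
    fix y assume "y \<in> (\<lambda>A. conj_hom A (conj_hom \<gamma> x)) ` \<Gamma>"
    then obtain A where "A \<in> \<Gamma>" "y = conj_hom (A ** \<gamma>) x" using 1 \<gamma> by auto
    then show "y \<in> (\<lambda>A. conj_hom A x) ` \<Gamma>" using cl by blast
  next
    fix y assume "y \<in> (\<lambda>A. conj_hom A x) ` \<Gamma>"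
    then obtain A where "A \<in> \<Gamma>" "y = conj_hom (A ** matrix_inv \<gamma>) (conj_hom \<gamma> x)" using 2 by auto
    then show "y \<in> (\<lambda>A. conj_hom A (conj_hom \<gamma> x)) ` \<Gamma>" using cl by blast
  qed
qed

text \<open>The points of the section are whole \<open>Pu_int\<close>-orbits, whereas the subdatum
  provides only \<open>D_tilde\<close>. Elements of \<open>Pu_int\<close> are real, so
  \<open>D_hom\<close> turns their action into conjugation, which disappears in the classes modulo
  \<Gamma>.\<close>

theorem special_ribet:
  assumes \<Gamma>: "mat_group \<Gamma>" "Pu_int \<subseteq> \<Gamma>"
  shows "special_subvariety (P_alpha \<alpha>) (D_hom ` D_alpha \<alpha> \<tau>0) \<Gamma>
    {hom_orbit \<Gamma> (D_hom F) |F. F \<in> \<Union> (orb Pu_int ` D_tilde f \<alpha> \<tau>0)}"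
proof -
  have shift: "hom_orbit \<Gamma> (D_hom (act \<gamma> F)) = hom_orbit \<Gamma> (D_hom F)"
    if \<gamma>F: "\<gamma> \<in> Pu_int" "F \<in> D_tilde f \<alpha> \<tau>0" for \<gamma> F
  proof -
    obtain A where A: "A \<in> real_plus (P_tilde f \<alpha>)" and F: "F = act A (pt \<tau>0 0 0 0)"
      using \<gamma>F(2) unfolding D_tilde_def orb_def by blast
    have \<gamma>: "\<gamma> \<in> P_alpha \<alpha>" "map_mat cnj \<gamma> = \<gamma>"
    proof -
      have "x \<in> \<int> \<Longrightarrow> x \<in> \<real>" for x :: complex by (auto elim!: Ints_cases)
      then show "\<gamma> \<in> P_alpha \<alpha>" "map_mat cnj \<gamma> = \<gamma>"
        using \<gamma>F(1) unfolding pts_u_part(2)[of \<alpha>, symmetric] pts_def u_part_def cnj_mat_real[symmetric] by blast+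
    qed
    note A' = real_plus_P_tilde[OF A]
    have grp: "mat_group (P_alpha \<alpha>)" by (rule p_group.G_group[OF p_group_P_alpha])
    have "\<gamma> ** A \<in> P_alpha \<alpha>" using \<gamma> A' mat_group_closed[OF grp] by blast
    moreover have "map_mat cnj (\<gamma> ** A) = \<gamma> ** A" using \<gamma> A' by (simp add: cnj_simps)
    ultimately have "D_hom (act \<gamma> F) = conj_hom (\<gamma> ** A) (x0 \<tau>0)"
      using D_hom_P_alpha[OF _ _ mat_1_U, of "\<gamma> ** A"] by (simp add: F act_act)
    also have "\<dots> = conj_hom \<gamma> (D_hom F)"
      using conj_hom_mult[of \<gamma> A] mat_group_closed(4)[OF grp] \<gamma> A' by (simp add: F D_hom_tilde[OF A])
    finally show ?thesis using hom_orbit_conj[OF \<Gamma>(1)] \<Gamma>(2) \<gamma>F(1) by auto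
  qed
  have "{hom_orbit \<Gamma> (D_hom F) |F. F \<in> \<Union> (orb Pu_int ` D_tilde f \<alpha> \<tau>0)} = hom_orbit \<Gamma> ` (D_hom ` D_tilde f \<alpha> \<tau>0)"
  proof (intro subset_antisym subsetI)
    fix Z assume "Z \<in> {hom_orbit \<Gamma> (D_hom F) |F. F \<in> \<Union> (orb Pu_int ` D_tilde f \<alpha> \<tau>0)}"
    then obtain \<gamma> F where "\<gamma> \<in> Pu_int" "F \<in> D_tilde f \<alpha> \<tau>0" "Z = hom_orbit \<Gamma> (D_hom (act \<gamma> F))"
      unfolding orb_def by blast
    then show "Z \<in> hom_orbit \<Gamma> ` (D_hom ` D_tilde f \<alpha> \<tau>0)" using shift by auto
  next
    fix Z assume "Z \<in> hom_orbit \<Gamma> ` (D_hom ` D_tilde f \<alpha> \<tau>0)"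
    then obtain F where F: "F \<in> D_tilde f \<alpha> \<tau>0" "Z = hom_orbit \<Gamma> (D_hom F)" by blast
    then have "F \<in> \<Union> (orb Pu_int ` D_tilde f \<alpha> \<tau>0)" using orb_self[OF Pu_int_group] by blast
    then show "Z \<in> {hom_orbit \<Gamma> (D_hom F) |F. F \<in> \<Union> (orb Pu_int ` D_tilde f \<alpha> \<tau>0)}" using F(2) by blast
  qed
  moreover have "D_hom ` D_tilde f \<alpha> \<tau>0 \<subseteq> D_hom ` D_alpha \<alpha> \<tau>0" using D_tilde_subset by blast
  ultimately show ?thesis
    unfolding special_subvariety_def
    using connected_msd_P_alpha connected_msd_P_tilde P_tilde_subset by blast
qed

end

section \<open>The domain \<open>D\<close>\<close>

lemma vec3_0 [simp]: "vec3 0 0 0 = 0"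
  by simp

lemma mem_wt: "vec3 a b c \<in> wt n \<longleftrightarrow> (n < 0 \<longrightarrow> c = 0) \<and> (n < -1 \<longrightarrow> b = 0) \<and> (n < -2 \<longrightarrow> a = 0)"
  by (auto simp: wt_def)

lemma subspace_wt: "vec.subspace (wt n :: (complex^('d::finite ix)) set)"
  unfolding vec.subspace_def
proof (intro conjI ballI allI)
  show "0 \<in> wt n" using mem_wt[of 0 0 0 n] by simp
  fix c and x y :: "complex^('d ix)" assume x: "x \<in> wt n"
  show "c *s x \<in> wt n" using x by (rule_tac vec3_cases[of x]) (simp add: mem_wt)
  assume y: "y \<in> wt n"
  show "x + y \<in> wt n" using x y by (rule_tac vec3_cases[of x], rule_tac vec3_cases[of y]) (simp add: mem_wt)
qed

lemma subspace_over_Q_wt: "subspace_over_Q (wt n)"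
proof -
  have le: "map_vec s v \<in> wt n" if "field_aut s" "v \<in> wt n" for s v
    using that by (rule_tac vec3_cases[of v]) (auto simp: mem_wt field_aut_props map_vec_linear)
  have "map_vec s ` wt n = wt n" if s: "field_aut s" for s
  proof (intro subset_antisym subsetI)
    fix v assume "v \<in> wt n"
    moreover have "v = map_vec s (map_vec (inv s) v)" using s by (simp add: map_vec_def vec_eq_iff)
    ultimately show "v \<in> map_vec s ` wt n" using le[OF field_aut_inv[OF s]] by blast
  qed (use le[OF s] in blast)
  then show ?thesis unfolding subspace_over_Q_def using subspace_wt by blast
qed

text \<open>A family of subspaces which contains the points of \<open>D\<close> and is stable under complex conjugation.\<close>

definition period_space :: "complex^'d \<Rightarrow> complex \<Rightarrow> complex^('d + 'd) \<Rightarrow> (complex^'d \<Rightarrow> complex^('d + 'd)) \<Rightarrow> (complex^('d::finite ix)) set" where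
  "period_space p q y e = {vec3 (bdot p a + q * b) (e a + b *s y) b |a b. True}"

lemma period_space_I: "vec3 (bdot p a + q * b) (e a + b *s y) b \<in> period_space p q y e"
  unfolding period_space_def by blast

lemma pt_period_space: "pt \<tau> u v w = period_space (inverse tpi *s u) (w / tpi) (vec2 v 0) (ev \<tau>)"
proof -
  have "(x + w * b) / c = inverse c * x + w / c * b" for x w b c :: complex
    by (simp add: field_simps add_divide_distrib)
  then show ?thesis unfolding pt_def period_space_def ev_def bdot_scale_left by simp
qed

lemma conj_period_space:
  assumes "\<And>a. map_vec cnj (e a) = e' (map_vec cnj a)"
  shows "conj_set (period_space p q y e) = period_space (map_vec cnj p) (cnj q) (map_vec cnj y) e'"
proof (intro subset_antisym subsetI)
  fix x assume "x \<in> conj_set (period_space p q y e)"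
  then show "x \<in> period_space (map_vec cnj p) (cnj q) (map_vec cnj y) e'"
    unfolding conj_set_def period_space_def by (auto simp: assms cnj_simps)
next
  fix x assume "x \<in> period_space (map_vec cnj p) (cnj q) (map_vec cnj y) e'"
  then obtain a b where x: "x = vec3 (bdot (map_vec cnj p) a + cnj q * b) (e' a + b *s map_vec cnj y) b"
    unfolding period_space_def by blast
  have "x = map_vec cnj (vec3 (bdot p (map_vec cnj a) + q * cnj b) (e (map_vec cnj a) + cnj b *s y) (cnj b))"
    by (simp add: x assms cnj_simps)
  then show "x \<in> conj_set (period_space p q y e)" unfolding conj_set_def using period_space_I by blast
qed

lemma set_sum_commute: "set_sum A B = set_sum B A" for A :: "'a::ab_semigroup_add set"
proof -
  have "set_sum A B \<subseteq> set_sum B A" for A B :: "'a set"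
  proof
    fix v assume "v \<in> set_sum A B"
    then obtain a b where "v = a + b" "a \<in> A" "b \<in> B" unfolding set_sum_def by blast
    then have "v = b + a" by (simp add: add.commute)
    then show "v \<in> set_sum B A" unfolding set_sum_def using \<open>a \<in> A\<close> \<open>b \<in> B\<close> by blast
  qed
  then show ?thesis by blast
qed

lemma set_sum_wt:
  "set_sum (wt n) (wt (n - 1)) = (wt n :: (complex^('a::finite ix)) set)"
  "set_sum (wt (n - 1)) (wt n) = (wt n :: (complex^('a::finite ix)) set)"
  "wt (n - 1) \<subseteq> (wt n :: (complex^('a::finite ix)) set)" "0 \<in> (wt n :: (complex^('a::finite ix)) set)"
proof -
  show sub: "wt (n - 1) \<subseteq> (wt n :: (complex^('a::finite ix)) set)" by (rule wt_mono) simp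
  show z: "0 \<in> (wt n :: (complex^('a::finite ix)) set)" for n by (rule vec.subspace_0[OF subspace_wt])
  show 1: "set_sum (wt n) (wt (n - 1)) = (wt n :: (complex^('a::finite ix)) set)"
  proof (intro subset_antisym subsetI)
    fix v :: "complex^('a ix)" assume "v \<in> set_sum (wt n) (wt (n - 1))"
    then show "v \<in> wt n" unfolding set_sum_def using vec.subspace_add[OF subspace_wt, of _ n] sub by blast
  next
    fix v :: "complex^('a ix)" assume "v \<in> wt n"
    moreover have "v = v + 0" by simp
    ultimately show "v \<in> set_sum (wt n) (wt (n - 1))" unfolding set_sum_def using z[of "n - 1"] by blast
  qed
  have "set_sum (wt (n - 1)) (wt n) = set_sum (wt n) (wt (n - 1) :: (complex^('a::finite ix)) set)"
    by (rule set_sum_commute)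
  then show "set_sum (wt (n - 1)) (wt n) = (wt n :: (complex^('a::finite ix)) set)" unfolding 1 .
qed

lemma set_sum_0: "set_sum {0} A = A" for A :: "(complex^'n) set"
  by (auto simp: set_sum_def)

lemma subspace_period_space:
  assumes "clinear_map e" shows "vec.subspace (period_space p q y e)"
  unfolding vec.subspace_def
proof (intro conjI ballI allI)
  note e = clinearD[OF assms]
  show "0 \<in> period_space p q y e" using period_space_I[of p 0 q 0 e y] by (simp add: e)
  fix c x x' assume "x \<in> period_space p q y e"
  then obtain a b where x: "x = vec3 (bdot p a + q * b) (e a + b *s y) b" unfolding period_space_def by blast
  have "c *s x = vec3 (bdot p (c *s a) + q * (c * b)) (e (c *s a) + (c * b) *s y) (c * b)"
    by (simp add: x e algebra_simps vec.scale_right_distrib)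
  then show "c *s x \<in> period_space p q y e" using period_space_I by metis
  assume "x' \<in> period_space p q y e"
  then obtain a' b' where x': "x' = vec3 (bdot p a' + q * b') (e a' + b' *s y) b'" unfolding period_space_def by blast
  have "x + x' = vec3 (bdot p (a + a') + q * (b + b')) (e (a + a') + (b + b') *s y) (b + b')"
    by (simp add: x x' e algebra_simps bdot_distribs vec.scale_left_distrib)
  then show "x + x' \<in> period_space p q y e" using period_space_I by metis
qed

lemma gr_filt_bounds: "0 \<in> F \<Longrightarrow> wt (n - 1) \<subseteq> gr_F wt (filt F) k n" "gr_F wt (filt F) k n \<subseteq> wt n"
proof -
  show "gr_F wt (filt F) k n \<subseteq> wt n"
    unfolding gr_F_def set_sum_def using vec.subspace_add[OF subspace_wt, of _ n] set_sum_wt(3)[of n] by blast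
  assume "0 \<in> F"
  then have "0 \<in> filt F k \<inter> wt n" using set_sum_wt(4) by (simp add: filt_def)
  then show "wt (n - 1) \<subseteq> gr_F wt (filt F) k n" unfolding gr_F_def set_sum_def by force
qed

text \<open>The parameters p, q, y only shift lower weights and drop out of the graded pieces; e
  alone survives, in weight -1. With arbitrary parameters the lemma serves both for F and for its
  conjugate.\<close>

lemma gr_period_space:
  assumes e: "clinear_map e" "\<forall>a. e a = 0 \<longrightarrow> a = 0"
  shows "k < 0 \<Longrightarrow> gr_F wt (filt (period_space p q y e)) k n = wt n"
    "k > 0 \<Longrightarrow> gr_F wt (filt (period_space p q y e)) k n = wt (n - 1)"
    "n \<ge> 0 \<Longrightarrow> gr_F wt (filt (period_space p q y e)) 0 n = wt n"
    "gr_F wt (filt (period_space p q y e)) 0 (-1) = {vec3 c (e a) 0 |c a. True}"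
    "n \<le> -2 \<Longrightarrow> gr_F wt (filt (period_space p q y e)) 0 n = wt (n - 1)"
proof -
  note el = clinearD[OF e(1)]
  have z: "0 \<in> period_space p q y e" by (rule vec.subspace_0[OF subspace_period_space[OF e(1)]])
  show "k < 0 \<Longrightarrow> gr_F wt (filt (period_space p q y e)) k n = wt n"
    by (simp add: gr_F_def filt_cases set_sum_wt)
  show "k > 0 \<Longrightarrow> gr_F wt (filt (period_space p q y e)) k n = wt (n - 1)"
    by (simp add: gr_F_def filt_cases set_sum_wt set_sum_0)
  show "gr_F wt (filt (period_space p q y e)) 0 n = wt n" if n: "n \<ge> 0"
  proof (rule subset_antisym[OF gr_filt_bounds(2)], rule subsetI)
    fix v :: "complex^('a ix)"
    obtain a b c where v: "v = vec3 a b c" by (rule vec3_cases)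
    have 1: "vec3 (bdot p 0 + q * c) (e 0 + c *s y) c \<in> filt (period_space p q y e) 0 \<inter> wt n"
      using n unfolding filt_cases by (simp add: period_space_I mem_wt del: bdot_zero)
    have 2: "vec3 (a - q * c) (b - c *s y) 0 \<in> wt (n - 1)" using n by (simp add: mem_wt)
    have "v = vec3 (bdot p 0 + q * c) (e 0 + c *s y) c + vec3 (a - q * c) (b - c *s y) 0" by (simp add: v el)
    then show "v \<in> gr_F wt (filt (period_space p q y e)) 0 n" unfolding gr_F_def set_sum_def using 1 2 by blast
  qed
  show "gr_F wt (filt (period_space p q y e)) 0 (-1) = {vec3 c (e a) 0 |c a. True}"
  proof (intro subset_antisym subsetI)
    fix v assume "v \<in> gr_F wt (filt (period_space p q y e)) 0 (-1)"
    then obtain s t where v: "v = s + t" "s \<in> period_space p q y e" "s \<in> wt (-1)" "t \<in> wt (-2)"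
      unfolding gr_F_def set_sum_def filt_cases by auto
    obtain a b where s: "s = vec3 (bdot p a + q * b) (e a + b *s y) b" using v(2) unfolding period_space_def by blast
    obtain d where t: "t = vec3 d 0 0" using v(4) unfolding wt_cases by blast
    have "b = 0" using v(3) unfolding s mem_wt by simp
    then have "v = vec3 (bdot p a + d) (e a) 0" by (simp add: v(1) s t)
    then show "v \<in> {vec3 c (e a) 0 |c a. True}" by blast
  next
    fix v assume "v \<in> {vec3 c (e a) 0 |c a. True}"
    then obtain c a where v: "v = vec3 c (e a) 0" by blast
    have 1: "vec3 (bdot p a) (e a) 0 \<in> filt (period_space p q y e) 0 \<inter> wt (-1)"
      using period_space_I[of p a q 0 e y] by (simp add: filt_cases mem_wt)
    have 2: "vec3 (c - bdot p a) 0 0 \<in> wt (-1 - 1)" by (simp add: mem_wt)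
    have "v = vec3 (bdot p a) (e a) 0 + vec3 (c - bdot p a) 0 0" by (simp add: v)
    then show "v \<in> gr_F wt (filt (period_space p q y e)) 0 (-1)" unfolding gr_F_def set_sum_def using 1 2 by blast
  qed
  show "gr_F wt (filt (period_space p q y e)) 0 n = wt (n - 1)" if n: "n \<le> -2"
  proof -
    have "s = 0" if s: "s \<in> period_space p q y e" "s \<in> wt n" for s
    proof -
      obtain a b where s': "s = vec3 (bdot p a + q * b) (e a + b *s y) b" using s(1) unfolding period_space_def by blast
      have "b = 0" "e a = 0" using s(2) n unfolding s' mem_wt by auto
      moreover from this(2) have "a = 0" using e(2) by blast
      ultimately show ?thesis by (simp add: s')
    qed
    then have "filt (period_space p q y e) 0 \<inter> wt n = {0}" unfolding filt_cases using z set_sum_wt(4) by blast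
    then show ?thesis by (simp add: gr_F_def set_sum_0)
  qed
qed

lemma gr0_pt: "gr0 (pt \<tau> u v w) = range (ev \<tau>)"
proof -
  have "(\<exists>a. vec3 a b 0 \<in> period_space p q y e) \<longleftrightarrow> (\<exists>a. b = e a)" for b p q y and e :: "complex^'a \<Rightarrow> complex^('a + 'a)"
    unfolding period_space_def by auto
  then show ?thesis unfolding gr0_def pt_period_space by auto
qed

theorem pt_in_D_dom:
  fixes \<tau> :: "complex^'d^'d::finite"
  assumes \<tau>: "\<tau> \<in> siegel" shows "pt \<tau> u v w \<in> D_dom"
proof -
  let ?p = "inverse tpi *s u" and ?q = "w / tpi" and ?y = "vec2 v 0 :: complex^('d + 'd)"
  let ?F = "period_space ?p ?q ?y (ev \<tau>)" and ?F' = "period_space (map_vec cnj ?p) (cnj ?q) (map_vec cnj ?y) (evbar \<tau>)"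
  define G where "G = gr_F wt (filt ?F)"
  define G' where "G' = gr_F wt (filt ?F')"
  have conj: "conj_set ?F = ?F'" by (rule conj_period_space) (rule cnj_ev)
  have "conj_set (filt ?F k) = filt ?F' k" for k
    unfolding conj[symmetric] by (simp add: filt_def conj_set_triv[OF \<tau>])
  then have bar: "gr_Fbar wt (filt ?F) = G'" by (simp add: fun_eq_iff G'_def gr_F_def gr_Fbar_def)
  have inj: "\<forall>a. ev \<tau> a = 0 \<longrightarrow> a = 0" "\<forall>a. evbar \<tau> a = 0 \<longrightarrow> a = 0" by (simp_all add: ev_def evbar_def)
  note lin = ev_clinear[OF \<tau>]
  note G = gr_period_space[OF lin(1) inj(1), where p = ?p and q = ?q and y = ?y, folded G_def]
  note G' = gr_period_space[OF lin(2) inj(2), where p = "map_vec cnj ?p" and q = "cnj ?q" and y = "map_vec cnj ?y", folded G'_def]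
  have z: "0 \<in> ?F" "0 \<in> ?F'" using vec.subspace_0[OF subspace_period_space] lin by blast+
  have bd: "wt (n - 1) \<subseteq> G k n" "G k n \<subseteq> wt n" "wt (n - 1) \<subseteq> G' k n" "G' k n \<subseteq> wt n" for k n
    unfolding G_def G'_def using gr_filt_bounds z by blast+
  have nm1: "set_sum (G p (-1)) (G' (-p) (-1)) = wt (-1) \<and> G p (-1) \<inter> G' (-p) (-1) = wt (-2)" for p
  proof -
    consider "p < 0" | "p = 0" | "p > 0" by linarith
    then show ?thesis
    proof cases
      case 1 then show ?thesis using G(1)[of p "-1"] G'(2)[of "-p" "-1"] set_sum_wt(1,3)[of "-1"] by auto
    next
      case 3 then show ?thesis using G(2)[of p "-1"] G'(1)[of "-p" "-1"] set_sum_wt(2,3)[of "-1"] by auto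
    next
      case 2
      have "set_sum (G 0 (-1)) (G' 0 (-1)) = wt (-1)"
      proof (intro subset_antisym subsetI)
        fix v assume "v \<in> set_sum (G 0 (-1)) (G' 0 (-1))"
        then show "v \<in> wt (-1)" unfolding set_sum_def using bd vec.subspace_add[OF subspace_wt, of _ "-1"] by blast
      next
        fix v :: "complex^('d ix)" assume "v \<in> wt (-1)"
        then obtain c x where v: "v = vec3 c x 0" unfolding wt_cases by blast
        obtain a b where x: "x = ev \<tau> a + evbar \<tau> b" by (rule ev_cases[OF \<tau>])
        have "vec3 c (ev \<tau> a) 0 \<in> G 0 (-1)" "vec3 0 (evbar \<tau> b) 0 \<in> G' 0 (-1)" unfolding G(4) G'(4) by blast+
        moreover have "v = vec3 c (ev \<tau> a) 0 + vec3 0 (evbar \<tau> b) 0" by (simp add: v x)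
        ultimately show "v \<in> set_sum (G 0 (-1)) (G' 0 (-1))" unfolding set_sum_def by blast
      qed
      moreover have "G 0 (-1) \<inter> G' 0 (-1) \<subseteq> wt (-2)"
      proof
        fix v assume "v \<in> G 0 (-1) \<inter> G' 0 (-1)"
        then obtain c a c' b where v: "v = vec3 c (ev \<tau> a) 0" "v = vec3 c' (evbar \<tau> b) 0" unfolding G(4) G'(4) by blast
        then have "ev \<tau> a = evbar \<tau> b" by simp
        then have "ev \<tau> a = 0" by (rule ev_evbar_0[OF \<tau>])
        then show "v \<in> wt (-2)" by (simp add: v(1) mem_wt)
      qed
      moreover have "wt (-2) \<subseteq> G 0 (-1) \<inter> G' 0 (-1)" using bd(1,3)[of "-1" 0] by simp
      ultimately show ?thesis using 2 by auto
    qed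
  qed
  have main: "set_sum (G p n) (G' (n + 1 - p) n) = wt n \<and> G p n \<inter> G' (n + 1 - p) n = wt (n - 1)" for p n
  proof -
    \<comment> \<open>Except for n = -1, either W does not jump at n, or one of the two graded
      filtrations is everything and the other one is trivial.\<close>
    have A: ?thesis if "G p n = wt n" "G' (n + 1 - p) n = wt (n - 1)"
      unfolding that using set_sum_wt[of n] by blast
    have B: ?thesis if "G p n = wt (n - 1)" "G' (n + 1 - p) n = wt n"
      unfolding that using set_sum_wt[of n] by blast
    have C: ?thesis if w: "wt n = (wt (n - 1) :: (complex^('d ix)) set)"
    proof (rule A)
      show "G p n = wt n" using bd(1)[of n p] bd(2)[of p n] unfolding w by blast
      show "G' (n + 1 - p) n = wt (n - 1)" using bd(3)[of n "n + 1 - p"] bd(4)[of "n + 1 - p" n] unfolding w by blast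
    qed
    consider "n \<ge> 1" | "n \<le> -3" | "n = 0" "p \<le> 0" | "n = 0" "p > 0" | "n = -1" | "n = -2" "p < 0" | "n = -2" "p \<ge> 0"
      by linarith
    then show ?thesis
    proof cases
      case 1 then show ?thesis by (intro C) (simp add: wt_cases)
    next
      case 2 then show ?thesis by (intro C) (simp add: wt_cases)
    next
      case 3 then show ?thesis using G(1)[of p n] G(3)[of n] by (intro A G') (cases "p = 0"; simp)+
    next
      case 4 then show ?thesis using G'(1)[of "1 - p" n] G'(3)[of n] by (intro B G) (cases "p = 1"; simp)+
    next
      case 5 then show ?thesis using nm1[of p] by simp
    next
      case 6 then show ?thesis using G'(2)[of "-1 - p" n] G'(5)[of n] by (intro A G) (cases "p = -1"; simp)+
    next
      case 7 then show ?thesis using G(2)[of p n] G(5)[of n] by (intro B G') (cases "p = 0"; simp)+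
    qed
  qed
  have "mixed_hodge UNIV wt (filt ?F)"
    unfolding mixed_hodge_def bar G_def[symmetric]
  proof (intro conjI allI)
    show "subspace_over_Q (UNIV :: (complex^('d ix)) set)" using subspace_over_Q_wt[of 0] by (simp add: wt_cases)
    show "\<exists>n. wt n = ({0} :: (complex^('d ix)) set)" by (rule exI[of _ "-3"]) (simp add: wt_cases)
    show "\<exists>n. wt n = (UNIV :: (complex^('d ix)) set)" by (rule exI[of _ 0]) (simp add: wt_cases)
    show "vec.subspace (filt ?F p)" for p
      using subspace_period_space[OF lin(1)] by (simp add: filt_def vec.subspace_single_0)
    show "filt ?F (p + 1) \<subseteq> filt ?F p" for p using z by (auto simp: filt_def)
    show "\<exists>p. filt ?F p = {0}" by (rule exI[of _ 1]) (simp add: filt_def)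
    show "\<exists>p. filt ?F p = UNIV" by (rule exI[of _ "-1"]) (simp add: filt_def)
    show "subspace_over_Q (wt n :: (complex^('d ix)) set)" "wt n \<subseteq> (wt (n + 1) :: (complex^('d ix)) set)" for n
      by (rule subspace_over_Q_wt, rule wt_mono) simp
  qed (use main in blast)+
  moreover have "hodge_type wt (filt ?F) {(-1,-1), (-1,0), (0,-1), (0,0)}"
    unfolding hodge_type_def bar G_def[symmetric]
  proof (intro allI impI, rule ccontr)
    fix p q assume ne: "G p (p + q) \<inter> G' q (p + q) \<noteq> wt (p + q - 1)" and T: "(p, q) \<notin> {(-1,-1), (-1,0), (0,-1), (0,0)}"
    define n where "n = p + q"
    have A: False if "G p n = wt (n - 1) \<or> G' q n = wt (n - 1)"
      using that ne bd(1,3)[of n] unfolding n_def[symmetric] by blast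
    have B: False if "wt n = (wt (n - 1) :: (complex^('d ix)) set)"
      using A bd(1)[of n p] bd(2)[of p n] that by blast
    have "n \<le> -3 \<or> p > 0 \<or> q > 0 \<or> (n = -2 \<and> p = 0) \<or> (n = -2 \<and> q = 0)"
    proof (rule ccontr)
      assume c: "\<not> ?thesis"
      then have "p \<le> 0" "q \<le> 0" "p + q \<ge> -2" unfolding n_def by auto
      then have "p \<in> {-2..0}" "q \<in> {-2..0}" by auto
      then have "p = -2 \<or> p = -1 \<or> p = 0" "q = -2 \<or> q = -1 \<or> q = 0" by auto
      then show False using c T \<open>p + q \<ge> -2\<close> unfolding n_def by (elim disjE) simp_all
    qed
    then consider "n \<le> -3" | "p > 0" | "q > 0" | "n = -2" "p = 0" | "n = -2" "q = 0" by blast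
    then show False
    proof cases
      case 1 then show ?thesis by (intro B) (simp add: wt_cases)
    next
      case 2 then show ?thesis using A G(2)[of p n] by blast
    next
      case 3 then show ?thesis using A G'(2)[of q n] by blast
    next
      case 4 then show ?thesis using A G(5)[of n] by simp
    next
      case 5 then show ?thesis using A G'(5)[of n] by simp
    qed
  qed
  moreover have "Psi_polarises (range (ev \<tau>))"
    unfolding Psi_polarises_def
  proof (intro conjI ballI impI)
    fix x y assume "x \<in> range (ev \<tau>)" "y \<in> range (ev \<tau>)"
    then show "Psi x y = 0" using sp_ev[OF \<tau>] unfolding Psi_def sp_def by auto
  next
    fix x assume "x \<in> range (ev \<tau>)" "x \<noteq> 0"
    moreover have "ev \<tau> 0 = 0" by (simp add: ev_def)
    ultimately obtain a where x: "x = ev \<tau> a" "a \<noteq> 0" by blast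
    let ?r = "2 * Im (bdot (map_vec cnj a) (\<tau> *v a))"
    have "Psi x (\<i> *s map_vec cnj x) / (2 * of_real pi * \<i>) = \<i> * sp x (map_vec cnj x)"
      unfolding Psi_def sp_def by (simp add: field_simps)
    also have "\<dots> = of_real ?r"
    proof -
      have "\<i> * (- 2 * \<i> * c) = 2 * c" for c :: complex by simp
      then show ?thesis unfolding x(1) sp_ev_cnj by (simp only: of_real_mult of_real_numeral)
    qed
    finally have eq: "Psi x (\<i> *s map_vec cnj x) / (2 * of_real pi * \<i>) = of_real ?r" .
    show "\<exists>r>0. Psi x (\<i> *s map_vec cnj x) / (2 * of_real pi * \<i>) = of_real r"
    proof (intro exI conjI)
      show "?r > 0" using siegel_Im_pos[OF \<tau> x(2)] by simp
    qed (rule eq)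
  qed
  ultimately show ?thesis unfolding D_dom_def mem_Collect_eq gr0_pt unfolding pt_period_space by blast
qed

section \<open>Holomorphic dependence on the parameters\<close>

lemma holo2_const: "holo2_on S (\<lambda>_. c)"
  unfolding holo2_on_def by (auto intro!: exI[of _ "\<lambda>_. 0"] derivative_intros)

lemma holo2_fst: "holo2_on S (\<lambda>y. fst y $ i $ j)"
proof -
  have "bounded_linear (\<lambda>y::(complex^'a^'a) \<times> (complex^'a). fst y $ i $ j)"
    by (intro bounded_linear_compose[OF bounded_linear_vec_nth] bounded_linear_fst)
  then show ?thesis unfolding holo2_on_def
    by (intro ballI exI[of _ "\<lambda>y. fst y $ i $ j"]) (simp add: bounded_linear_imp_has_derivative map_mat_def)
qed

lemma holo2_snd: "holo2_on S (\<lambda>y. snd y $ i)"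
proof -
  have "bounded_linear (\<lambda>y::(complex^'a^'a) \<times> (complex^'a). snd y $ i)"
    by (intro bounded_linear_compose[OF bounded_linear_vec_nth] bounded_linear_snd)
  then show ?thesis unfolding holo2_on_def
    by (intro ballI exI[of _ "\<lambda>y. snd y $ i"]) (simp add: bounded_linear_imp_has_derivative)
qed

lemma holo2_add: "holo2_on S h \<Longrightarrow> holo2_on S k \<Longrightarrow> holo2_on S (\<lambda>y. h y + k y)"
  unfolding holo2_on_def
proof
  fix x assume h: "\<forall>x\<in>S. \<exists>h'. (h has_derivative h') (at x) \<and> (\<forall>s t. h' (map_mat ((*) \<i>) s, \<i> *s t) = \<i> * h' (s, t))"
    and k: "\<forall>x\<in>S. \<exists>h'. (k has_derivative h') (at x) \<and> (\<forall>s t. h' (map_mat ((*) \<i>) s, \<i> *s t) = \<i> * h' (s, t))"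
    and x: "x \<in> S"
  obtain h' where h': "(h has_derivative h') (at x)" "\<forall>s t. h' (map_mat ((*) \<i>) s, \<i> *s t) = \<i> * h' (s, t)" using h x by blast
  obtain k' where k': "(k has_derivative k') (at x)" "\<forall>s t. k' (map_mat ((*) \<i>) s, \<i> *s t) = \<i> * k' (s, t)" using k x by blast
  show "\<exists>h'. ((\<lambda>y. h y + k y) has_derivative h') (at x) \<and> (\<forall>s t. h' (map_mat ((*) \<i>) s, \<i> *s t) = \<i> * h' (s, t))"
    by (intro exI[of _ "\<lambda>d. h' d + k' d"] conjI has_derivative_add h'(1) k'(1)) (simp add: h'(2) k'(2) algebra_simps)
qed

lemma holo2_mult: "holo2_on S h \<Longrightarrow> holo2_on S k \<Longrightarrow> holo2_on S (\<lambda>y. h y * k y)"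
  unfolding holo2_on_def
proof
  fix x assume h: "\<forall>x\<in>S. \<exists>h'. (h has_derivative h') (at x) \<and> (\<forall>s t. h' (map_mat ((*) \<i>) s, \<i> *s t) = \<i> * h' (s, t))"
    and k: "\<forall>x\<in>S. \<exists>h'. (k has_derivative h') (at x) \<and> (\<forall>s t. h' (map_mat ((*) \<i>) s, \<i> *s t) = \<i> * h' (s, t))"
    and x: "x \<in> S"
  obtain h' where h': "(h has_derivative h') (at x)" "\<forall>s t. h' (map_mat ((*) \<i>) s, \<i> *s t) = \<i> * h' (s, t)" using h x by blast
  obtain k' where k': "(k has_derivative k') (at x)" "\<forall>s t. k' (map_mat ((*) \<i>) s, \<i> *s t) = \<i> * k' (s, t)" using k x by blast
  show "\<exists>h'. ((\<lambda>y. h y * k y) has_derivative h') (at x) \<and> (\<forall>s t. h' (map_mat ((*) \<i>) s, \<i> *s t) = \<i> * h' (s, t))"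
    by (intro exI[of _ "\<lambda>d. h x * k' d + h' d * k x"] conjI has_derivative_mult h'(1) k'(1))
      (simp add: h'(2) k'(2) algebra_simps)
qed

lemma holo2_sum: "(\<And>i. holo2_on S (h i)) \<Longrightarrow> holo2_on S (\<lambda>y. \<Sum>i\<in>I. h i y)"
proof (induction I rule: infinite_finite_induct)
  case (insert i I)
  then show ?case using holo2_add[of S "h i"] by simp
qed (simp_all add: holo2_const)

lemma cim_vec2_nth: "(cim A *v vec2 0 (c *s t)) $ i = (\<Sum>j\<in>UNIV. of_int (A $ i $ Inr j) * (c * t $ j))"
  by (simp add: matrix_vector_mult_def cim_def sum_UNIV_plus)

lemma holo2_v_ribet: "holo2_on S (\<lambda>y. v_ribet \<alpha> (fst y) (snd y) $ k)"
proof -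
  have eq: "v_ribet \<alpha> (fst y) (snd y) $ k = (\<Sum>j\<in>UNIV. of_int (\<alpha> $ Inl k $ Inr j) * (inverse tpi * snd y $ j)) +
      (-1) * (\<Sum>i\<in>UNIV. fst y $ k $ i * (\<Sum>j\<in>UNIV. of_int (\<alpha> $ Inr i $ Inr j) * (inverse tpi * snd y $ j)))" for y
    unfolding v_ribet_def projA_def vector_minus_component matrix_vector_mult_def[of "fst y"] vec_lambda_beta cim_vec2_nth
    by simp
  show ?thesis unfolding eq by (intro holo2_add holo2_mult holo2_sum holo2_const holo2_fst holo2_snd)
qed

lemma holo2_w_ribet: "holo2_on S (\<lambda>y. w_ribet \<alpha> (snd y))"
proof -
  have eq: "w_ribet \<alpha> (snd y) = - (tpi / 2) * (\<Sum>i\<in>UNIV. (inverse tpi * snd y $ i) *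
      (\<Sum>j\<in>UNIV. of_int (\<alpha> $ Inr i $ Inr j) * (inverse tpi * snd y $ j)))" for y
    unfolding w_ribet_def bdot_def sum_UNIV_plus vec2_nth cim_vec2_nth vector_smult_component by simp
  show ?thesis unfolding eq by (intro holo2_mult holo2_sum holo2_const holo2_snd)
qed

lemma holo_of_holo2: "holo2_on UNIV h \<Longrightarrow> holo_on N (\<lambda>t. h (\<tau>, t))"
  unfolding holo_on_def
proof
  fix t assume h: "holo2_on UNIV h"
  obtain h' where h': "(h has_derivative h') (at (\<tau>, t))" "\<forall>s t. h' (map_mat ((*) \<i>) s, \<i> *s t) = \<i> * h' (s, t)"
    using h unfolding holo2_on_def by blast
  have "((\<lambda>t. (\<tau>, t)) has_derivative (\<lambda>s. (0, s))) (at t)" by (intro derivative_intros)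
  then have "((\<lambda>t. h (\<tau>, t)) has_derivative (\<lambda>s. h' (0, s))) (at t)"
    using h'(1) by (rule has_derivative_compose)
  moreover have "h' (0, \<i> *s s) = \<i> * h' (0, s)" for s
  proof -
    have "map_mat ((*) \<i>) (0 :: complex^'a^'a) = 0" by (simp add: map_mat_def vec_eq_iff)
    then show ?thesis using h'(2) by metis
  qed
  ultimately show "\<exists>h'. ((\<lambda>t. h (\<tau>, t)) has_derivative h') (at t) \<and> (\<forall>t. h' (\<i> *s t) = \<i> * h' t)" by blast
qed

section \<open>The section over the family\<close>

text \<open>Over \<open>H_alpha\<close> the choice of t is immaterial by
  \<open>ribet_section_clsB\<close>: shifting t by the lattice is the action of an integral element
  of \<open>P_tilde\<close> that lies in \<open>Pu_int\<close>.\<close>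

definition ribet_section :: "int^('d::finite + 'd)^('d + 'd) \<Rightarrow>
    (complex^'d^'d) \<times> (complex^'d) set \<Rightarrow> (complex^('d ix)) set set" where
  "ribet_section \<alpha> = (\<lambda>(\<tau>, b). orb Pu_int (ribet_pt \<alpha> \<tau> (SOME t. clsB \<tau> t = b)))"

context ribet
begin

lemma ribet_section_clsB:
  assumes H: "\<tau> \<in> H_alpha \<alpha> \<tau>0"
  shows "ribet_section \<alpha> (\<tau>, clsB \<tau> t) = orb Pu_int (ribet_pt \<alpha> \<tau> t)"
proof -
  define t' where "t' = (SOME t'. clsB \<tau> t' = clsB \<tau> t)"
  have "clsB \<tau> t' = clsB \<tau> t" unfolding t'_def by (rule someI) (rule refl)
  then obtain n where "t - t' = projB \<tau> (civ n)" unfolding clsB_eq latB_def by blast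
  then have t: "t = t' + projB \<tau> (civ n)" by (simp add: algebra_simps)
  show ?thesis unfolding ribet_section_def case_prod_conv t'_def[symmetric]
    unfolding t orb_Pu_ribet_pt[OF H_alphaD[OF H]] ..
qed

lemma ribet_section_image: "ribet_section \<alpha> ` B_family \<alpha> \<tau>0 = orb Pu_int ` D_tilde f \<alpha> \<tau>0"
proof (intro subset_antisym subsetI)
  fix Z assume "Z \<in> ribet_section \<alpha> ` B_family \<alpha> \<tau>0"
  then obtain \<tau> t where "\<tau> \<in> H_alpha \<alpha> \<tau>0" "Z = ribet_section \<alpha> (\<tau>, clsB \<tau> t)"
    unfolding B_family_def B_var_def by auto
  then show "Z \<in> orb Pu_int ` D_tilde f \<alpha> \<tau>0" unfolding D_tilde_eq using ribet_section_clsB by auto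
next
  fix Z assume "Z \<in> orb Pu_int ` D_tilde f \<alpha> \<tau>0"
  then obtain \<tau> t where H: "\<tau> \<in> H_alpha \<alpha> \<tau>0" and Z: "Z = orb Pu_int (ribet_pt \<alpha> \<tau> t)"
    unfolding D_tilde_eq by blast
  have "(\<tau>, clsB \<tau> t) \<in> B_family \<alpha> \<tau>0" using H unfolding B_family_def B_var_def by blast
  then show "Z \<in> ribet_section \<alpha> ` B_family \<alpha> \<tau>0" unfolding Z ribet_section_clsB[OF H, symmetric] by blast
qed

lemma quot_map_ribet_pt:
  assumes H: "\<tau> \<in> H_alpha \<alpha> \<tau>0"
  shows "quot_map Pu_int (orb (pts \<int> (u_part (P_tilde f \<alpha>))) (ribet_pt \<alpha> \<tau> t)) = orb Pu_int (ribet_pt \<alpha> \<tau> t)"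
  unfolding orb_tilde_eq[OF H_alphaD[OF H]] quot_map_def
  using orb_Pu_ribet_pt[OF H_alphaD[OF H]] by blast

text \<open>Equality of \<open>Pu_int\<close>-classes forces equal \<tau> and values of t that
  differ by the lattice of \<open>B_var\<close>. Such a shift is already realised by the integral
  unipotent part of \<open>P_tilde\<close>, which gives injectivity.\<close>

theorem bij_ribet_section:
  "bij_betw (quot_map Pu_int) (quot (pts \<int> (u_part (P_tilde f \<alpha>))) (D_tilde f \<alpha> \<tau>0))
    (ribet_section \<alpha> ` B_family \<alpha> \<tau>0)"
  unfolding bij_betw_def
proof
  let ?T = "pts \<int> (u_part (P_tilde f \<alpha>))"
  have "quot_map Pu_int (orb ?T F) = orb Pu_int F" if "F \<in> D_tilde f \<alpha> \<tau>0" for F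
    using that quot_map_ribet_pt unfolding D_tilde_eq by blast
  then show "quot_map Pu_int ` quot ?T (D_tilde f \<alpha> \<tau>0) = ribet_section \<alpha> ` B_family \<alpha> \<tau>0"
    unfolding ribet_section_image quot_def image_image by (intro image_cong refl)
  show "inj_on (quot_map Pu_int) (quot ?T (D_tilde f \<alpha> \<tau>0))"
  proof (rule inj_onI)
    fix X Y assume "X \<in> quot ?T (D_tilde f \<alpha> \<tau>0)" "Y \<in> quot ?T (D_tilde f \<alpha> \<tau>0)" and eq: "quot_map Pu_int X = quot_map Pu_int Y"
    then obtain \<tau> t \<tau>' t' where X: "X = orb ?T (ribet_pt \<alpha> \<tau> t)" and H: "\<tau> \<in> H_alpha \<alpha> \<tau>0"
      and Y: "Y = orb ?T (ribet_pt \<alpha> \<tau>' t')" and H': "\<tau>' \<in> H_alpha \<alpha> \<tau>0"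
      unfolding quot_def D_tilde_eq by blast
    have "cpt \<tau> t (v_ribet \<alpha> \<tau> t) (w_ribet \<alpha> t) = cpt \<tau>' t' (v_ribet \<alpha> \<tau>' t') (w_ribet \<alpha> t')"
      using eq unfolding X Y quot_map_ribet_pt[OF H] quot_map_ribet_pt[OF H'] unfolding cpt_Pu ribet_pt_def .
    then obtain n where n: "\<tau>' = \<tau>" "t' = t + projB \<tau> (civ n)" unfolding cpt_eq_iff[OF H_alphaD(1)[OF H]] by blast
    have "\<exists>m. t + projB \<tau> (civ k) = t' + projB \<tau> (civ m)" for k
      by (rule exI[of _ "k - n"]) (simp add: n(2) civ_linear projB_linear)
    moreover have "\<exists>m. t' + projB \<tau> (civ k) = t + projB \<tau> (civ m)" for k
      by (rule exI[of _ "n + k"]) (simp add: n(2) civ_linear projB_linear)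
    ultimately show "X = Y" unfolding X Y n(1) orb_tilde_eq[OF H_alphaD[OF H]] by (intro subset_antisym) (auto, metis+)
  qed
qed

theorem family_section_ribet: "family_section \<alpha> \<tau>0 (ribet_section \<alpha>)"
  unfolding family_section_def pts_u_part
proof (intro conjI ballI allI)
  fix x assume "x \<in> B_family \<alpha> \<tau>0"
  then obtain \<tau> t where x: "x = (\<tau>, clsB \<tau> t)" and H: "\<tau> \<in> H_alpha \<alpha> \<tau>0"
    unfolding B_family_def B_var_def by auto
  have "ribet_pt \<alpha> \<tau> t \<in> D_alpha \<alpha> \<tau>0" using D_tilde_subset H unfolding D_tilde_eq by blast
  then have "ribet_section \<alpha> (\<tau>, clsB \<tau> t) \<in> quot Pu_int (D_alpha \<alpha> \<tau>0)"
    unfolding ribet_section_clsB[OF H] quot_def by blast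
  moreover have "pt \<tau> t (v_ribet \<alpha> \<tau> t) (w_ribet \<alpha> t) \<in> ribet_section \<alpha> (\<tau>, clsB \<tau> t)"
    unfolding ribet_section_clsB[OF H] ribet_pt_def by (rule orb_self[OF Pu_int_group])
  ultimately show "case x of (\<tau>, b) \<Rightarrow> ribet_section \<alpha> (\<tau>, b) \<in> quot Pu_int (D_alpha \<alpha> \<tau>0) \<and>
      (\<exists>u v w. pt \<tau> u v w \<in> ribet_section \<alpha> (\<tau>, b) \<and> clsB \<tau> u = b)"
    unfolding x by blast
next
  fix \<tau>1 t1 assume "\<tau>1 \<in> H_alpha \<alpha> \<tau>0"
  show "\<exists>N V w. open N \<and> (\<tau>1, t1) \<in> N \<and> (\<forall>k. holo2_on N (\<lambda>y. V y $ k)) \<and> holo2_on N w \<and>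
      (\<forall>(\<tau>, t)\<in>N. \<tau> \<in> H_alpha \<alpha> \<tau>0 \<longrightarrow> pt \<tau> t (V (\<tau>, t)) (w (\<tau>, t)) \<in> ribet_section \<alpha> (\<tau>, clsB \<tau> t))"
  \<comment> \<open>The formulas for v and w are polynomial in \<tau> and t, so one chart serves
    everywhere.\<close>
  proof (rule exI[of _ UNIV], rule exI[of _ "\<lambda>y. v_ribet \<alpha> (fst y) (snd y)"], rule exI[of _ "\<lambda>y. w_ribet \<alpha> (snd y)"],
      intro conjI allI ballI holo2_v_ribet holo2_w_ribet)
    fix y :: "(complex^'d^'d) \<times> (complex^'d)"
    show "case y of (\<tau>, t) \<Rightarrow> \<tau> \<in> H_alpha \<alpha> \<tau>0 \<longrightarrow> pt \<tau> t (v_ribet \<alpha> (fst (\<tau>, t)) (snd (\<tau>, t))) (w_ribet \<alpha> (snd (\<tau>, t)))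
        \<in> ribet_section \<alpha> (\<tau>, clsB \<tau> t)"
      using ribet_section_clsB orb_self[OF Pu_int_group] by (auto simp: ribet_pt_def split: prod.split)
  qed auto
qed

end

section \<open>Sections over the graph of \<open>\<alpha>\<close>\<close>

lemma cpt_add_w:
  assumes \<tau>: "\<tau> \<in> siegel" and eq: "cpt \<tau> u v w = cpt \<tau> u' v' w'"
  shows "cpt \<tau> u v (w + h) = cpt \<tau> u' v' (w' + h)"
proof -
  obtain m k n where *: "u' = u + projB \<tau> (civ m)" "v' = v + projA \<tau> (civ n)"
    "w' = w + tpi * (bdot (vfst (civ m)) v + of_int k) - bdot u' (vsnd (civ n))"
    using eq unfolding cpt_eq_iff[OF \<tau>] by blast
  have "w' + h = (w + h) + tpi * (bdot (vfst (civ m)) v + of_int k) - bdot u' (vsnd (civ n))"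
    unfolding *(3) by simp
  then show ?thesis unfolding cpt_eq_iff[OF \<tau>] using *(1,2) by blast
qed

lemma cpt_fibre_repr:
  assumes \<tau>: "\<tau> \<in> siegel" and c: "c \<in> poincare_fibre \<tau> (clsA \<tau> v) (clsB \<tau> u)"
  shows "\<exists>w. c = cpt \<tau> u v w"
proof -
  obtain u' v' w' where *: "c = cpt \<tau> u' v' w'" "clsA \<tau> v' = clsA \<tau> v" "clsB \<tau> u' = clsB \<tau> u"
    using c unfolding poincare_fibre_def by blast
  obtain n where "v - v' = projA \<tau> (civ n)" using *(2) unfolding clsA_eq latA_def by blast
  then have v: "v' = v + projA \<tau> (civ (- n))" by (simp add: civ_linear projA_linear algebra_simps)
  obtain m where "u' - u = projB \<tau> (civ m)" using *(3)[symmetric] unfolding clsB_eq latB_def by blast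
  then have u: "u' = u + projB \<tau> (civ m)" by (simp add: algebra_simps)
  show ?thesis unfolding *(1) unfolding v cpt_shift_v[OF \<tau>] unfolding u cpt_shift_u[OF \<tau>] by blast
qed

lemma poincare_fibre_I:
  assumes "\<tau> \<in> siegel" shows "cpt \<tau> u v w \<in> poincare_fibre \<tau> (clsA \<tau> v) (clsB \<tau> u)"
proof -
  have "cpt \<tau> u v w \<in> poincare \<tau>"
    unfolding poincare_def quot_def cpt_def range_ev using pt_in_D_dom[OF assms] gr0_pt by blast
  then show ?thesis unfolding poincare_fibre_def by blast
qed

lemma holo_on_subset: "holo_on S h \<Longrightarrow> T \<subseteq> S \<Longrightarrow> holo_on T h"
  unfolding holo_on_def by blast

lemma holo_on_add: "holo_on S h \<Longrightarrow> holo_on S k \<Longrightarrow> holo_on S (\<lambda>t. h t + k t)"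
  unfolding holo_on_def
proof
  fix x assume h: "\<forall>x\<in>S. \<exists>h'. (h has_derivative h') (at x) \<and> (\<forall>t. h' (\<i> *s t) = \<i> * h' t)"
    and k: "\<forall>x\<in>S. \<exists>h'. (k has_derivative h') (at x) \<and> (\<forall>t. h' (\<i> *s t) = \<i> * h' t)" and x: "x \<in> S"
  obtain h' where h': "(h has_derivative h') (at x)" "\<forall>t. h' (\<i> *s t) = \<i> * h' t" using h x by blast
  obtain k' where k': "(k has_derivative k') (at x)" "\<forall>t. k' (\<i> *s t) = \<i> * k' t" using k x by blast
  show "\<exists>h'. ((\<lambda>t. h t + k t) has_derivative h') (at x) \<and> (\<forall>t. h' (\<i> *s t) = \<i> * h' t)"
    by (intro exI[of _ "\<lambda>d. h' d + k' d"] conjI has_derivative_add h'(1) k'(1)) (simp add: h'(2) k'(2) algebra_simps)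
qed

lemma bdot_scaleR: "bdot (c *\<^sub>R x) y = c *\<^sub>R bdot x y" "bdot x (c *\<^sub>R y) = c *\<^sub>R bdot x y"
  by (simp_all add: bdot_def scaleR_sum_right)

lemma holo_on_bdot: "holo_on S (\<lambda>t. bdot t c)"
proof -
  have "linear (\<lambda>t. bdot t c)"
    by (rule linearI) (simp_all add: bdot_distribs bdot_scaleR)
  then have "((\<lambda>t. bdot t c) has_derivative (\<lambda>t. bdot t c)) (at x)" for x
    by (intro bounded_linear_imp_has_derivative linear_conv_bounded_linear[THEN iffD1])
  then show ?thesis unfolding holo_on_def by (intro ballI exI[of _ "\<lambda>t. bdot t c"]) simp
qed

lemma holo_on_minus: "holo_on S h \<Longrightarrow> holo_on S (\<lambda>t. - h t)"
  unfolding holo_on_def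
proof
  fix x assume h: "\<forall>x\<in>S. \<exists>h'. (h has_derivative h') (at x) \<and> (\<forall>t. h' (\<i> *s t) = \<i> * h' t)" and x: "x \<in> S"
  obtain h' where h': "(h has_derivative h') (at x)" "\<forall>t. h' (\<i> *s t) = \<i> * h' t" using h x by blast
  show "\<exists>h'. ((\<lambda>t. - h t) has_derivative h') (at x) \<and> (\<forall>t. h' (\<i> *s t) = \<i> * h' t)"
    by (intro exI[of _ "\<lambda>d. - h' d"] conjI has_derivative_minus h'(1)) (simp add: h'(2))
qed

lemma holo_on_isCont:
  assumes "\<And>k. holo_on N (\<lambda>t. V t $ k)" "t \<in> N" shows "isCont V t"
proof -
  have "isCont (\<lambda>t. V t $ k) t" for k
    using assms has_derivative_continuous unfolding holo_on_def by blast
  then show ?thesis unfolding isCont_def by (intro vec_tendstoI) simp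
qed

text \<open>In real coordinates the values are integral vectors, and continuity keeps them at
  distance less than 1 from the value at t0. This compares two lifts of one map to the universal
  covering of \<open>A_var\<close>.\<close>

lemma lattice_valued_const:
  fixes \<tau> :: "complex^'d^'d::finite" and D :: "complex^'d \<Rightarrow> complex^'d"
  assumes \<tau>: "\<tau> \<in> siegel" and N: "open N" "t0 \<in> N" and D: "\<And>t. t \<in> N \<Longrightarrow> D t \<in> latA \<tau>" and cont: "isCont D t0"
  shows "\<exists>N' n. open N' \<and> t0 \<in> N' \<and> N' \<subseteq> N \<and> (\<forall>t\<in>N'. D t = projA \<tau> (civ n))"
proof -
  obtain r where r: "linear r" "\<And>x. r (projA \<tau> (cor x)) = x" by (rule projA_real_coords[OF \<tau>]) blast
  have "isCont r (D t0)" using r(1) by (rule linear_continuous_at[OF linear_conv_bounded_linear[THEN iffD1]])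
  then have "isCont (\<lambda>t. r (D t)) t0" using cont by (rule isCont_o2[rotated])
  then obtain d where d: "d > 0" "\<And>t. dist t t0 < d \<Longrightarrow> dist (r (D t)) (r (D t0)) < 1"
    unfolding continuous_at_eps_delta by (meson zero_less_one)
  obtain n where n: "D t0 = projA \<tau> (civ n)" using D[OF N(2)] unfolding latA_def by blast
  have "D t = projA \<tau> (civ n)" if t: "t \<in> N \<inter> ball t0 d" for t
  proof -
    obtain m where m: "D t = projA \<tau> (civ m)" using D t unfolding latA_def by blast
    have "dist (r (D t)) (r (D t0)) < 1" using d(2)[of t] t by (simp add: dist_commute[of t0])
    then have "norm (\<chi> i. real_of_int (m $ i) - real_of_int (n $ i)) < 1"
      unfolding m n cor_civ r(2) dist_norm by (simp add: minus_vec_def)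
    then have "\<bar>real_of_int (m $ i) - real_of_int (n $ i)\<bar> < 1" for i
      using component_le_norm_cart[of "\<chi> i. real_of_int (m $ i) - real_of_int (n $ i)" i] by simp
    then have "m $ i = n $ i" for i by (metis (no_types) of_int_diff of_int_abs of_int_less_1_iff zabs_less_one_iff eq_iff_diff_eq_0)
    then show ?thesis unfolding m by (simp add: vec_eq_iff civ_def)
  qed
  then show ?thesis using N d(1) by (intro exI[of _ "N \<inter> ball t0 d"] exI[of _ n]) auto
qed

text \<open>The linear map \<open>v_ribet\<close> is the lift to the universal coverings; by
  \<open>graph_map_clsB\<close> the choice of t is harmless when \<alpha> is compatible with
  \<tau>.\<close>

definition graph_map :: "int^('d::finite + 'd)^('d + 'd) \<Rightarrow> complex^'d^'d \<Rightarrow> (complex^'d) set \<Rightarrow> (complex^'d) set" where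
  "graph_map \<alpha> \<tau> b = clsA \<tau> (v_ribet \<alpha> \<tau> (SOME t. clsB \<tau> t = b))"

lemma clinear_v_ribet: "clinear_map (v_ribet \<alpha> \<tau>)"
proof (rule clinearI)
  have 1: "vec2 0 (inverse tpi *s (x + y)) = vec2 0 (inverse tpi *s x) + vec2 0 (inverse tpi *s y)" for x y :: "complex^'a"
    by (simp add: vec.scale_right_distrib)
  show "v_ribet \<alpha> \<tau> (x + y) = v_ribet \<alpha> \<tau> x + v_ribet \<alpha> \<tau> y" for x y
    unfolding v_ribet_def 1 matrix_vector_right_distrib projA_linear ..
  have 2: "vec2 0 (inverse tpi *s (c *s x)) = c *s vec2 0 (inverse tpi *s x)" for c and x :: "complex^'a"
    by (simp add: mult_ac)
  show "v_ribet \<alpha> \<tau> (c *s x) = c *s v_ribet \<alpha> \<tau> x" for c x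
    unfolding v_ribet_def 2 matrix_vec_scale projA_linear ..
qed

context
  fixes \<tau> :: "complex^'d^'d::finite" and \<alpha> :: "int^('d + 'd)^('d + 'd)"
  assumes \<tau>: "\<tau> \<in> siegel" and comp: "compatible \<tau> (cim \<alpha>)"
begin

lemma v_ribet_lattice: "v_ribet \<alpha> \<tau> ` latB \<tau> \<subseteq> latA \<tau>"
  unfolding latB_def latA_def by (auto simp: v_ribet_projB[OF \<tau> comp] cim_mv_civ)

lemma graph_map_clsB: "graph_map \<alpha> \<tau> (clsB \<tau> t) = clsA \<tau> (v_ribet \<alpha> \<tau> t)"
proof -
  define t' where "t' = (SOME t'. clsB \<tau> t' = clsB \<tau> t)"
  have "clsB \<tau> t' = clsB \<tau> t" unfolding t'_def by (rule someI) (rule refl)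
  then have "t - t' \<in> latB \<tau>" unfolding clsB_eq .
  then have "v_ribet \<alpha> \<tau> t - v_ribet \<alpha> \<tau> t' \<in> latA \<tau>"
    using v_ribet_lattice unfolding clinearD(4)[OF clinear_v_ribet, symmetric] by blast
  then show ?thesis unfolding graph_map_def t'_def[symmetric] clsA_eq .
qed

lemma lattice_matrix_graph_map: "lattice_matrix \<tau> (graph_map \<alpha> \<tau>) \<alpha>"
  unfolding lattice_matrix_def lifts_to_def
  using clinear_v_ribet v_ribet_lattice graph_map_clsB v_ribet_projB[OF \<tau> comp] by blast

lemma holo_v_ribet: "holo_on N (\<lambda>t. v_ribet \<alpha> \<tau> t $ k)"
  using holo_of_holo2[OF holo2_v_ribet] by simp

lemma holo_w_ribet: "holo_on N (w_ribet \<alpha>)"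
  using holo_of_holo2[OF holo2_w_ribet] by simp

theorem graph_section_unique:
  assumes s: "graph_section \<tau> (graph_map \<alpha> \<tau>) s" "s (clsB \<tau> 0) = cpt \<tau> 0 0 0"
    and period: "\<And>t n. cpt \<tau> (t + projB \<tau> (civ n)) (v_ribet \<alpha> \<tau> (t + projB \<tau> (civ n))) (w_ribet \<alpha> (t + projB \<tau> (civ n)))
      = cpt \<tau> t (v_ribet \<alpha> \<tau> t) (w_ribet \<alpha> t)"
  shows "s (clsB \<tau> t) = cpt \<tau> t (v_ribet \<alpha> \<tau> t) (w_ribet \<alpha> t)"
proof -
  let ?v = "v_ribet \<alpha> \<tau>" and ?w = "w_ribet \<alpha>"
  have "\<exists>h. s (clsB \<tau> t) = cpt \<tau> t (?v t) (?w t + h)" for t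
  proof -
    have "s (clsB \<tau> t) \<in> poincare_fibre \<tau> (graph_map \<alpha> \<tau> (clsB \<tau> t)) (clsB \<tau> t)"
      using s(1) unfolding graph_section_def B_var_def by blast
    then obtain w where "s (clsB \<tau> t) = cpt \<tau> t (?v t) w" unfolding graph_map_clsB using cpt_fibre_repr[OF \<tau>] by blast
    then show ?thesis by (intro exI[of _ "w - ?w t"]) simp
  qed
  then obtain H where H: "\<And>t. s (clsB \<tau> t) = cpt \<tau> t (?v t) (?w t + H t)" by metis
  have H_eq: "exp (H t) = exp h" if "s (clsB \<tau> t) = cpt \<tau> t (?v t) (?w t + h)" for t h
    using that H[of t] cpt_w_iff[OF \<tau>, of t "?v t" "?w t + h" "?w t + H t"] by (simp add: exp_add)
  define E where "E t = exp (H t)" for t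
  obtain r :: "complex^'d \<Rightarrow> real^('d + 'd)" where r: "linear r"
    "\<And>k. r (projB \<tau> (civ (axis k 1))) = axis k 1"
    "\<And>t. t = (\<Sum>k\<in>UNIV. r t $ k *\<^sub>R projB \<tau> (civ (axis k 1)))"
    by (rule lat_coords[OF \<tau>]) blast
  have per: "E (t + projB \<tau> (civ n)) = 1 * E t" for t n
  proof -
    let ?t = "t + projB \<tau> (civ n)"
    have "s (clsB \<tau> ?t) = cpt \<tau> t (?v t) (?w t + H t)" unfolding clsB_shift by (rule H)
    also have "\<dots> = cpt \<tau> ?t (?v ?t) (?w ?t + H t)" by (rule cpt_add_w[OF \<tau> period[symmetric]])
    finally show ?thesis using H_eq unfolding E_def by simp
  qed
  have loc: "\<exists>N h. open N \<and> t0 \<in> N \<and> holo_on N h \<and> (\<forall>t\<in>N. E t = exp (h t))" for t0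
  proof -
    obtain N V w where N: "open N" "t0 \<in> N" and V: "\<And>k. holo_on N (\<lambda>t. V t $ k)" and w: "holo_on N w"
      and sV: "\<And>t. t \<in> N \<Longrightarrow> s (clsB \<tau> t) = cpt \<tau> t (V t) (w t)"
      using s(1) unfolding graph_section_def by metis
    have lat: "?v t - V t \<in> latA \<tau>" if t: "t \<in> N" for t
    proof -
      have "cpt \<tau> t (V t) (w t) = cpt \<tau> t (?v t) (?w t + H t)" using sV[OF t] H by simp
      then obtain n where "?v t = V t + projA \<tau> (civ n)" unfolding cpt_eq_iff[OF \<tau>] by blast
      then show ?thesis unfolding latA_def by auto
    qed
    have "isCont (\<lambda>t. ?v t - V t) t0"
      by (intro continuous_diff holo_on_isCont[OF V N(2)] holo_on_isCont[OF holo_v_ribet N(2)])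
    from lattice_valued_const[OF \<tau> N lat this]
    obtain N' n where N': "open N'" "t0 \<in> N'" "N' \<subseteq> N" and n: "\<And>t. t \<in> N' \<Longrightarrow> ?v t - V t = projA \<tau> (civ n)" by metis
    \<comment> \<open>Moving the lift from V to \<open>v_ribet\<close> costs the factor of
      automorphy in v, which is the exponential of a linear form in t as long as the lattice vector
      is constant.\<close>
    let ?h = "\<lambda>t. (w t + bdot t (- vsnd (civ n))) + - ?w t"
    have "E t = exp (?h t)" if t: "t \<in> N'" for t
    proof -
      have V': "V t = ?v t + projA \<tau> (civ (- n))" using n[OF t] by (simp add: civ_linear projA_linear algebra_simps)
      have vs: "vsnd (civ (- n)) = - vsnd (civ n)" by (simp add: vec_eq_iff civ_def)
      have "s (clsB \<tau> t) = cpt \<tau> t (?v t) (w t + bdot t (- vsnd (civ n)))"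
        using sV[of t] t N'(3) unfolding V' cpt_shift_v[OF \<tau>] vs by blast
      then have "s (clsB \<tau> t) = cpt \<tau> t (?v t) (?w t + ?h t)" by simp
      then show ?thesis unfolding E_def by (rule H_eq)
    qed
    moreover have "holo_on N' ?h"
      by (intro holo_on_add holo_on_bdot holo_on_minus holo_w_ribet holo_on_subset[OF w N'(3)])
    ultimately show ?thesis using N'(1,2) by (intro exI[of _ N'] exI[of _ ?h]) auto
  qed
  obtain l where l: "\<And>t. E t = E 0 * exp (bdot l t)"
    using quasi_periodic_exp[where E = E and p = "\<lambda>k. projB \<tau> (civ (axis k 1))" and m = "\<lambda>_. 1", OF loc r per] by blast
  have "s (clsB \<tau> 0) = cpt \<tau> 0 (?v 0) (?w 0 + 0)" using s(2) by (simp add: ribet_pt_0)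
  then have E0: "E 0 = 1" using H_eq[of 0 0] unfolding E_def by simp
  \<comment> \<open>E is 1 on the lattice, so the real part of the linear form of l vanishes there
    and, by real linearity, everywhere; evaluated at i t as well, this makes the form zero.\<close>
  have re_lattice: "Re (bdot l (projB \<tau> (civ n))) = 0" for n
  proof -
    have "exp (bdot l (projB \<tau> (civ n))) = 1" using per[of 0 n] l[of "projB \<tau> (civ n)"] E0 by simp
    then have "norm (exp (bdot l (projB \<tau> (civ n)))) = 1" by simp
    then show ?thesis by simp
  qed
  have re_sum: "Re (bdot l t) = (\<Sum>k\<in>UNIV. r t $ k * Re (bdot l (projB \<tau> (civ (axis k 1)))))" for t
  proof -
    have lin: "linear (\<lambda>t. Re (bdot l t))"
      by (rule linearI) (simp_all add: bdot_distribs bdot_scaleR)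
    have "Re (bdot l t) = Re (bdot l (\<Sum>k\<in>UNIV. r t $ k *\<^sub>R projB \<tau> (civ (axis k 1))))"
      using arg_cong[OF r(3)[of t], of "\<lambda>t. Re (bdot l t)"] .
    also have "\<dots> = (\<Sum>k\<in>UNIV. r t $ k * Re (bdot l (projB \<tau> (civ (axis k 1)))))"
      unfolding linear_sum[OF lin] linear_scale[OF lin] by simp
    finally show ?thesis .
  qed
  have Re0: "Re (bdot l t) = 0" for t by (subst re_sum) (simp add: re_lattice)
  have "bdot l t = 0" using Re0[of t] Re0[of "\<i> *s t"] by (simp add: complex_eq_iff)
  then have "exp (H t) = 1" using l[of t] E0 unfolding E_def by simp
  then have "exp (?w t + H t) = exp (?w t)" by (simp add: exp_add)
  then show ?thesis unfolding H[of t] using cpt_w_iff[OF \<tau>] by blast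
qed

end

theorem theorem5p2:
  fixes \<tau>0 :: "complex^'d^'d"
    and f fdual :: "(complex^'d) set \<Rightarrow> (complex^'d::finite) set"
    and fZ \<alpha>Z :: "int^('d + 'd)^('d + 'd)"
  assumes "\<tau>0 \<in> siegel"
    and "morphism_BA \<tau>0 f"
    and "lattice_matrix \<tau>0 f fZ"
    and "dual_morphism \<tau>0 f fdual"
    and "lattice_matrix \<tau>0 (\<lambda>b. coset_diff (f b) (fdual b)) \<alpha>Z"
  shows "\<exists>r. family_section \<alpha>Z \<tau>0 r
    \<and> bij_betw (quot_map (pts \<int> (u_part (P_alpha \<alpha>Z))))
        (quot (pts \<int> (u_part (P_tilde fZ \<alpha>Z))) (D_tilde fZ \<alpha>Z \<tau>0))
        (r ` B_family \<alpha>Z \<tau>0)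
    \<and> (\<forall>\<Gamma>. congruence_subgroup \<Gamma> (P_alpha \<alpha>Z) \<and> pts \<int> (u_part (P_alpha \<alpha>Z)) \<subseteq> \<Gamma> \<longrightarrow>
        special_subvariety (P_alpha \<alpha>Z) (D_hom ` D_alpha \<alpha>Z \<tau>0) \<Gamma>
          {hom_orbit \<Gamma> (D_hom F) |F. F \<in> \<Union> (r ` B_family \<alpha>Z \<tau>0)})
    \<and> (\<forall>\<tau>\<in>H_alpha \<alpha>Z \<tau>0. \<exists>a. lattice_matrix \<tau> a \<alpha>Z
        \<and> graph_section \<tau> a (\<lambda>b. r (\<tau>, b))
        \<and> r (\<tau>, clsB \<tau> 0) = cpt \<tau> 0 0 0
        \<and> (\<forall>s. graph_section \<tau> a s \<and> s (clsB \<tau> 0) = cpt \<tau> 0 0 0 \<longrightarrow>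
             (\<forall>b\<in>B_var \<tau>. s b = r (\<tau>, b))))"
proof -
  note \<alpha> = alpha_eq[OF assms(1,3,4,5)]
  \<comment> \<open>\<open>alpha_eq\<close> supplies both the symmetry relation with f and the
    compatibility at \<tau>0.\<close>
  interpret ribet fZ \<alpha>Z \<tau>0 by unfold_locales (use \<alpha> assms(1) in simp_all)
  let ?r = "ribet_section \<alpha>Z"
  have fibre: "?r (\<tau>, clsB \<tau> t) = cpt \<tau> t (v_ribet \<alpha>Z \<tau> t) (w_ribet \<alpha>Z t)" if "\<tau> \<in> H_alpha \<alpha>Z \<tau>0" for \<tau> t
    unfolding ribet_section_clsB[OF that] ribet_pt_def cpt_Pu ..
  have "lattice_matrix \<tau> (graph_map \<alpha>Z \<tau>) \<alpha>Z \<and> graph_section \<tau> (graph_map \<alpha>Z \<tau>) (\<lambda>b. ?r (\<tau>, b))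
        \<and> ?r (\<tau>, clsB \<tau> 0) = cpt \<tau> 0 0 0
        \<and> (\<forall>s. graph_section \<tau> (graph_map \<alpha>Z \<tau>) s \<and> s (clsB \<tau> 0) = cpt \<tau> 0 0 0 \<longrightarrow>
             (\<forall>b\<in>B_var \<tau>. s b = ?r (\<tau>, b)))" if H: "\<tau> \<in> H_alpha \<alpha>Z \<tau>0" for \<tau>
  proof (intro conjI allI impI ballI)
    note \<tau> = H_alphaD[OF H]
    show "lattice_matrix \<tau> (graph_map \<alpha>Z \<tau>) \<alpha>Z" by (rule lattice_matrix_graph_map[OF \<tau>])
    show "?r (\<tau>, clsB \<tau> 0) = cpt \<tau> 0 0 0" by (simp add: fibre[OF H] ribet_pt_0)
    show "graph_section \<tau> (graph_map \<alpha>Z \<tau>) (\<lambda>b. ?r (\<tau>, b))"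
      unfolding graph_section_def
    proof (intro conjI ballI allI)
      fix b assume "b \<in> B_var \<tau>"
      then obtain t where b: "b = clsB \<tau> t" unfolding B_var_def by blast
      show "?r (\<tau>, b) \<in> poincare_fibre \<tau> (graph_map \<alpha>Z \<tau> b) b"
        unfolding b fibre[OF H] graph_map_clsB[OF \<tau>] by (rule poincare_fibre_I[OF \<tau>(1)])
    next
      fix t0 :: "complex^'d"
      show "\<exists>N V w. open N \<and> t0 \<in> N \<and> (\<forall>k. holo_on N (\<lambda>t. V t $ k)) \<and> holo_on N w \<and>
          (\<forall>t\<in>N. ?r (\<tau>, clsB \<tau> t) = cpt \<tau> t (V t) (w t))"
        by (rule exI[of _ UNIV], rule exI[of _ "v_ribet \<alpha>Z \<tau>"], rule exI[of _ "w_ribet \<alpha>Z"])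
          (simp add: holo_v_ribet[OF \<tau>] holo_w_ribet[OF \<tau>] fibre[OF H])
    qed
    fix s b assume s: "graph_section \<tau> (graph_map \<alpha>Z \<tau>) s \<and> s (clsB \<tau> 0) = cpt \<tau> 0 0 0" and "b \<in> B_var \<tau>"
    then obtain t where b: "b = clsB \<tau> t" unfolding B_var_def by blast
    show "s b = ?r (\<tau>, b)"
      unfolding b fibre[OF H]
    proof (rule graph_section_unique[OF \<tau> s[THEN conjunct1] s[THEN conjunct2]])
      fix t n
      show "cpt \<tau> (t + projB \<tau> (civ n)) (v_ribet \<alpha>Z \<tau> (t + projB \<tau> (civ n))) (w_ribet \<alpha>Z (t + projB \<tau> (civ n)))
          = cpt \<tau> t (v_ribet \<alpha>Z \<tau> t) (w_ribet \<alpha>Z t)"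
        unfolding fibre[OF H, symmetric] clsB_shift ..
    qed
  qed
  then show ?thesis
    unfolding pts_u_part
    using family_section_ribet bij_ribet_section special_ribet
    unfolding ribet_section_image[symmetric] congruence_subgroup_def
    by (intro exI[of _ ?r] conjI allI impI ballI) (blast+)
qed

end
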